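(* Let $U_0\in\mathcal{S}$, let $\tau_{\min}>0$, and let $\{U_n\}$ be generated by the two-stage scheme with time steps satisfying, for all $n\geqslant0$, $$\tau_n\in\Big(\tau_{\min},\ \min\Big\{\frac{\lambda_1}{\max\{3,2c_e\}\lambda_{\max}(\langle U_0,U_0\rangle)},\ \frac{\lambda_1}{2\sqrt{2E(U_0)\lambda_{\max}(\langle U_0,U_0\rangle)}}\Big\}\Big).$$ Then: 1. there exists an orthogonal matrix $\tilde Q_*\in\mathcal{O}^N$ such that $\lim_{n\to\infty}\|U_n-V_*\tilde Q_*\|_a=0$; 2. $\lim_{n\to\infty}E(U_n)=E(V_* )$; 3. $\lim_{n\to\infty}\|\nabla_GE_{\mathcal{G}}(U_n)\|_a=0$.
   Context: $\Omega\subset\mathbb{R}^d$ is a bounded domain, and $(\cdot,\cdot)$, $\|\cdot\|$ denote the $L^2(\Omega)$ inner product and norm. $\mathcal{V}:\Omega\to\mathbb{R}$ is a potential such that $a(u,v)=\int_\Omega(\nabla u\cdot\nabla v+\mathcal{V}uv)\,dx$ on $H_0^1(\Omega)$ is symmetric, bounded and coercive, with $c_1\|\nabla u\|^2\leqslant a(u,u)\leqslant c_2\|\nabla u\|^2$. $\|u\|_a=\sqrt{a(u,u)}$, and $c_\Omega>0$ satisfies $\|u\|\leqslant c_\Omega\|u\|_a$ on $H_0^1(\Omega)$. Let $\lambda_1\leqslant\lambda_2\leqslant\cdots$ be the eigenvalues (with multiplicity) of $a(u,v)=\lambda(u,v)$ for all $v$. Assume $\lambda_N<\lambda_{N+1}$.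 Let $V_*=(v_1,\dots,v_N)$ be $L^2$-orthonormal eigenfunctions for $\lambda_1,\dots,\lambda_N$. $\mathcal{G}=(-\Delta+\mathcal{V})^{-1}$: $\mathcal{G}f\in H_0^1(\Omega)$ is the unique element with $a(\mathcal{G}f,v)=(f,v)$ for all $v$. For $N$-tuples: - $\mathcal{G}U=(\mathcal{G}u_1,\dots,\mathcal{G}u_N)$; - $UA$ has $j$-th entry $\sum_iu_iA_{ij}$; - $\langle U,V\rangle=((u_i,v_j))_{i,j}$ and $\langle U,V\rangle_a=(a(u_i,v_j))_{i,j}$; - $\|U\|_a^2=\operatorname{tr}\langle U,U\rangle_a$. $E(U)=\frac12\|U\|_a^2$ and $\nabla_GE_{\mathcal{G}}(U)=\mathcal{G}U-U\langle\mathcal{G}U,U\rangle$. $\mathcal{O}^N$ is the set of orthogonal $N\times N$ matrices, and $\lambda_{\max}$ denotes the largest eigenvalue. The quasi-Stiefel set is $\mathcal{M}^N_{\geqslant}=\{U:\langle U,U\rangle-I_N\text{ positive semidefinite}\}$. Set $$E_{\mathrm{ES}}=\tfrac12\Big(\sum_{i=1}^{N-1}\lambda_i+\lambda_{N+1}\Big),\qquad E_1=\tfrac12\big(E(V_* )+E_{\mathrm{ES}}\big),$$ $$\mathcal{S}=\{U: UQ\in\mathcal{M}^N_{\geqslant}\text{ for some }Q\in\mathcal{O}^N,\ E(U)\leqslant E_1\},$$ $$c_e=2\Big(\frac{\sqrt2E(U_0)}{\lambda_1}+c_\Omega^2\sqrt{E(U_0)\lambda_{\max}(\langle U_0,U_0\rangle)}\Big)\sqrt{NE(U_0)\lambda_{\max}(\langle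 U_0,U_0\rangle)}+\frac12.$$ Define $\mathcal{A}_UV=\mathcal{G}U\langle U,V\rangle-U\langle U,\mathcal{G}V\rangle$. The two-stage scheme: $\hat U_{n+1}$ solves $$\hat U_{n+1}=U_n+\tau_n\mathcal{A}_{U_n}\Big(\tfrac{\hat U_{n+1}+U_n}{2}\Big),$$ and $$U_{n+1}=\hat U_{n+1}-\tau_n\mathcal{G}\hat U_{n+1}\big(\langle\hat U_{n+1},\hat U_{n+1}\rangle-I_N\big).$$ *)

theory Defs
  imports "HOL-Analysis.Analysis"
begin

definition smooth_fun :: "('a::euclidean_space \<Rightarrow> real) \<Rightarrow> bool" where
  "smooth_fun f \<longleftrightarrow> (\<exists>S. f \<in> S \<and>
     (\<forall>g\<in>S. continuous_on UNIV g \<and>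
        (\<exists>D. (\<forall>x. (g has_derivative (\<lambda>h. D x \<bullet> h)) (at x)) \<and>
             (\<forall>i\<in>Basis. (\<lambda>x. D x \<bullet> i) \<in> S))))"

definition test_fun :: "'a::euclidean_space set \<Rightarrow> ('a \<Rightarrow> real) \<Rightarrow> bool" where
  "test_fun \<Omega> \<phi> \<longleftrightarrow> smooth_fun \<phi> \<and> compact (closure {x. \<phi> x \<noteq> 0})
      \<and> closure {x. \<phi> x \<noteq> 0} \<subseteq> \<Omega>"

definition L2_fun :: "'a::euclidean_space set \<Rightarrow> ('a \<Rightarrow> real) \<Rightarrow> bool" where
  "L2_fun \<Omega> u \<longleftrightarrow> set_borel_measurable lebesgue \<Omega> u \<and>
      set_integrable lebesgue \<Omega> (\<lambda>x. (u x)\<^sup>2)"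

definition L2_vfun :: "'a::euclidean_space set \<Rightarrow> ('a \<Rightarrow> 'a) \<Rightarrow> bool" where
  "L2_vfun \<Omega> g \<longleftrightarrow> set_borel_measurable lebesgue \<Omega> g \<and>
      set_integrable lebesgue \<Omega> (\<lambda>x. (norm (g x))\<^sup>2)"

text \<open>u belongs to H_0^1(Omega) with weak gradient g: (u,g) is the H^1-limit of
  test functions (H_0^1 = closure of C_c^infinity(Omega) in H^1).\<close>
definition H01_grad :: "'a::euclidean_space set \<Rightarrow> ('a \<Rightarrow> real) \<Rightarrow> ('a \<Rightarrow> 'a) \<Rightarrow> bool" where
  "H01_grad \<Omega> u g \<longleftrightarrow> L2_fun \<Omega> u \<and> L2_vfun \<Omega> g \<and>
     (\<exists>\<phi> D\<phi>. (\<forall>k. test_fun \<Omega> (\<phi> k) \<and>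
                   (\<forall>x. (\<phi> k has_derivative (\<lambda>h. D\<phi> k x \<bullet> h)) (at x))) \<and>
        (\<lambda>k. LINT x:\<Omega>|lebesgue. (\<phi> k x - u x)\<^sup>2) \<longlonglongrightarrow> 0 \<and>
        (\<lambda>k. LINT x:\<Omega>|lebesgue. (norm (D\<phi> k x - g x))\<^sup>2) \<longlonglongrightarrow> 0)"

definition H01 :: "'a::euclidean_space set \<Rightarrow> ('a \<Rightarrow> real) \<Rightarrow> bool" where
  "H01 \<Omega> u \<longleftrightarrow> (\<exists>g. H01_grad \<Omega> u g)"

definition wgrad :: "'a::euclidean_space set \<Rightarrow> ('a \<Rightarrow> real) \<Rightarrow> 'a \<Rightarrow> 'a" where
  "wgrad \<Omega> u = (SOME g. H01_grad \<Omega> u g)"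

definition l2 :: "'a::euclidean_space set \<Rightarrow> ('a \<Rightarrow> real) \<Rightarrow> ('a \<Rightarrow> real) \<Rightarrow> real" where
  "l2 \<Omega> u v = (LINT x:\<Omega>|lebesgue. u x * v x)"

definition aform :: "'a::euclidean_space set \<Rightarrow> ('a \<Rightarrow> real) \<Rightarrow> ('a \<Rightarrow> real) \<Rightarrow> ('a \<Rightarrow> real) \<Rightarrow> real" where
  "aform \<Omega> V u v = (LINT x:\<Omega>|lebesgue. wgrad \<Omega> u x \<bullet> wgrad \<Omega> v x + V x * u x * v x)"

text \<open>G f: the element w of H_0^1 with a(w,v) = (f,v) for all v in H_0^1
  (unique up to a.e. equality under the standing assumptions).\<close>
definition green :: "'a::euclidean_space set \<Rightarrow> ('a \<Rightarrow> real) \<Rightarrow> ('a \<Rightarrow> real) \<Rightarrow> ('a \<Rightarrow> real)" where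
  "green \<Omega> V f = (SOME w. H01 \<Omega> w \<and> (\<forall>v. H01 \<Omega> v \<longrightarrow> aform \<Omega> V w v = l2 \<Omega> f v))"

definition eigpair :: "'a::euclidean_space set \<Rightarrow> ('a \<Rightarrow> real) \<Rightarrow> real \<Rightarrow> ('a \<Rightarrow> real) \<Rightarrow> bool" where
  "eigpair \<Omega> V \<mu> u \<longleftrightarrow> H01 \<Omega> u \<and> \<not> (AE x in lebesgue. x \<in> \<Omega> \<longrightarrow> u x = 0) \<and>
     (\<forall>v. H01 \<Omega> v \<longrightarrow> aform \<Omega> V u v = \<mu> * l2 \<Omega> u v)"

text \<open>lam 1 <= lam 2 <= ... is the list of all eigenvalues of a(u,v) = lam (u,v),
  repeated according to multiplicity: there is an L^2-orthonormal system of
  eigenfunctions e_i (i >= 1) for lam i, and every eigenfunction for an eigenvalue mu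
  is (a.e.) a finite linear combination of the e_i with lam i = mu.
  (Index 0 is unused.)\<close>
definition eigen_seq :: "'a::euclidean_space set \<Rightarrow> ('a \<Rightarrow> real) \<Rightarrow> (nat \<Rightarrow> real) \<Rightarrow> bool" where
  "eigen_seq \<Omega> V lam \<longleftrightarrow> (\<forall>i\<ge>1. lam i \<le> lam (Suc i)) \<and>
     (\<exists>e. (\<forall>i\<ge>1. eigpair \<Omega> V (lam i) (e i)) \<and>
          (\<forall>i\<ge>1. \<forall>j\<ge>1. l2 \<Omega> (e i) (e j) = (if i = j then 1 else 0)) \<and>
          (\<forall>\<mu> u. eigpair \<Omega> V \<mu> u \<longrightarrow>
              (\<exists>I c. finite I \<and> I \<subseteq> {i. i \<ge> 1 \<and> lam i = \<mu>} \<and>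
                 (AE x in lebesgue. x \<in> \<Omega> \<longrightarrow> u x = (\<Sum>i\<in>I. c i * e i x)))))"

section \<open>N x N matrices (as nat => nat => real, indices < N)\<close>

definition mmul :: "nat \<Rightarrow> (nat \<Rightarrow> nat \<Rightarrow> real) \<Rightarrow> (nat \<Rightarrow> nat \<Rightarrow> real) \<Rightarrow> nat \<Rightarrow> nat \<Rightarrow> real" where
  "mmul N A B = (\<lambda>i j. \<Sum>k<N. A i k * B k j)"

definition idm :: "nat \<Rightarrow> nat \<Rightarrow> real" where
  "idm = (\<lambda>i j. if i = j then 1 else 0)"

definition orthogonal_mat :: "nat \<Rightarrow> (nat \<Rightarrow> nat \<Rightarrow> real) \<Rightarrow> bool" where
  "orthogonal_mat N Q \<longleftrightarrow> (\<forall>i<N. \<forall>j<N. (\<Sum>k<N. Q k i * Q k j) = idm i j)"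

definition psd_mat :: "nat \<Rightarrow> (nat \<Rightarrow> nat \<Rightarrow> real) \<Rightarrow> bool" where
  "psd_mat N M \<longleftrightarrow> (\<forall>x. (\<Sum>i<N. \<Sum>j<N. x i * M i j * x j) \<ge> 0)"

definition lmax :: "nat \<Rightarrow> (nat \<Rightarrow> nat \<Rightarrow> real) \<Rightarrow> real" where
  "lmax N M = Max {\<mu>. \<exists>x. (\<exists>i<N. x i \<noteq> 0) \<and> (\<forall>i<N. (\<Sum>j<N. M i j * x j) = \<mu> * x i)}"

section \<open>N-tuples of functions (nat => 'a => real, indices < N)\<close>

type_synonym 'a tuple = "nat \<Rightarrow> 'a \<Rightarrow> real"

definition tmul :: "nat \<Rightarrow> 'a tuple \<Rightarrow> (nat \<Rightarrow> nat \<Rightarrow> real) \<Rightarrow> 'a tuple" where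
  "tmul N U A = (\<lambda>j x. \<Sum>i<N. U i x * A i j)"

definition gram :: "'a::euclidean_space set \<Rightarrow> 'a tuple \<Rightarrow> 'a tuple \<Rightarrow> nat \<Rightarrow> nat \<Rightarrow> real" where
  "gram \<Omega> U W = (\<lambda>i j. l2 \<Omega> (U i) (W j))"

definition tgreen :: "'a::euclidean_space set \<Rightarrow> ('a \<Rightarrow> real) \<Rightarrow> 'a tuple \<Rightarrow> 'a tuple" where
  "tgreen \<Omega> V U = (\<lambda>i. green \<Omega> V (U i))"

definition anorm :: "nat \<Rightarrow> 'a::euclidean_space set \<Rightarrow> ('a \<Rightarrow> real) \<Rightarrow> 'a tuple \<Rightarrow> real" where
  "anorm N \<Omega> V U = sqrt (\<Sum>i<N. aform \<Omega> V (U i) (U i))"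

definition energy :: "nat \<Rightarrow> 'a::euclidean_space set \<Rightarrow> ('a \<Rightarrow> real) \<Rightarrow> 'a tuple \<Rightarrow> real" where
  "energy N \<Omega> V U = (anorm N \<Omega> V U)\<^sup>2 / 2"

definition gradG :: "nat \<Rightarrow> 'a::euclidean_space set \<Rightarrow> ('a \<Rightarrow> real) \<Rightarrow> 'a tuple \<Rightarrow> 'a tuple" where
  "gradG N \<Omega> V U = (\<lambda>j x. tgreen \<Omega> V U j x
       - tmul N U (gram \<Omega> (tgreen \<Omega> V U) U) j x)"

definition opA :: "nat \<Rightarrow> 'a::euclidean_space set \<Rightarrow> ('a \<Rightarrow> real) \<Rightarrow> 'a tuple \<Rightarrow> 'a tuple \<Rightarrow> 'a tuple" where
  "opA N \<Omega> V U W = (\<lambda>j x. tmul N (tgreen \<Omega> V U) (gram \<Omega> U W) j x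
       - tmul N U (gram \<Omega> U (tgreen \<Omega> V W)) j x)"

definition tH01 :: "nat \<Rightarrow> 'a::euclidean_space set \<Rightarrow> 'a tuple \<Rightarrow> bool" where
  "tH01 N \<Omega> U \<longleftrightarrow> (\<forall>i<N. H01 \<Omega> (U i))"

definition teq :: "nat \<Rightarrow> 'a::euclidean_space set \<Rightarrow> 'a tuple \<Rightarrow> 'a tuple \<Rightarrow> bool" where
  "teq N \<Omega> U W \<longleftrightarrow> (\<forall>i<N. AE x in lebesgue. x \<in> \<Omega> \<longrightarrow> U i x = W i x)"

definition quasi_stiefel :: "nat \<Rightarrow> 'a::euclidean_space set \<Rightarrow> 'a tuple \<Rightarrow> bool" where
  "quasi_stiefel N \<Omega> U \<longleftrightarrow> psd_mat N (\<lambda>i j. gram \<Omega> U U i j - idm i j)"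

definition two_stage :: "nat \<Rightarrow> 'a::euclidean_space set \<Rightarrow> ('a \<Rightarrow> real) \<Rightarrow> (nat \<Rightarrow> real)
    \<Rightarrow> (nat \<Rightarrow> 'a tuple) \<Rightarrow> bool" where
  "two_stage N \<Omega> V \<tau> U \<longleftrightarrow> (\<exists>Uh. \<forall>n.
      tH01 N \<Omega> (U n) \<and> tH01 N \<Omega> (Uh n) \<and>
      teq N \<Omega> (Uh n)
        (\<lambda>j x. U n j x + \<tau> n * opA N \<Omega> V (U n) (\<lambda>i y. (Uh n i y + U n i y) / 2) j x) \<and>
      teq N \<Omega> (U (Suc n))
        (\<lambda>j x. Uh n j x - \<tau> n * tmul N (tgreen \<Omega> V (Uh n))
                 (\<lambda>i k. gram \<Omega> (Uh n) (Uh n) i k - idm i k) j x))"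

end

theory Submission
  imports Defs
begin

text \<open>Write \<open>S\<close> for the Gram matrix of \<open>U n\<close> in \<open>L\<^sup>2\<close> and \<open>T\<close> for the antisymmetric tensor
  \<open>\<Sum>k. G (u k) \<otimes> u k - u k \<otimes> G (u k)\<close> in the energy inner product. Stage one preserves \<open>S\<close>
  and lowers the energy \<open>E\<close> by at least \<open>\<tau>/8 |T|\<^sup>2\<close> (after scaling to \<open>lam 1 = 1\<close>). Stage two
  moves \<open>S\<close> towards \<open>I\<close>. The matrix \<open>S - I\<close> need not stay positive semidefinite, so the argument
  carries along a positive semidefinite \<open>Y\<close>, initially 0, such that \<open>S - I + Y\<close> stays positive
  semidefinite. Then \<open>E + 12/5 E(U 0) tr Y\<close> decreases by at least a fixed multiple of
  \<open>|T|\<^sup>2 + |S - I|\<^sup>2 + tr (S - I + Y) + tr Y\<close>; in particular \<open>S\<close> tends to \<open>I\<close>. Below the energy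
  level of the hypothesis the tuple cannot lose an eigendirection, and there \<open>|T|\<^sup>2\<close> controls the
  component of \<open>U n\<close> orthogonal to \<open>V\<^sub>*\<close>. Hence the excess of the functional over \<open>E(V\<^sub>*)\<close> is
  bounded by a multiple of its decrease and decays geometrically, so the coordinates of \<open>U n\<close> in
  \<open>V\<^sub>*\<close> form Cauchy sequences.

  On the analytic side, weak gradients are unique and the energy form is complete on \<open>H\<^sub>0\<^sup>1\<close>. A
  Poincare inequality on the cells of a fine grid bounds the \<open>L\<^sup>2\<close> norm by a small multiple of the
  energy norm plus finitely many functionals. This compactness yields minimizers of Rayleigh
  quotients, so that completeness of the eigenvalue list gives
  \<open>a(w, w) \<ge> lam (N + 1) (w, w)\<close> for \<open>w\<close> orthogonal to \<open>V\<^sub>*\<close>.\<close>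

section \<open>Positive semidefinite forms\<close>

text \<open>Every matrix and tensor in the argument has finite rank. Vectors therefore live in a
  bare real vector space with forms on it, and Gram-Schmidt supplies finitely many coordinates
  whenever a Hilbert-Schmidt norm is needed. The forms may be degenerate, because functions that
  agree almost everywhere are at distance 0.

  The second stage is the obstacle. With \<open>M\<close> the matrix of \<open>G\<close> on the
  intermediate tuple, it turns \<open>S - I\<close> into \<open>(I - t M) (S - I) (I - t M)\<close>
  plus terms of second order, one of which is \<open>- t\<^sup>2 M (S - I) M\<close>. This term can
  push \<open>S - I\<close> below 0, and \<open>Y\<close> is built to compensate it:
  \<open>Y\<close> contracts under conjugation with \<open>I - t M\<close> and is refilled only at
  order \<open>t\<^sup>2\<close>, so a multiple of \<open>tr Y\<close> can be added to the energy
  without spoiling its decrease.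

  After energies and time steps have been divided by \<open>lam 1\<close>, the step size condition
  yields \<open>t * (4 * E0 * \<Lambda>\<^sup>2 + \<Lambda>) \<le> 1\<close>, where \<Lambda> is the
  largest eigenvalue of the initial Gram matrix. The numerical constants of both stages are fitted
  to this inequality together with \<open>E0 \<ge> 1/2\<close> and
  \<open>\<Lambda> \<ge> 1\<close>.\<close>

locale psd_form =
  fixes q :: "'v::real_vector \<Rightarrow> 'v \<Rightarrow> real"
  assumes sym: "q x y = q y x"
    and add_left: "q (x + y) z = q x z + q y z"
    and scale_left: "q (c *\<^sub>R x) y = c * q x y"
    and nonneg: "0 \<le> q x x"
begin

lemma add_right: "q x (y + z) = q x y + q x z"
  by (metis add_left sym)

lemma scale_right: "q x (c *\<^sub>R y) = c * q x y"
  by (metis scale_left sym)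

lemma zero_left [simp]: "q 0 y = 0"
  using scale_left[of 0 0 y] by simp

lemma zero_right [simp]: "q y 0 = 0"
  using sym[of y 0] by simp

lemma diff_left: "q (x - y) z = q x z - q y z"
  using add_left[of "x - y" y z] by simp

lemma diff_right: "q x (y - z) = q x y - q x z"
  by (metis diff_left sym)

lemma sum_left: "q (\<Sum>i\<in>I. f i) y = (\<Sum>i\<in>I. q (f i) y)"
  by (induction I rule: infinite_finite_induct) (auto simp: add_left)

lemma sum_right: "q y (\<Sum>i\<in>I. f i) = (\<Sum>i\<in>I. q y (f i))"
  by (induction I rule: infinite_finite_induct) (auto simp: add_right)

lemmas lin = add_left add_right scale_left scale_right diff_left diff_right sum_left sum_right

lemma quad_add: "q (x + y) (x + y) = q x x + 2 * q x y + q y y"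
  by (simp add: lin sym[of y x])

lemma quad_diff: "q (x - y) (x - y) = q x x - 2 * q x y + q y y"
  by (simp add: lin sym[of y x])

lemma quad_scale: "q (c *\<^sub>R x) (c *\<^sub>R x) = c\<^sup>2 * q x x"
  by (simp add: lin power2_eq_square)

lemma quad_add_le: "q (x + y) (x + y) \<le> 2 * q x x + 2 * q y y"
  using nonneg[of "x - y"] by (simp add: quad_add quad_diff)

lemma quad_diff_le: "q (x - y) (x - y) \<le> 2 * q x x + 2 * q y y"
  using nonneg[of "x + y"] by (simp add: quad_add quad_diff)

lemma cs: "(q x y)\<^sup>2 \<le> q x x * q y y"
proof (cases "q y y = 0")
  case True
  have "q x y = 0"
  proof (rule ccontr)
    assume n: "q x y \<noteq> 0"
    \<comment> \<open>With \<open>q y y = 0\<close> the quadratic in \<open>c\<close> is affine;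
      this \<open>c\<close> makes it equal to -1.\<close>
    define c where "c = (q x x + 1) / (2 * q x y)"
    have "0 \<le> q (x - c *\<^sub>R y) (x - c *\<^sub>R y)" by (rule nonneg)
    also have "\<dots> = q x x - 2 * c * q x y"
      using True by (simp add: quad_diff scale_left scale_right)
    also have "\<dots> = -1" using n by (simp add: c_def field_simps)
    finally show False by simp
  qed
  then show ?thesis using True by simp
next
  case False
  then have p: "q y y > 0" using nonneg[of y] by simp
  have "0 \<le> q (x - (q x y / q y y) *\<^sub>R y) (x - (q x y / q y y) *\<^sub>R y)" by (rule nonneg)
  also have "\<dots> = q x x - (q x y)\<^sup>2 / q y y"
    using p by (simp add: quad_diff scale_left scale_right power2_eq_square field_simps)
  finally show ?thesis using p by (simp add: field_simps)
qed

lemma null_orth: "q x x = 0 \<Longrightarrow> q x y = 0"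
  using cs[of x y] by simp

definition nrm :: "'v \<Rightarrow> real" where "nrm x = sqrt (q x x)"

lemma nrm_nonneg [simp]: "0 \<le> nrm x" by (simp add: nrm_def nonneg)

lemma nrm_sq: "(nrm x)\<^sup>2 = q x x" by (simp add: nrm_def nonneg)

lemma nrm_le: "c \<ge> 0 \<Longrightarrow> q x x \<le> c\<^sup>2 \<Longrightarrow> nrm x \<le> c"
  by (simp add: nrm_def real_le_lsqrt nonneg)

lemma abs_le_nrm: "\<bar>q x y\<bar> \<le> nrm x * nrm y"
proof (rule power2_le_imp_le)
  show "\<bar>q x y\<bar>\<^sup>2 \<le> (nrm x * nrm y)\<^sup>2" using cs[of x y] by (simp add: power_mult_distrib nrm_sq)
qed simp

lemma le_nrm: "q x y \<le> nrm x * nrm y"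
  using abs_le_nrm[of x y] by linarith

lemma nrm_triangle: "nrm (x + y) \<le> nrm x + nrm y"
  using le_nrm[of x y] by (intro nrm_le) (simp_all add: quad_add power2_sum nrm_sq)

lemma nrm_scale: "nrm (c *\<^sub>R x) = \<bar>c\<bar> * nrm x"
  by (simp add: nrm_def quad_scale real_sqrt_mult)

lemma nrm_minus: "nrm (- x) = nrm x"
  using nrm_scale[of "-1" x] by simp

lemma nrm_diff: "nrm (x - y) \<le> nrm x + nrm y"
  using nrm_triangle[of x "- y"] by (simp add: nrm_minus)

lemma nrm_sum: "nrm (\<Sum>i\<in>I. f i) \<le> (\<Sum>i\<in>I. nrm (f i))"
proof (induction I rule: infinite_finite_induct)
  case (insert x F)
  then show ?case using nrm_triangle[of "f x" "\<Sum>i\<in>F. f i"] by simp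
qed (simp_all add: nrm_def)

lemma orth_expansion:
  fixes m :: nat
  assumes on: "\<And>i j. i < m \<Longrightarrow> j < m \<Longrightarrow> q (f i) (f j) = (if i = j then 1 else 0)"
  shows "q (x - (\<Sum>i<m. q x (f i) *\<^sub>R f i)) (x - (\<Sum>i<m. q x (f i) *\<^sub>R f i))
       = q x x - (\<Sum>i<m. (q x (f i))\<^sup>2)"
    and "j < m \<Longrightarrow> q (x - (\<Sum>i<m. q x (f i) *\<^sub>R f i)) (f j) = 0"
proof -
  let ?s = "\<Sum>i<m. q x (f i) *\<^sub>R f i"
  have s: "q ?s (f j) = q x (f j)" if "j < m" for j
  proof -
    have "q ?s (f j) = (\<Sum>i<m. q x (f i) * (if i = j then 1 else 0))"
      using that by (simp add: lin on)
    also have "\<dots> = q x (f j)" using that by (simp add: mult_delta_right)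
    finally show ?thesis .
  qed
  then show "j < m \<Longrightarrow> q (x - ?s) (f j) = 0" by (simp add: diff_left)
  have ss: "q ?s ?s = (\<Sum>i<m. (q x (f i))\<^sup>2)"
    by (simp add: sum_right scale_right s power2_eq_square)
  have xs: "q x ?s = (\<Sum>i<m. (q x (f i))\<^sup>2)"
    by (simp add: sum_right scale_right power2_eq_square)
  show "q (x - ?s) (x - ?s) = q x x - (\<Sum>i<m. (q x (f i))\<^sup>2)"
    by (simp add: quad_diff ss xs)
qed

lemma bessel:
  fixes m :: nat
  assumes "\<And>i j. i < m \<Longrightarrow> j < m \<Longrightarrow> q (f i) (f j) = (if i = j then 1 else 0)"
  shows "(\<Sum>i<m. (q x (f i))\<^sup>2) \<le> q x x"
  using orth_expansion(1)[OF assms, where x = x] nonneg[of "x - (\<Sum>i<m. q x (f i) *\<^sub>R f i)"] by simp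

text \<open>Equality in Bessel's inequality makes the remainder a null vector, and a null vector is
  orthogonal to everything. So one scalar identity for \<open>x\<close> yields the expansion against
  every \<open>y\<close>.\<close>

lemma parseval_all:
  fixes m :: nat
  assumes on: "\<And>i j. i < m \<Longrightarrow> j < m \<Longrightarrow> q (f i) (f j) = (if i = j then 1 else 0)"
    and eq: "q x x = (\<Sum>i<m. (q x (f i))\<^sup>2)"
  shows "q x y = (\<Sum>i<m. q x (f i) * q y (f i))"
proof -
  let ?s = "\<Sum>i<m. q x (f i) *\<^sub>R f i"
  have "q (x - ?s) (x - ?s) = 0" using orth_expansion(1)[OF on, where x = x] eq by simp
  then have "q (x - ?s) y = 0" by (rule null_orth)
  then have "q x y = q ?s y" by (simp add: diff_left)
  then show ?thesis by (simp add: lin sym[of y])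
qed

text \<open>Gram--Schmidt, stated so that it also covers degenerate forms: every vector of
  a finite set is recovered from its coordinates up to a null vector.\<close>
lemma coordinates:
  assumes "finite F"
  shows "\<exists>m (f :: nat \<Rightarrow> 'v). (\<forall>i<m. \<forall>j<m. q (f i) (f j) = (if i = j then 1 else 0))
     \<and> (\<forall>x\<in>F. \<forall>y. q x y = (\<Sum>i<m. q x (f i) * q y (f i)))"
  using assms
proof (induction F rule: finite_induct)
  case empty
  then show ?case by (intro exI[of _ 0]) auto
next
  case (insert u F)
  then obtain m and f :: "nat \<Rightarrow> 'v"
    where on: "\<And>i j. i < m \<Longrightarrow> j < m \<Longrightarrow> q (f i) (f j) = (if i = j then 1 else 0)"
      and ex: "\<And>x y. x \<in> F \<Longrightarrow> q x y = (\<Sum>i<m. q x (f i) * q y (f i))"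
    by blast
  define r where "r = u - (\<Sum>i<m. q u (f i) *\<^sub>R f i)"
  have rr: "q r r = q u u - (\<Sum>i<m. (q u (f i))\<^sup>2)"
    unfolding r_def by (rule orth_expansion(1)[OF on])
  have rf: "q r (f j) = 0" if "j < m" for j
    unfolding r_def by (rule orth_expansion(2)[OF on that])
  show ?case
  proof (cases "q r r = 0")
    case True
    then have "q u u = (\<Sum>i<m. (q u (f i))\<^sup>2)" using rr by simp
    note pu = parseval_all[OF on this]
    show ?thesis
    proof (intro exI[of _ m] exI[of _ f] conjI allI impI ballI)
      fix x y assume "x \<in> insert u F"
      then show "q x y = (\<Sum>i<m. q x (f i) * q y (f i))"
        using pu ex by (cases "x = u") blast+
    qed (rule on)
  next
    case False
    then have rp: "q r r > 0" using nonneg[of r] by simp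
    \<comment> \<open>Reached only if \<open>u\<close> is not yet captured up to a null vector; the
      normalized remainder becomes the next basis vector.\<close>
    define g where "g = (\<lambda>i. if i < m then f i else (1 / nrm r) *\<^sub>R r)"
    have np: "nrm r > 0" using rp by (simp add: nrm_def)
    have rn: "q r r = nrm r * nrm r" by (simp add: nrm_sq[symmetric] power2_eq_square)
    have gm: "q (g m) (g m) = 1"
      using np by (simp add: g_def scale_left scale_right rn)
    have gmf: "q (g m) (f j) = 0" "q (f j) (g m) = 0" if "j < m" for j
      using rf[OF that] by (simp_all add: g_def scale_left scale_right sym[of "f j" r])
    have gon: "q (g i) (g j) = (if i = j then 1 else 0)" if ij: "i < Suc m" "j < Suc m" for i j
    proof -
      consider "i < m" "j < m" | "i < m" "j = m" | "i = m" "j < m" | "i = m" "j = m"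
        using ij unfolding less_Suc_eq by blast
      then show ?thesis
      proof cases
        case 1
        then have "g i = f i" "g j = f j" by (simp_all add: g_def)
        then show ?thesis using on 1 by simp
      next
        case 2
        then have "g i = f i" by (simp add: g_def)
        then show ?thesis using gmf(2)[of i] 2 by simp
      next
        case 3
        then have "g j = f j" by (simp add: g_def)
        then show ?thesis using gmf(1)[of j] 3 by simp
      qed (simp add: gm)
    qed
    have gs: "(\<Sum>i<Suc m. q x (g i) * q y (g i)) = (\<Sum>i<m. q x (f i) * q y (f i)) + q x (g m) * q y (g m)" for x y
      by (simp add: g_def)
    have ru: "q u r = q r r"
    proof -
      have "q r r = q u r - q (\<Sum>i<m. q u (f i) *\<^sub>R f i) r" unfolding r_def by (simp add: diff_left)
      also have "q (\<Sum>i<m. q u (f i) *\<^sub>R f i) r = 0" using rf by (simp add: sum_left scale_left) (metis (no_types, lifting) lessThan_iff mult_zero_right sum.neutral sym)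
      finally show ?thesis by simp
    qed
    have "q u (g m) = nrm r" using np ru by (simp add: g_def scale_right rn)
    then have uu: "q u u = (\<Sum>i<Suc m. (q u (g i))\<^sup>2)"
      using rr gs[of u u] by (simp add: power2_eq_square rn)
    \<comment> \<open>The new coordinate of an old vector vanishes: \<open>ex\<close> expands
      \<open>q x (g m)\<close> in the \<open>f i\<close>, and \<open>g m\<close> is orthogonal to
      all of them.\<close>
    have F: "q x y = (\<Sum>i<Suc m. q x (g i) * q y (g i))" if "x \<in> F" for x y
    proof -
      have "q x (g m) = (\<Sum>i<m. q x (f i) * q (g m) (f i))" by (rule ex[OF that])
      then have "q x (g m) = 0" by (simp add: gmf)
      then show ?thesis using ex[OF that, of y] gs[of x y] by simp
    qed
    note pu = parseval_all[OF gon uu]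
    show ?thesis
    proof (intro exI[of _ "Suc m"] exI[of _ g] conjI allI impI ballI)
      fix x y assume "x \<in> insert u F"
      then show "q x y = (\<Sum>i<Suc m. q x (g i) * q y (g i))"
        using pu F by (cases "x = u") blast+
    qed (rule gon)
  qed
qed

end

section \<open>Real coordinate vectors\<close>

text \<open>Functions are not an instance of \<^class>\<open>real_vector\<close>, hence this copy of the function type.\<close>
datatype 'i rvec = RVec (rapp: "'i \<Rightarrow> real")

lemma rvec_eqI: "(\<And>i. rapp x i = rapp y i) \<Longrightarrow> x = y"
  by (metis rvec.collapse ext)

instantiation rvec :: (type) real_vector
begin

definition "0 = RVec (\<lambda>_. 0)"
definition "x + y = RVec (\<lambda>i. rapp x i + rapp y i)"
definition "x - y = RVec (\<lambda>i. rapp x i - rapp y i)"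
definition "- x = RVec (\<lambda>i. - rapp x i)"
definition "c *\<^sub>R x = RVec (\<lambda>i. c * rapp x i)"

instance
  by standard
    (auto simp: zero_rvec_def plus_rvec_def minus_rvec_def uminus_rvec_def scaleR_rvec_def
      algebra_simps intro!: rvec_eqI)

end

lemma rapp_simps [simp]:
  "rapp 0 i = 0" "rapp (x + y) i = rapp x i + rapp y i" "rapp (x - y) i = rapp x i - rapp y i"
  "rapp (- x) i = - rapp x i" "rapp (c *\<^sub>R x) i = c * rapp x i"
  by (simp_all add: zero_rvec_def plus_rvec_def minus_rvec_def uminus_rvec_def scaleR_rvec_def)

lemma rapp_sum [simp]: "rapp (\<Sum>k\<in>K. f k) i = (\<Sum>k\<in>K. rapp (f k) i)"
  by (induction K rule: infinite_finite_induct) auto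

definition dot :: "nat \<Rightarrow> nat rvec \<Rightarrow> nat rvec \<Rightarrow> real" where
  "dot N x y = (\<Sum>i<N. rapp x i * rapp y i)"

definition unitv :: "nat \<Rightarrow> nat rvec" where
  "unitv i = RVec (\<lambda>j. if j = i then 1 else 0)"

lemma rapp_unitv [simp]: "rapp (unitv i) j = (if j = i then 1 else 0)"
  by (simp add: unitv_def)

interpretation dot: psd_form "dot N"
  by standard
    (auto simp: dot_def algebra_simps sum.distrib sum_distrib_left intro!: sum_nonneg)

lemma dot_unitv [simp]:
  "i < N \<Longrightarrow> dot N (unitv i) x = rapp x i" "i < N \<Longrightarrow> dot N x (unitv i) = rapp x i"
  by (simp_all add: dot_def if_distrib if_distribR cong: if_cong)

lemma dot_self: "dot N x x = (\<Sum>i<N. (rapp x i)\<^sup>2)"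
  by (simp add: dot_def power2_eq_square)

definition tr :: "nat \<Rightarrow> (nat rvec \<Rightarrow> nat rvec \<Rightarrow> real) \<Rightarrow> real" where
  "tr N q = (\<Sum>i<N. q (unitv i) (unitv i))"

text \<open>\<open>dot N\<close> and \<open>tr N\<close> see only the first \<open>N\<close>
  coordinates, an arbitrary form on \<open>nat rvec\<close> sees all of them. A form can be compared
  with its trace only on vectors supported below \<open>N\<close>.\<close>

definition supp :: "nat \<Rightarrow> nat rvec \<Rightarrow> bool" where
  "supp N x \<longleftrightarrow> (\<forall>i\<ge>N. rapp x i = 0)"

lemma supp_expand: "supp N x \<Longrightarrow> x = (\<Sum>i<N. rapp x i *\<^sub>R unitv i)"
  by (rule rvec_eqI) (auto simp: supp_def if_distrib cong: if_cong)

lemma supp_unitv: "i < N \<Longrightarrow> supp N (unitv i)"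
  by (auto simp: supp_def)

lemma supp_diff: "supp N x \<Longrightarrow> supp N y \<Longrightarrow> supp N (x - y)"
  and supp_scale: "supp N x \<Longrightarrow> supp N (c *\<^sub>R x)"
  by (auto simp: supp_def)

context psd_form
begin

text \<open>The trace of \<open>A Y A\<close> for a symmetric operator \<open>A\<close> with \<open>A\<^sup>2 \<le> c\<close>:
  factor \<open>Y\<close> through coordinates and move \<open>A\<close> onto the factors.\<close>
lemma comb_trace:
  fixes A :: "nat rvec \<Rightarrow> nat rvec" and W :: "nat \<Rightarrow> 'v"
  assumes A: "\<And>x y. dot N (A x) y = dot N x (A y)"
    and c: "\<And>x. dot N (A x) (A x) \<le> c * dot N x x"
  shows "(\<Sum>i<N. q (\<Sum>k<N. rapp (A (unitv i)) k *\<^sub>R W k) (\<Sum>k<N. rapp (A (unitv i)) k *\<^sub>R W k))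
     \<le> c * (\<Sum>i<N. q (W i) (W i))"
proof -
  let ?V = "\<lambda>i. \<Sum>k<N. rapp (A (unitv i)) k *\<^sub>R W k"
  define F where "F = W ` {..<N} \<union> ?V ` {..<N}"
  have "finite F" by (simp add: F_def)
  from coordinates[OF this] obtain m and f :: "nat \<Rightarrow> 'v"
    where ex: "\<And>x y. x \<in> F \<Longrightarrow> q x y = (\<Sum>i<m. q x (f i) * q y (f i))"
    by auto
  define w where "w p = RVec (\<lambda>k. q (W k) (f p))" for p
  have V: "q (?V i) (f p) = rapp (A (w p)) i" if "i < N" for i p
  proof -
    have "q (?V i) (f p) = dot N (A (unitv i)) (w p)" by (simp add: lin dot_def w_def)
    also have "\<dots> = dot N (unitv i) (A (w p))" by (rule A)
    finally show ?thesis using that by simp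
  qed
  have "(\<Sum>i<N. q (?V i) (?V i)) = (\<Sum>i<N. \<Sum>p<m. (rapp (A (w p)) i)\<^sup>2)"
    by (intro sum.cong refl, subst ex) (simp_all add: V power2_eq_square F_def)
  also have "\<dots> = (\<Sum>p<m. dot N (A (w p)) (A (w p)))"
    by (subst sum.swap) (simp add: dot_self)
  also have "\<dots> \<le> (\<Sum>p<m. c * dot N (w p) (w p))" by (intro sum_mono c)
  also have "\<dots> = c * (\<Sum>p<m. \<Sum>i<N. (q (W i) (f p))\<^sup>2)"
    by (simp add: sum_distrib_left dot_self w_def)
  also have "(\<Sum>p<m. \<Sum>i<N. (q (W i) (f p))\<^sup>2) = (\<Sum>i<N. q (W i) (W i))"
    by (subst sum.swap, intro sum.cong refl, subst ex[of "W _"]) (simp_all add: power2_eq_square F_def)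
  finally show ?thesis .
qed

text \<open>Triangle inequality and Cauchy-Schwarz for the coefficients: the operator norm of a
  synthesis map is at most its Hilbert-Schmidt norm.\<close>

lemma comb_le: "q (\<Sum>k<N. rapp x k *\<^sub>R W k) (\<Sum>k<N. rapp x k *\<^sub>R W k) \<le> (\<Sum>k<N. q (W k) (W k)) * dot N x x"
proof -
  have "nrm (\<Sum>k<N. rapp x k *\<^sub>R W k) \<le> (\<Sum>k<N. \<bar>rapp x k\<bar> * nrm (W k))"
    by (rule order_trans[OF nrm_sum]) (simp add: nrm_scale)
  then have "(nrm (\<Sum>k<N. rapp x k *\<^sub>R W k))\<^sup>2 \<le> (\<Sum>k<N. \<bar>rapp x k\<bar> * nrm (W k))\<^sup>2"
    by (simp add: power_mono)
  also have "\<dots> \<le> (\<Sum>k<N. \<bar>rapp x k\<bar>\<^sup>2) * (\<Sum>k<N. (nrm (W k))\<^sup>2)"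
    by (rule Cauchy_Schwarz_ineq_sum)
  finally show ?thesis by (simp add: nrm_sq dot_self mult.commute)
qed

end

lemma psd_trace:
  assumes "psd_form q" and A: "\<And>x y. dot N (A x) y = dot N x (A y)"
    and "\<And>x. dot N (A x) (A x) \<le> c * dot N x x" and s: "\<And>i. i < N \<Longrightarrow> supp N (A (unitv i))"
  shows "(\<Sum>i<N. q (A (unitv i)) (A (unitv i))) \<le> c * tr N q"
  using psd_form.comb_trace[OF assms(1) A assms(3), where W = unitv] supp_expand[OF s]
  by (simp add: tr_def)

text \<open>This is \<open>comb_le\<close> for the unit vectors, which reproduce \<open>x\<close>
  because of its support.\<close>

lemma psd_le_trace:
  assumes "psd_form q" "supp N x"
  shows "q x x \<le> tr N q * dot N x x"
  using psd_form.comb_le[OF assms(1), where x = x and N = N and W = unitv] supp_expand[OF assms(2)]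
  by (simp add: tr_def)

text \<open>A two-sided bound on a quadratic form bounds the operator: polarize at \<open>x\<close> and \<open>D x\<close>.\<close>
lemma sym_op_bound:
  assumes sm: "\<And>x y. dot N (D x) y = dot N x (D y)"
    and ad: "\<And>x y z. dot N (D (x + y)) z = dot N (D x) z + dot N (D y) z"
    and sc: "\<And>r x z. dot N (D (r *\<^sub>R x)) z = r * dot N (D x) z"
    and "0 \<le> c"
    and b: "\<And>x. \<bar>dot N (D x) x\<bar> \<le> c * dot N x x"
  shows "dot N (D x) (D x) \<le> c\<^sup>2 * dot N x x"
proof -
  have mi: "dot N (D (x - y)) z = dot N (D x) z - dot N (D y) z" for x y z
    using ad[of "x - y" y z] by simp
  have pol: "4 * dot N (D u) v \<le> 2 * c * (dot N u u + dot N v v)" for u v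
  proof -
    have "4 * dot N (D u) v = dot N (D (u + v)) (u + v) - dot N (D (u - v)) (u - v)"
      by (simp add: ad mi dot.add_right dot.diff_right sm[of v u] dot.sym[of N v])
    also have "\<dots> \<le> c * dot N (u + v) (u + v) + c * dot N (u - v) (u - v)"
      using b[of "u + v"] b[of "u - v"] by linarith
    also have "\<dots> = 2 * c * (dot N u u + dot N v v)"
      by (simp add: dot.quad_add dot.quad_diff algebra_simps)
    finally show ?thesis .
  qed
  show ?thesis
  proof (cases "c = 0")
    case True
    then show ?thesis using pol[of x "D x"] by simp
  next
    case False
    then have "c > 0" using assms(4) by simp
    \<comment> \<open>Scaling \<open>x\<close> by \<open>c\<close> balances the two squares, so that
      half of the left side can be absorbed.\<close>
    have "4 * c * dot N (D x) (D x) \<le> 2 * c * (c\<^sup>2 * dot N x x + dot N (D x) (D x))"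
      using pol[of "c *\<^sub>R x" "D x"] by (simp add: sc dot.quad_scale)
    then have "c * dot N (D x) (D x) \<le> c * (c\<^sup>2 * dot N x x)" by (simp add: algebra_simps)
    then show ?thesis using \<open>c > 0\<close> by simp
  qed
qed

section \<open>One step of the two-stage scheme\<close>

lemma psd_form_pullback:
  assumes "psd_form q" and "\<And>x y. f (x + y) = f x + f y" and "\<And>c x. f (c *\<^sub>R x) = c *\<^sub>R f x"
  shows "psd_form (\<lambda>x y. q (f x) (f y))"
proof -
  interpret psd_form q by fact
  show ?thesis by standard (auto simp: assms(2,3) add_left scale_left nonneg intro: sym)
qed

lemma psd_form_add:
  assumes "psd_form q" "psd_form r"
  shows "psd_form (\<lambda>x y. q x y + r x y)"
proof -
  interpret q: psd_form q by fact
  interpret r: psd_form r by fact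
  show ?thesis
  proof
    show "q x y + r x y = q y x + r y x" for x y using q.sym[of x y] r.sym[of x y] by simp
  qed (auto simp: q.add_left q.scale_left r.add_left r.scale_left q.nonneg r.nonneg algebra_simps)
qed

lemma psd_form_scale:
  assumes "psd_form q" "0 \<le> (c::real)"
  shows "psd_form (\<lambda>x y. c * q x y)"
proof -
  interpret q: psd_form q by fact
  show ?thesis
  proof
    show "c * q x y = c * q y x" for x y using q.sym[of x y] by simp
  qed (auto simp: q.add_left q.scale_left q.nonneg assms(2) algebra_simps)
qed

text \<open>The synthesis operator of a tuple. The form \<open>b (comb N U x) (comb N U y)\<close>
  is its Gram matrix, so matrix inequalities become inequalities between quadratic forms.\<close>

definition comb :: "nat \<Rightarrow> (nat \<Rightarrow> 'v::real_vector) \<Rightarrow> nat rvec \<Rightarrow> 'v" where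
  "comb N U x = (\<Sum>k<N. rapp x k *\<^sub>R U k)"

lemma comb_add: "comb N U (x + y) = comb N U x + comb N U y"
  and comb_scale: "comb N U (c *\<^sub>R x) = c *\<^sub>R comb N U x"
  by (simp_all add: comb_def algebra_simps sum.distrib sum_subtractf scaleR_sum_right)

lemma comb_unitv [simp]: "i < N \<Longrightarrow> comb N U (unitv i) = U i"
proof -
  assume "i < N"
  have "comb N U (unitv i) = (\<Sum>k<N. if k = i then U k else 0)"
    unfolding comb_def by (intro sum.cong) auto
  then show ?thesis using \<open>i < N\<close> by simp
qed

lemma comb_tuple_add: "comb N (\<lambda>k. U k + W k) x = comb N U x + comb N W x"
  and comb_tuple_diff: "comb N (\<lambda>k. U k - W k) x = comb N U x - comb N W x"
  and comb_tuple_scale: "comb N (\<lambda>k. c *\<^sub>R U k) x = c *\<^sub>R comb N U x"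
  by (simp_all add: comb_def algebra_simps sum.distrib sum_subtractf scaleR_sum_right)

context psd_form
begin

lemma comb_right: "q y (comb N W x) = (\<Sum>k<N. rapp x k * q y (W k))"
  by (simp add: comb_def sum_right scale_right)

lemma comb_left: "q (comb N W x) y = (\<Sum>k<N. rapp x k * q (W k) y)"
  by (simp add: comb_def sum_left scale_left)

lemma comb_bound: "q (comb N W x) (comb N W x) \<le> (\<Sum>k<N. q (W k) (W k)) * dot N x x"
  unfolding comb_def by (rule comb_le)

text \<open>The functionals \<open>q (W j)\<close> form the adjoint of \<open>comb N W\<close>, and
  an adjoint has the same norm: apply Cauchy-Schwarz to \<open>v\<close> and
  \<open>comb N W y\<close>, where \<open>y\<close> collects the values \<open>q (W j) v\<close>,
  and cancel one factor.\<close>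

lemma adj_bound:
  assumes c: "\<And>x. q (comb N W x) (comb N W x) \<le> c * dot N x x" and "0 \<le> c"
  shows "(\<Sum>j<N. (q (W j) v)\<^sup>2) \<le> c * q v v"
proof -
  define y where "y = RVec (\<lambda>j. q (W j) v)"
  define s where "s = (\<Sum>j<N. (q (W j) v)\<^sup>2)"
  have s1: "q (comb N W y) v = s"
    by (simp add: comb_left y_def s_def power2_eq_square)
  have yy: "dot N y y = s" by (simp add: dot_self y_def s_def)
  have "s\<^sup>2 \<le> q (comb N W y) (comb N W y) * q v v" using cs[of "comb N W y" v] s1 by simp
  also have "\<dots> \<le> (c * s) * q v v" using c[of y] yy by (intro mult_right_mono nonneg) simp
  finally have h: "s * s \<le> s * (c * q v v)" by (simp add: power2_eq_square algebra_simps)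
  have s0: "s \<ge> 0" by (simp add: s_def sum_nonneg)
  show ?thesis
  proof (cases "s = 0")
    case True
    have "0 \<le> c * q v v" using assms(2) nonneg[of v] by simp
    then show ?thesis using True s_def by simp
  next
    case False
    then have "s > 0" using s0 by simp
    then show ?thesis using h unfolding s_def[symmetric] by simp
  qed
qed

end

text \<open>The Hilbert-Schmidt inner product of two m by m matrices; pairs as indices let
  \<open>rvec\<close> carry matrices as well as vectors.\<close>

definition hs :: "nat \<Rightarrow> (nat \<times> nat) rvec \<Rightarrow> (nat \<times> nat) rvec \<Rightarrow> real" where
  "hs m S T = (\<Sum>p<m. \<Sum>r<m. rapp S (p, r) * rapp T (p, r))"

interpretation hs: psd_form "hs m"
  by standard
    (auto simp: hs_def algebra_simps sum.distrib sum_distrib_left intro!: sum_nonneg)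

text \<open>The scaled problem: \<open>a\<close> is the energy form divided by \<open>lam 1\<close>,
  \<open>b\<close> the L^2 form and \<open>G\<close> the solution operator. Since \<open>ba\<close>
  puts the whole spectrum above 1, \<open>G\<close> is a contraction for either form.\<close>

locale form_pair =
  a: psd_form a + b: psd_form b for a b :: "'v::real_vector \<Rightarrow> 'v \<Rightarrow> real" +
  fixes G :: "'v \<Rightarrow> 'v"
  assumes G_add: "G (x + y) = G x + G y"
    and G_scale: "G (c *\<^sub>R x) = c *\<^sub>R G x"
    and aG: "a (G f) v = b f v"
    and ba: "b v v \<le> a v v"
begin

lemma aG': "a v (G f) = b v f"
  by (metis aG a.sym b.sym)

lemma bG: "b (G f) v = b f (G v)"
  by (metis aG aG')

lemma G_comb: "G (comb N U x) = comb N (\<lambda>k. G (U k)) x"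
proof -
  have G0: "G 0 = 0" using G_scale[of 0 0] by simp
  have "G (\<Sum>k\<in>I. f k) = (\<Sum>k\<in>I. G (f k))" for I and f :: "nat \<Rightarrow> 'v"
    by (induction I rule: infinite_finite_induct) (auto simp: G_add G0)
  then show ?thesis by (simp add: comb_def G_scale)
qed

lemma G_diff: "G (x - y) = G x - G y"
  using G_add[of "x - y" y] by (simp add: algebra_simps)

lemma aGG_nonneg: "0 \<le> b f (G f)"
  using a.nonneg[of "G f"] by (simp add: aG)

text \<open>\<open>b f (G f)\<close> equals \<open>a (G f) (G f)\<close>, which dominates
  \<open>b (G f) (G f)\<close>. Cauchy-Schwarz in \<open>b\<close> therefore bounds its square by
  \<open>b f f\<close> times itself.\<close>

lemma bG_le: "b f (G f) \<le> b f f"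
proof (cases "b f (G f) = 0")
  case True
  then show ?thesis using b.nonneg by simp
next
  case False
  then have p: "b f (G f) > 0" using aGG_nonneg[of f] by simp
  have "(b f (G f))\<^sup>2 \<le> b f f * b (G f) (G f)" by (rule b.cs)
  also have "\<dots> \<le> b f f * b f (G f)"
    using ba[of "G f"] b.nonneg[of f] by (intro mult_left_mono) (simp_all add: aG)
  finally show ?thesis using p by (simp add: power2_eq_square)
qed

lemma bGG_le: "b (G f) (G f) \<le> b f (G f)"
  using ba[of "G f"] by (simp add: aG)

end

section \<open>The antisymmetric tensor of a tuple and the first stage\<close>

context form_pair
begin

text \<open>Let \<open>T\<close> be the antisymmetric tensor \<open>\<Sum>k. G (U k) \<otimes> U k - U k \<otimes> G (U k)\<close>. Then
  \<open>tnorm\<close> is its squared Hilbert--Schmidt norm and \<open>tapp\<close> its action as an operator, both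
  with respect to the inner product \<open>a\<close>.\<close>
definition tnorm :: "nat \<Rightarrow> (nat \<Rightarrow> 'v) \<Rightarrow> real" where
  "tnorm N U = 2 * (\<Sum>k<N. \<Sum>l<N. b (U k) (G (U l)) * a (U k) (U l) - (b (U k) (U l))\<^sup>2)"
definition tapp :: "nat \<Rightarrow> (nat \<Rightarrow> 'v) \<Rightarrow> 'v \<Rightarrow> 'v" where
  "tapp N U y = (\<Sum>k<N. a (U k) y *\<^sub>R G (U k) - a (G (U k)) y *\<^sub>R U k)"

text \<open>The Hilbert-Schmidt norm of a product is at most operator norm times Hilbert-Schmidt
  norm. Antisymmetry of \<open>T\<close> moves it from the \<open>y j\<close> to the coordinate
  vectors \<open>f p\<close>; the hypothesis then applies to each \<open>T (f p)\<close>, and the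
  sum of their squared norms is \<open>tnorm\<close>.\<close>

lemma tapp_bound:
  fixes n :: nat
  assumes y: "\<And>v. (\<Sum>j<n. (a (y j) v)\<^sup>2) \<le> c * a v v"
  shows "(\<Sum>j<n. a (tapp N U (y j)) (tapp N U (y j))) \<le> c * tnorm N U"
proof -
  define F where "F = U ` {..<N} \<union> (\<lambda>k. G (U k)) ` {..<N} \<union> (\<lambda>j. tapp N U (y j)) ` {..<n}"
  have "finite F" by (simp add: F_def)
  from a.coordinates[OF this] obtain m and f :: "nat \<Rightarrow> 'v"
    where on: "\<And>i j. i < m \<Longrightarrow> j < m \<Longrightarrow> a (f i) (f j) = (if i = j then 1 else 0)"
      and ex: "\<And>x y. x \<in> F \<Longrightarrow> a x y = (\<Sum>i<m. a x (f i) * a y (f i))"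
    by blast
  have exU: "a (U k) y = (\<Sum>i<m. a (U k) (f i) * a y (f i))"
    and exGU: "a (G (U k)) y = (\<Sum>i<m. a (G (U k)) (f i) * a y (f i))" if "k < N" for k y
    using that by (auto intro!: ex simp: F_def)
  have exT: "a (tapp N U (y k)) z = (\<Sum>i<m. a (tapp N U (y k)) (f i) * a z (f i))" if "k < n" for k z
    using that by (auto intro!: ex simp: F_def)
  define w where "w p = tapp N U (f p)" for p
  have anti: "a (tapp N U x) z = - a x (tapp N U z)" for x z
    by (simp add: tapp_def a.lin a.sym[of x] sum_negf[symmetric] mult.commute)
  have "(\<Sum>j<n. a (tapp N U (y j)) (tapp N U (y j))) = (\<Sum>j<n. \<Sum>p<m. (a (y j) (w p))\<^sup>2)"
    by (intro sum.cong refl, subst exT) (simp_all add: anti w_def power2_eq_square)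
  also have "\<dots> = (\<Sum>p<m. \<Sum>j<n. (a (y j) (w p))\<^sup>2)" by (rule sum.swap)
  also have "\<dots> \<le> (\<Sum>p<m. c * a (w p) (w p))" by (intro sum_mono y)
  also have "(\<Sum>p<m. c * a (w p) (w p)) = c * (\<Sum>p<m. a (w p) (w p))" by (simp add: sum_distrib_left)
  \<comment> \<open>The coordinates are exact on \<open>U k\<close> and \<open>G (U k)\<close>, so
    the sums over \<open>p\<close> collapse by \<open>e\<close>, and the four products pair up into
    \<open>tnorm\<close>.\<close>
  also have "(\<Sum>p<m. a (w p) (w p)) = tnorm N U"
  proof -
    have e: "(\<Sum>p<m. a x (f p) * a z (f p) * s) = a x z * s" if "\<And>y. a x y = (\<Sum>i<m. a x (f i) * a y (f i))" for x z s
      unfolding that[of z] by (simp add: sum_distrib_right)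
    have "(\<Sum>p<m. a (w p) (w p)) = (\<Sum>p<m. \<Sum>k<N. \<Sum>l<N.
        a (U k) (f p) * a (U l) (f p) * a (G (U k)) (G (U l)) - a (U k) (f p) * a (G (U l)) (f p) * a (G (U k)) (U l)
      - (a (G (U k)) (f p) * a (U l) (f p) * a (U k) (G (U l)) - a (G (U k)) (f p) * a (G (U l)) (f p) * a (U k) (U l)))"
      unfolding w_def tapp_def a.sum_left unfolding a.sum_right
      by (intro sum.cong refl)
        (simp add: a.diff_left a.diff_right a.scale_left a.scale_right algebra_simps)
    also have "\<dots> = (\<Sum>k<N. \<Sum>l<N. \<Sum>p<m.
        a (U k) (f p) * a (U l) (f p) * a (G (U k)) (G (U l)) - a (U k) (f p) * a (G (U l)) (f p) * a (G (U k)) (U l)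
      - (a (G (U k)) (f p) * a (U l) (f p) * a (U k) (G (U l)) - a (G (U k)) (f p) * a (G (U l)) (f p) * a (U k) (U l)))"
      by (simp only: sum.swap[of _ "{..<N}" "{..<m}"])
    also have "\<dots> = (\<Sum>k<N. \<Sum>l<N. 2 * (b (U k) (G (U l)) * a (U k) (U l) - (b (U k) (U l))\<^sup>2))"
    proof (intro sum.cong refl)
      fix k l assume "k \<in> {..<N}" "l \<in> {..<N}"
      then have k: "k < N" by simp
      show "(\<Sum>p<m. a (U k) (f p) * a (U l) (f p) * a (G (U k)) (G (U l)) - a (U k) (f p) * a (G (U l)) (f p) * a (G (U k)) (U l)
        - (a (G (U k)) (f p) * a (U l) (f p) * a (U k) (G (U l)) - a (G (U k)) (f p) * a (G (U l)) (f p) * a (U k) (U l)))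
        = 2 * (b (U k) (G (U l)) * a (U k) (U l) - (b (U k) (U l))\<^sup>2)"
        by (simp only: sum_subtractf e[OF exU[OF k]] e[OF exGU[OF k]])
          (simp add: aG aG' bG power2_eq_square algebra_simps)
    qed
    finally show ?thesis by (simp add: tnorm_def sum_distrib_left)
  qed
  finally show ?thesis .
qed

end

text \<open>\<open>tb\<close> is the step size condition in scaled form, \<open>U_up\<close> bounds
  the Gram matrix and \<open>U_en\<close> the energy. \<open>Uh\<close> is given, not constructed:
  solvability of the implicit equation belongs to the hypotheses.\<close>

locale stage_one = form_pair a b G for a b :: "'v::real_vector \<Rightarrow> 'v \<Rightarrow> real" and G +
  fixes N :: nat and U Uh :: "nat \<Rightarrow> 'v" and t \<Lambda> E0 :: real
  assumes stage1: "j < N \<Longrightarrow> Uh j = U j + t *\<^sub>R (\<Sum>k<N. b (U k) ((1/2) *\<^sub>R (Uh j + U j)) *\<^sub>R G (U k)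
      - b (U k) (G ((1/2) *\<^sub>R (Uh j + U j))) *\<^sub>R U k)"
    and t0: "0 < t"
    and E0: "1/2 \<le> E0" and L1: "1 \<le> \<Lambda>"
    and tb: "t * (4 * E0 * \<Lambda>\<^sup>2 + \<Lambda>) \<le> 1"
    and U_up: "b (comb N U x) (comb N U x) \<le> \<Lambda> * dot N x x"
    and U_en: "(\<Sum>k<N. a (U k) (U k)) \<le> 2 * E0"
begin

definition "Um j = (1/2) *\<^sub>R (Uh j + U j)"
definition "Ad j = (\<Sum>k<N. b (U k) (Um j) *\<^sub>R G (U k) - b (U k) (G (Um j)) *\<^sub>R U k)"
abbreviation "T2 \<equiv> tnorm N U"

lemma Uh_eq: "j < N \<Longrightarrow> Uh j = U j + t *\<^sub>R Ad j"
  unfolding Ad_def Um_def by (rule stage1)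

text \<open>The implicit midpoint rule preserves quadratic invariants: the difference of two Gram
  entries is \<open>t\<close> times a pairing of \<open>Ad\<close> with the midpoint
  \<open>Um\<close>, and \<open>Ad\<close> is skew against \<open>Um\<close>.\<close>

lemma gram_Uh:
  assumes "i < N" "j < N"
  shows "b (Uh i) (Uh j) = b (U i) (U j)"
proof -
  have sk: "b (Ad i) (Um j) + b (Um i) (Ad j) = 0"
    by (simp add: Ad_def b.lin sum_subtractf[symmetric] sum.distrib[symmetric] bG
      b.sym[of "Um i"] b.sym[of "G (Um i)"] mult.commute)
  have "b (Uh i) (Uh j) - b (U i) (U j)
      = (b (Uh i - U i) (Um j) + b (Um i) (Uh j - U j))"
    by (simp add: Um_def b.lin algebra_simps)
  also have "\<dots> = t * (b (Ad i) (Um j) + b (Um i) (Ad j))"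
    using Uh_eq[OF assms(1)] Uh_eq[OF assms(2)] by (simp add: b.lin algebra_simps)
  finally show ?thesis using sk by simp
qed

lemma comb_gram: "b (comb N Uh x) (comb N Uh y) = b (comb N U x) (comb N U y)"
  by (simp add: b.comb_left b.comb_right gram_Uh)

text \<open>\<open>E0 \<ge> 1/2\<close> and \<open>\<Lambda> \<ge> 1\<close> give
  \<open>4 * E0 * \<Lambda>\<^sup>2 \<ge> 2 * \<Lambda>\<close>, so the bracket in \<open>tb\<close>
  is at least \<open>3 * \<Lambda>\<close>; dropping its second summand gives the other
  bound.\<close>

lemma tL: "t * \<Lambda> \<le> 1/3" and tEL: "t * (E0 * \<Lambda>\<^sup>2) \<le> 1/4"
proof -
  have 1: "\<Lambda> * 1 \<le> \<Lambda> * \<Lambda>" using L1 by (intro mult_left_mono) auto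
  have 2: "(1/2) * (\<Lambda> * \<Lambda>) \<le> E0 * (\<Lambda> * \<Lambda>)" using E0 by (intro mult_right_mono) auto
  have "t * (3 * \<Lambda>) \<le> t * (4 * E0 * \<Lambda>\<^sup>2 + \<Lambda>)"
    using 1 2 t0 by (intro mult_left_mono) (auto simp: power2_eq_square)
  then show "t * \<Lambda> \<le> 1/3" using tb by linarith
  have "t * (4 * (E0 * \<Lambda>\<^sup>2)) \<le> t * (4 * E0 * \<Lambda>\<^sup>2 + \<Lambda>)"
    using t0 L1 by (intro mult_left_mono) auto
  then show "t * (E0 * \<Lambda>\<^sup>2) \<le> 1/4" using tb by linarith
qed

text \<open>The energy drop. In coordinates of a finite \<open>a\<close>-orthonormal system let
  \<open>T V = GV \<otimes> V - V \<otimes> GV\<close>. Then \<open>T2\<close> is the squared norm of \<open>T U\<close>, the energy changes by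
  \<open>- t/2\<close> times the inner product of \<open>T U\<close> and \<open>T Um\<close>, and \<open>T Um\<close> is close to \<open>T U\<close>.\<close>
lemma stage_one_main:
  "(\<Sum>j<N. a (Ad j) (Ad j)) \<le> \<Lambda> * T2" (is ?th1)
  "(\<Sum>j<N. a (Uh j) (Uh j)) \<le> (\<Sum>j<N. a (U j) (U j)) - t / 4 * T2" (is ?th2)
  "0 \<le> T2" (is ?th3)
proof -
  define F where "F = U ` {..<N} \<union> (\<lambda>k. G (U k)) ` {..<N}"
  have "finite F" by (simp add: F_def)
  from a.coordinates[OF this] obtain m and f :: "nat \<Rightarrow> 'v"
    where on: "\<And>i j. i < m \<Longrightarrow> j < m \<Longrightarrow> a (f i) (f j) = (if i = j then 1 else 0)"
      and ex: "\<And>x y. x \<in> F \<Longrightarrow> a x y = (\<Sum>i<m. a x (f i) * a y (f i))"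
    by blast
  have exU: "a (U k) y = (\<Sum>i<m. a (U k) (f i) * a y (f i))"
    and exGU: "a (G (U k)) y = (\<Sum>i<m. a (G (U k)) (f i) * a y (f i))" if "k < N" for k y
    using that by (auto intro!: ex simp: F_def)
  \<comment> \<open>The coordinate matrix of the sum of all
    \<open>X k \<otimes> Z k\<close>.\<close>
  define ten where "ten X Z = RVec (\<lambda>(p, r). \<Sum>k<N. a (X k) (f p) * a (Z k) (f r))" for X Z :: "nat \<Rightarrow> 'v"
  define TT where "TT V = ten (\<lambda>k. G (V k)) V - ten V (\<lambda>k. G (V k))" for V
  have ten_add: "ten (\<lambda>k. X k + X' k) Z = ten X Z + ten X' Z" for X X' Z
    by (auto simp: ten_def a.lin algebra_simps sum.distrib intro!: rvec_eqI)
  \<comment> \<open>The matrix is the product of a Hilbert-Schmidt factor, the coordinates of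
    \<open>X\<close>, and the bounded operator \<open>comb N Z\<close>.\<close>
  have ten_norm: "hs m (ten X Z) (ten X Z) \<le> c * (\<Sum>k<N. a (X k) (X k))"
    and ten_norm': "hs m (ten Z X) (ten Z X) \<le> c * (\<Sum>k<N. a (X k) (X k))"
    if c: "\<And>x. a (comb N Z x) (comb N Z x) \<le> c * dot N x x" "0 \<le> c" for X Z c
  proof -
    define x where "x p = RVec (\<lambda>k. a (X k) (f p))" for p
    have q: "(\<Sum>k<N. a (X k) (f p) * a (Z k) (f r)) = a (comb N Z (x p)) (f r)" for p r
      by (simp add: a.comb_left x_def)
    have 1: "(\<Sum>p<m. \<Sum>r<m. (a (comb N Z (x p)) (f r))\<^sup>2) \<le> c * (\<Sum>k<N. a (X k) (X k))"
    proof -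
      have "(\<Sum>p<m. \<Sum>r<m. (a (comb N Z (x p)) (f r))\<^sup>2) \<le> (\<Sum>p<m. c * dot N (x p) (x p))"
        by (intro sum_mono order_trans[OF a.bessel[OF on] c(1)])
      also have "\<dots> = c * (\<Sum>k<N. \<Sum>p<m. (a (X k) (f p))\<^sup>2)"
        by (subst sum.swap) (simp add: sum_distrib_left dot_self x_def)
      also have "\<dots> \<le> c * (\<Sum>k<N. a (X k) (X k))"
        by (intro mult_left_mono sum_mono a.bessel[OF on] c(2))
      finally show ?thesis .
    qed
    have "hs m (ten X Z) (ten X Z) = (\<Sum>p<m. \<Sum>r<m. (a (comb N Z (x p)) (f r))\<^sup>2)"
      by (simp add: hs_def ten_def q power2_eq_square)
    then show "hs m (ten X Z) (ten X Z) \<le> c * (\<Sum>k<N. a (X k) (X k))" using 1 by simp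
    have "hs m (ten Z X) (ten Z X) = (\<Sum>r<m. \<Sum>p<m. (a (comb N Z (x p)) (f r))\<^sup>2)"
      by (simp add: hs_def ten_def q[symmetric] power2_eq_square mult.commute)
    also have "\<dots> = (\<Sum>p<m. \<Sum>r<m. (a (comb N Z (x p)) (f r))\<^sup>2)" by (rule sum.swap)
    finally show "hs m (ten Z X) (ten Z X) \<le> c * (\<Sum>k<N. a (X k) (X k))" using 1 by simp
  qed
  have ten_inner: "hs m (ten X Z) (ten X' Z') = (\<Sum>k<N. \<Sum>l<N. a (X k) (X' l) * a (Z k) (Z' l))"
    if "\<And>k y. k < N \<Longrightarrow> a (X k) y = (\<Sum>i<m. a (X k) (f i) * a y (f i))"
      "\<And>k y. k < N \<Longrightarrow> a (Z k) y = (\<Sum>i<m. a (Z k) (f i) * a y (f i))" for X Z X' Z'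
  proof -
    have "hs m (ten X Z) (ten X' Z') = (\<Sum>p<m. \<Sum>r<m. \<Sum>k<N. \<Sum>l<N.
        (a (X k) (f p) * a (X' l) (f p)) * (a (Z k) (f r) * a (Z' l) (f r)))"
      unfolding hs_def ten_def by (simp add: sum_product) (simp add: mult_ac)
    also have "\<dots> = (\<Sum>k<N. \<Sum>l<N. \<Sum>p<m. \<Sum>r<m.
        (a (X k) (f p) * a (X' l) (f p)) * (a (Z k) (f r) * a (Z' l) (f r)))"
      by (simp only: sum.swap[of _ "{..<N}" "{..<m}"])
    also have "\<dots> = (\<Sum>k<N. \<Sum>l<N. a (X k) (X' l) * a (Z k) (Z' l))"
      by (intro sum.cong refl) (simp add: sum_product[symmetric] that(1)[of _ "X' _"] that(2)[of _ "Z' _"])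
    finally show ?thesis .
  qed
  have TT_inner: "hs m (TT U) (TT V) = 2 * (\<Sum>k<N. \<Sum>l<N. b (U k) (G (V l)) * a (U k) (V l) - (b (U k) (V l))\<^sup>2)" for V
    unfolding TT_def
    by (simp add: hs.diff_left hs.diff_right ten_inner[OF exGU exU] ten_inner[OF exU exGU] aG aG' bG
        sum_subtractf sum_negf power2_eq_square sum_distrib_left mult_ac)
  have T2: "T2 = hs m (TT U) (TT U)" by (simp add: TT_inner tnorm_def)
  then show ?th3 using hs.nonneg by simp
  have combUm: "comb N Um x = (1/2) *\<^sub>R (comb N Uh x + comb N U x)" for x
  proof -
    have "comb N Um x = comb N (\<lambda>k. (1/2) *\<^sub>R (Uh k + U k)) x" by (simp add: comb_def Um_def)
    then show ?thesis by (simp add: comb_tuple_scale comb_tuple_add)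
  qed
  \<comment> \<open>\<open>U\<close> and \<open>Uh\<close> have the same Gram matrix; by convexity
    the midpoint obeys their common bound.\<close>
  have Um_up: "b (comb N Um x) (comb N Um x) \<le> \<Lambda> * dot N x x" for x
    using b.quad_add_le[of "comb N Uh x" "comb N U x"] U_up[of x]
    by (simp add: combUm b.quad_scale comb_gram power2_eq_square)
  have GUm: "a (comb N (\<lambda>k. G (Um k)) x) (comb N (\<lambda>k. G (Um k)) x) \<le> \<Lambda> * dot N x x" for x
    using bG_le[of "comb N Um x"] Um_up[of x] by (simp add: G_comb[symmetric] aG)
  have GU: "a (comb N (\<lambda>k. G (U k)) x) (comb N (\<lambda>k. G (U k)) x) \<le> \<Lambda> * dot N x x" for x
    using bG_le[of "comb N U x"] U_up[of x] by (simp add: G_comb[symmetric] aG)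
  show 1: ?th1
  proof -
    have "Ad j = tapp N U (G (Um j))" for j
      by (simp add: Ad_def tapp_def aG aG' bG)
    then show ?thesis
      using tapp_bound[where y = "\<lambda>j. G (Um j)" and n = N and c = \<Lambda> and N = N and U = U] a.adj_bound[OF GUm] L1 by simp
  qed
  \<comment> \<open>\<open>TT\<close> is quadratic, so \<open>TT Um - TT U\<close> is bilinear in
    the difference \<open>De\<close> and the sum \<open>Z\<close> (see \<open>diff\<close>). It is
    small because \<open>De\<close> is.\<close>
  define De where "De = (\<lambda>k. Um k - U k)"
  define Z where "Z = (\<lambda>k. Um k + U k)"
  define dl where "dl = sqrt (\<Sum>k<N. a (De k) (De k))"
  have dl2: "dl\<^sup>2 = (\<Sum>k<N. a (De k) (De k))" and dl0: "0 \<le> dl"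
    by (simp_all add: dl_def sum_nonneg a.nonneg)
  have De: "De k = (t / 2) *\<^sub>R Ad k" if "k < N" for k
    using Uh_eq[OF that] by (simp add: De_def Um_def algebra_simps flip: scaleR_add_left)
  have "dl\<^sup>2 = (t/2)\<^sup>2 * (\<Sum>k<N. a (Ad k) (Ad k))"
    by (simp add: dl2 De a.quad_scale sum_distrib_left)
  also have "\<dots> \<le> (t/2)\<^sup>2 * (\<Lambda> * T2)" by (intro mult_left_mono 1) simp
  finally have dlT: "dl\<^sup>2 \<le> (t/2)\<^sup>2 * (\<Lambda> * T2)" .
  have T20: "0 \<le> T2" using T2 hs.nonneg by simp
  \<comment> \<open>A crude bound on \<open>T2\<close>, whose purpose is to compare
    \<open>dl\<close> with \<open>sqrt E0\<close> in \<open>dl_le\<close>.\<close>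
  have "T2 \<le> 2 * (\<Sum>k<N. \<Sum>l<N. b (U k) (G (U l)) * a (U k) (U l))"
    unfolding tnorm_def by (intro mult_left_mono sum_mono) auto
  also have "\<dots> = 2 * hs m (ten (\<lambda>k. G (U k)) U) (ten (\<lambda>k. G (U k)) U)"
    by (simp add: ten_inner[OF exGU exU] aG bG)
  also have "\<dots> \<le> 2 * (\<Lambda> * (\<Sum>k<N. a (U k) (U k)))"
    using L1 by (intro mult_left_mono ten_norm'[OF GU]) auto
  also have "\<dots> \<le> 2 * (\<Lambda> * (2 * E0))" using L1 U_en by (intro mult_left_mono) auto
  finally have T2_le: "T2 \<le> 4 * (\<Lambda> * E0)" by simp
  have dl_le: "dl \<le> sqrt E0 / 3"
  proof (rule power2_le_imp_le)
    have "(t/2)\<^sup>2 * (\<Lambda> * T2) \<le> (t/2)\<^sup>2 * (\<Lambda> * (4 * (\<Lambda> * E0)))"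
      using L1 T2_le by (intro mult_left_mono) auto
    also have "\<dots> = (t * \<Lambda>)\<^sup>2 * E0" by (simp add: power2_eq_square)
    also have "\<dots> \<le> (1/3)\<^sup>2 * E0" using tL t0 L1 E0 by (intro mult_right_mono power_mono) auto
    finally show "dl\<^sup>2 \<le> (sqrt E0 / 3)\<^sup>2" using dlT E0 by (simp add: power_divide)
  qed (use E0 in simp)
  have dl_le2: "dl \<le> (t/2) * (sqrt \<Lambda> * sqrt T2)"
  proof (rule power2_le_imp_le)
    show "dl\<^sup>2 \<le> (t/2 * (sqrt \<Lambda> * sqrt T2))\<^sup>2" using dlT L1 T20 by (simp add: power_mult_distrib power_divide)
  qed (use t0 L1 T20 in simp)
  \<comment> \<open>\<open>Z\<close> is \<open>2 U + De\<close>, and the energy bounds the operator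
    norm of \<open>U\<close> by \<open>sqrt (2 * E0)\<close>.\<close>
  define cz where "cz = 2 * sqrt (2 * E0) + dl"
  have cz0: "0 \<le> cz" using dl0 E0 by (simp add: cz_def)
  have combZ: "comb N Z x = 2 *\<^sub>R comb N U x + comb N De x" for x
    by (simp add: Z_def De_def comb_tuple_add comb_tuple_diff scaleR_2)
  have Z_op: "a (comb N Z x) (comb N Z x) \<le> cz\<^sup>2 * dot N x x" for x
  proof -
    have u: "a.nrm (comb N U x) \<le> sqrt (2 * E0) * dot.nrm N x"
    proof (rule a.nrm_le)
      have "a (comb N U x) (comb N U x) \<le> (2 * E0) * dot N x x"
        by (rule order_trans[OF a.comb_bound]) (intro mult_right_mono U_en dot.nonneg)
      then show "a (comb N U x) (comb N U x) \<le> (sqrt (2 * E0) * dot.nrm N x)\<^sup>2"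
        using E0 by (simp add: power_mult_distrib dot.nrm_sq)
    qed (use E0 in simp)
    have d: "a.nrm (comb N De x) \<le> dl * dot.nrm N x"
    proof (rule a.nrm_le)
      show "a (comb N De x) (comb N De x) \<le> (dl * dot.nrm N x)\<^sup>2"
        using a.comb_bound[of N De x] by (simp add: power_mult_distrib dot.nrm_sq dl2)
    qed (use dl0 in simp)
    have "a.nrm (comb N Z x) \<le> 2 * a.nrm (comb N U x) + a.nrm (comb N De x)"
      unfolding combZ by (rule order_trans[OF a.nrm_triangle]) (simp add: a.nrm_scale)
    also have "\<dots> \<le> cz * dot.nrm N x" using u d by (simp add: cz_def algebra_simps)
    finally have "(a.nrm (comb N Z x))\<^sup>2 \<le> (cz * dot.nrm N x)\<^sup>2" by (intro power_mono) simp_all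
    then show ?thesis by (simp add: a.nrm_sq power_mult_distrib dot.nrm_sq)
  qed
  have GZ_op: "a (comb N (\<lambda>k. G (Z k)) x) (comb N (\<lambda>k. G (Z k)) x) \<le> (4 * \<Lambda>) * dot N x x" for x
  proof -
    have "comb N Z x = comb N Um x + comb N U x" by (simp add: Z_def comb_tuple_add)
    then have "b (comb N Z x) (comb N Z x) \<le> (4 * \<Lambda>) * dot N x x"
      using b.quad_add_le[of "comb N Um x" "comb N U x"] Um_up[of x] U_up[of x] by simp
    then show ?thesis using bG_le[of "comb N Z x"] by (simp add: G_comb[symmetric] aG)
  qed
  have GDe: "(\<Sum>k<N. a (G (De k)) (G (De k))) \<le> dl\<^sup>2"
    unfolding dl2 by (intro sum_mono) (use bG_le ba order_trans aG in metis)
  have n1: "hs.nrm m (ten (\<lambda>k. G (De k)) Z) \<le> cz * dl" "hs.nrm m (ten Z (\<lambda>k. G (De k))) \<le> cz * dl"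
  proof -
    have *: "cz\<^sup>2 * (\<Sum>k<N. a (G (De k)) (G (De k))) \<le> (cz * dl)\<^sup>2"
      using GDe by (simp add: power_mult_distrib mult_left_mono)
    show "hs.nrm m (ten (\<lambda>k. G (De k)) Z) \<le> cz * dl" "hs.nrm m (ten Z (\<lambda>k. G (De k))) \<le> cz * dl"
      using cz0 dl0 order_trans[OF ten_norm[OF Z_op] *] order_trans[OF ten_norm'[OF Z_op] *]
      by (auto intro!: hs.nrm_le)
  qed
  have n2: "hs.nrm m (ten (\<lambda>k. G (Z k)) De) \<le> 2 * sqrt \<Lambda> * dl" "hs.nrm m (ten De (\<lambda>k. G (Z k))) \<le> 2 * sqrt \<Lambda> * dl"
  proof -
    have *: "(4 * \<Lambda>) * (\<Sum>k<N. a (De k) (De k)) \<le> (2 * sqrt \<Lambda> * dl)\<^sup>2"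
      using L1 by (simp add: power_mult_distrib dl2)
    have L: "0 \<le> 4 * \<Lambda>" using L1 by simp
    show "hs.nrm m (ten (\<lambda>k. G (Z k)) De) \<le> 2 * sqrt \<Lambda> * dl" "hs.nrm m (ten De (\<lambda>k. G (Z k))) \<le> 2 * sqrt \<Lambda> * dl"
      using L1 dl0 order_trans[OF ten_norm[OF GZ_op L] *] order_trans[OF ten_norm'[OF GZ_op L] *]
      by (auto intro!: hs.nrm_le)
  qed
  have diff: "TT Um - TT U = (1/2) *\<^sub>R ((ten (\<lambda>k. G (De k)) Z + ten (\<lambda>k. G (Z k)) De)
      - (ten De (\<lambda>k. G (Z k)) + ten Z (\<lambda>k. G (De k))))"
  proof (rule rvec_eqI)
    fix pr :: "nat \<times> nat"
    obtain p r where pr: "pr = (p, r)" by force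
    show "rapp (TT Um - TT U) pr = rapp ((1/2) *\<^sub>R ((ten (\<lambda>k. G (De k)) Z + ten (\<lambda>k. G (Z k)) De)
      - (ten De (\<lambda>k. G (Z k)) + ten Z (\<lambda>k. G (De k))))) pr"
      by (simp add: pr TT_def ten_def sum_distrib_left sum.distrib[symmetric] sum_subtractf[symmetric] sum_divide_distrib)
        (intro sum.cong refl, simp add: De_def Z_def G_add G_diff a.lin field_simps)
  qed
  have "hs.nrm m (TT Um - TT U) \<le> (1/2) * ((cz * dl + 2 * sqrt \<Lambda> * dl) + (2 * sqrt \<Lambda> * dl + cz * dl))"
    unfolding diff hs.nrm_scale
    using order_trans[OF hs.nrm_diff add_mono[OF order_trans[OF hs.nrm_triangle add_mono[OF n1(1) n2(1)]]
      order_trans[OF hs.nrm_triangle add_mono[OF n2(2) n1(2)]]]] by simp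
  also have "\<dots> = dl * (cz + 2 * sqrt \<Lambda>)" by (simp add: algebra_simps)
  \<comment> \<open>By \<open>dl_le\<close> the factor of \<open>sqrt E0\<close> in
    \<open>cz\<close> is at most \<open>2 * sqrt 2 + 1/3\<close>, just below 3162/1000.\<close>
  also have "\<dots> \<le> ((t/2) * (sqrt \<Lambda> * sqrt T2)) * ((3162/1000) * sqrt E0 + 2 * sqrt \<Lambda>)"
  proof (rule mult_mono[OF dl_le2])
    have "sqrt 2 \<le> (14143/10000)" by (rule real_le_lsqrt) (simp_all add: power2_eq_square)
    then have "sqrt 2 * sqrt E0 \<le> (14143/10000) * sqrt E0" using E0 by (intro mult_right_mono) auto
    moreover have se: "0 \<le> sqrt E0" using E0 by simp
    ultimately show "cz + 2 * sqrt \<Lambda> \<le> (3162/1000) * sqrt E0 + 2 * sqrt \<Lambda>"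
      using dl_le se unfolding cz_def real_sqrt_mult by linarith
    show "0 \<le> cz + 2 * sqrt \<Lambda>" using cz0 L1 by simp
  qed (use t0 L1 T20 in simp)
  also have "\<dots> = ((t/2) * ((3162/1000) * (sqrt \<Lambda> * sqrt E0) + 2 * \<Lambda>)) * sqrt T2"
    using L1 by (simp add: algebra_simps)
  \<comment> \<open>A linear program in \<open>t * E0 * \<Lambda>\<^sup>2\<close> and
    \<open>t * \<Lambda>\<close>: under \<open>tb\<close> and \<open>E0 \<ge> 1/2\<close> the worst
    case has the values 1/6 and 1/3, where the factor of \<open>sqrt T2\<close> is about
    0.71.\<close>
  also have "\<dots> \<le> 3/4 * sqrt T2"
  proof (rule mult_right_mono)
    have x: "1/2 \<le> E0 * \<Lambda>" using mult_mono[OF E0 L1] E0 by simp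
    have "sqrt (\<Lambda> * E0) \<le> (14143/10000) * (E0 * \<Lambda>)"
    proof (rule real_le_lsqrt)
      have "(E0 * \<Lambda>) * 1 \<le> (E0 * \<Lambda>) * (2 * (E0 * \<Lambda>))" using x by (intro mult_left_mono) auto
      then show "\<Lambda> * E0 \<le> ((14143/10000) * (E0 * \<Lambda>))\<^sup>2" using x by (simp add: power2_eq_square field_simps)
    qed (use x in auto)
    then have s: "t * (sqrt \<Lambda> * sqrt E0) \<le> t * ((14143/10000) * (E0 * \<Lambda>))"
      using t0 by (intro mult_left_mono) (auto simp: real_sqrt_mult)
    have y: "t * (E0 * \<Lambda>) \<le> t * (E0 * \<Lambda>\<^sup>2)"
      using t0 E0 L1 by (intro mult_left_mono) (auto simp: power2_eq_square)
    have z: "t * \<Lambda> \<le> 2 * (t * (E0 * \<Lambda>))"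
      using mult_right_mono[OF E0, of "t * \<Lambda>"] t0 L1 by (simp add: algebra_simps)
    have w: "4 * (t * (E0 * \<Lambda>\<^sup>2)) + t * \<Lambda> \<le> 1" using tb by (simp add: algebra_simps)
    have "(t/2) * ((3162/1000) * (sqrt \<Lambda> * sqrt E0) + 2 * \<Lambda>) = (1581/1000) * (t * (sqrt \<Lambda> * sqrt E0)) + t * \<Lambda>"
      by (simp add: algebra_simps)
    also have "\<dots> \<le> 3/4" using s y z w by linarith
    finally show "(t/2) * ((3162/1000) * (sqrt \<Lambda> * sqrt E0) + 2 * \<Lambda>) \<le> 3/4" .
  qed (use T20 in simp)
  finally have small: "hs.nrm m (TT Um - TT U) \<le> 3/4 * sqrt T2" .
  have "\<bar>hs m (TT U) (TT Um - TT U)\<bar> \<le> sqrt T2 * (3/4 * sqrt T2)"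
    using order_trans[OF hs.abs_le_nrm mult_left_mono[OF small hs.nrm_nonneg]]
    by (simp add: hs.nrm_def T2)
  also have "sqrt T2 * (3/4 * sqrt T2) = 3/4 * T2"
    using T20 by (metis abs_of_nonneg mult.left_commute real_sqrt_mult_self)
  finally have "\<bar>hs m (TT U) (TT Um) - T2\<bar> \<le> 3/4 * T2" by (simp add: hs.diff_right T2[symmetric])
  then have inner: "T2 / 4 \<le> hs m (TT U) (TT Um)" by linarith
  \<comment> \<open>For the midpoint rule the difference of the quadratic energies is linear in
    \<open>Ad\<close>; no term in \<open>t\<^sup>2\<close> is left over.\<close>
  have "(\<Sum>j<N. a (Uh j) (Uh j)) - (\<Sum>j<N. a (U j) (U j)) = 2 * t * (\<Sum>j<N. a (Ad j) (Um j))"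
    by (simp add: sum_subtractf[symmetric] sum_distrib_left Uh_eq Um_def a.lin a.sym[of "Ad _" "U _"] algebra_simps)
  also have "(\<Sum>j<N. a (Ad j) (Um j)) = - (1/2) * hs m (TT U) (TT Um)"
  proof -
    have "(\<Sum>j<N. a (Ad j) (Um j)) = (\<Sum>j<N. \<Sum>k<N. (b (U k) (Um j))\<^sup>2 - b (U k) (G (Um j)) * a (U k) (Um j))"
      by (simp add: Ad_def a.lin aG power2_eq_square)
    also have "\<dots> = (\<Sum>k<N. \<Sum>j<N. (b (U k) (Um j))\<^sup>2 - b (U k) (G (Um j)) * a (U k) (Um j))"
      by (rule sum.swap)
    also have "\<dots> = - (1/2) * hs m (TT U) (TT Um)"
      by (simp add: TT_inner sum_negf[symmetric])
    finally show ?thesis .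
  qed
  finally have "(\<Sum>j<N. a (Uh j) (Uh j)) = (\<Sum>j<N. a (U j) (U j)) - t * hs m (TT U) (TT Um)" by simp
  moreover have "t * (T2 / 4) \<le> t * hs m (TT U) (TT Um)" using inner t0 by (intro mult_left_mono) auto
  ultimately show ?th2 by simp
qed

end


section \<open>Second stage: the change of the Gram matrix\<close>

locale stage_two =
  m: psd_form m for m :: "nat rvec \<Rightarrow> nat rvec \<Rightarrow> real" +
  fixes N :: nat and d m2 :: "nat rvec \<Rightarrow> nat rvec \<Rightarrow> real" and D M :: "nat rvec \<Rightarrow> nat rvec"
    and t \<Lambda> E0 :: real
  assumes d_sym: "d x y = d y x"
    and d_add: "d (x + y) z = d x z + d y z"
    and d_scale: "d (c *\<^sub>R x) y = c * d x y"
    and Dd: "dot N (D x) y = d x y"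
    and Mm: "dot N (M x) y = m x y"
    and M_add: "M (x + y) = M x + M y"
    and M_scale: "M (c *\<^sub>R x) = c *\<^sub>R M x"
    and M_supp: "supp N (M x)"
    and m_up: "m x x \<le> \<Lambda> * dot N x x"
    and m2_up: "m2 x x \<le> \<Lambda> * dot N x x"
    and m2_nonneg: "0 \<le> m2 x x"
    and m_lo: "9 / (32 * E0) * dot N x x \<le> m x x"
    and d_up: "d x x \<le> (\<Lambda> - 1) * dot N x x"
    and d_lo: "- ((\<Lambda> - 1) / (8 * E0 * \<Lambda>)) * dot N x x \<le> d x x"
    and t0: "0 < t" and E0: "1/2 \<le> E0" and L1: "1 \<le> \<Lambda>"
    and tb: "t * (4 * E0 * \<Lambda>\<^sup>2 + \<Lambda>) \<le> 1"
    and tL: "t * \<Lambda> \<le> 1/3" and tEL: "t * (E0 * \<Lambda>\<^sup>2) \<le> 1/4"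
begin

text \<open>\<open>d\<close>, \<open>m\<close> and \<open>m2\<close> are the matrices
  \<open>S - I\<close>, of \<open>G\<close> and of \<open>G\<^sup>2\<close> on the tuple
  \<open>Uh\<close>, as forms; \<open>D\<close> and \<open>M\<close> are the first two as operators.
  \<open>dn\<close> is \<open>S - I\<close> after the second stage. Completing the square with
  \<open>zz\<close> in \<open>dn_self\<close> exposes the subtracted term
  \<open>t\<^sup>2 * d (M x) (M x)\<close>, which may destroy positivity; \<open>Yn\<close> adds it
  back, together with enough of \<open>Y\<close> to keep the increment positive
  semidefinite.\<close>

definition "dn x y = d x y - t * m (D x) y - t * m x (D y) + t\<^sup>2 * m2 (D x) (D y)"
definition "zz x = x - t *\<^sub>R M x"
definition "Yn Y x y = Y (zz x) (zz y) + t\<^sup>2 * (d (M x) (M y) + Y (M x) (M y))"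

lemma d_diff: "d (x - y) z = d x z - d y z"
  using d_add[of "x - y" y z] by simp

text \<open>\<open>M\<close> is positive semidefinite and at most \<Lambda>, hence
  \<open>M\<^sup>2 \<le> \<Lambda> M\<close>: Cauchy-Schwarz for \<open>m\<close> at
  \<open>x\<close> and \<open>M x\<close>.\<close>

lemma M_bound: "dot N (M x) (M x) \<le> \<Lambda> * m x x"
proof -
  define s where "s = dot N (M x) (M x)"
  have s0: "0 \<le> s" by (simp add: s_def dot.nonneg)
  have "s\<^sup>2 = (m x (M x))\<^sup>2" by (simp add: s_def Mm)
  also have "\<dots> \<le> m x x * m (M x) (M x)" by (rule m.cs)
  also have "\<dots> \<le> m x x * (\<Lambda> * s)" unfolding s_def by (intro mult_left_mono m_up m.nonneg)
  finally have h: "s * s \<le> s * (\<Lambda> * m x x)" by (simp add: power2_eq_square algebra_simps)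
  have "0 \<le> \<Lambda> * m x x" using L1 m.nonneg[of x] by simp
  then show ?thesis
    using h s0 unfolding s_def[symmetric] by (cases "s = 0") auto
qed

lemma mDx: "m (D x) x = d x (M x)" "m x (D x) = d x (M x)"
  by (metis Mm Dd dot.sym m.sym)+

lemma d_zz: "d (zz x) (zz x) = d x x - 2 * t * d x (M x) + t\<^sup>2 * d (M x) (M x)"
  using d_sym[of "M x" x] d_sym[of x "M x - x"] d_sym[of "M x" "t *\<^sub>R M x"]
  by (simp add: zz_def d_diff d_scale d_sym[of x "x - t *\<^sub>R M x"] d_sym[of "M x" "x - t *\<^sub>R M x"]
    power2_eq_square algebra_simps)

lemma dn_self: "dn x x = d (zz x) (zz x) - t\<^sup>2 * d (M x) (M x) + t\<^sup>2 * m2 (D x) (D x)"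
  by (simp add: dn_def d_zz mDx)

lemma dot_zz: "dot N (zz x) (zz x) = dot N x x - 2 * t * m x x + t\<^sup>2 * dot N (M x) (M x)"
proof -
  have "dot N x (M x) = m x x" by (metis Mm dot.sym)
  then show ?thesis
    by (simp add: zz_def dot.quad_diff dot.scale_right dot.scale_left power2_eq_square)
qed

text \<open>The negative part allowed to \<open>S - I\<close>. It satisfies
  \<open>\<Lambda> - 1 = 8 * del * E0 * \<Lambda>\<close>, so \<open>tb\<close> and
  \<open>tEL\<close> yield \<open>t * ((del + (\<Lambda> - 1)) * \<Lambda>) \<le> 2 * del\<close>;
  this is exactly what makes the lower bound reproduce itself in \<open>dn_lo\<close>.\<close>

definition "del = (\<Lambda> - 1) / (8 * E0 * \<Lambda>)"

lemma del: "0 \<le> del" "del \<le> (\<Lambda> - 1) / 4" "del \<le> 1/4" "t * ((del + (\<Lambda> - 1)) * \<Lambda>) \<le> 2 * del"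
proof -
  have EL: "1/2 \<le> E0 * \<Lambda>" using mult_mono[OF E0 L1] E0 by simp
  then have pos: "0 < 8 * E0 * \<Lambda>" by simp
  show "0 \<le> del" using L1 pos by (simp add: del_def)
  show "del \<le> (\<Lambda> - 1) / 4" unfolding del_def using L1 EL by (intro divide_left_mono) auto
  have "(\<Lambda> - 1) * 4 \<le> 4 * \<Lambda>" by simp
  also have "\<dots> \<le> 8 * E0 * \<Lambda>" using E0 L1 by (intro mult_right_mono) auto
  finally have "(\<Lambda> - 1) * 4 \<le> 8 * E0 * \<Lambda>" .
  then show "del \<le> 1/4" unfolding del_def using pos by (simp add: pos_divide_le_eq)
  define w where "w = E0 * \<Lambda>"
  have w: "1/2 \<le> w" "\<Lambda> - 1 = del * (8 * w)" using EL E0 L1 by (auto simp: w_def del_def)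
  have tw: "t * (w * \<Lambda>) \<le> 1/4" using tEL by (simp add: w_def power2_eq_square algebra_simps)
  have "t * ((del + (\<Lambda> - 1)) * \<Lambda>) = del * (t * \<Lambda> + 8 * (t * (w * \<Lambda>)))"
    by (simp add: w(2) algebra_simps)
  also have "\<dots> \<le> del * 2"
    using tb mult_nonneg_nonneg[OF less_imp_le[OF t0] order_trans[OF zero_le_one L1]] \<open>0 \<le> del\<close>
    by (intro mult_left_mono) (auto simp: w_def power2_eq_square algebra_simps)
  finally show "t * ((del + (\<Lambda> - 1)) * \<Lambda>) \<le> 2 * del" by simp
qed

text \<open>In the lower bound, conjugation with \<open>zz\<close> gains
  \<open>2 * t * del * m x x\<close>. The second-order terms cost at most
  \<open>t\<^sup>2 * (del + \<Lambda> - 1) * \<Lambda> * m x x\<close>, which is no more by the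
  choice of \<open>del\<close>.\<close>

lemma dn_lo: "- del * dot N x x \<le> dn x x"
proof -
  have 1: "- del * dot N (zz x) (zz x) \<le> d (zz x) (zz x)" using d_lo[of "zz x"] by (simp add: del_def)
  have 2: "t\<^sup>2 * d (M x) (M x) \<le> t\<^sup>2 * ((\<Lambda> - 1) * dot N (M x) (M x))" by (intro mult_left_mono d_up) simp
  have 3: "0 \<le> t\<^sup>2 * m2 (D x) (D x)" using m2_nonneg by simp
  have 4: "t\<^sup>2 * ((del + (\<Lambda> - 1)) * dot N (M x) (M x)) \<le> t\<^sup>2 * ((del + (\<Lambda> - 1)) * (\<Lambda> * m x x))"
    using del(1) L1 by (intro mult_left_mono M_bound) auto
  have 5: "(t * m x x) * (t * ((del + (\<Lambda> - 1)) * \<Lambda>)) \<le> (t * m x x) * (2 * del)"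
    using t0 m.nonneg[of x] by (intro mult_left_mono del) auto
  have "dn x x + del * dot N x x \<ge> 2 * t * del * m x x - t\<^sup>2 * ((del + (\<Lambda> - 1)) * dot N (M x) (M x))"
    using 1 2 3 by (simp add: dn_self dot_zz algebra_simps)
  then show ?thesis using 4 5 by (simp add: algebra_simps power2_eq_square)
qed

lemma D_bound: "dot N (D x) (D x) \<le> (\<Lambda> - 1)\<^sup>2 * dot N x x"
proof (rule sym_op_bound)
  show "dot N (D x) y = dot N x (D y)" for x y by (metis Dd dot.sym d_sym)
  show "\<bar>dot N (D x) x\<bar> \<le> (\<Lambda> - 1) * dot N x x" for x
  proof -
    have "del * dot N x x \<le> (\<Lambda> - 1) * dot N x x"
      using del L1 by (intro mult_right_mono dot.nonneg) auto
    then show ?thesis using d_up[of x] d_lo[of x] by (simp add: Dd del_def abs_le_iff)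
  qed
qed (use L1 in \<open>auto simp: Dd d_add d_scale\<close>)

text \<open>Conjugation with \<open>zz\<close> frees \<open>2 * t * (\<Lambda> - 1) * m x x\<close>.
  In units of \<open>t * (\<Lambda> - 1) * m x x\<close> the terms in \<open>M x\<close> use 5/12 of
  this and the \<open>m2\<close> term, by \<open>m_lo\<close>, uses 8/9.\<close>

lemma dn_up: "dn x x \<le> (\<Lambda> - 1) * dot N x x"
proof -
  let ?c = "\<Lambda> - 1"
  have c: "0 \<le> ?c" using L1 by simp
  have 1: "d (zz x) (zz x) \<le> ?c * dot N (zz x) (zz x)" by (rule d_up)
  have 2: "- t\<^sup>2 * d (M x) (M x) \<le> t\<^sup>2 * (del * dot N (M x) (M x))"
    using mult_left_mono[OF d_lo[of "M x"], of "t\<^sup>2"] by (simp add: del_def)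
  have 3: "t\<^sup>2 * m2 (D x) (D x) \<le> t\<^sup>2 * (\<Lambda> * (?c\<^sup>2 * dot N x x))"
    by (intro mult_left_mono order_trans[OF m2_up] D_bound) (use L1 in auto)
  have 4: "t\<^sup>2 * ((?c + del) * dot N (M x) (M x)) \<le> t\<^sup>2 * ((5/4 * ?c) * (\<Lambda> * m x x))"
    using del c L1 m.nonneg[of x] by (intro mult_left_mono mult_mono M_bound dot.nonneg) auto
  have 5: "(t * (5/4 * ?c * m x x)) * (t * \<Lambda>) \<le> (t * (5/4 * ?c * m x x)) * (1/3)"
    using t0 c m.nonneg[of x] by (intro mult_left_mono tL) auto
  have 6: "t\<^sup>2 * (\<Lambda> * (?c\<^sup>2 * dot N x x)) \<le> (t * ?c) * (1 / (4 * E0) * dot N x x)"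
  proof -
    have "?c * \<Lambda> \<le> \<Lambda> * \<Lambda>" using L1 by (intro mult_right_mono) auto
    then have "t * (?c * \<Lambda>) \<le> t * \<Lambda>\<^sup>2" using t0 by (intro mult_left_mono) (auto simp: power2_eq_square)
    also have "\<dots> \<le> 1 / (4 * E0)" using tEL E0 by (simp add: field_simps)
    finally have "(t * ?c) * (t * (?c * \<Lambda>) * dot N x x) \<le> (t * ?c) * (1 / (4 * E0) * dot N x x)"
      using t0 c by (intro mult_left_mono mult_right_mono dot.nonneg) auto
    then show ?thesis by (simp add: power2_eq_square algebra_simps)
  qed
  have 7: "(t * ?c) * (1 / (4 * E0) * dot N x x) \<le> (t * ?c) * (8/9 * m x x)"
    using m_lo[of x] t0 c E0 by (intro mult_left_mono) (auto simp: field_simps)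
  have "?c * dot N x x - dn x x \<ge> 2 * (t * ?c * m x x) - t\<^sup>2 * ((?c + del) * dot N (M x) (M x)) - t\<^sup>2 * m2 (D x) (D x)"
    using 1 2 by (simp add: dn_self dot_zz algebra_simps)
  moreover have "0 \<le> t * ?c * m x x" using t0 c m.nonneg[of x] by simp
  moreover have "t\<^sup>2 * ((5/4 * ?c) * (\<Lambda> * m x x)) = (t * (5/4 * ?c * m x x)) * (t * \<Lambda>)"
    "(t * (5/4 * ?c * m x x)) * (1/3) = 5/12 * (t * ?c * m x x)"
    "(t * ?c) * (8/9 * m x x) = 8/9 * (t * ?c * m x x)"
    by (simp_all add: power2_eq_square)
  ultimately show ?thesis using 3 4 5 6 7 by linarith
qed

lemma zz_add: "zz (x + y) = zz x + zz y" and zz_scale: "zz (c *\<^sub>R x) = c *\<^sub>R zz x"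
  by (simp_all add: zz_def M_add M_scale algebra_simps)

text \<open>By \<open>tL\<close> the quadratic term is at most \<open>1/3 * t * m x x\<close>,
  against a gain of \<open>2 * t * m x x\<close>; this leaves 5/3, and \<open>m_lo\<close> converts
  \<open>m\<close> into a multiple of \<open>dot\<close>.\<close>

lemma zz_bound: "dot N (zz x) (zz x) \<le> (1 - 5/3 * t * (9 / (32 * E0))) * dot N x x"
proof -
  have 1: "t\<^sup>2 * dot N (M x) (M x) \<le> (t * m x x) * (t * \<Lambda>)"
    using mult_left_mono[OF M_bound[of x], of "t\<^sup>2"] by (simp add: power2_eq_square algebra_simps)
  have 2: "(t * m x x) * (t * \<Lambda>) \<le> (t * m x x) * (1/3)"
    using t0 m.nonneg[of x] by (intro mult_left_mono tL) auto
  have 3: "5/3 * t * (9 / (32 * E0) * dot N x x) \<le> 5/3 * t * m x x"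
    using t0 by (intro mult_left_mono m_lo) auto
  show ?thesis using 1 2 3 by (simp add: dot_zz algebra_simps)
qed

lemma M_sym: "dot N (M x) y = dot N x (M y)"
  by (metis Mm dot.sym m.sym)

context
  fixes Y
  assumes Y: "psd_form Y" and dY: "psd_form (\<lambda>x y. d x y + Y x y)"
begin

lemma Yn_psd: "psd_form (Yn Y)"
  unfolding Yn_def
  by (intro psd_form_add psd_form_scale psd_form_pullback[OF Y] psd_form_pullback[OF dY])
    (simp_all add: zz_add zz_scale M_add M_scale)

lemma dn_Yn_nonneg: "0 \<le> dn x x + Yn Y x x"
proof -
  have "0 \<le> d (zz x) (zz x) + Y (zz x) (zz x)" "0 \<le> t\<^sup>2 * Y (M x) (M x)" "0 \<le> t\<^sup>2 * m2 (D x) (D x)"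
    using psd_form.nonneg[OF dY, of "zz x"] psd_form.nonneg[OF Y, of "M x"] m2_nonneg[of "D x"] by simp_all
  then show ?thesis by (simp add: dn_self Yn_def distrib_left)
qed

text \<open>Both parts of \<open>Yn\<close> are conjugates, so \<open>psd_trace\<close> applies,
  with \<open>zz_bound\<close> and with \<open>M\<^sup>2 \<le> \<Lambda>\<^sup>2\<close>. The old
  trace contracts, and the influx has order \<open>t\<^sup>2\<close>.\<close>

lemma Yn_trace:
  "tr N (Yn Y) \<le> (1 - 5/3 * t * (9 / (32 * E0))) * tr N Y + t\<^sup>2 * (\<Lambda>\<^sup>2 * (tr N d + tr N Y))"
proof -
  have 1: "(\<Sum>i<N. Y (zz (unitv i)) (zz (unitv i))) \<le> (1 - 5/3 * t * (9 / (32 * E0))) * tr N Y"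
  proof (rule psd_trace[OF Y])
    show "dot N (zz x) y = dot N x (zz y)" for x y
      by (simp add: zz_def dot.lin M_sym)
    show "supp N (zz (unitv i))" if "i < N" for i
      using that by (auto simp: zz_def intro: supp_diff supp_scale supp_unitv M_supp)
  qed (rule zz_bound)
  have M2: "dot N (M x) (M x) \<le> \<Lambda>\<^sup>2 * dot N x x" for x
    using order_trans[OF M_bound mult_left_mono[OF m_up[of x], of \<Lambda>]] L1 by (simp add: power2_eq_square mult.assoc)
  have 2: "(\<Sum>i<N. d (M (unitv i)) (M (unitv i)) + Y (M (unitv i)) (M (unitv i)))
      \<le> \<Lambda>\<^sup>2 * tr N (\<lambda>x y. d x y + Y x y)"
    by (rule psd_trace[OF dY]) (auto intro: M_sym M2 M_supp)
  have "tr N (Yn Y) = (\<Sum>i<N. Y (zz (unitv i)) (zz (unitv i)))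
      + t\<^sup>2 * (\<Sum>i<N. d (M (unitv i)) (M (unitv i)) + Y (M (unitv i)) (M (unitv i)))"
    by (simp add: tr_def Yn_def sum.distrib sum_distrib_left algebra_simps)
  then show ?thesis
    using 1 mult_left_mono[OF 2, of "t\<^sup>2"] by (simp add: tr_def sum.distrib)
qed

end

end

section \<open>Both stages combined, and the Lyapunov functional\<close>

context form_pair
begin

text \<open>The matrix \<open>S - I\<close> as a form on coefficient vectors; \<open>frob\<close>
  below is its squared Frobenius norm.\<close>

definition dev :: "nat \<Rightarrow> (nat \<Rightarrow> 'v) \<Rightarrow> nat rvec \<Rightarrow> nat rvec \<Rightarrow> real" where
  "dev N U x y = b (comb N U x) (comb N U y) - dot N x y"

definition nrg :: "nat \<Rightarrow> (nat \<Rightarrow> 'v) \<Rightarrow> real" where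
  "nrg N U = (\<Sum>k<N. a (U k) (U k)) / 2"

definition frob :: "nat \<Rightarrow> (nat \<Rightarrow> 'v) \<Rightarrow> real" where
  "frob N U = (\<Sum>i<N. \<Sum>k<N. (dev N U (unitv i) (unitv k))\<^sup>2)"

lemma frob_nonneg: "0 \<le> frob N U"
  by (simp add: frob_def sum_nonneg)

lemma dev_sym: "dev N U x y = dev N U y x"
  by (simp add: dev_def b.sym[of "comb N U x"] dot.sym[of N x])

end

text \<open>The invariant of the iteration: \<open>Y\<close> dominates the negative part of \<open>S - I\<close>, where \<open>S\<close>
  is the Gram matrix. (\<open>S - I\<close> itself need not stay positive semidefinite.)\<close>
definition (in form_pair) invar :: "nat \<Rightarrow> real \<Rightarrow> real \<Rightarrow> (nat \<Rightarrow> 'v) \<Rightarrow> (nat rvec \<Rightarrow> nat rvec \<Rightarrow> real) \<Rightarrow> bool" where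
  "invar N \<Lambda> E0 U Y \<longleftrightarrow> psd_form Y \<and> psd_form (\<lambda>x y. dev N U x y + Y x y)
    \<and> (\<forall>x. dev N U x x \<le> (\<Lambda> - 1) * dot N x x)
    \<and> (\<forall>x. - ((\<Lambda> - 1) / (8 * E0 * \<Lambda>)) * dot N x x \<le> dev N U x x)
    \<and> nrg N U + 12/5 * E0 * tr N Y \<le> E0"

locale full_step = form_pair a b G for a b :: "'v::real_vector \<Rightarrow> 'v \<Rightarrow> real" and G +
  fixes N :: nat and U Uh U1 :: "nat \<Rightarrow> 'v" and t \<Lambda> E0 :: real and Y
  assumes st1: "j < N \<Longrightarrow> Uh j = U j + t *\<^sub>R (\<Sum>k<N. b (U k) ((1/2) *\<^sub>R (Uh j + U j)) *\<^sub>R G (U k)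
      - b (U k) (G ((1/2) *\<^sub>R (Uh j + U j))) *\<^sub>R U k)"
    and st2: "j < N \<Longrightarrow> U1 j = Uh j - t *\<^sub>R (\<Sum>k<N. (b (Uh k) (Uh j) - (if k = j then 1 else 0)) *\<^sub>R G (Uh k))"
    and t0: "0 < t"
    and E0: "1/2 \<le> E0" and L1: "1 \<le> \<Lambda>"
    and tb: "t * (4 * E0 * \<Lambda>\<^sup>2 + \<Lambda>) \<le> 1"
    and inv: "invar N \<Lambda> E0 U Y"
begin

lemma Y: "psd_form Y" and dY: "psd_form (\<lambda>x y. dev N U x y + Y x y)"
  and d_up: "dev N U x x \<le> (\<Lambda> - 1) * dot N x x"
  and d_lo: "- ((\<Lambda> - 1) / (8 * E0 * \<Lambda>)) * dot N x x \<le> dev N U x x"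
  and lyap: "nrg N U + 12/5 * E0 * tr N Y \<le> E0"
  using inv by (auto simp: invar_def)

lemma trY: "0 \<le> tr N Y"
  by (simp add: tr_def sum_nonneg psd_form.nonneg[OF Y])

lemma nrg_le: "nrg N U \<le> E0"
proof -
  have "0 \<le> 12/5 * E0 * tr N Y" using trY E0 by (intro mult_nonneg_nonneg) auto
  then show ?thesis using lyap by linarith
qed

sublocale s1: stage_one a b G N U Uh t \<Lambda> E0
proof
  show "b (comb N U x) (comb N U x) \<le> \<Lambda> * dot N x x" for x
    using d_up[of x] by (simp add: dev_def algebra_simps)
  show "(\<Sum>k<N. a (U k) (U k)) \<le> 2 * E0" using nrg_le by (simp add: nrg_def)
qed (use st1 t0 E0 L1 tb in auto)

definition "m x y = b (comb N Uh x) (G (comb N Uh y))"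
definition "m2 x y = b (G (comb N Uh x)) (G (comb N Uh y))"
definition "Dop x = RVec (\<lambda>k. if k < N then b (Uh k) (comb N Uh x) - rapp x k else 0)"
definition "Mop x = RVec (\<lambda>k. if k < N then b (Uh k) (G (comb N Uh x)) else 0)"

lemma dev_Uh: "dev N Uh x y = dev N U x y"
  by (simp add: dev_def s1.comb_gram)

lemma Dop: "dot N (Dop x) y = dev N U x y"
  unfolding dev_Uh[symmetric] unfolding dev_def
  by (simp add: Dop_def dot_def b.comb_right[of _ N Uh y] b.sym[of _ "comb N Uh x"]
      sum_subtractf algebra_simps)

lemma Mop: "dot N (Mop x) y = m x y"
  using bG[of "comb N Uh x" "comb N Uh y"]
  by (simp add: m_def Mop_def dot_def b.comb_right[of _ N Uh y] b.sym[of _ "G (comb N Uh x)"] mult.commute)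

lemma m_psd: "psd_form m"
proof
  show "m x y = m y x" for x y unfolding m_def using bG b.sym by metis
  show "0 \<le> m x x" for x by (simp add: m_def aGG_nonneg)
qed (simp_all add: m_def comb_add comb_scale b.add_left b.scale_left)

lemma Uh_up: "b (comb N Uh x) (comb N Uh x) \<le> \<Lambda> * dot N x x"
  by (simp add: s1.comb_gram s1.U_up)

lemma nrg_Uh: "nrg N Uh \<le> nrg N U - t / 8 * tnorm N U"
  using s1.stage_one_main(2) by (simp add: nrg_def)

lemma nrg_Uh_le: "(\<Sum>k<N. a (Uh k) (Uh k)) \<le> 2 * E0"
proof -
  have "0 \<le> t / 8 * tnorm N U" using t0 s1.stage_one_main(3) by simp
  then show ?thesis using nrg_Uh nrg_le by (simp add: nrg_def)
qed

text \<open>Cauchy-Schwarz in \<open>a\<close> between \<open>G u\<close> and \<open>u\<close> gives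
  \<open>(b u u)\<^sup>2 \<le> m x x * a u u\<close> for \<open>u = comb N Uh x\<close>. The
  permitted defect is at most 1/4, so \<open>b u u\<close> is at least 3/4 of
  \<open>dot N x x\<close>, while \<open>a u u\<close> is at most \<open>2 * E0 * dot N x x\<close>;
  the constant is 9/16 divided by \<open>2 * E0\<close>.\<close>

lemma m_lo: "9 / (32 * E0) * dot N x x \<le> m x x"
proof (cases "dot N x x = 0")
  case True
  then show ?thesis by (simp add: m_def aGG_nonneg)
next
  case False
  then have p: "0 < dot N x x" using dot.nonneg[of N x] by simp
  let ?u = "comb N Uh x"
  have EL: "1/2 * \<Lambda> \<le> E0 * \<Lambda>" using E0 L1 by (intro mult_right_mono) auto
  have "(\<Lambda> - 1) / (8 * E0 * \<Lambda>) \<le> 1/4"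
  proof -
    have "(\<Lambda> - 1) * 4 \<le> 4 * \<Lambda>" by simp
    also have "\<dots> \<le> 8 * E0 * \<Lambda>" using E0 L1 by (intro mult_right_mono) auto
    finally show ?thesis using E0 L1 by (simp add: pos_divide_le_eq)
  qed
  then have "(\<Lambda> - 1) / (8 * E0 * \<Lambda>) * dot N x x \<le> 1/4 * dot N x x" by (intro mult_right_mono dot.nonneg)
  then have lo: "3/4 * dot N x x \<le> b ?u ?u"
    using d_lo[of x] s1.comb_gram[of x x] unfolding dev_def mult_minus_left by linarith
  have "(3/4 * dot N x x)\<^sup>2 \<le> (b ?u ?u)\<^sup>2" using lo p by (intro power_mono) auto
  also have "\<dots> = (a (G ?u) ?u)\<^sup>2" by (simp add: aG)
  also have "\<dots> \<le> a (G ?u) (G ?u) * a ?u ?u" by (rule a.cs)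
  also have "\<dots> \<le> a (G ?u) (G ?u) * (2 * E0 * dot N x x)"
  proof (rule mult_left_mono[OF _ a.nonneg])
    show "a ?u ?u \<le> 2 * E0 * dot N x x"
      by (rule order_trans[OF a.comb_bound]) (intro mult_right_mono nrg_Uh_le dot.nonneg)
  qed
  also have "a (G ?u) (G ?u) = m x x" by (simp add: m_def aG)
  finally have "9/16 * dot N x x \<le> m x x * (2 * E0)"
    using p by (simp add: power2_eq_square algebra_simps)
  then show ?thesis using E0 by (simp add: field_simps)
qed

sublocale s2: stage_two m N "dev N U" m2 Dop Mop t \<Lambda> E0
proof -
  interpret m: psd_form m by (rule m_psd)
  show "stage_two m N (dev N U) m2 Dop Mop t \<Lambda> E0"
  proof
    show "m x x \<le> \<Lambda> * dot N x x" for x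
      using bG_le[of "comb N Uh x"] Uh_up[of x] by (simp add: m_def)
    then show "m2 x x \<le> \<Lambda> * dot N x x" for x
      using bGG_le[of "comb N Uh x"] order_trans by (fastforce simp: m_def m2_def)
    show "0 \<le> m2 x x" for x by (simp add: m2_def b.nonneg)
    show "supp N (Mop x)" for x by (simp add: supp_def Mop_def)
  qed (use dev_sym Dop Mop m_lo d_up d_lo t0 E0 L1 tb s1.tL s1.tEL in
      \<open>auto simp: dev_def comb_add comb_scale G_add G_scale b.lin dot.lin Mop_def algebra_simps intro!: rvec_eqI\<close>)
qed

text \<open>The second stage as an operator identity: a coefficient vector passes through
  \<open>D\<close> before \<open>G\<close> acts. From this form \<open>dev_Un\<close> reads off that
  the new \<open>S - I\<close> is \<open>dn\<close>.\<close>

lemma comb_Un: "comb N U1 x = comb N Uh x - t *\<^sub>R G (comb N Uh (Dop x))"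
proof -
  have "comb N U1 x = (\<Sum>j<N. rapp x j *\<^sub>R (Uh j - t *\<^sub>R (\<Sum>k<N. (b (Uh k) (Uh j) - (if k = j then 1 else 0)) *\<^sub>R G (Uh k))))"
    by (simp add: comb_def st2)
  also have "\<dots> = comb N Uh x - t *\<^sub>R (\<Sum>j<N. \<Sum>k<N. (rapp x j * (b (Uh k) (Uh j) - (if k = j then 1 else 0))) *\<^sub>R G (Uh k))"
    by (simp add: comb_def scaleR_diff_right sum_subtractf scaleR_sum_right mult_ac)
  also have "(\<Sum>j<N. \<Sum>k<N. (rapp x j * (b (Uh k) (Uh j) - (if k = j then 1 else 0))) *\<^sub>R G (Uh k))
     = (\<Sum>k<N. (\<Sum>j<N. rapp x j * (b (Uh k) (Uh j) - (if k = j then 1 else 0))) *\<^sub>R G (Uh k))"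
    by (subst sum.swap) (simp add: scaleR_sum_left)
  also have "\<dots> = (\<Sum>k<N. rapp (Dop x) k *\<^sub>R G (Uh k))"
    by (intro sum.cong refl arg_cong2[where f = scaleR])
      (simp add: Dop_def b.comb_right right_diff_distrib sum_subtractf mult_delta_right)
  also have "\<dots> = G (comb N Uh (Dop x))" by (simp add: G_comb) (simp add: comb_def)
  finally show ?thesis .
qed

lemma dev_Un: "dev N U1 x y = s2.dn x y"
  by (simp add: s2.dn_def dev_def[of N U1] comb_Un b.lin m_def m2_def bG dev_Uh[symmetric])
    (simp add: dev_def power2_eq_square algebra_simps)

text \<open>\<open>aG'\<close> cancels the \<open>G\<close> of the correction: to first order, twice
  the energy changes by \<open>- 2 t\<close> times the trace of \<open>D + D\<^sup>2\<close>. By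
  \<open>tL\<close> the quadratic term costs at most \<open>1/3 * t * frob\<close>, which leaves
  5/3, or 5/6 after halving.\<close>

lemma nrg_Un: "nrg N U1 \<le> nrg N Uh - t * tr N (dev N U) - 5/6 * t * frob N U"
proof -
  have fr: "(\<Sum>i<N. dot N (Dop (unitv i)) (Dop (unitv i))) = frob N U"
    unfolding frob_def dot_self
    by (intro sum.cong refl) (metis Dop dot_unitv(2) lessThan_iff)
  have st: "a (U1 i) (U1 i) \<le> a (Uh i) (Uh i) - 2 * t * dev N U (unitv i) (unitv i)
      - 5/3 * t * dot N (Dop (unitv i)) (Dop (unitv i))" if i: "i < N" for i
  proof -
    let ?D = "Dop (unitv i)" and ?w = "comb N Uh (Dop (unitv i))"
    have U1: "U1 i = Uh i - t *\<^sub>R G ?w" using comb_Un[of "unitv i"] i by simp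
    have c: "a (Uh i) (G ?w) = dot N ?D ?D + dev N U (unitv i) (unitv i)"
    proof -
      have "a (Uh i) (G ?w) = b (comb N Uh (unitv i)) ?w" using i by (simp add: aG')
      also have "\<dots> = dev N U (unitv i) ?D + dot N (unitv i) ?D" by (simp add: dev_def s1.comb_gram)
      also have "dev N U (unitv i) ?D = dot N ?D ?D" by (simp add: Dop)
      also have "dot N (unitv i) ?D = dev N U (unitv i) (unitv i)" by (metis Dop dot.sym)
      finally show ?thesis .
    qed
    have g: "a (G ?w) (G ?w) \<le> \<Lambda> * dot N ?D ?D"
      using bG_le[of ?w] Uh_up[of ?D] by (simp add: aG)
    have "t\<^sup>2 * a (G ?w) (G ?w) \<le> t\<^sup>2 * (\<Lambda> * dot N ?D ?D)" using g by (intro mult_left_mono) auto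
    also have "\<dots> = (t * dot N ?D ?D) * (t * \<Lambda>)" by (simp add: power2_eq_square)
    also have "\<dots> \<le> (t * dot N ?D ?D) * (1/3)" using t0 dot.nonneg[of N ?D] by (intro mult_left_mono s1.tL) auto
    finally show ?thesis
      by (simp add: U1 a.quad_diff a.quad_scale a.scale_left a.scale_right c algebra_simps power2_eq_square)
  qed
  have "(\<Sum>i<N. a (U1 i) (U1 i)) \<le> (\<Sum>i<N. a (Uh i) (Uh i) - 2 * t * dev N U (unitv i) (unitv i)
      - 5/3 * t * dot N (Dop (unitv i)) (Dop (unitv i)))"
    by (intro sum_mono st) simp
  also have "\<dots> = (\<Sum>i<N. a (Uh i) (Uh i)) - 2 * t * tr N (dev N U) - 5/3 * t * frob N U"
    by (simp only: sum_subtractf sum_distrib_left[symmetric] fr tr_def)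
  finally show ?thesis by (simp add: nrg_def)
qed

text \<open>Turns decay of the dissipation into decay of the steps. The first stage moves by
  \<open>t * Ad\<close>, controlled by \<open>tnorm\<close>; the second by \<open>G\<close> applied
  to combinations with the columns of \<open>D\<close>, controlled by \<open>frob\<close>.\<close>

lemma increment: "(\<Sum>i<N. a (U1 i - U i) (U1 i - U i)) \<le> 2 * t\<^sup>2 * \<Lambda> * (tnorm N U + frob N U)"
proof -
  have fr: "(\<Sum>i<N. dot N (Dop (unitv i)) (Dop (unitv i))) = frob N U"
    unfolding frob_def dot_self
    by (intro sum.cong refl) (metis Dop dot_unitv(2) lessThan_iff)
  have st: "a (U1 i - U i) (U1 i - U i) \<le> 2 * t\<^sup>2 * a (s1.Ad i) (s1.Ad i) + 2 * t\<^sup>2 * \<Lambda> * dot N (Dop (unitv i)) (Dop (unitv i))"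
    if i: "i < N" for i
  proof -
    let ?w = "comb N Uh (Dop (unitv i))"
    have e: "U1 i - U i = t *\<^sub>R s1.Ad i - t *\<^sub>R G ?w"
      using comb_Un[of "unitv i"] i s1.Uh_eq[OF i] by simp
    have g: "a (G ?w) (G ?w) \<le> \<Lambda> * dot N (Dop (unitv i)) (Dop (unitv i))"
      using bG_le[of ?w] Uh_up[of "Dop (unitv i)"] by (simp add: aG)
    have "a (U1 i - U i) (U1 i - U i) \<le> 2 * t\<^sup>2 * a (s1.Ad i) (s1.Ad i) + 2 * t\<^sup>2 * a (G ?w) (G ?w)"
      unfolding e using a.quad_diff_le[of "t *\<^sub>R s1.Ad i" "t *\<^sub>R G ?w"] by (simp add: a.quad_scale)
    then show ?thesis using mult_left_mono[OF g, of "2 * t\<^sup>2"] by simp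
  qed
  have "(\<Sum>i<N. a (U1 i - U i) (U1 i - U i)) \<le> 2 * t\<^sup>2 * (\<Sum>i<N. a (s1.Ad i) (s1.Ad i)) + 2 * t\<^sup>2 * \<Lambda> * frob N U"
    using sum_mono[OF st, of "{..<N}"] by (simp add: sum.distrib sum_distrib_left fr[symmetric])
  also have "\<dots> \<le> 2 * t\<^sup>2 * (\<Lambda> * tnorm N U) + 2 * t\<^sup>2 * \<Lambda> * frob N U"
    using L1 by (intro add_mono mult_left_mono s1.stage_one_main(1)) auto
  finally show ?thesis by (simp add: algebra_simps)
qed

text \<open>The weight 12/5 balances the books. Contraction of \<open>Y\<close> is worth
  \<open>12/5 * 5/3 * 9/32 = 9/8\<close> times \<open>t * ?y\<close>; writing the trace of
  \<open>S - I\<close> as \<open>?p - ?y\<close> consumes 1 of it and leaves 1/8. The influx into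
  \<open>Y\<close> costs \<open>12/5 * 1/4 = 3/5\<close> of \<open>t * ?p\<close>, leaving 2/5 of
  the energy gain. The common factor kept is 1/8.\<close>

lemma step: "invar N \<Lambda> E0 U1 (s2.Yn Y)"
  "nrg N U1 + 12/5 * E0 * tr N (s2.Yn Y) \<le> nrg N U + 12/5 * E0 * tr N Y
     - t / 8 * (tnorm N U + frob N U + (tr N (dev N U) + tr N Y) + tr N Y)"
proof -
  let ?y = "tr N Y" and ?p = "tr N (dev N U) + tr N Y"
  have p0: "0 \<le> ?p"
    using sum_nonneg[of "{..<N}" "\<lambda>i. dev N U (unitv i) (unitv i) + Y (unitv i) (unitv i)"] psd_form.nonneg[OF dY]
    by (simp add: tr_def sum.distrib)
  have 1: "12/5 * E0 * tr N (s2.Yn Y) \<le> 12/5 * E0 * ((1 - 5/3 * t * (9 / (32 * E0))) * ?y + t\<^sup>2 * (\<Lambda>\<^sup>2 * ?p))"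
    using E0 by (intro mult_left_mono s2.Yn_trace Y dY) auto
  have 2: "12/5 * E0 * ((1 - 5/3 * t * (9 / (32 * E0))) * ?y + t\<^sup>2 * (\<Lambda>\<^sup>2 * ?p))
     = 12/5 * E0 * ?y - 9/8 * t * ?y + 12/5 * ((t * ?p) * (t * (E0 * \<Lambda>\<^sup>2)))"
    using E0 by (simp add: field_simps power2_eq_square)
  have 3: "(t * ?p) * (t * (E0 * \<Lambda>\<^sup>2)) \<le> (t * ?p) * (1/4)"
    using t0 p0 by (intro mult_left_mono s1.tEL) auto
  have 4: "0 \<le> t * frob N U" "0 \<le> t * ?p" "0 \<le> t * ?y" "0 \<le> t * tnorm N U"
    using t0 p0 trY frob_nonneg s1.stage_one_main(3) by (simp_all del: distrib_left_numeral)
  have e: "t * tr N (dev N U) = t * ?p - t * ?y" by (simp add: algebra_simps)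
  have "nrg N U1 + 12/5 * E0 * tr N (s2.Yn Y) \<le> nrg N U + 12/5 * E0 * ?y - t / 8 * tnorm N U - 5/6 * (t * frob N U)
      - 2/5 * (t * ?p) - 1/8 * (t * ?y)"
    using nrg_Un nrg_Uh 1 2 3 e by linarith
  then show A: "nrg N U1 + 12/5 * E0 * tr N (s2.Yn Y) \<le> nrg N U + 12/5 * E0 * tr N Y
     - t / 8 * (tnorm N U + frob N U + ?p + tr N Y)"
    using 4 by (simp add: distrib_left)
  have "0 \<le> t / 8 * (tnorm N U + frob N U + ?p + tr N Y)"
    using t0 p0 trY frob_nonneg[of N U] s1.stage_one_main(3) by (intro mult_nonneg_nonneg) auto
  then have L: "nrg N U1 + 12/5 * E0 * tr N (s2.Yn Y) \<le> E0" using A lyap by linarith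
  interpret Yn: psd_form "s2.Yn Y" by (rule s2.Yn_psd[OF Y dY])
  have "psd_form (\<lambda>x y. dev N U1 x y + s2.Yn Y x y)"
  proof
    show "0 \<le> dev N U1 x x + s2.Yn Y x x" for x by (simp add: dev_Un s2.dn_Yn_nonneg[OF Y dY])
    show "dev N U1 x y + s2.Yn Y x y = dev N U1 y x + s2.Yn Y y x" for x y
      by (simp add: dev_sym[of N U1 x y] Yn.sym[of x y])
  qed (simp_all add: dev_def comb_add comb_scale b.lin dot.lin Yn.lin algebra_simps)
  then show "invar N \<Lambda> E0 U1 (s2.Yn Y)"
    using s2.Yn_psd[OF Y dY] L s2.dn_up s2.dn_lo by (simp add: invar_def dev_Un s2.del_def)
qed

end

section \<open>Convergence of the scheme\<close>

text \<open>Lets \<open>psd_le_trace\<close> be applied to arbitrary vectors: neither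
  \<open>dot N\<close> nor \<open>comb N\<close> notices the cut.\<close>

definition trunc :: "nat \<Rightarrow> nat rvec \<Rightarrow> nat rvec" where
  "trunc N x = RVec (\<lambda>k. if k < N then rapp x k else 0)"

lemma supp_trunc: "supp N (trunc N x)"
  and comb_trunc: "comb N U (trunc N x) = comb N U x"
  and dot_trunc: "dot N (trunc N x) y = dot N x y" "dot N y (trunc N x) = dot N y x"
  by (simp_all add: supp_def trunc_def comb_def dot_def)

text \<open>Here \<open>lam\<close> starts at index 0 and is scaled; \<open>lN\<close> and
  \<open>lup\<close> are the scaled eigenvalues on the two sides of the gap. The spectrum enters the
  convergence proof only through these assumptions.\<close>

locale eig_gap = form_pair a b G for a b :: "'v::real_vector \<Rightarrow> 'v \<Rightarrow> real" and G +
  fixes N :: nat and v :: "nat \<Rightarrow> 'v" and lam :: "nat \<Rightarrow> real" and lN lup :: real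
  assumes v_on: "\<And>i j. i < N \<Longrightarrow> j < N \<Longrightarrow> b (v i) (v j) = (if i = j then 1 else 0)"
    and v_eig: "\<And>i w. i < N \<Longrightarrow> a (v i) w = lam i * b (v i) w"
    and lam_pos: "\<And>i. i < N \<Longrightarrow> 0 < lam i" and lam_le: "\<And>i. i < N \<Longrightarrow> lam i \<le> lN"
    and lN: "0 < lN" and lup: "lN < lup"
    and gap: "\<And>w. (\<And>i. i < N \<Longrightarrow> b w (v i) = 0) \<Longrightarrow> lup * b w w \<le> a w w"
begin

text \<open>The eigenvector equation makes this component orthogonal to the \<open>v i\<close> for
  \<open>a\<close> as well as for \<open>b\<close>, so both forms split (\<open>b_split\<close>,
  \<open>a_split\<close>).\<close>

definition "rest w = w - (\<Sum>i<N. b (v i) w *\<^sub>R v i)"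

lemma rest_orth: "i < N \<Longrightarrow> b (rest w) (v i) = 0"
  using b.orth_expansion(2)[OF v_on, of N i w] by (simp add: rest_def b.sym[of w])

lemma rest_orth_a: "i < N \<Longrightarrow> a (v i) (rest w) = 0"
  by (simp add: v_eig b.sym[of "v i"] rest_orth)

lemma split: "w = rest w + (\<Sum>i<N. b (v i) w *\<^sub>R v i)"
  by (simp add: rest_def)

lemma sum_v: "b (\<Sum>i<N. p i *\<^sub>R v i) (\<Sum>i<N. r i *\<^sub>R v i) = (\<Sum>i<N. p i * r i)"
  "a (\<Sum>i<N. p i *\<^sub>R v i) (\<Sum>i<N. r i *\<^sub>R v i) = (\<Sum>i<N. lam i * (p i * r i))"
proof -
  have 1: "b (v i) (\<Sum>i<N. r i *\<^sub>R v i) = r i" if "i < N" for i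
    using that by (simp add: b.sum_right b.scale_right v_on mult_delta_right)
  show "b (\<Sum>i<N. p i *\<^sub>R v i) (\<Sum>i<N. r i *\<^sub>R v i) = (\<Sum>i<N. p i * r i)"
    by (simp add: b.sum_left b.scale_left 1)
  show "a (\<Sum>i<N. p i *\<^sub>R v i) (\<Sum>i<N. r i *\<^sub>R v i) = (\<Sum>i<N. lam i * (p i * r i))"
    by (simp add: a.sum_left a.scale_left v_eig 1 mult_ac)
qed

lemma rest_sum_v: "b (rest w) (\<Sum>i<N. r i *\<^sub>R v i) = 0" "b (\<Sum>i<N. r i *\<^sub>R v i) (rest w) = 0"
  "a (rest w) (\<Sum>i<N. r i *\<^sub>R v i) = 0" "a (\<Sum>i<N. r i *\<^sub>R v i) (rest w) = 0"
proof -
  show *: "b (\<Sum>i<N. r i *\<^sub>R v i) (rest w) = 0" "a (\<Sum>i<N. r i *\<^sub>R v i) (rest w) = 0"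
    by (simp_all add: b.sum_left b.scale_left a.sum_left a.scale_left rest_orth_a b.sym[of "v _"] rest_orth)
  show "b (rest w) (\<Sum>i<N. r i *\<^sub>R v i) = 0" "a (rest w) (\<Sum>i<N. r i *\<^sub>R v i) = 0"
    using * b.sym a.sym by metis+
qed

lemma b_split: "b w z = (\<Sum>i<N. b (v i) w * b (v i) z) + b (rest w) (rest z)"
  and a_split: "a w z = (\<Sum>i<N. lam i * (b (v i) w * b (v i) z)) + a (rest w) (rest z)"
  by (subst split[of w], subst split[of z], simp add: a.add_left a.add_right b.add_left b.add_right sum_v rest_sum_v)+

lemma rest_diff_v: "rest (w - (\<Sum>i<N. r i *\<^sub>R v i)) = rest w"
  and bv_diff_v: "i < N \<Longrightarrow> b (v i) (w - (\<Sum>i<N. r i *\<^sub>R v i)) = b (v i) w - r i"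
proof -
  have 1: "b (v i) (\<Sum>i<N. r i *\<^sub>R v i) = r i" if "i < N" for i
    using that by (simp add: b.sum_right b.scale_right v_on mult_delta_right)
  show "rest (w - (\<Sum>i<N. r i *\<^sub>R v i)) = rest w"
    by (simp add: rest_def b.diff_right 1 scaleR_diff_left sum_subtractf)
  show "i < N \<Longrightarrow> b (v i) (w - (\<Sum>i<N. r i *\<^sub>R v i)) = b (v i) w - r i"
    by (simp add: b.diff_right 1)
qed

lemma rest_comb: "rest (comb N U x) = comb N (\<lambda>k. rest (U k)) x"
proof -
  have "(\<Sum>i<N. b (v i) (comb N U x) *\<^sub>R v i) = (\<Sum>k<N. rapp x k *\<^sub>R (\<Sum>i<N. b (v i) (U k) *\<^sub>R v i))"
    by (simp add: b.comb_right scaleR_sum_left scaleR_sum_right) (subst sum.swap, simp)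
  then show ?thesis by (simp add: rest_def comb_def scaleR_diff_right sum_subtractf)
qed

lemma gap_rest: "lup * b (rest w) (rest w) \<le> a (rest w) (rest w)"
  by (rule gap) (rule rest_orth)

context
  fixes U :: "nat \<Rightarrow> 'v" and \<epsilon> :: real
  assumes eps0: "0 \<le> \<epsilon>" and eps: "\<And>x. dev N U x x \<le> \<epsilon> * dot N x x"
begin

text \<open>The squared length of \<open>v i\<close> as seen through the tuple: 1 when
  \<open>U\<close> is orthonormal and spans \<open>v i\<close>, smaller when \<open>U\<close> loses
  that direction.\<close>

definition "coef i = (\<Sum>j<N. (b (v i) (U j))\<^sup>2)"

lemma U_eps: "b (comb N U x) (comb N U x) \<le> (1 + \<epsilon>) * dot N x x"
  using eps[of x] by (simp add: dev_def algebra_simps)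

lemma coef_le: "i < N \<Longrightarrow> coef i \<le> 1 + \<epsilon>"
  using b.adj_bound[OF U_eps, of "v i"] eps0 v_on[of i i] by (simp add: coef_def b.sym[of "v i" "U _"])

text \<open>Whatever part of the tuple is not spent on the \<open>v i\<close> has Rayleigh quotient
  at least \<open>lup\<close>. For \<open>\<epsilon> = 0\<close> each unit missing from a
  \<open>coef i\<close> thus costs at least \<open>lup - lN\<close>; the other terms in \<epsilon>
  pay for a Gram matrix different from the identity.\<close>

lemma nrg_lower:
  assumes lo: "real N - real N * \<epsilon> \<le> (\<Sum>j<N. b (U j) (U j))"
  shows "(\<Sum>i<N. lam i) - 2 * real N * lup * \<epsilon> + (lup - lN) * (\<Sum>i<N. 1 + \<epsilon> - coef i) \<le> 2 * nrg N U"
proof -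
  have "(\<Sum>j<N. \<Sum>i<N. lam i * (b (v i) (U j))\<^sup>2) + lup * (\<Sum>j<N. b (U j) (U j) - (\<Sum>i<N. (b (v i) (U j))\<^sup>2))
     \<le> (\<Sum>j<N. a (U j) (U j))"
    unfolding sum_distrib_left sum.distrib[symmetric]
  proof (rule sum_mono)
    fix j
    show "(\<Sum>i<N. lam i * (b (v i) (U j))\<^sup>2) + lup * (b (U j) (U j) - (\<Sum>i<N. (b (v i) (U j))\<^sup>2)) \<le> a (U j) (U j)"
      using gap_rest[of "U j"] a_split[of "U j" "U j"] b_split[of "U j" "U j"] by (simp add: power2_eq_square)
  qed
  also have "(\<Sum>j<N. \<Sum>i<N. lam i * (b (v i) (U j))\<^sup>2) = (\<Sum>i<N. lam i * coef i)"
    by (subst sum.swap) (simp add: coef_def sum_distrib_left)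
  also have "(\<Sum>j<N. b (U j) (U j) - (\<Sum>i<N. (b (v i) (U j))\<^sup>2)) = (\<Sum>j<N. b (U j) (U j)) - (\<Sum>i<N. coef i)"
    unfolding sum_subtractf coef_def by (subst (2) sum.swap) simp
  finally have 1: "(\<Sum>i<N. lam i * coef i) + lup * ((\<Sum>j<N. b (U j) (U j)) - (\<Sum>i<N. coef i)) \<le> 2 * nrg N U"
    by (simp add: nrg_def)
  have 2: "lup * (real N - real N * \<epsilon>) \<le> lup * (\<Sum>j<N. b (U j) (U j))"
    using lN lup by (intro mult_left_mono lo) auto
  have 3: "(lup - lN) * (\<Sum>i<N. 1 + \<epsilon> - coef i) \<le> (\<Sum>i<N. (lup - lam i) * (1 + \<epsilon> - coef i))"
    unfolding sum_distrib_left using lam_le coef_le by (intro sum_mono mult_right_mono) auto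
  have 4: "(\<Sum>i<N. (lup - lam i) * (1 + \<epsilon> - coef i))
     = (real N * lup - (\<Sum>i<N. lam i)) * (1 + \<epsilon>) - lup * (\<Sum>i<N. coef i) + (\<Sum>i<N. lam i * coef i)"
    by (simp add: algebra_simps sum.distrib sum_subtractf sum_distrib_left)
  have 5: "0 \<le> (\<Sum>i<N. lam i) * \<epsilon>" using lam_pos eps0 by (intro mult_nonneg_nonneg sum_nonneg) (auto intro: less_imp_le)
  show ?thesis using 1 2 3 4 5 by (simp add: algebra_simps)
qed

lemma nrg_upper: "2 * nrg N U \<le> (\<Sum>i<N. lam i) + real N * lN * \<epsilon> + (\<Sum>j<N. a (rest (U j)) (rest (U j)))"
proof -
  have "2 * nrg N U = (\<Sum>j<N. (\<Sum>i<N. lam i * (b (v i) (U j))\<^sup>2)) + (\<Sum>j<N. a (rest (U j)) (rest (U j)))"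
    unfolding nrg_def sum.distrib[symmetric] by (simp add: a_split[of "U _"] power2_eq_square)
  also have "(\<Sum>j<N. \<Sum>i<N. lam i * (b (v i) (U j))\<^sup>2) = (\<Sum>i<N. lam i * coef i)"
    by (subst sum.swap) (simp add: coef_def sum_distrib_left)
  also have "\<dots> \<le> (\<Sum>i<N. lam i + lN * \<epsilon>)"
  proof (rule sum_mono)
    fix i assume "i \<in> {..<N}"
    then have i: "i < N" by simp
    have "lam i * coef i \<le> lam i * (1 + \<epsilon>)" using lam_pos[OF i] coef_le[OF i] by (intro mult_left_mono) auto
    moreover have "lam i * \<epsilon> \<le> lN * \<epsilon>" using lam_le[OF i] eps0 by (intro mult_right_mono) auto
    ultimately show "lam i * coef i \<le> lam i + lN * \<epsilon>" by (simp add: algebra_simps)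
  qed
  finally show ?thesis by (simp add: sum.distrib)
qed

text \<open>With \<open>B\<close> the matrix of the numbers \<open>b (v i) (U j)\<close>, the form
  \<open>(1 + \<epsilon>) I - B\<^sup>T B\<close> is positive semidefinite by Bessel, and its trace
  is the total deficit of the \<open>coef i\<close>. A trace of at most 3/4 bounds the whole form,
  so \<open>B\<close> stays uniformly invertible.\<close>

lemma cone:
  assumes "(\<Sum>i<N. 1 + \<epsilon> - coef i) \<le> 3/4" "supp N x"
  shows "1/4 * dot N x x \<le> (\<Sum>i<N. (b (v i) (comb N U x))\<^sup>2)"
proof -
  let ?q = "\<lambda>x y. (1 + \<epsilon>) * dot N x y - (\<Sum>i<N. b (v i) (comb N U x) * b (v i) (comb N U y))"
  have "psd_form ?q"
  proof
    fix x
    have "(\<Sum>i<N. (b (comb N U x) (v i))\<^sup>2) \<le> b (comb N U x) (comb N U x)" by (rule b.bessel[OF v_on])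
    then show "0 \<le> ?q x x" using U_eps[of x] by (simp add: power2_eq_square b.sym[of "comb N U x" "v _"])
  next
    show "?q x y = ?q y x" for x y by (simp add: dot.sym[of N x y] mult.commute)
  qed (auto simp: dot.lin comb_add comb_scale b.lin algebra_simps sum.distrib sum_distrib_left)
  from psd_le_trace[OF this assms(2)]
  have "?q x x \<le> tr N ?q * dot N x x" .
  also have "tr N ?q = (\<Sum>i<N. 1 + \<epsilon> - coef i)"
  proof -
    have "tr N ?q = (\<Sum>j<N. (1 + \<epsilon>)) - (\<Sum>j<N. \<Sum>i<N. (b (v i) (U j))\<^sup>2)"
      unfolding tr_def sum_subtractf[symmetric] by (intro sum.cong refl) (simp add: power2_eq_square)
    also have "(\<Sum>j<N. \<Sum>i<N. (b (v i) (U j))\<^sup>2) = (\<Sum>i<N. coef i)"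
      unfolding coef_def by (rule sum.swap)
    finally show ?thesis by (simp add: sum_subtractf)
  qed
  also have "\<dots> * dot N x x \<le> 3/4 * dot N x x" by (intro mult_right_mono assms dot.nonneg)
  finally have "(1 + \<epsilon>) * dot N x x - 3/4 * dot N x x \<le> (\<Sum>i<N. (b (v i) (comb N U x))\<^sup>2)"
    by (simp add: power2_eq_square)
  moreover have "0 \<le> \<epsilon> * dot N x x" using eps0 dot.nonneg by simp
  ultimately show ?thesis by (simp add: algebra_simps)
qed

end

text \<open>A Polyak--Lojasiewicz type bound: \<open>T\<close> maps \<open>v i\<close> to \<open>(lam i * G - 1)\<close> applied to a
  combination of the \<open>U k\<close>, and \<open>1 - lam i * G\<close> is bounded below on the complement of the \<open>v i\<close>.\<close>
lemma rest_le_tnorm: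
  assumes cone: "\<And>x. supp N x \<Longrightarrow> 1/4 * dot N x x \<le> (\<Sum>i<N. (b (v i) (comb N U x))\<^sup>2)"
  shows "(1 - lN / lup)\<^sup>2 * (\<Sum>k<N. a (rest (U k)) (rest (U k))) \<le> 4 * lN * tnorm N U"
proof -
  define c where "c i = RVec (\<lambda>k. if k < N then b (v i) (U k) else 0)" for i
  define r where "r i = comb N (\<lambda>k. rest (U k)) (c i)" for i
  define \<kappa> where "\<kappa> = 1 - lN / lup"
  have k0: "0 < \<kappa>" using lN lup by (simp add: \<kappa>_def)
  have cx: "b (v i) (comb N U x) = dot N (c i) x" for i x
    by (simp add: b.comb_right c_def dot_def mult.commute)
  have T: "\<kappa>\<^sup>2 * a (r i) (r i) \<le> a (tapp N U (v i)) (tapp N U (v i))" if i: "i < N" for i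
  proof -
    have Tv: "tapp N U (v i) = lam i *\<^sub>R G (comb N U (c i)) - comb N U (c i)"
    proof -
      have 1: "a (U k) (v i) = lam i * b (v i) (U k)" for k by (simp add: a.sym[of "U k"] v_eig i)
      have 2: "a (G (U k)) (v i) = b (v i) (U k)" for k by (simp add: aG b.sym)
      show ?thesis
        unfolding tapp_def 1 2 G_comb
        by (simp add: comb_def c_def sum_subtractf scaleR_sum_right mult_ac)
    qed
    have r: "r i = rest (comb N U (c i))" by (simp add: r_def rest_comb)
    \<comment> \<open>Testing with \<open>r i\<close> removes everything along the eigenvectors, and
      on the complement \<open>b\<close> is at most \<open>a / lup\<close>; hence the factor
      \<open>1 - lN / lup\<close>.\<close>
    have "a (tapp N U (v i)) (r i) = lam i * b (r i) (r i) - a (r i) (r i)"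
      unfolding Tv r using b_split[of "comb N U (c i)" "rest (comb N U (c i))"] a_split[of "comb N U (c i)" "rest (comb N U (c i))"]
    proof -
      have rr: "rest (rest w) = rest w" for w
        using rest_diff_v[of w "\<lambda>i. b (v i) w"] by (simp add: rest_def)
      have bv: "b (v j) (rest w) = 0" if "j < N" for j w using rest_orth[OF that] b.sym by metis
      show "a (lam i *\<^sub>R G (comb N U (c i)) - comb N U (c i)) (rest (comb N U (c i))) =
        lam i * b (rest (comb N U (c i))) (rest (comb N U (c i))) - a (rest (comb N U (c i))) (rest (comb N U (c i)))"
        using b_split[of "comb N U (c i)" "rest (comb N U (c i))"] a_split[of "comb N U (c i)" "rest (comb N U (c i))"]
        by (simp add: a.diff_left a.scale_left aG rr bv)
    qed
    also have "\<dots> \<le> - (\<kappa> * a (r i) (r i))"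
    proof -
      have "b (r i) (r i) \<le> a (r i) (r i) / lup"
        using gap_rest[of "comb N U (c i)"] lN lup by (simp add: r field_simps)
      then have "lam i * b (r i) (r i) \<le> lN * (a (r i) (r i) / lup)"
        using lam_le[OF i] lam_pos[OF i] lN by (intro mult_mono b.nonneg) auto
      then show ?thesis by (simp add: \<kappa>_def algebra_simps)
    qed
    finally have h: "\<kappa> * a (r i) (r i) \<le> - a (tapp N U (v i)) (r i)" by simp
    have "(\<kappa> * a (r i) (r i))\<^sup>2 \<le> (- a (tapp N U (v i)) (r i))\<^sup>2"
      using h k0 a.nonneg[of "r i"] by (intro power_mono) auto
    also have "\<dots> \<le> a (tapp N U (v i)) (tapp N U (v i)) * a (r i) (r i)" using a.cs by simp
    finally have s: "a (r i) (r i) * (\<kappa>\<^sup>2 * a (r i) (r i)) \<le> a (r i) (r i) * a (tapp N U (v i)) (tapp N U (v i))"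
      by (simp add: power2_eq_square mult_ac)
    show ?thesis
    proof (cases "a (r i) (r i) = 0")
      case True
      then show ?thesis using a.nonneg by simp
    next
      case False
      then have "0 < a (r i) (r i)" using a.nonneg[of "r i"] by simp
      then show ?thesis using s by simp
    qed
  qed
  have T2: "(\<Sum>j<N. a (tapp N U (v j)) (tapp N U (v j))) \<le> lN * tnorm N U"
  proof (rule tapp_bound)
    fix w
    \<comment> \<open>Division by \<open>sqrt (lam i)\<close> makes the \<open>v i\<close>
      orthonormal for \<open>a\<close>; Bessel's inequality for them costs a factor
      \<open>lN\<close>.\<close>
    have on: "a ((1 / sqrt (lam i)) *\<^sub>R v i) ((1 / sqrt (lam j)) *\<^sub>R v j) = (if i = j then 1 else 0)"
      if "i < N" "j < N" for i j
      using that lam_pos[of i] by (auto simp: a.scale_left a.scale_right v_eig v_on field_simps)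
    have "(\<Sum>j<N. (a (v j) w)\<^sup>2) \<le> (\<Sum>j<N. lN * (a w ((1 / sqrt (lam j)) *\<^sub>R v j))\<^sup>2)"
    proof (rule sum_mono)
      fix j assume "j \<in> {..<N}"
      then have j: "j < N" by simp
      have "lam j * (a (v j) w)\<^sup>2 \<le> lN * (a (v j) w)\<^sup>2" using lam_le[OF j] by (intro mult_right_mono) auto
      then show "(a (v j) w)\<^sup>2 \<le> lN * (a w ((1 / sqrt (lam j)) *\<^sub>R v j))\<^sup>2"
        using lam_pos[OF j] by (simp add: a.scale_right a.sym[of w] power_divide field_simps)
    qed
    also have "\<dots> \<le> lN * a w w"
      unfolding sum_distrib_left[symmetric] using lN by (intro mult_left_mono a.bessel on) auto
    finally show "(\<Sum>j<N. (a (v j) w)\<^sup>2) \<le> lN * a w w" .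
  qed
  \<comment> \<open>\<open>cone\<close> applied to the coordinate vectors \<open>x p\<close> of the
    components \<open>rest (U k)\<close>: passing from these to the \<open>r i\<close> loses at most
    a factor 4.\<close>
  have R: "1/4 * (\<Sum>k<N. a (rest (U k)) (rest (U k))) \<le> (\<Sum>i<N. a (r i) (r i))"
  proof -
    define F where "F = (\<lambda>k. rest (U k)) ` {..<N} \<union> r ` {..<N}"
    have "finite F" by (simp add: F_def)
    from a.coordinates[OF this] obtain m and f :: "nat \<Rightarrow> 'v"
      where ex: "\<And>x y. x \<in> F \<Longrightarrow> a x y = (\<Sum>i<m. a x (f i) * a y (f i))"
      by blast
    define x where "x p = RVec (\<lambda>k. if k < N then a (rest (U k)) (f p) else 0)" for p
    have rx: "a (r i) (f p) = b (v i) (comb N U (x p))" for i p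
      by (simp add: r_def a.comb_left cx x_def dot_def)
    have "1/4 * (\<Sum>k<N. a (rest (U k)) (rest (U k))) = (\<Sum>k<N. \<Sum>p<m. 1/4 * (a (rest (U k)) (f p))\<^sup>2)"
      unfolding sum_distrib_left
      by (intro sum.cong refl, subst ex) (auto simp: F_def power2_eq_square sum_distrib_left)
    also have "\<dots> = (\<Sum>p<m. \<Sum>k<N. 1/4 * (a (rest (U k)) (f p))\<^sup>2)" by (rule sum.swap)
    also have "\<dots> = (\<Sum>p<m. 1/4 * dot N (x p) (x p))"
      by (simp add: dot_self x_def sum_divide_distrib)
    also have "\<dots> \<le> (\<Sum>p<m. \<Sum>i<N. (b (v i) (comb N U (x p)))\<^sup>2)"
      by (intro sum_mono cone) (simp add: supp_def x_def)
    also have "\<dots> = (\<Sum>i<N. \<Sum>p<m. (a (r i) (f p))\<^sup>2)"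
      unfolding rx by (rule sum.swap)
    also have "\<dots> = (\<Sum>i<N. a (r i) (r i))"
      by (intro sum.cong refl, subst ex) (auto simp: F_def power2_eq_square)
    finally show ?thesis .
  qed
  have "\<kappa>\<^sup>2 * (1/4 * (\<Sum>k<N. a (rest (U k)) (rest (U k)))) \<le> \<kappa>\<^sup>2 * (\<Sum>i<N. a (r i) (r i))"
    by (intro mult_left_mono R) simp
  also have "\<dots> \<le> (\<Sum>i<N. a (tapp N U (v i)) (tapp N U (v i)))"
    unfolding sum_distrib_left by (intro sum_mono T) simp
  also have "\<dots> \<le> lN * tnorm N U" by (rule T2)
  finally show ?thesis by (simp add: \<kappa>_def)
qed

end

text \<open>\<open>en0\<close> is the energy condition of the theorem. The threshold is midway
  between the energies of the ground state and of the first excited state, which differ by half the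
  gap; so twice the energy exceeds the sum of the \<open>lam i\<close> by at most half the gap. Of
  the bounds on the initial Gram matrix, \<open>S_up\<close> persists along the iteration,
  \<open>S_lo\<close> only after adding \<open>Y\<close>.\<close>

locale two_stage_scheme = eig_gap a b G N v lam lN lup
  for a b :: "'v::real_vector \<Rightarrow> 'v \<Rightarrow> real" and G N v lam lN lup +
  fixes U Uh :: "nat \<Rightarrow> nat \<Rightarrow> 'v" and t :: "nat \<Rightarrow> real" and tmin \<Lambda> :: real
  assumes N1: "1 \<le> N"
    and st1: "\<And>n j. j < N \<Longrightarrow> Uh n j = U n j + t n *\<^sub>R (\<Sum>k<N. b (U n k) ((1/2) *\<^sub>R (Uh n j + U n j)) *\<^sub>R G (U n k)
      - b (U n k) (G ((1/2) *\<^sub>R (Uh n j + U n j))) *\<^sub>R U n k)"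
    and st2: "\<And>n j. j < N \<Longrightarrow> U (Suc n) j = Uh n j
      - t n *\<^sub>R (\<Sum>k<N. (b (Uh n k) (Uh n j) - (if k = j then 1 else 0)) *\<^sub>R G (Uh n k))"
    and tmin: "0 < tmin" "\<And>n. tmin \<le> t n"
    and tb: "\<And>n. t n * (4 * nrg N (U 0) * \<Lambda>\<^sup>2 + \<Lambda>) \<le> 1"
    and S_lo: "\<And>x. dot N x x \<le> b (comb N (U 0) x) (comb N (U 0) x)"
    and S_up: "\<And>x. b (comb N (U 0) x) (comb N (U 0) x) \<le> \<Lambda> * dot N x x"
    and en0: "2 * nrg N (U 0) \<le> (\<Sum>i<N. lam i) + (lup - lN) / 2"
begin

abbreviation "E0 \<equiv> nrg N (U 0)"

lemma t0: "0 < t n"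
  using tmin by (meson less_le_trans)

lemma L1: "1 \<le> \<Lambda>"
proof -
  have "dot N (unitv 0) (unitv 0) = 1" using N1 by simp
  then show ?thesis using order_trans[OF S_lo S_up, of "unitv 0"] by simp
qed

lemma E0: "1/2 \<le> E0"
proof -
  have "1 \<le> a (U 0 k) (U 0 k)" if "k < N" for k
    using S_lo[of "unitv k"] ba[of "U 0 k"] that by simp
  then have "(\<Sum>k<N. 1) \<le> (\<Sum>k<N. a (U 0 k) (U 0 k))" by (intro sum_mono) auto
  then show ?thesis using N1 by (simp add: nrg_def)
qed

definition "good Y \<longleftrightarrow> Y 0 = (\<lambda>_ _. 0) \<and> (\<forall>n. invar N \<Lambda> E0 (U n) (Y n) \<and>
  nrg N (U (Suc n)) + 12/5 * E0 * tr N (Y (Suc n)) \<le> nrg N (U n) + 12/5 * E0 * tr N (Y n)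
     - t n / 8 * (tnorm N (U n) + frob N (U n) + (tr N (dev N (U n)) + tr N (Y n)) + tr N (Y n)))"

lemma full_step:
  assumes "invar N \<Lambda> E0 (U n) Y"
  shows "full_step a b G N (U n) (Uh n) (U (Suc n)) (t n) \<Lambda> E0 Y"
  using assms st1 st2 t0 E0 L1 tb by unfold_locales auto

lemma ex_good: "\<exists>Y. good Y"
proof -
  have "psd_form (\<lambda>x y. dev N (U 0) x y + 0)"
  proof
    show "dev N (U 0) x y + 0 = dev N (U 0) y x + 0" for x y by (simp add: dev_sym)
  qed (use S_lo in \<open>simp_all add: dev_def comb_add comb_scale b.lin dot.lin algebra_simps\<close>)
  moreover have "psd_form (\<lambda>(_::nat rvec) (_::nat rvec). 0)" by standard simp_all
  moreover have "- ((\<Lambda> - 1) / (8 * E0 * \<Lambda>)) * dot N x x \<le> dev N (U 0) x x" for x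
  proof -
    have "0 \<le> (\<Lambda> - 1) / (8 * E0 * \<Lambda>) * dot N x x"
      using L1 E0 by (intro mult_nonneg_nonneg divide_nonneg_nonneg dot.nonneg) auto
    moreover have "0 \<le> dev N (U 0) x x" using S_lo[of x] by (simp add: dev_def)
    ultimately show ?thesis by simp
  qed
  ultimately have 0: "invar N \<Lambda> E0 (U 0) (\<lambda>_ _. 0)"
    using S_up by (simp add: invar_def dev_def tr_def algebra_simps)
  have st: "\<exists>Y'. invar N \<Lambda> E0 (U (Suc n)) Y' \<and>
      nrg N (U (Suc n)) + 12/5 * E0 * tr N Y' \<le> nrg N (U n) + 12/5 * E0 * tr N Y
     - t n / 8 * (tnorm N (U n) + frob N (U n) + (tr N (dev N (U n)) + tr N Y) + tr N Y)"
    if "invar N \<Lambda> E0 (U n) Y" for n Y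
    using full_step.step[OF full_step[OF that]] by blast
  \<comment> \<open>Dependent choice: \<open>Y (Suc n)\<close> is obtained from \<open>Y n\<close>
    and must satisfy the decrease relative to it.\<close>
  have "\<exists>Y. \<forall>n. (invar N \<Lambda> E0 (U n) (Y n) \<and> (n = 0 \<longrightarrow> Y n = (\<lambda>_ _. 0))) \<and>
     nrg N (U (Suc n)) + 12/5 * E0 * tr N (Y (Suc n)) \<le> nrg N (U n) + 12/5 * E0 * tr N (Y n)
     - t n / 8 * (tnorm N (U n) + frob N (U n) + (tr N (dev N (U n)) + tr N (Y n)) + tr N (Y n))"
    by (rule dependent_nat_choice) (use 0 st in auto)
  then show ?thesis unfolding good_def by auto
qed

lemma t_le: "t n \<le> 1/3"
proof -
  have "1 \<le> \<Lambda>\<^sup>2" using L1 by simp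
  then have "2 * 1 \<le> (4 * E0) * \<Lambda>\<^sup>2" using E0 by (intro mult_mono) auto
  then have "3 \<le> 4 * E0 * \<Lambda>\<^sup>2 + \<Lambda>" using L1 by linarith
  then have "t n * 3 \<le> t n * (4 * E0 * \<Lambda>\<^sup>2 + \<Lambda>)" using less_imp_le[OF t0[of n]] by (rule mult_left_mono)
  then show ?thesis using tb[of n] by linarith
qed

theorem convergence:
  "\<exists>Q. (\<forall>i<N. \<forall>j<N. (\<Sum>k<N. Q k i * Q k j) = (if i = j then 1 else (0::real)))
     \<and> (\<lambda>n. \<Sum>j<N. a (U n j - (\<Sum>i<N. Q i j *\<^sub>R v i)) (U n j - (\<Sum>i<N. Q i j *\<^sub>R v i))) \<longlonglongrightarrow> 0"
proof -
  obtain Y where "good Y" using ex_good by blast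
  then have inv: "invar N \<Lambda> E0 (U n) (Y n)"
    and desc: "nrg N (U (Suc n)) + 12/5 * E0 * tr N (Y (Suc n)) \<le> nrg N (U n) + 12/5 * E0 * tr N (Y n)
     - t n / 8 * (tnorm N (U n) + frob N (U n) + (tr N (dev N (U n)) + tr N (Y n)) + tr N (Y n))" for n
    unfolding good_def by auto
  have Y: "psd_form (Y n)" and dY: "psd_form (\<lambda>x y. dev N (U n) x y + Y n x y)" for n
    using inv by (auto simp: invar_def)
  define y where "y n = tr N (Y n)" for n
  define p where "p n = tr N (dev N (U n)) + y n" for n
  define D where "D n = tnorm N (U n) + frob N (U n) + p n + y n" for n
  define L where "L n = nrg N (U n) + 12/5 * E0 * y n" for n
  define q where "q = tmin / 8"
  have q0: "0 < q" using tmin by (simp add: q_def)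
  have y0: "0 \<le> y n" for n by (simp add: y_def tr_def sum_nonneg psd_form.nonneg[OF Y])
  have p0: "0 \<le> p n" for n
    using sum_nonneg[of "{..<N}" "\<lambda>i. dev N (U n) (unitv i) (unitv i) + Y n (unitv i) (unitv i)"] psd_form.nonneg[OF dY]
    by (simp add: p_def y_def tr_def sum.distrib)
  have tn0: "0 \<le> tnorm N (U n)" for n
  proof -
    interpret full_step a b G N "U n" "Uh n" "U (Suc n)" "t n" \<Lambda> E0 "Y n" by (rule full_step[OF inv])
    show ?thesis by (rule s1.stage_one_main(3))
  qed
  have D0: "0 \<le> D n" for n using tn0[of n] frob_nonneg[of N "U n"] p0[of n] y0[of n] by (simp add: D_def)
  have Ldesc: "L (Suc n) \<le> L n - q * D n" for n
  proof -
    have "q * D n \<le> t n / 8 * D n" using tmin(2)[of n] D0[of n] by (intro mult_right_mono) (simp_all add: q_def)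
    then show ?thesis using desc[of n] by (simp add: L_def y_def D_def p_def)
  qed
  have L0: "0 \<le> L n" for n
    using y0[of n] E0 by (simp add: L_def nrg_def sum_nonneg a.nonneg)
  have Lsum: "q * (\<Sum>k<n. D k) \<le> L 0 - L n" for n
  proof (induction n)
    case (Suc n)
    then show ?case using Ldesc[of n] by (simp add: algebra_simps)
  qed simp
  have "summable D"
  proof (rule summableI_nonneg_bounded[OF D0])
    show "(\<Sum>k<n. D k) \<le> L 0 / q" for n
      using Lsum[of n] L0[of n] q0 by (simp add: field_simps)
  qed
  then have Dlim: "D \<longlonglongrightarrow> 0" by (rule summable_LIMSEQ_zero)
  have Dle: "p n + y n \<le> D n" "frob N (U n) \<le> D n" "tnorm N (U n) \<le> D n" for n
    using tn0[of n] frob_nonneg[of N "U n"] p0[of n] y0[of n] by (simp_all add: D_def)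
  \<comment> \<open>\<open>S - I \<le> S - I + Y\<close>, and the right side is positive
    semidefinite, hence at most its trace \<open>p\<close>.\<close>
  have devp: "dev N (U n) x x \<le> p n * dot N x x" for n x
  proof -
    have "dev N (U n) x x = dev N (U n) (trunc N x) (trunc N x)"
      by (simp add: dev_def comb_trunc dot_trunc)
    also have "\<dots> \<le> dev N (U n) (trunc N x) (trunc N x) + Y n (trunc N x) (trunc N x)"
      using psd_form.nonneg[OF Y] by simp
    also have "\<dots> \<le> tr N (\<lambda>x y. dev N (U n) x y + Y n x y) * dot N (trunc N x) (trunc N x)"
      by (rule psd_le_trace[OF dY supp_trunc])
    also have "\<dots> = p n * dot N x x" by (simp add: dot_trunc p_def y_def tr_def sum.distrib)
    finally show ?thesis .
  qed
  have trd: "(\<Sum>j<N. b (U n j) (U n j)) = real N + p n - y n" for n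
    by (simp add: p_def tr_def dev_def sum_subtractf)
  \<comment> \<open>\<open>p\<close> alone bounds \<open>S - I\<close> from above. Adding
    \<open>y\<close> also covers the lower bound \<open>lo\<close>, since the trace of
    \<open>S - I\<close> is \<open>p - y\<close>.\<close>
  define \<epsilon> where "\<epsilon> n = p n + y n" for n
  have e0: "0 \<le> \<epsilon> n" for n using p0[of n] y0[of n] by (simp add: \<epsilon>_def)
  have deve: "dev N (U n) x x \<le> \<epsilon> n * dot N x x" for n x
    using devp[of n x] mult_nonneg_nonneg[OF y0[of n] dot.nonneg[of N x]] by (simp add: \<epsilon>_def distrib_right)
  have lo: "real N - real N * \<epsilon> n \<le> (\<Sum>j<N. b (U n j) (U n j))" for n
  proof -
    have "1 * \<epsilon> n \<le> real N * \<epsilon> n" using N1 e0[of n] by (intro mult_right_mono) auto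
    then show ?thesis using trd[of n] p0[of n] by (simp add: \<epsilon>_def)
  qed
  define Es where "Es = (\<Sum>i<N. lam i) / 2"
  define l where "l n = L n - Es" for n
  have lup0: "0 < lup" using lN lup by simp
  have coefs: "0 \<le> (\<Sum>i<N. 1 + \<epsilon> n - coef (U n) i)" for n
    using coef_le[OF e0 deve] by (intro sum_nonneg) auto
  have nlo: "Es - real N * lup * \<epsilon> n \<le> L n" for n
  proof -
    have "0 \<le> (lup - lN) * (\<Sum>i<N. 1 + \<epsilon> n - coef (U n) i)" using lup coefs by (intro mult_nonneg_nonneg) auto
    then have "Es - real N * lup * \<epsilon> n \<le> nrg N (U n)"
      using nrg_lower[OF e0 deve lo, of n] by (simp add: Es_def)
    moreover have "0 \<le> 12/5 * E0 * y n" using E0 y0[of n] by simp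
    ultimately show ?thesis unfolding L_def by linarith
  qed
  have elim: "\<epsilon> \<longlonglongrightarrow> 0"
    by (rule tendsto_sandwich[OF _ _ tendsto_const Dlim]) (use e0 Dle(1) in \<open>auto simp: \<epsilon>_def\<close>)
  have Lmono: "L m \<le> L n" if "n \<le> m" for n m
    using that
  proof (induction m rule: dec_induct)
    case (step k)
    have "0 \<le> q * D k" using q0 D0[of k] by simp
    then show ?case using Ldesc[of k] step by linarith
  qed simp
  \<comment> \<open>\<open>L\<close> decreases and is bounded below by \<open>Es\<close> up to a
    multiple of \<epsilon>, which tends to 0; so it never falls below \<open>Es\<close>.\<close>
  have l0: "0 \<le> l n" for n
  proof -
    have "(\<lambda>m. - (real N * lup * \<epsilon> m)) \<longlonglongrightarrow> - (real N * lup * 0)" by (intro tendsto_intros elim)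
    moreover have "\<forall>m\<ge>n. - (real N * lup * \<epsilon> m) \<le> l n"
    proof (intro allI impI)
      fix m assume "n \<le> m"
      then show "- (real N * lup * \<epsilon> m) \<le> l n" using nlo[of m] Lmono[of n m] by (simp add: l_def)
    qed
    ultimately show ?thesis using LIMSEQ_le_const2[of _ "0::real" "l n"] by auto
  qed
  define \<kappa> where "\<kappa> = (1 - lN / lup)\<^sup>2"
  have k0: "0 < \<kappa>" using lN lup by (simp add: \<kappa>_def)
  have L0E: "L n \<le> E0" for n using inv[of n] by (simp add: invar_def L_def y_def)
  \<comment> \<open>Beyond \<open>n0\<close> the error in \<open>nrg_lower\<close> is at most a
    quarter of the gap. Together with the half allowed by \<open>en0\<close> the deficit of the
    coefficients is at most 3/4, as \<open>cone\<close> requires.\<close>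
  have "eventually (\<lambda>n. \<epsilon> n < (lup - lN) / (8 * real N * lup)) sequentially"
    using elim lup lup0 N1 by (intro order_tendstoD) auto
  then obtain n0 where n0: "\<And>n. n0 \<le> n \<Longrightarrow> \<epsilon> n < (lup - lN) / (8 * real N * lup)"
    unfolding eventually_sequentially by blast
  have rest: "\<kappa> * (\<Sum>k<N. a (rest (U n k)) (rest (U n k))) \<le> 4 * lN * D n" if n: "n0 \<le> n" for n
  proof -
    have "(\<Sum>i<N. 1 + \<epsilon> n - coef (U n) i) \<le> 3/4"
    proof -
      have "0 \<le> 12/5 * E0 * y n" using E0 y0[of n] by simp
      then have "2 * nrg N (U n) \<le> (\<Sum>i<N. lam i) + (lup - lN) / 2"
        using L0E[of n] en0 unfolding L_def by linarith
      moreover have "2 * real N * lup * \<epsilon> n \<le> (lup - lN) / 4"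
        using n0[OF n] lup0 N1 by (simp add: field_simps)
      ultimately have "(lup - lN) * (\<Sum>i<N. 1 + \<epsilon> n - coef (U n) i) \<le> (lup - lN) * (3/4)"
        using nrg_lower[OF e0 deve lo, of n] by linarith
      then show ?thesis using lup by (simp only: mult_le_cancel_left_pos diff_gt_0_iff_gt)
    qed
    from rest_le_tnorm[OF cone[OF e0 deve this]]
    have "\<kappa> * (\<Sum>k<N. a (rest (U n k)) (rest (U n k))) \<le> 4 * lN * tnorm N (U n)" by (simp add: \<kappa>_def)
    also have "\<dots> \<le> 4 * lN * D n" using lN Dle(3) by (intro mult_left_mono) auto
    finally show ?thesis .
  qed
  \<comment> \<open>One summand for each part of \<open>l n\<close>: the component outside the
    eigenspace (half of \<open>4 * lN / \<kappa>\<close>), the excess of \<open>S\<close> over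
    \<open>I\<close>, and the weight of \<open>y\<close>. The summand \<open>q\<close> makes
    \<open>r\<close> nonnegative.\<close>
  define C where "C = 2 * lN / \<kappa> + real N * lN + 12/5 * E0 + q"
  have C: "q \<le> C" "0 < C" using k0 lN E0 q0 by (auto simp: C_def intro!: add_nonneg_pos add_nonneg_nonneg)
  have lC: "l n \<le> C * D n" if n: "n0 \<le> n" for n
  proof -
    have "2 * nrg N (U n) \<le> 2 * Es + real N * lN * p n + (\<Sum>j<N. a (rest (U n j)) (rest (U n j)))"
      using nrg_upper[OF p0 devp] by (simp add: Es_def)
    moreover have "(\<Sum>j<N. a (rest (U n j)) (rest (U n j))) \<le> 4 * lN / \<kappa> * D n"
      using rest[OF n] k0 by (simp add: field_simps)
    moreover have "real N * lN * p n \<le> real N * lN * D n" "12/5 * E0 * y n \<le> 12/5 * E0 * D n"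
      using Dle(1)[of n] p0[of n] y0[of n] lN E0 by (auto intro!: mult_left_mono)
    moreover have "0 \<le> q * D n" "0 \<le> real N * lN * D n" using q0 D0[of n] lN by auto
    ultimately show ?thesis unfolding l_def L_def C_def by (simp add: algebra_simps)
  qed
  define r where "r = 1 - q / C"
  have r: "0 \<le> r" "r < 1" using C q0 by (auto simp: r_def)
  have lr: "l (Suc n) \<le> r * l n" if n: "n0 \<le> n" for n
  proof -
    have "q / C * l n \<le> q / C * (C * D n)" using lC[OF n] q0 C by (intro mult_left_mono) auto
    then have "q / C * l n \<le> q * D n" using C by simp
    then show ?thesis using Ldesc[of n] by (simp add: l_def r_def algebra_simps)
  qed
  have geo: "l (n0 + k) \<le> r ^ k * l n0" for k
  proof (induction k)
    case (Suc k)
    have "l (n0 + Suc k) \<le> r * l (n0 + k)" using lr[of "n0 + k"] by simp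
    also have "\<dots> \<le> r * (r ^ k * l n0)" using Suc r by (intro mult_left_mono) auto
    finally show ?case by simp
  qed simp
  have Dgeo: "D (n0 + k) \<le> l n0 / q * r ^ k" for k
  proof -
    have "q * D (n0 + k) \<le> l (n0 + k)" using Ldesc[of "n0 + k"] l0[of "Suc (n0 + k)"] by (simp add: l_def)
    also have "\<dots> \<le> r ^ k * l n0" by (rule geo)
    finally show ?thesis using q0 by (simp add: field_simps)
  qed
  define c where "c i j n = b (v i) (U n j)" for i j n
  note tpos = t0 and tle = t_le
  have inc: "\<bar>c i j (Suc n) - c i j n\<bar> \<le> sqrt (\<Lambda> * D n)" if i: "i < N" and j: "j < N" for i j n
  proof -
    interpret full_step a b G N "U n" "Uh n" "U (Suc n)" "t n" \<Lambda> E0 "Y n" by (rule full_step[OF inv])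
    let ?d = "U (Suc n) j - U n j"
    have "a ?d ?d \<le> (\<Sum>k<N. a (U (Suc n) k - U n k) (U (Suc n) k - U n k))"
      using j by (intro member_le_sum a.nonneg) auto
    also have "\<dots> \<le> 2 * (t n)\<^sup>2 * \<Lambda> * (tnorm N (U n) + frob N (U n))" by (rule increment)
    also have "\<dots> = (2 * (t n)\<^sup>2) * (\<Lambda> * (tnorm N (U n) + frob N (U n)))" by simp
    also have "\<dots> \<le> 1 * (\<Lambda> * (tnorm N (U n) + frob N (U n)))"
    proof (rule mult_right_mono)
      have "(t n)\<^sup>2 \<le> (1/3)\<^sup>2" using tle[of n] tpos[of n] by (intro power_mono) auto
      then show "2 * (t n)\<^sup>2 \<le> 1" by (simp add: power2_eq_square)
    qed (use L1 tn0[of n] frob_nonneg[of N "U n"] in simp)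
    also have "\<dots> \<le> \<Lambda> * D n" using L1 p0[of n] y0[of n] by (simp add: D_def)
    finally have ad: "a ?d ?d \<le> \<Lambda> * D n" .
    have "(b (v i) ?d)\<^sup>2 \<le> b (v i) (v i) * b ?d ?d" by (rule b.cs)
    also have "\<dots> \<le> \<Lambda> * D n" using v_on[OF i i] ba[of ?d] ad by simp
    finally have "(b (v i) ?d)\<^sup>2 \<le> \<Lambda> * D n" .
    then have "\<bar>b (v i) ?d\<bar> \<le> sqrt (\<Lambda> * D n)" by (simp add: real_le_rsqrt)
    then show ?thesis by (simp add: c_def b.diff_right)
  qed
  have conv: "convergent (c i j)" if i: "i < N" and j: "j < N" for i j
  proof -
    \<comment> \<open>The steps have size \<open>sqrt (D n)\<close>. Summability of \<open>D\<close>
      would not suffice for their summability; the geometric decay does.\<close>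
    define B where "B = sqrt (\<Lambda> * (l n0 / q))"
    have "summable (\<lambda>k. B * (sqrt r) ^ k)"
      using r by (intro summable_mult summable_geometric) (simp add: real_sqrt_lt_1_iff)
    then have "summable (\<lambda>k. c i j (Suc (k + n0)) - c i j (k + n0))"
    proof (rule summable_comparison_test'[where N = 0])
      fix k
      have "\<bar>c i j (Suc (k + n0)) - c i j (k + n0)\<bar> \<le> sqrt (\<Lambda> * D (n0 + k))"
        using inc[OF i j, of "k + n0"] by (simp add: add.commute)
      also have "\<dots> \<le> sqrt (\<Lambda> * (l n0 / q * r ^ k))" using Dgeo[of k] L1 by (intro real_sqrt_le_mono mult_left_mono) auto
      also have "\<dots> = B * (sqrt r) ^ k" by (simp add: B_def real_sqrt_mult real_sqrt_power real_sqrt_divide mult_ac)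
      finally show "norm (c i j (Suc (k + n0)) - c i j (k + n0)) \<le> B * (sqrt r) ^ k" by simp
    qed
    then have "convergent (\<lambda>n. \<Sum>k<n. c i j (Suc (k + n0)) - c i j (k + n0))"
      by (simp add: summable_iff_convergent)
    moreover have "(\<Sum>k<n. c i j (Suc (k + n0)) - c i j (k + n0)) = c i j (n + n0) - c i j n0" for n
      using sum_lessThan_telescope[of "\<lambda>k. c i j (k + n0)" n] by simp
    ultimately have "convergent (\<lambda>n. c i j (n + n0) - c i j n0)" by simp
    then have "convergent (\<lambda>n. (c i j (n + n0) - c i j n0) + c i j n0)"
      by (intro convergent_add convergent_const)
    then show ?thesis by (simp add: convergent_ignore_initial_segment)
  qed
  define Q where "Q i j = lim (c i j)" for i j
  have cQ: "c i j \<longlonglongrightarrow> Q i j" if "i < N" "j < N" for i j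
    using conv[OF that] by (simp add: Q_def convergent_LIMSEQ_iff)
  have restlim: "(\<lambda>n. \<Sum>k<N. a (rest (U n k)) (rest (U n k))) \<longlonglongrightarrow> 0"
  proof (rule tendsto_sandwich[OF _ _ tendsto_const])
    show "\<forall>\<^sub>F n in sequentially. 0 \<le> (\<Sum>k<N. a (rest (U n k)) (rest (U n k)))"
      by (simp add: sum_nonneg a.nonneg)
    show "\<forall>\<^sub>F n in sequentially. (\<Sum>k<N. a (rest (U n k)) (rest (U n k))) \<le> 4 * lN / \<kappa> * D n"
      unfolding eventually_sequentially using rest k0 by (intro exI[of _ n0]) (simp add: field_simps)
    show "(\<lambda>n. 4 * lN / \<kappa> * D n) \<longlonglongrightarrow> 0" using tendsto_mult_left[OF Dlim, of "4 * lN / \<kappa>"] by simp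
  qed
  have bound0: "x \<longlonglongrightarrow> 0" if "\<And>n. \<bar>x n\<bar> \<le> z n" "z \<longlonglongrightarrow> 0" for x z :: "nat \<Rightarrow> real"
    using that by (intro Lim_null_comparison[of x z]) auto
  \<comment> \<open>The Gram entry tends to that of the identity because \<open>frob\<close> tends
    to 0, and to the entry of \<open>Q\<^sup>T Q\<close> because the components
    \<open>rest (U n k)\<close> vanish in the limit.\<close>
  have Qorth: "(\<Sum>k<N. Q k i * Q k j) = (if i = j then 1 else 0)" if i: "i < N" and j: "j < N" for i j
  proof -
    have "(\<lambda>n. b (rest (U n i)) (rest (U n j))) \<longlonglongrightarrow> 0"
    proof (rule bound0[OF _ restlim])
      fix n
      have le: "b (rest (U n k)) (rest (U n k)) \<le> (\<Sum>k<N. a (rest (U n k)) (rest (U n k)))" if "k < N" for k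
        by (rule order_trans[OF ba]) (use that in \<open>auto intro!: member_le_sum a.nonneg\<close>)
      have "(b (rest (U n i)) (rest (U n j)))\<^sup>2 \<le> (\<Sum>k<N. a (rest (U n k)) (rest (U n k))) * (\<Sum>k<N. a (rest (U n k)) (rest (U n k)))"
        using mult_mono[OF le[OF i] le[OF j]] b.nonneg b.cs[of "rest (U n i)" "rest (U n j)"]
        by (meson order_trans sum_nonneg a.nonneg)
      then show "\<bar>b (rest (U n i)) (rest (U n j))\<bar> \<le> (\<Sum>k<N. a (rest (U n k)) (rest (U n k)))"
        by (intro power2_le_imp_le[of "\<bar>_\<bar>"] sum_nonneg a.nonneg) (simp_all add: power2_eq_square)
    qed
    moreover have "(\<lambda>n. \<Sum>k<N. c k i n * c k j n) \<longlonglongrightarrow> (\<Sum>k<N. Q k i * Q k j)"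
      by (intro tendsto_intros cQ i j) auto
    ultimately have "(\<lambda>n. b (U n i) (U n j)) \<longlonglongrightarrow> (\<Sum>k<N. Q k i * Q k j) + 0"
      unfolding b_split[of "U _ i" "U _ j"] c_def[symmetric] by (intro tendsto_add)
    moreover have "(\<lambda>n. dev N (U n) (unitv i) (unitv j)) \<longlonglongrightarrow> 0"
    proof (rule bound0)
      fix n
      have "(dev N (U n) (unitv i) (unitv j))\<^sup>2 \<le> (\<Sum>k<N. (dev N (U n) (unitv i) (unitv k))\<^sup>2)"
        using j by (intro member_le_sum) auto
      also have "\<dots> \<le> frob N (U n)"
        unfolding frob_def using i by (intro member_le_sum sum_nonneg) auto
      also have "\<dots> \<le> D n" by (rule Dle)
      finally show "\<bar>dev N (U n) (unitv i) (unitv j)\<bar> \<le> sqrt (D n)" by (simp add: real_le_rsqrt)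
    qed (use tendsto_real_sqrt[OF Dlim] in simp)
    then have "(\<lambda>n. dev N (U n) (unitv i) (unitv j) + (if i = j then 1 else 0)) \<longlonglongrightarrow> 0 + (if i = j then 1 else 0)"
      by (intro tendsto_intros)
    moreover have "dev N (U n) (unitv i) (unitv j) + (if i = j then 1 else 0) = b (U n i) (U n j)" for n
      using i j by (auto simp: dev_def)
    ultimately show ?thesis using LIMSEQ_unique by fastforce
  qed
  have dist: "a (U n j - (\<Sum>i<N. Q i j *\<^sub>R v i)) (U n j - (\<Sum>i<N. Q i j *\<^sub>R v i))
      = (\<Sum>i<N. lam i * (c i j n - Q i j)\<^sup>2) + a (rest (U n j)) (rest (U n j))" for n j
    by (subst a_split) (simp add: rest_diff_v bv_diff_v c_def power2_eq_square)
  have "(\<lambda>n. \<Sum>j<N. \<Sum>i<N. lam i * (c i j n - Q i j)\<^sup>2) \<longlonglongrightarrow> (\<Sum>j<N. \<Sum>i<N. lam i * (Q i j - Q i j)\<^sup>2)"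
    by (intro tendsto_intros cQ) auto
  from tendsto_add[OF this restlim]
  have "(\<lambda>n. \<Sum>j<N. a (U n j - (\<Sum>i<N. Q i j *\<^sub>R v i)) (U n j - (\<Sum>i<N. Q i j *\<^sub>R v i))) \<longlonglongrightarrow> 0"
    by (simp add: dist sum.distrib)
  then show ?thesis using Qorth by blast
qed

end

section \<open>Square integrable functions\<close>

text \<open>Values in a Euclidean space cover functions and their gradients at once.\<close>

definition sq_int :: "'a measure \<Rightarrow> ('a \<Rightarrow> 'b::euclidean_space) \<Rightarrow> bool" where
  "sq_int M f \<longleftrightarrow> f \<in> borel_measurable M \<and> integrable M (\<lambda>x. (norm (f x))\<^sup>2)"

definition sqn :: "'a measure \<Rightarrow> ('a \<Rightarrow> 'b::euclidean_space) \<Rightarrow> real" where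
  "sqn M f = (\<integral>x. (norm (f x))\<^sup>2 \<partial>M)"

lemma sq_int_meas: "sq_int M f \<Longrightarrow> f \<in> borel_measurable M"
  by (simp add: sq_int_def)

lemma sqn_nonneg: "0 \<le> sqn M f"
  by (simp add: sqn_def)

lemma norm_add_sq_le: "(norm (x + y :: 'b::euclidean_space))\<^sup>2 \<le> 2 * (norm x)\<^sup>2 + 2 * (norm y)\<^sup>2"
  using zero_le_power2[of "norm (x - y)"] by (simp add: power2_norm_eq_inner inner_add inner_diff inner_commute)

lemma sq_int_add:
  assumes "sq_int M f" "sq_int M g"
  shows "sq_int M (\<lambda>x. f x + g x)" "sqn M (\<lambda>x. f x + g x) \<le> 2 * sqn M f + 2 * sqn M g"
proof -
  have [measurable]: "f \<in> borel_measurable M" "g \<in> borel_measurable M"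
    using assms by (auto simp: sq_int_def)
  have i: "integrable M (\<lambda>x. 2 * (norm (f x))\<^sup>2 + 2 * (norm (g x))\<^sup>2)"
    using assms by (auto simp: sq_int_def)
  have j: "integrable M (\<lambda>x. (norm (f x + g x))\<^sup>2)"
    by (rule Bochner_Integration.integrable_bound[OF i]) (use norm_add_sq_le in \<open>auto intro!: AE_I2\<close>)
  then show "sq_int M (\<lambda>x. f x + g x)" by (simp add: sq_int_def)
  have "sqn M (\<lambda>x. f x + g x) \<le> (\<integral>x. 2 * (norm (f x))\<^sup>2 + 2 * (norm (g x))\<^sup>2 \<partial>M)"
    unfolding sqn_def by (rule integral_mono[OF j i norm_add_sq_le])
  also have "\<dots> = 2 * sqn M f + 2 * sqn M g"
    using assms by (simp add: sqn_def sq_int_def)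
  finally show "sqn M (\<lambda>x. f x + g x) \<le> 2 * sqn M f + 2 * sqn M g" .
qed

lemma sq_int_scale:
  assumes "sq_int M f"
  shows "sq_int M (\<lambda>x. c *\<^sub>R f x)" "sqn M (\<lambda>x. c *\<^sub>R f x) = c\<^sup>2 * sqn M f"
  using assms by (auto simp: sq_int_def sqn_def power_mult_distrib)

lemma sq_int_diff:
  assumes "sq_int M f" "sq_int M g"
  shows "sq_int M (\<lambda>x. f x - g x)" "sqn M (\<lambda>x. f x - g x) \<le> 2 * sqn M f + 2 * sqn M g"
  using sq_int_add[OF assms(1) sq_int_scale(1)[OF assms(2), of "-1"]] sq_int_scale(2)[OF assms(2), of "-1"] by simp_all

lemma sq_int_cong_AE:
  assumes "sq_int M f" "g \<in> borel_measurable M" "AE x in M. f x = g x"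
  shows "sq_int M g" "sqn M f = sqn M g"
proof -
  have [measurable]: "f \<in> borel_measurable M" "g \<in> borel_measurable M"
    using assms by (auto simp: sq_int_def)
  have "integrable M (\<lambda>x. (norm (g x))\<^sup>2) \<longleftrightarrow> integrable M (\<lambda>x. (norm (f x))\<^sup>2)"
    by (rule integrable_cong_AE) (use assms(3) in auto)
  then show "sq_int M g" using assms by (simp add: sq_int_def)
  show "sqn M f = sqn M g" unfolding sqn_def
    by (rule integral_cong_AE) (use assms(3) in auto)
qed

lemma sq_int_inner:
  assumes "sq_int M f" "sq_int M g"
  shows "integrable M (\<lambda>x. f x \<bullet> g x)"
proof -
  have [measurable]: "f \<in> borel_measurable M" "g \<in> borel_measurable M"
    using assms by (auto simp: sq_int_def)
  have i: "integrable M (\<lambda>x. (norm (f x))\<^sup>2 + (norm (g x))\<^sup>2)"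
    using assms by (auto simp: sq_int_def)
  show ?thesis
  proof (rule Bochner_Integration.integrable_bound[OF i])
    show "AE x in M. norm (f x \<bullet> g x) \<le> norm ((norm (f x))\<^sup>2 + (norm (g x))\<^sup>2)"
    proof (rule AE_I2)
      fix x
      have "\<bar>f x \<bullet> g x\<bar> \<le> norm (f x) * norm (g x)" by (rule Cauchy_Schwarz_ineq2)
      also have "\<dots> \<le> (norm (f x))\<^sup>2 + (norm (g x))\<^sup>2"
        using sum_squares_bound[of "norm (f x)" "norm (g x)"]
          mult_nonneg_nonneg[OF norm_ge_zero norm_ge_zero, of "f x" "g x"] by linarith
      finally show "norm (f x \<bullet> g x) \<le> norm ((norm (f x))\<^sup>2 + (norm (g x))\<^sup>2)" by simp
    qed
  qed measurable
qed

lemma sq_int_cs: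
  assumes "sq_int M f" "sq_int M g"
  shows "(\<integral>x. f x \<bullet> g x \<partial>M)\<^sup>2 \<le> sqn M f * sqn M g"
proof -
  let ?i = "\<integral>x. f x \<bullet> g x \<partial>M"
  have q: "0 \<le> sqn M f - 2 * c * ?i + c\<^sup>2 * sqn M g" for c
  proof -
    have "0 \<le> (\<integral>x. (norm (f x - c *\<^sub>R g x))\<^sup>2 \<partial>M)" by simp
    also have "\<dots> = (\<integral>x. ((norm (f x))\<^sup>2 - 2 * c * (f x \<bullet> g x)) + c\<^sup>2 * (norm (g x))\<^sup>2 \<partial>M)"
      by (intro Bochner_Integration.integral_cong refl)
        (simp add: power2_norm_eq_inner inner_diff inner_commute power2_eq_square[of c] algebra_simps)
    also have "\<dots> = sqn M f - 2 * c * ?i + c\<^sup>2 * sqn M g"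
      using assms sq_int_inner[OF assms] by (simp add: sqn_def sq_int_def)
    finally show ?thesis .
  qed
  show ?thesis
  proof (cases "sqn M g = 0")
    case True
    have "?i = 0"
    proof (rule ccontr)
      assume n: "?i \<noteq> 0"
      show False using q[of "(sqn M f + 1) / (2 * ?i)"] True n by (simp add: field_simps)
    qed
    then show ?thesis using True by simp
  next
    case False
    then have p: "0 < sqn M g" using sqn_nonneg[of M g] by simp
    show ?thesis using q[of "?i / sqn M g"] p by (simp add: field_simps power2_eq_square)
  qed
qed

lemma sqn_zero_AE: "sq_int M f \<Longrightarrow> sqn M f = 0 \<Longrightarrow> AE x in M. f x = 0"
  using integral_nonneg_eq_0_iff_AE[of M "\<lambda>x. (norm (f x))\<^sup>2"] by (auto simp: sq_int_def sqn_def)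

text \<open>Riesz-Fischer by way of L^1: on a finite measure a Cauchy sequence in L^2 is Cauchy in
  L^1, so a subsequence converges almost everywhere, and Fatou's lemma transfers the L^2 estimates
  to the limit.\<close>

lemma sq_int_complete:
  fixes f :: "nat \<Rightarrow> 'a \<Rightarrow> 'b::euclidean_space"
  assumes "finite_measure M" and f: "\<And>n. sq_int M (f n)"
    and cau: "\<And>e. e > 0 \<Longrightarrow> \<exists>N. \<forall>i\<ge>N. \<forall>j\<ge>N. sqn M (\<lambda>x. f i x - f j x) < e"
  shows "\<exists>g. sq_int M g \<and> (\<lambda>n. sqn M (\<lambda>x. f n x - g x)) \<longlonglongrightarrow> 0"
proof -
  interpret finite_measure M by fact
  have fm[measurable]: "f n \<in> borel_measurable M" for n using f by (simp add: sq_int_def)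
  \<comment> \<open>Pointwise \<open>norm h \<le> (d + (norm h)\<^sup>2 / d) / 2\<close>, with
    \<open>d\<close> free for later balancing.\<close>
  have int1: "integrable M h \<and> (\<forall>d>0. (\<integral>x. norm (h x) \<partial>M) \<le> (d * measure M (space M) + sqn M h / d) / 2)"
    if h: "sq_int M h" for h :: "'a \<Rightarrow> 'b"
  proof -
    have b: "norm (h x) \<le> (d + (norm (h x))\<^sup>2 / d) / 2" if "d > 0" for d x
      using sum_squares_bound[of "norm (h x)" d] that by (simp add: field_simps power2_eq_square)
    have i: "integrable M (\<lambda>x. (d + (norm (h x))\<^sup>2 / d) / 2)" for d
      using h by (simp add: sq_int_def)
    have hi: "integrable M h"
    proof (rule Bochner_Integration.integrable_bound[OF i[of 1]])
      show "AE x in M. norm (h x) \<le> norm ((1 + (norm (h x))\<^sup>2 / 1) / 2)" using b[of 1] by (auto intro!: AE_I2)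
    qed (use h in \<open>simp add: sq_int_def\<close>)
    moreover have "(\<integral>x. norm (h x) \<partial>M) \<le> (d * measure M (space M) + sqn M h / d) / 2" if "d > 0" for d
    proof -
      have "(\<integral>x. norm (h x) \<partial>M) \<le> (\<integral>x. (d + (norm (h x))\<^sup>2 / d) / 2 \<partial>M)"
        using hi b[OF that] by (intro integral_mono i) auto
      also have "\<dots> = (d * measure M (space M) + sqn M h / d) / 2"
        using h by (simp add: sq_int_def sqn_def mult.commute)
      finally show ?thesis .
    qed
    ultimately show ?thesis by blast
  qed
  define m where "m = measure M (space M) + 1"
  have m: "0 < m" by (simp add: m_def add_nonneg_pos)
  obtain r where r: "strict_mono r" "AE x in M. Cauchy (\<lambda>i. f (r i) x)"
  proof (rule cauchy_L1_AE_cauchy_subseq[of M f])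
    show "integrable M (f n)" for n using int1[OF f] by blast
    fix e :: real assume e: "e > 0"
    \<comment> \<open>Balances the halves of \<open>int1\<close>: \<open>d\<close> times the total
      measure is at most \<open>e\<close>, and \<open>sqn < d * e\<close> gives the other
      \<open>e\<close>. The 1 in \<open>m\<close> excludes division by zero.\<close>
    define d where "d = e / m"
    have d: "d > 0" using e m by (simp add: d_def)
    obtain N where N: "\<forall>i\<ge>N. \<forall>j\<ge>N. sqn M (\<lambda>x. f i x - f j x) < d * e" using cau[of "d * e"] d e by auto
    show "\<exists>N. \<forall>i\<ge>N. \<forall>j\<ge>N. (LINT x|M. norm (f i x - f j x)) < e"
    proof (intro exI[of _ N] allI impI)
      fix i j assume ij: "N \<le> i" "N \<le> j"
      have "(LINT x|M. norm (f i x - f j x)) \<le> (d * measure M (space M) + sqn M (\<lambda>x. f i x - f j x) / d) / 2"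
        using int1[OF sq_int_diff(1)[OF f f]] d by blast
      also have "\<dots> < (e + e) / 2"
      proof -
        have "d * measure M (space M) \<le> d * m" using d by (simp add: m_def)
        also have "\<dots> = e" using m by (simp add: d_def)
        finally have "d * measure M (space M) \<le> e" .
        moreover have "sqn M (\<lambda>x. f i x - f j x) / d < e" using N ij d by (simp add: field_simps)
        ultimately show ?thesis by (intro divide_strict_right_mono add_le_less_mono) auto
      qed
      finally show "(LINT x|M. norm (f i x - f j x)) < e" by simp
    qed
  qed auto
  define g where "g x = lim (\<lambda>i. f (r i) x)" for x
  have [measurable]: "g \<in> borel_measurable M" unfolding g_def by measurable
  have lim: "AE x in M. (\<lambda>i. f (r i) x) \<longlonglongrightarrow> g x"
    using r(2) by eventually_elim (simp add: g_def Cauchy_convergent_iff convergent_LIMSEQ_iff)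
  have key: "sq_int M (\<lambda>x. f n x - g x) \<and> sqn M (\<lambda>x. f n x - g x) \<le> e"
    if N: "\<forall>i\<ge>N. \<forall>j\<ge>N. sqn M (\<lambda>x. f i x - f j x) < e" and n: "n \<ge> N" and e: "e > 0" for n N e
  proof -
    have "(\<integral>\<^sup>+x. ennreal ((norm (f n x - g x))\<^sup>2) \<partial>M) = (\<integral>\<^sup>+x. liminf (\<lambda>i. ennreal ((norm (f n x - f (r i) x))\<^sup>2)) \<partial>M)"
    proof (rule nn_integral_cong_AE)
      show "AE x in M. ennreal ((norm (f n x - g x))\<^sup>2) = liminf (\<lambda>i. ennreal ((norm (f n x - f (r i) x))\<^sup>2))"
        using lim
      proof eventually_elim
        case (elim x)
        have "(\<lambda>i. ennreal ((norm (f n x - f (r i) x))\<^sup>2)) \<longlonglongrightarrow> ennreal ((norm (f n x - g x))\<^sup>2)"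
          by (intro tendsto_ennrealI tendsto_intros elim)
        then show ?case by (rule lim_imp_Liminf[OF sequentially_bot, symmetric])
      qed
    qed
    also have "\<dots> \<le> liminf (\<lambda>i. \<integral>\<^sup>+x. ennreal ((norm (f n x - f (r i) x))\<^sup>2) \<partial>M)"
      by (intro nn_integral_liminf) measurable
    also have "\<dots> \<le> ennreal e"
    proof (rule Liminf_le)
      have "(\<integral>\<^sup>+x. ennreal ((norm (f n x - f (r i) x))\<^sup>2) \<partial>M) = ennreal (sqn M (\<lambda>x. f n x - f (r i) x))" for i
        unfolding sqn_def using sq_int_diff(1)[OF f f, of n "r i"] by (intro nn_integral_eq_integral) (auto simp: sq_int_def)
      moreover have "sqn M (\<lambda>x. f n x - f (r i) x) \<le> e" if "i \<ge> N" for i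
        using N n order_trans[OF that seq_suble[OF r(1)]] by (auto intro: less_imp_le)
      ultimately show "\<forall>\<^sub>F i in sequentially. (\<integral>\<^sup>+x. ennreal ((norm (f n x - f (r i) x))\<^sup>2) \<partial>M) \<le> ennreal e"
        unfolding eventually_sequentially by (intro exI[of _ N]) (simp add: ennreal_leI)
    qed simp
    finally have le: "(\<integral>\<^sup>+x. ennreal ((norm (f n x - g x))\<^sup>2) \<partial>M) \<le> ennreal e" .
    then have i: "integrable M (\<lambda>x. (norm (f n x - g x))\<^sup>2)"
      by (intro integrableI_nonneg) (auto simp: le_less_trans[OF le])
    have "ennreal (sqn M (\<lambda>x. f n x - g x)) \<le> ennreal e"
      using nn_integral_eq_integral[OF i] le by (simp add: sqn_def)
    then show ?thesis using i e by (simp add: sq_int_def ennreal_le_iff)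
  qed
  have "sq_int M g"
  proof -
    obtain N where N: "\<forall>i\<ge>N. \<forall>j\<ge>N. sqn M (\<lambda>x. f i x - f j x) < 1" using cau[of 1] by auto
    have "sq_int M (\<lambda>x. f N x - (f N x - g x))"
      by (rule sq_int_diff(1)[OF f]) (use key[OF N, of N] in auto)
    moreover have "(\<lambda>x. f N x - (f N x - g x)) = g" by (simp add: fun_eq_iff)
    ultimately show ?thesis by simp
  qed
  moreover have "(\<lambda>n. sqn M (\<lambda>x. f n x - g x)) \<longlonglongrightarrow> 0"
  proof (rule LIMSEQ_I)
    fix e :: real assume e: "e > 0"
    obtain N where N: "\<forall>i\<ge>N. \<forall>j\<ge>N. sqn M (\<lambda>x. f i x - f j x) < e / 2" using cau[of "e/2"] e by auto
    have "norm (sqn M (\<lambda>x. f n x - g x) - 0) < e" if "n \<ge> N" for n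
      using key[OF N that] e sqn_nonneg[of M "\<lambda>x. f n x - g x"] by auto
    then show "\<exists>no. \<forall>n\<ge>no. norm (sqn M (\<lambda>x. f n x - g x) - 0) < e" by blast
  qed
  ultimately show ?thesis by blast
qed

section \<open>Compactly supported \<open>C\<^sup>1\<close> functions\<close>

definition c1c :: "('a::euclidean_space \<Rightarrow> real) \<Rightarrow> ('a \<Rightarrow> 'a) \<Rightarrow> bool" where
  "c1c F DF \<longleftrightarrow> (\<forall>x. (F has_derivative (\<lambda>h. DF x \<bullet> h)) (at x)) \<and> continuous_on UNIV DF
     \<and> (\<exists>R>0. \<forall>x. norm x > R \<longrightarrow> F x = 0 \<and> DF x = 0)"

lemma c1c_cont: "c1c F DF \<Longrightarrow> continuous_on UNIV F"
  unfolding c1c_def by (meson has_derivative_continuous continuous_at_imp_continuous_on)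

lemma integrable_compact_support:
  fixes f :: "'a::euclidean_space \<Rightarrow> 'b::{banach, second_countable_topology}"
  assumes "continuous_on UNIV f" "\<And>x. norm x > R \<Longrightarrow> f x = 0"
  shows "integrable lborel f"
proof -
  have "integrable lborel (\<lambda>x. indicator (cball 0 R) x *\<^sub>R f x)"
    using assms(1) by (intro borel_integrable_compact) (auto intro: continuous_on_subset)
  also have "(\<lambda>x. indicator (cball 0 R) x *\<^sub>R f x) = f"
    using assms(2) by (auto simp: indicator_def fun_eq_iff not_le)
  finally show ?thesis .
qed

lemma bounded_compact_support:
  fixes f :: "'a::euclidean_space \<Rightarrow> 'b::real_normed_vector"
  assumes "continuous_on UNIV f" "\<And>x. norm x > R \<Longrightarrow> f x = 0"
  shows "\<exists>B\<ge>0. \<forall>x. norm (f x) \<le> B"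
proof -
  have "compact (f ` cball 0 R)"
    using assms(1) by (intro compact_continuous_image) (auto intro: continuous_on_subset)
  then obtain B where B: "\<And>x. x \<in> cball 0 R \<Longrightarrow> norm (f x) \<le> B"
    by (meson compact_imp_bounded bounded_iff image_eqI)
  have "norm (f x) \<le> max B 0" for x
    using B[of x] assms(2)[of x] by (cases "norm x \<le> R") (auto simp: not_le)
  then show ?thesis by (intro exI[of _ "max B 0"]) auto
qed

lemma lborel_integral_translate:
  fixes f :: "'a::euclidean_space \<Rightarrow> 'b::{banach, second_countable_topology}"
  assumes "f \<in> borel_measurable borel"
  shows "(\<integral>x. f (x + c) \<partial>lborel) = (\<integral>x. f x \<partial>lborel)"
proof -
  have "(\<integral>x. f x \<partial>lborel) = (\<integral>x. f x \<partial>distr lborel borel ((+) c))" by (simp add: lborel_distr_plus)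
  also have "\<dots> = (\<integral>x. f (c + x) \<partial>lborel)" using assms by (intro integral_distr) auto
  finally show ?thesis by (simp add: add.commute)
qed

text \<open>Dominated convergence: \<open>F\<close> is Lipschitz with the bound \<open>B\<close> of
  its gradient, and the quotients vanish outside the ball of radius \<open>R + norm h\<close>,
  whatever \<open>n\<close>.\<close>

lemma difference_quotient:
  fixes F :: "'a::euclidean_space \<Rightarrow> real" and h :: 'a
  assumes c: "c1c F DF"
  defines "q n x \<equiv> real (Suc n) * (F (x + (1 / real (Suc n)) *\<^sub>R h) - F x)"
  shows "(\<lambda>n. \<integral>x. q n x \<partial>lborel) \<longlonglongrightarrow> (\<integral>x. DF x \<bullet> h \<partial>lborel)"
    and "(\<lambda>n. \<integral>x. (q n x)\<^sup>2 \<partial>lborel) \<longlonglongrightarrow> (\<integral>x. (DF x \<bullet> h)\<^sup>2 \<partial>lborel)"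
proof -
  have der: "\<And>x. (F has_derivative (\<lambda>h. DF x \<bullet> h)) (at x)" and cD: "continuous_on UNIV DF"
    using c by (auto simp: c1c_def)
  obtain R where R: "R > 0" "\<And>x. norm x > R \<Longrightarrow> F x = 0 \<and> DF x = 0" using c by (auto simp: c1c_def)
  have cF: "continuous_on UNIV F" by (rule c1c_cont[OF c])
  obtain B where B: "B \<ge> 0" "\<And>x. norm (DF x) \<le> B"
    using bounded_compact_support[OF cD, of R] R(2) by blast
  have lip: "\<bar>F (x + k) - F x\<bar> \<le> B * norm k" for x k
  proof -
    have "norm (F (x + k) - F x) \<le> B * norm (x + k - x)"
    proof (rule differentiable_bound[of UNIV F "\<lambda>x h. DF x \<bullet> h"])
      show "onorm (\<lambda>h. DF x \<bullet> h) \<le> B" for x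
      proof (rule onorm_bound)
        show "norm (DF x \<bullet> h) \<le> B * norm h" for h
          using Cauchy_Schwarz_ineq2[of "DF x" h] mult_right_mono[OF B(2)[of x] norm_ge_zero[of h]] by simp
      qed (use B in simp)
    qed (use der in auto)
    then show ?thesis by simp
  qed
  have qb: "\<bar>q n x\<bar> \<le> B * norm h * indicator (cball 0 (R + norm h)) x" for n x
  proof (cases "norm x \<le> R + norm h")
    case True
    have "\<bar>q n x\<bar> = real (Suc n) * \<bar>F (x + (1 / real (Suc n)) *\<^sub>R h) - F x\<bar>" by (simp add: q_def abs_mult)
    also have "\<dots> \<le> real (Suc n) * (B * norm ((1 / real (Suc n)) *\<^sub>R h))" by (intro mult_left_mono lip) auto
    also have "\<dots> = B * norm h" by simp
    finally show ?thesis using True by simp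
  next
    case False
    have "norm ((1 / real (Suc n)) *\<^sub>R h) \<le> norm h" 
      using mult_left_mono[of 1 "1 + real n" "norm h"] by (simp add: divide_le_eq)
    then have "norm (x + (1 / real (Suc n)) *\<^sub>R h) > R"
      using False norm_triangle_ineq4[of "x + (1 / real (Suc n)) *\<^sub>R h" "(1 / real (Suc n)) *\<^sub>R h"] by simp
    moreover have "norm x > R" using False norm_ge_zero[of h] by linarith
    ultimately show ?thesis using R(2) B(1) by (simp add: q_def)
  qed
  have qlim: "(\<lambda>n. q n x) \<longlonglongrightarrow> DF x \<bullet> h" for x
  proof -
    have v: "((\<lambda>s. x + s *\<^sub>R h) has_derivative (\<lambda>s. s *\<^sub>R h)) (at 0)"
      by (auto intro!: derivative_eq_intros)
    have "(F has_derivative (\<lambda>h. DF x \<bullet> h)) (at (x + 0 *\<^sub>R h))" using der by simp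
    from has_derivative_compose[OF v this]
    have "((\<lambda>s. F (x + s *\<^sub>R h)) has_real_derivative (DF x \<bullet> h)) (at 0)"
      by (simp add: has_field_derivative_def mult.commute[of _ "DF x \<bullet> h"])
    then have "(\<lambda>s. (F (x + s *\<^sub>R h) - F x) / s) \<midarrow>0\<rightarrow> DF x \<bullet> h"
      by (simp add: has_field_derivative_iff)
    moreover have "filterlim (\<lambda>n. 1 / real (Suc n)) (at 0) sequentially"
      by (intro filterlim_atI) (use LIMSEQ_Suc[OF lim_1_over_n] in auto)
    ultimately have "(\<lambda>n. (F (x + (1 / real (Suc n)) *\<^sub>R h) - F x) / (1 / real (Suc n))) \<longlonglongrightarrow> DF x \<bullet> h"
      by (rule filterlim_compose)
    then show ?thesis by (simp add: q_def mult.commute)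
  qed
  have cq: "continuous_on UNIV (q n)" for n
    unfolding q_def by (intro continuous_intros continuous_on_compose2[OF cF]) auto
  have [measurable]: "q n \<in> borel_measurable borel" for n
    by (rule borel_measurable_continuous_onI[OF cq])
  have [measurable]: "DF \<in> borel_measurable borel" by (rule borel_measurable_continuous_onI[OF cD])
  have ind: "integrable lborel (\<lambda>x. A * indicator (cball (0::'a) S) x)" for A S :: real
    using borel_integrable_compact[of "cball (0::'a) S" "\<lambda>_. A"] by (simp add: mult.commute)
  show "(\<lambda>n. \<integral>x. q n x \<partial>lborel) \<longlonglongrightarrow> (\<integral>x. DF x \<bullet> h \<partial>lborel)"
    by (rule integral_dominated_convergence[OF _ _ ind[of "B * norm h" "R + norm h"]])
      (use qlim qb in auto)
  show "(\<lambda>n. \<integral>x. (q n x)\<^sup>2 \<partial>lborel) \<longlonglongrightarrow> (\<integral>x. (DF x \<bullet> h)\<^sup>2 \<partial>lborel)"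
  proof (rule integral_dominated_convergence[OF _ _ ind[of "(B * norm h)\<^sup>2" "R + norm h"]])
    show "AE x in lborel. norm ((q n x)\<^sup>2) \<le> (B * norm h)\<^sup>2 * indicator (cball 0 (R + norm h)) x" for n
    proof (rule AE_I2)
      fix x
      have "\<bar>q n x\<bar>\<^sup>2 \<le> (B * norm h * indicator (cball 0 (R + norm h)) x)\<^sup>2" by (intro power_mono qb) auto
      then show "norm ((q n x)\<^sup>2) \<le> (B * norm h)\<^sup>2 * indicator (cball 0 (R + norm h)) x"
        by (auto simp: indicator_def split: if_splits)
    qed
  qed (auto intro!: tendsto_intros qlim)
qed

lemma c1c_integrable: "c1c F DF \<Longrightarrow> integrable lborel F"
  using c1c_cont integrable_compact_support[of F] unfolding c1c_def by blast

text \<open>Lebesgue measure is translation invariant, so every difference quotient integrates to 0;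
  pass to the limit.\<close>

lemma c1c_integral_deriv:
  assumes c: "c1c F DF"
  shows "(\<integral>x. DF x \<bullet> h \<partial>lborel) = 0"
proof -
  have m[measurable]: "F \<in> borel_measurable borel"
    by (rule borel_measurable_continuous_onI[OF c1c_cont[OF c]])
  have i: "integrable lborel (\<lambda>x. F (x + k))" for k
  proof -
    have "integrable (distr lborel borel ((+) k)) F" using c1c_integrable[OF c] by (simp add: lborel_distr_plus)
    then show ?thesis by (subst (asm) integrable_distr_eq) (auto simp: add.commute)
  qed
  have z: "(\<integral>x. real (Suc n) * (F (x + (1 / real (Suc n)) *\<^sub>R h) - F x) \<partial>lborel) = 0" for n
    using i[of "(1 / real (Suc n)) *\<^sub>R h"] i[of 0] lborel_integral_translate[OF m] by simp
  have "(\<lambda>n. 0) \<longlonglongrightarrow> (\<integral>x. DF x \<bullet> h \<partial>lborel)"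
    using difference_quotient(1)[OF c, of h] by (simp only: z)
  then show ?thesis using LIMSEQ_unique tendsto_const by blast
qed

lemma c1c_mult:
  assumes "c1c F DF" "c1c H DH"
  shows "c1c (\<lambda>x. F x * H x) (\<lambda>x. H x *\<^sub>R DF x + F x *\<^sub>R DH x)"
proof -
  obtain R where R: "R > 0" "\<And>x. norm x > R \<Longrightarrow> F x = 0 \<and> DF x = 0" using assms(1) by (auto simp: c1c_def)
  have "((\<lambda>x. F x * H x) has_derivative (\<lambda>h. (H x *\<^sub>R DF x + F x *\<^sub>R DH x) \<bullet> h)) (at x)" for x
  proof -
    have "(F has_derivative (\<lambda>h. DF x \<bullet> h)) (at x)" "(H has_derivative (\<lambda>h. DH x \<bullet> h)) (at x)"
      using assms by (auto simp: c1c_def)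
    from has_derivative_mult[OF this] show ?thesis by (simp add: inner_add_left algebra_simps)
  qed
  moreover have "continuous_on UNIV (\<lambda>x. H x *\<^sub>R DF x + F x *\<^sub>R DH x)"
    using assms c1c_cont by (auto simp: c1c_def intro!: continuous_intros)
  ultimately show ?thesis using R unfolding c1c_def by (intro conjI exI[of _ R]) auto
qed

lemma c1c_parts:
  assumes "c1c F DF" "c1c H DH"
  shows "(\<integral>x. (DF x \<bullet> h) * H x \<partial>lborel) = - (\<integral>x. F x * (DH x \<bullet> h) \<partial>lborel)"
proof -
  obtain R where R: "R > 0" "\<And>x. norm x > R \<Longrightarrow> F x = 0 \<and> DF x = 0" using assms(1) by (auto simp: c1c_def)
  have c: "continuous_on UNIV DF" "continuous_on UNIV DH" "continuous_on UNIV F" "continuous_on UNIV H"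
    using assms c1c_cont by (auto simp: c1c_def)
  have i1: "integrable lborel (\<lambda>x. (DF x \<bullet> h) * H x)"
    by (rule integrable_compact_support[of _ R]) (use R c in \<open>auto intro!: continuous_intros\<close>)
  have i2: "integrable lborel (\<lambda>x. F x * (DH x \<bullet> h))"
    by (rule integrable_compact_support[of _ R]) (use R c in \<open>auto intro!: continuous_intros\<close>)
  have "0 = (\<integral>x. (DF x \<bullet> h) * H x + F x * (DH x \<bullet> h) \<partial>lborel)"
    using c1c_integral_deriv[OF c1c_mult[OF assms], of h] by (simp add: inner_add_left mult.commute)
  also have "\<dots> = (\<integral>x. (DF x \<bullet> h) * H x \<partial>lborel) + (\<integral>x. F x * (DH x \<bullet> h) \<partial>lborel)"
    by (rule Bochner_Integration.integral_add[OF i1 i2])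
  finally show ?thesis by simp
qed

section \<open>A finite-rank Poincare inequality\<close>

text \<open>Cut \<open>h\<close> into \<open>n + 1\<close> equal steps. Cauchy-Schwarz and
  translation invariance bound the left side by the integral of the squared difference quotient with
  step \<open>h / (n + 1)\<close>, and \<open>n\<close> tends to infinity. Integration along
  segments is avoided.\<close>

lemma translate_bound:
  fixes F :: "'a::euclidean_space \<Rightarrow> real"
  assumes c: "c1c F DF"
  shows "(\<integral>x. (F (x + h) - F x)\<^sup>2 \<partial>lborel) \<le> (norm h)\<^sup>2 * (\<integral>x. (norm (DF x))\<^sup>2 \<partial>lborel)"
proof -
  have cD: "continuous_on UNIV DF" using c by (auto simp: c1c_def)
  have cF: "continuous_on UNIV F" by (rule c1c_cont[OF c])
  obtain R where R: "R > 0" "\<And>x. norm x > R \<Longrightarrow> F x = 0 \<and> DF x = 0" using c by (auto simp: c1c_def)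
  have int: "integrable lborel (\<lambda>x. (F (x + u) - F (x + w))\<^sup>2)" for u w
  proof (rule integrable_compact_support[of _ "R + norm u + norm w"])
    show "continuous_on UNIV (\<lambda>x. (F (x + u) - F (x + w))\<^sup>2)"
      by (intro continuous_intros continuous_on_compose2[OF cF]) auto
    fix x :: 'a assume "R + norm u + norm w < norm x"
    moreover have "norm x \<le> norm (x + u) + norm u" "norm x \<le> norm (x + w) + norm w"
      using norm_triangle_ineq4[of "x + u" u] norm_triangle_ineq4[of "x + w" w] by simp_all
    ultimately have "norm (x + u) > R" "norm (x + w) > R"
      using norm_ge_zero[of u] norm_ge_zero[of w] by linarith+
    then show "(F (x + u) - F (x + w))\<^sup>2 = 0" using R(2) by simp
  qed
  have step: "(\<integral>x. (F (x + h) - F x)\<^sup>2 \<partial>lborel)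
     \<le> (\<integral>x. (real (Suc n) * (F (x + (1 / real (Suc n)) *\<^sub>R h) - F x))\<^sup>2 \<partial>lborel)" for n
  proof -
    let ?m = "Suc n"
    define k where "k = (1 / real ?m) *\<^sub>R h"
    have hk: "real ?m *\<^sub>R k = h" by (simp add: k_def)
    have pt: "(F (x + h) - F x)\<^sup>2 \<le> real ?m * (\<Sum>j<?m. (F (x + real (Suc j) *\<^sub>R k) - F (x + real j *\<^sub>R k))\<^sup>2)" for x
    proof -
      have "F (x + h) - F x = (\<Sum>j<?m. F (x + real (Suc j) *\<^sub>R k) - F (x + real j *\<^sub>R k))"
        by (subst sum_lessThan_telescope[of "\<lambda>j. F (x + real j *\<^sub>R k)"]) (simp only: hk, simp)
      then have "(F (x + h) - F x)\<^sup>2 = (\<Sum>j<?m. 1 * (F (x + real (Suc j) *\<^sub>R k) - F (x + real j *\<^sub>R k)))\<^sup>2" by simp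
      also have "\<dots> \<le> (\<Sum>j<?m. 1\<^sup>2) * (\<Sum>j<?m. (F (x + real (Suc j) *\<^sub>R k) - F (x + real j *\<^sub>R k))\<^sup>2)"
        by (rule Cauchy_Schwarz_ineq_sum)
      finally show ?thesis by (simp del: of_nat_Suc)
    qed
    have tr: "(\<integral>x. (F (x + real (Suc j) *\<^sub>R k) - F (x + real j *\<^sub>R k))\<^sup>2 \<partial>lborel) = (\<integral>x. (F (x + k) - F x)\<^sup>2 \<partial>lborel)" for j
    proof -
      have "(\<lambda>x. (F (x + k) - F x)\<^sup>2) \<in> borel_measurable borel"
        by (intro borel_measurable_continuous_onI continuous_intros continuous_on_compose2[OF cF]) auto
      from lborel_integral_translate[OF this, of "real j *\<^sub>R k"]
      show ?thesis by (simp add: scaleR_add_left add_ac)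
    qed
    have "(\<integral>x. (F (x + h) - F x)\<^sup>2 \<partial>lborel)
        \<le> (\<integral>x. real ?m * (\<Sum>j<?m. (F (x + real (Suc j) *\<^sub>R k) - F (x + real j *\<^sub>R k))\<^sup>2) \<partial>lborel)"
      using int[of h 0] by (intro integral_mono pt) (auto intro!: Bochner_Integration.integrable_sum int simp del: of_nat_Suc sum.lessThan_Suc)
    also have "\<dots> = real ?m * (\<Sum>j<?m. (\<integral>x. (F (x + real (Suc j) *\<^sub>R k) - F (x + real j *\<^sub>R k))\<^sup>2 \<partial>lborel))"
      using int by (simp del: of_nat_Suc sum.lessThan_Suc)
    also have "\<dots> = (\<integral>x. (real ?m * (F (x + k) - F x))\<^sup>2 \<partial>lborel)"
      by (simp add: tr power_mult_distrib power2_eq_square[of "real ?m"] del: of_nat_Suc sum.lessThan_Suc)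
    finally show ?thesis by (simp add: k_def)
  qed
  have "(\<integral>x. (F (x + h) - F x)\<^sup>2 \<partial>lborel) \<le> (\<integral>x. (DF x \<bullet> h)\<^sup>2 \<partial>lborel)"
    by (rule LIMSEQ_le_const[OF difference_quotient(2)[OF c, of h]]) (use step in blast)
  also have "\<dots> \<le> (\<integral>x. (norm h)\<^sup>2 * (norm (DF x))\<^sup>2 \<partial>lborel)"
  proof (rule integral_mono)
    show "integrable lborel (\<lambda>x. (DF x \<bullet> h)\<^sup>2)"
      by (rule integrable_compact_support[of _ R]) (use R cD in \<open>auto intro!: continuous_intros\<close>)
    show "integrable lborel (\<lambda>x. (norm h)\<^sup>2 * (norm (DF x))\<^sup>2)"
      by (rule integrable_compact_support[of _ R]) (use R cD in \<open>auto intro!: continuous_intros\<close>)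
    show "(DF x \<bullet> h)\<^sup>2 \<le> (norm h)\<^sup>2 * (norm (DF x))\<^sup>2" for x
      using Cauchy_Schwarz_ineq[of "DF x" h] by (simp add: power2_norm_eq_inner mult.commute)
  qed
  finally show ?thesis by simp
qed

section \<open>Averages over the cells of a grid\<close>

definition cell :: "real \<Rightarrow> ('a::euclidean_space \<Rightarrow> int) \<Rightarrow> 'a set" where
  "cell s k = {x. \<forall>i\<in>Basis. \<lfloor>x \<bullet> i / s\<rfloor> = k i}"

lemma cell_borel [measurable]: "cell s k \<in> sets borel"
  unfolding cell_def by measurable

lemma cell_measure:
  fixes k :: "'a::euclidean_space \<Rightarrow> int"
  assumes s: "0 < s"
  shows "emeasure lborel (cell s k) = ennreal (s ^ DIM('a))"
proof -
  define l :: 'a where "l = (\<Sum>i\<in>Basis. (s * of_int (k i)) *\<^sub>R i)"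
  define u :: 'a where "u = (\<Sum>i\<in>Basis. (s * (of_int (k i) + 1)) *\<^sub>R i)"
  have li: "l \<bullet> i = s * of_int (k i)" and ui: "u \<bullet> i = s * (of_int (k i) + 1)" if "i \<in> Basis" for i
    using that by (simp_all add: l_def u_def)
  have fl: "\<lfloor>x \<bullet> i / s\<rfloor> = k i \<longleftrightarrow> l \<bullet> i \<le> x \<bullet> i \<and> x \<bullet> i < u \<bullet> i" if "i \<in> Basis" for x i
    using s by (simp add: li[OF that] ui[OF that] floor_eq_iff pos_le_divide_eq pos_divide_less_eq mult.commute)
  have "box l u \<subseteq> cell s k" "cell s k \<subseteq> cbox l u"
    by (auto simp: cell_def fl mem_box less_imp_le)
  moreover have le: "l \<bullet> i \<le> u \<bullet> i" if "i \<in> Basis" for i using that s by (simp add: li ui)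
  have prod: "(\<Prod>i\<in>Basis. (u - l) \<bullet> i) = s ^ DIM('a)"
    by (simp add: inner_diff_left li ui algebra_simps)
  have "emeasure lborel (box l u) = ennreal (s ^ DIM('a))"
    using le by (simp add: emeasure_lborel_box prod)
  moreover have "emeasure lborel (cbox l u) = ennreal (s ^ DIM('a))"
    using le by (simp add: emeasure_lborel_cbox prod)
  ultimately show ?thesis
    using emeasure_mono[of "box l u" "cell s k" lborel] emeasure_mono[of "cell s k" "cbox l u" lborel] by simp
qed

text \<open>\<open>2 |C| \<integral>\<^sub>C F\<^sup>2 - 2 (\<integral>\<^sub>C F)\<^sup>2\<close> is the double integral of \<open>(F y - F x)\<^sup>2\<close> over \<open>C \<times> C\<close>.\<close>
lemma cell_mean_identity:
  fixes F :: "'a::euclidean_space \<Rightarrow> real"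
  assumes F: "integrable lborel F" "integrable lborel (\<lambda>x. (F x)\<^sup>2)" and s: "0 < s"
  shows "(\<integral>\<^sup>+x. (\<integral>\<^sup>+y. ennreal (indicator (cell s k) x * indicator (cell s k) y * (F y - F x)\<^sup>2) \<partial>lborel) \<partial>lborel)
     = ennreal (2 * s ^ DIM('a) * (\<integral>x. indicator (cell s k) x * (F x)\<^sup>2 \<partial>lborel) - 2 * (\<integral>x. indicator (cell s k) x * F x \<partial>lborel)\<^sup>2)"
    and "0 \<le> 2 * s ^ DIM('a) * (\<integral>x. indicator (cell s k) x * (F x)\<^sup>2 \<partial>lborel) - 2 * (\<integral>x. indicator (cell s k) x * F x \<partial>lborel)\<^sup>2"
proof -
  let ?C = "cell s k"
  let ?v = "s ^ DIM('a)"
  let ?I1 = "\<integral>x. indicator ?C x * F x \<partial>lborel" and ?I2 = "\<integral>x. indicator ?C x * (F x)\<^sup>2 \<partial>lborel"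
  have [measurable]: "F \<in> borel_measurable borel" using F(1) borel_measurable_integrable by fastforce
  have i0: "integrable lborel (\<lambda>y. indicator ?C y :: real)"
    using cell_measure[OF s, of k] by (simp add: integrable_indicator_iff)
  have v: "measure lborel ?C = ?v"
    using cell_measure[OF s, of k] s by (simp add: measure_def)
  have i1: "integrable lborel (\<lambda>x. indicator ?C x * F x)"
    using integrable_real_mult_indicator[of ?C lborel F] F by (simp add: mult.commute)
  have i2: "integrable lborel (\<lambda>x. indicator ?C x * (F x)\<^sup>2)"
    using integrable_real_mult_indicator[of ?C lborel "\<lambda>x. (F x)\<^sup>2"] F by (simp add: mult.commute)
  have eq: "indicator ?C x * indicator ?C y * (F y - F x)\<^sup>2
     = indicator ?C x * (indicator ?C y * (F y)\<^sup>2) - 2 * (indicator ?C x * F x) * (indicator ?C y * F y)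
       + (indicator ?C x * (F x)\<^sup>2) * indicator ?C y" for x y
    by (simp add: power2_eq_square algebra_simps)
  have inner_int: "integrable lborel (\<lambda>y. indicator ?C x * indicator ?C y * (F y - F x)\<^sup>2)" for x
    unfolding eq using i0 i1 i2 by auto
  have inner: "(\<integral>y. indicator ?C x * indicator ?C y * (F y - F x)\<^sup>2 \<partial>lborel)
     = indicator ?C x * ?I2 - 2 * (indicator ?C x * F x) * ?I1 + (indicator ?C x * (F x)\<^sup>2) * ?v" for x
    unfolding eq using i0 i1 i2 by (simp add: v)
  have out_int: "integrable lborel (\<lambda>x. indicator ?C x * ?I2 - 2 * (indicator ?C x * F x) * ?I1 + (indicator ?C x * (F x)\<^sup>2) * ?v)"
    using i0 i1 i2 by auto
  have nn: "0 \<le> indicator ?C x * ?I2 - 2 * (indicator ?C x * F x) * ?I1 + (indicator ?C x * (F x)\<^sup>2) * ?v" for x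
  proof -
    have "0 \<le> (\<integral>y. indicator ?C x * indicator ?C y * (F y - F x)\<^sup>2 \<partial>lborel)" by (rule Bochner_Integration.integral_nonneg) simp
    then show ?thesis by (simp only: inner)
  qed
  have val: "(\<integral>x. indicator ?C x * ?I2 - 2 * (indicator ?C x * F x) * ?I1 + (indicator ?C x * (F x)\<^sup>2) * ?v \<partial>lborel)
     = 2 * ?v * ?I2 - 2 * ?I1\<^sup>2"
  proof -
    have "(\<integral>x. indicator ?C x * ?I2 - 2 * (indicator ?C x * F x) * ?I1 + (indicator ?C x * (F x)\<^sup>2) * ?v \<partial>lborel)
      = ?v * ?I2 - 2 * ?I1 * ?I1 + ?I2 * ?v"
      using i0 i1 i2 by (simp add: v)
    then show ?thesis by (simp add: power2_eq_square)
  qed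
  have "(\<integral>\<^sup>+x. (\<integral>\<^sup>+y. ennreal (indicator ?C x * indicator ?C y * (F y - F x)\<^sup>2) \<partial>lborel) \<partial>lborel)
     = (\<integral>\<^sup>+x. ennreal (indicator ?C x * ?I2 - 2 * (indicator ?C x * F x) * ?I1 + (indicator ?C x * (F x)\<^sup>2) * ?v) \<partial>lborel)"
    by (intro nn_integral_cong, subst nn_integral_eq_integral[OF inner_int]) (simp_all add: inner)
  also have "\<dots> = ennreal (\<integral>x. indicator ?C x * ?I2 - 2 * (indicator ?C x * F x) * ?I1 + (indicator ?C x * (F x)\<^sup>2) * ?v \<partial>lborel)"
    by (rule nn_integral_eq_integral[OF out_int AE_I2]) (rule nn)
  finally show "(\<integral>\<^sup>+x. (\<integral>\<^sup>+y. ennreal (indicator ?C x * indicator ?C y * (F y - F x)\<^sup>2) \<partial>lborel) \<partial>lborel)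
    = ennreal (2 * ?v * ?I2 - 2 * ?I1\<^sup>2)" unfolding val .
  show "0 \<le> 2 * ?v * ?I2 - 2 * ?I1\<^sup>2"
    unfolding val[symmetric] by (rule Bochner_Integration.integral_nonneg) (rule nn)
qed

lemma nn_integral_translate:
  fixes f :: "'a::euclidean_space \<Rightarrow> ennreal"
  assumes [measurable]: "f \<in> borel_measurable borel"
  shows "(\<integral>\<^sup>+x. f (c + x) \<partial>lborel) = (\<integral>\<^sup>+x. f x \<partial>lborel)"
proof -
  have "(\<integral>\<^sup>+x. f x \<partial>lborel) = (\<integral>\<^sup>+x. f x \<partial>distr lborel borel ((+) c))" by (simp add: lborel_distr_plus)
  also have "\<dots> = (\<integral>\<^sup>+x. f (c + x) \<partial>lborel)" by (intro nn_integral_distr) auto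
  finally show ?thesis by simp
qed

text \<open>Points of the same cell differ by a vector \<open>h\<close> of a cube with side
  \<open>2 * s\<close>. Since the cells are disjoint, the double integrals of
  \<open>cell_mean_identity\<close> add up to at most the integral of
  \<open>(F (x + h) - F x)\<^sup>2\<close> over all \<open>x\<close> and all such \<open>h\<close>;
  \<open>translate_bound\<close> applies for each \<open>h\<close>.\<close>

lemma cell_sum_bound:
  fixes F :: "'a::euclidean_space \<Rightarrow> real"
  assumes c: "c1c F DF" and s: "0 < s" and K: "finite K" "K \<subseteq> extensional Basis"
  shows "(\<Sum>k\<in>K. 2 * s ^ DIM('a) * (\<integral>x. indicator (cell s k) x * (F x)\<^sup>2 \<partial>lborel) - 2 * (\<integral>x. indicator (cell s k) x * F x \<partial>lborel)\<^sup>2)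
     \<le> (2 * s) ^ DIM('a) * (real DIM('a) * s\<^sup>2 * (\<integral>x. (norm (DF x))\<^sup>2 \<partial>lborel))"
proof -
  let ?G = "\<integral>x. (norm (DF x))\<^sup>2 \<partial>lborel"
  let ?B = "cbox (- (s *\<^sub>R One)) (s *\<^sub>R One) :: 'a set"
  have cF: "continuous_on UNIV F" by (rule c1c_cont[OF c])
  have [measurable]: "F \<in> borel_measurable borel" by (rule borel_measurable_continuous_onI[OF cF])
  obtain R where R: "R > 0" "\<And>x. norm x > R \<Longrightarrow> F x = 0 \<and> DF x = 0" using c by (auto simp: c1c_def)
  have i1: "integrable lborel F" by (rule c1c_integrable[OF c])
  have i2: "integrable lborel (\<lambda>x. (F x)\<^sup>2)"
    by (rule integrable_compact_support[of _ R]) (use R cF in \<open>auto intro!: continuous_intros\<close>)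
  define a where "a k = 2 * s ^ DIM('a) * (\<integral>x. indicator (cell s k) x * (F x)\<^sup>2 \<partial>lborel) - 2 * (\<integral>x. indicator (cell s k) x * F x \<partial>lborel)\<^sup>2" for k
  have a: "ennreal (a k) = (\<integral>\<^sup>+x. (\<integral>\<^sup>+y. ennreal (indicator (cell s k) x * indicator (cell s k) y * (F y - F x)\<^sup>2) \<partial>lborel) \<partial>lborel)" for k
    unfolding a_def by (rule cell_mean_identity(1)[OF i1 i2 s, symmetric])
  have G0: "0 \<le> ?G" by simp
  \<comment> \<open>At most one index in \<open>K\<close> has \<open>x\<close> in its cell:
    \<open>x\<close> determines the index on \<open>Basis\<close>, and
    \<open>K \<subseteq> extensional Basis\<close> fixes it elsewhere.\<close>
  have pt: "(\<Sum>k\<in>K. indicator (cell s k) x * indicator (cell s k) y) \<le> (indicator ?B (y - x) :: real)" for x y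
  proof -
    define k0 where "k0 = restrict (\<lambda>i. \<lfloor>x \<bullet> i / s\<rfloor>) Basis"
    have z: "indicator (cell s k) x * indicator (cell s k) y = (0::real)" if "k \<in> K" "k \<noteq> k0" for k
    proof -
      have "x \<notin> cell s k"
      proof
        assume "x \<in> cell s k"
        then have "k = k0" using that(1) K(2) by (auto simp: cell_def k0_def extensional_def fun_eq_iff restrict_def)
        then show False using that(2) by simp
      qed
      then show ?thesis by simp
    qed
    have "(\<Sum>k\<in>K. indicator (cell s k) x * indicator (cell s k) y) = (\<Sum>k\<in>K. if k = k0 then indicator (cell s k0) x * indicator (cell s k0) y else (0::real))"
      by (intro sum.cong refl) (auto simp: z)
    also have "\<dots> \<le> indicator (cell s k0) x * indicator (cell s k0) y" using K(1) by (simp add: sum.delta)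
    also have "\<dots> \<le> indicator ?B (y - x)"
    proof (cases "x \<in> cell s k0 \<and> y \<in> cell s k0")
      case True
      have "y - x \<in> ?B"
        unfolding mem_box
      proof
        fix i :: 'a assume i: "i \<in> Basis"
        have "\<lfloor>x \<bullet> i / s\<rfloor> = \<lfloor>y \<bullet> i / s\<rfloor>" using True i by (simp add: cell_def)
        then have "\<bar>y \<bullet> i / s - x \<bullet> i / s\<bar> \<le> 1" by linarith
        then have "\<bar>(y \<bullet> i - x \<bullet> i) / s\<bar> \<le> 1" by (simp add: diff_divide_distrib)
        then have "\<bar>y \<bullet> i - x \<bullet> i\<bar> \<le> s" using s by (simp add: abs_divide)
        then show "- (s *\<^sub>R One) \<bullet> i \<le> (y - x) \<bullet> i \<and> (y - x) \<bullet> i \<le> s *\<^sub>R One \<bullet> i"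
          using i by (auto simp: inner_diff_left abs_le_iff)
      qed
      then show ?thesis by (simp add: indicator_def)
    qed auto
    finally show ?thesis .
  qed
  have a0: "0 \<le> a k" for k
    unfolding a_def by (rule cell_mean_identity(2)[OF i1 i2 s])
  have "ennreal (\<Sum>k\<in>K. a k) = (\<Sum>k\<in>K. ennreal (a k))" using a0 by (simp add: sum_ennreal)
  also have "\<dots> = (\<integral>\<^sup>+x. (\<integral>\<^sup>+y. (\<Sum>k\<in>K. ennreal (indicator (cell s k) x * indicator (cell s k) y * (F y - F x)\<^sup>2)) \<partial>lborel) \<partial>lborel)"
    unfolding a by (simp add: nn_integral_sum del: sum_ennreal)
  also have "\<dots> \<le> (\<integral>\<^sup>+x. (\<integral>\<^sup>+y. ennreal (indicator ?B (y - x) * (F y - F x)\<^sup>2) \<partial>lborel) \<partial>lborel)"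
  proof (intro nn_integral_mono)
    fix x y
    have "(\<Sum>k\<in>K. ennreal (indicator (cell s k) x * indicator (cell s k) y * (F y - F x)\<^sup>2))
      = ennreal ((\<Sum>k\<in>K. indicator (cell s k) x * indicator (cell s k) y) * (F y - F x)\<^sup>2)"
      by (subst sum_ennreal) (auto simp: sum_distrib_right)
    also have "\<dots> \<le> ennreal (indicator ?B (y - x) * (F y - F x)\<^sup>2)"
      by (intro ennreal_leI mult_right_mono pt) simp
    finally show "(\<Sum>k\<in>K. ennreal (indicator (cell s k) x * indicator (cell s k) y * (F y - F x)\<^sup>2))
      \<le> ennreal (indicator ?B (y - x) * (F y - F x)\<^sup>2)" .
  qed
  also have "\<dots> = (\<integral>\<^sup>+x. (\<integral>\<^sup>+h. ennreal (indicator ?B h * (F (x + h) - F x)\<^sup>2) \<partial>lborel) \<partial>lborel)"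
  proof (rule nn_integral_cong)
    fix x
    have "(\<lambda>y. ennreal (indicator ?B (y - x) * (F y - F x)\<^sup>2)) \<in> borel_measurable borel" by measurable
    from nn_integral_translate[OF this, of x]
    show "(\<integral>\<^sup>+y. ennreal (indicator ?B (y - x) * (F y - F x)\<^sup>2) \<partial>lborel)
        = (\<integral>\<^sup>+h. ennreal (indicator ?B h * (F (x + h) - F x)\<^sup>2) \<partial>lborel)" by simp
  qed
  also have "\<dots> = (\<integral>\<^sup>+h. (\<integral>\<^sup>+x. ennreal (indicator ?B h * (F (x + h) - F x)\<^sup>2) \<partial>lborel) \<partial>lborel)"
    by (rule lborel_pair.Fubini') measurable
  also have "\<dots> \<le> (\<integral>\<^sup>+h. ennreal (real DIM('a) * s\<^sup>2 * ?G) * indicator ?B h \<partial>lborel)"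
  proof (intro nn_integral_mono)
    fix h :: 'a
    show "(\<integral>\<^sup>+x. ennreal (indicator ?B h * (F (x + h) - F x)\<^sup>2) \<partial>lborel) \<le> ennreal (real DIM('a) * s\<^sup>2 * ?G) * indicator ?B h"
    proof (cases "h \<in> ?B")
      case True
      have ii: "integrable lborel (\<lambda>x. (F (x + h) - F x)\<^sup>2)"
      proof (rule integrable_compact_support[of _ "R + norm h"])
        show "continuous_on UNIV (\<lambda>x. (F (x + h) - F x)\<^sup>2)"
          by (intro continuous_intros continuous_on_compose2[OF cF]) auto
        fix x :: 'a assume "R + norm h < norm x"
        moreover have "norm x \<le> norm (x + h) + norm h" using norm_triangle_ineq4[of "x + h" h] by simp
        ultimately have "norm (x + h) > R" "norm x > R" using norm_ge_zero[of h] by linarith+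
        then show "(F (x + h) - F x)\<^sup>2 = 0" using R(2) by simp
      qed
      have "(norm h)\<^sup>2 = (\<Sum>i\<in>Basis. (h \<bullet> i)\<^sup>2)" 
        unfolding power2_norm_eq_inner by (subst euclidean_inner) (simp add: power2_eq_square)
      also have "\<dots> \<le> (\<Sum>i\<in>(Basis::'a set). s\<^sup>2)"
      proof (rule sum_mono)
        fix i :: 'a assume "i \<in> Basis"
        then have "\<bar>h \<bullet> i\<bar> \<le> s" using True by (auto simp: mem_box abs_le_iff)
        then show "(h \<bullet> i)\<^sup>2 \<le> s\<^sup>2" using s by (simp add: abs_le_square_iff[symmetric])
      qed
      finally have hh: "(norm h)\<^sup>2 \<le> real DIM('a) * s\<^sup>2" by simp
      have "(\<integral>\<^sup>+x. ennreal ((F (x + h) - F x)\<^sup>2) \<partial>lborel) = ennreal (\<integral>x. (F (x + h) - F x)\<^sup>2 \<partial>lborel)"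
        by (rule nn_integral_eq_integral[OF ii]) simp
      also have "\<dots> \<le> ennreal (real DIM('a) * s\<^sup>2 * ?G)"
        by (intro ennreal_leI order_trans[OF translate_bound[OF c]] mult_right_mono hh G0)
      finally show ?thesis using True by simp
    qed simp
  qed
  also have "\<dots> = ennreal (real DIM('a) * s\<^sup>2 * ?G) * emeasure lborel ?B"
    by (simp add: nn_integral_cmult_indicator)
  also have "emeasure lborel ?B = ennreal ((2 * s) ^ DIM('a))"
  proof -
    have "emeasure lborel ?B = ennreal (\<Prod>i\<in>(Basis::'a set). (s *\<^sub>R One - (- (s *\<^sub>R One))) \<bullet> i)"
      using s by (intro emeasure_lborel_cbox) auto
    also have "(\<Prod>i\<in>(Basis::'a set). (s *\<^sub>R One - (- (s *\<^sub>R One))) \<bullet> i) = (\<Prod>i\<in>(Basis::'a set). 2 * s)"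
      by (intro prod.cong refl) (simp add: inner_add_left)
    finally show ?thesis by simp
  qed
  also have "ennreal (real DIM('a) * s\<^sup>2 * ?G) * ennreal ((2 * s) ^ DIM('a)) = ennreal ((2 * s) ^ DIM('a) * (real DIM('a) * s\<^sup>2 * ?G))"
    using s G0 by (simp add: ennreal_mult[symmetric] mult.commute)
  finally have "(\<Sum>k\<in>K. a k) \<le> (2 * s) ^ DIM('a) * (real DIM('a) * s\<^sup>2 * ?G)"
    using s G0 by (subst (asm) ennreal_le_iff) auto
  then show ?thesis by (simp add: a_def)
qed

lemma poincare_finite_rank:
  assumes "0 < R" "0 < (\<epsilon>::real)"
  shows "\<exists>(K :: ('a::euclidean_space \<Rightarrow> int) set) s A. finite K \<and> 0 < s \<and> 0 \<le> A \<and>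
    (\<forall>F DF. c1c F DF \<longrightarrow> (\<forall>x. norm x > R \<longrightarrow> F x = 0) \<longrightarrow>
      (\<integral>x. (F x)\<^sup>2 \<partial>lborel) \<le> \<epsilon> * (\<integral>x. (norm (DF x))\<^sup>2 \<partial>lborel)
        + A * (\<Sum>k\<in>K. (\<integral>x. indicator (cell s k) x * F x \<partial>lborel)\<^sup>2))"
proof -
  let ?d = "DIM('a)"
  \<comment> \<open>Dividing \<open>cell_sum_bound\<close> by \<open>2 * s ^ ?d\<close> leaves the
    gradient with the coefficient \<open>2 ^ ?d * real ?d * s\<^sup>2 / 2\<close>; the cell size
    \<open>s\<close> makes this equal to \<epsilon>.\<close>
  define c where "c = (2::real) ^ ?d * real ?d / 2"
  have c: "0 < c" by (simp add: c_def)
  define s where "s = sqrt (\<epsilon> / c)"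
  have s: "0 < s" "c * s\<^sup>2 = \<epsilon>" using assms c by (simp_all add: s_def)
  \<comment> \<open>Cells with indices between \<open>-m\<close> and \<open>m\<close> cover the ball
    of radius \<open>R\<close>, outside of which \<open>F\<close> vanishes.\<close>
  define m where "m = \<lceil>R / s\<rceil> + 1"
  define K where "K = PiE (Basis :: 'a set) (\<lambda>_. {-m..m})"
  have K: "finite K" "K \<subseteq> extensional Basis" by (auto simp: K_def PiE_def[of _ "\<lambda>_. _"] intro: finite_PiE[unfolded PiE_def])
  have main: "(\<integral>x. (F x)\<^sup>2 \<partial>lborel) \<le> \<epsilon> * (\<integral>x. (norm (DF x))\<^sup>2 \<partial>lborel)
        + (1 / s ^ ?d) * (\<Sum>k\<in>K. (\<integral>x. indicator (cell s k) x * F x \<partial>lborel)\<^sup>2)"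
    if F: "c1c F DF" "\<And>x. norm x > R \<Longrightarrow> F x = 0" for F DF
  proof -
    let ?G = "\<integral>x. (norm (DF x))\<^sup>2 \<partial>lborel"
    have cF: "continuous_on UNIV F" by (rule c1c_cont[OF F(1)])
    have i2: "integrable lborel (\<lambda>x. (F x)\<^sup>2)"
      by (rule integrable_compact_support[of _ R]) (use F(2) cF in \<open>auto intro!: continuous_intros\<close>)
    have i3: "integrable lborel (\<lambda>x. indicator (cell s k) x * (F x)\<^sup>2)" for k
      using integrable_real_mult_indicator[of "cell s k" lborel "\<lambda>x. (F x)\<^sup>2"] i2 by (simp add: mult.commute)
    have "(\<integral>x. (F x)\<^sup>2 \<partial>lborel) \<le> (\<integral>x. (\<Sum>k\<in>K. indicator (cell s k) x * (F x)\<^sup>2) \<partial>lborel)"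
    proof (rule integral_mono[OF i2])
      show "integrable lborel (\<lambda>x. \<Sum>k\<in>K. indicator (cell s k) x * (F x)\<^sup>2)" using i3 by auto
      fix x
      show "(F x)\<^sup>2 \<le> (\<Sum>k\<in>K. indicator (cell s k) x * (F x)\<^sup>2)"
      proof (cases "norm x > R")
        case True
        then show ?thesis using F(2)[of x] by simp
      next
        case False
        define k0 where "k0 = restrict (\<lambda>i. \<lfloor>x \<bullet> i / s\<rfloor>) Basis"
        have "\<lfloor>x \<bullet> i / s\<rfloor> \<in> {-m..m}" if i: "i \<in> Basis" for i
        proof -
          have "\<bar>x \<bullet> i\<bar> \<le> R" using Basis_le_norm[OF i, of x] False by linarith
          then have "\<bar>x \<bullet> i / s\<bar> \<le> R / s" using s by (simp add: abs_divide divide_right_mono)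
          then have "- (R / s) \<le> x \<bullet> i / s" "x \<bullet> i / s \<le> R / s" by linarith+
          then show ?thesis unfolding m_def atLeastAtMost_iff by linarith
        qed
        then have "k0 \<in> K" by (auto simp: K_def k0_def)
        moreover have "x \<in> cell s k0" by (simp add: cell_def k0_def)
        ultimately have "(F x)\<^sup>2 = indicator (cell s k0) x * (F x)\<^sup>2" by simp
        also have "\<dots> \<le> (\<Sum>k\<in>K. indicator (cell s k) x * (F x)\<^sup>2)"
          using K(1) \<open>k0 \<in> K\<close> by (intro member_le_sum) auto
        finally show ?thesis .
      qed
    qed
    also have "\<dots> = (\<Sum>k\<in>K. \<integral>x. indicator (cell s k) x * (F x)\<^sup>2 \<partial>lborel)" using i3 by (simp add: Bochner_Integration.integral_sum)
    finally have "2 * s ^ ?d * (\<integral>x. (F x)\<^sup>2 \<partial>lborel) \<le> 2 * s ^ ?d * (\<Sum>k\<in>K. \<integral>x. indicator (cell s k) x * (F x)\<^sup>2 \<partial>lborel)"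
      using s by (intro mult_left_mono) auto
    also have "\<dots> \<le> (2 * s) ^ ?d * (real ?d * s\<^sup>2 * ?G) + 2 * (\<Sum>k\<in>K. (\<integral>x. indicator (cell s k) x * F x \<partial>lborel)\<^sup>2)"
      using cell_sum_bound[OF F(1) s(1) K] by (simp add: sum_subtractf sum_distrib_left)
    also have "(2 * s) ^ ?d * (real ?d * s\<^sup>2 * ?G) = 2 * s ^ ?d * (\<epsilon> * ?G)"
      by (simp add: s(2)[symmetric] c_def power_mult_distrib)
    finally have "s ^ ?d * (\<integral>x. (F x)\<^sup>2 \<partial>lborel) \<le> s ^ ?d * (\<epsilon> * ?G) + (\<Sum>k\<in>K. (\<integral>x. indicator (cell s k) x * F x \<partial>lborel)\<^sup>2)"
      by simp
    then show ?thesis using s(1) by (simp add: field_simps)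
  qed
  show ?thesis
    by (intro exI[of _ K] exI[of _ s] exI[of _ "1 / s ^ ?d"]) (use K s main in auto)
qed

section \<open>The space \<open>H\<^sub>0\<^sup>1\<close>\<close>

text \<open>\<open>smooth_fun\<close> is coinductive: it asks for a set of functions closed under
  partial derivatives. The witness consists of all combinations, with the fixed coefficients
  \<open>r\<close> and \<open>s\<close>, of a member of either set.\<close>

lemma smooth_fun_lincomb:
  assumes "smooth_fun f" "smooth_fun g"
  shows "smooth_fun (\<lambda>x. r * f x + s * g x)"
proof -
  obtain S where S: "f \<in> S" "\<And>g. g \<in> S \<Longrightarrow> continuous_on UNIV g \<and>
        (\<exists>D. (\<forall>x. (g has_derivative (\<lambda>h. D x \<bullet> h)) (at x)) \<and> (\<forall>i\<in>Basis. (\<lambda>x. D x \<bullet> i) \<in> S))"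
    using assms(1) unfolding smooth_fun_def by blast
  obtain T where T: "g \<in> T" "\<And>g. g \<in> T \<Longrightarrow> continuous_on UNIV g \<and>
        (\<exists>D. (\<forall>x. (g has_derivative (\<lambda>h. D x \<bullet> h)) (at x)) \<and> (\<forall>i\<in>Basis. (\<lambda>x. D x \<bullet> i) \<in> T))"
    using assms(2) unfolding smooth_fun_def by blast
  define W where "W = {\<lambda>x. r * p x + s * q x | p q. p \<in> S \<and> q \<in> T}"
  show ?thesis
    unfolding smooth_fun_def
  proof (intro exI[of _ W] conjI ballI)
    show "(\<lambda>x. r * f x + s * g x) \<in> W" using S(1) T(1) by (auto simp: W_def)
    fix w assume "w \<in> W"
    then obtain p q where w: "w = (\<lambda>x. r * p x + s * q x)" "p \<in> S" "q \<in> T" by (auto simp: W_def)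
    obtain P where P: "\<And>x. (p has_derivative (\<lambda>h. P x \<bullet> h)) (at x)" "\<And>i. i \<in> Basis \<Longrightarrow> (\<lambda>x. P x \<bullet> i) \<in> S"
      using S(2)[OF w(2)] by blast
    obtain Q where Q: "\<And>x. (q has_derivative (\<lambda>h. Q x \<bullet> h)) (at x)" "\<And>i. i \<in> Basis \<Longrightarrow> (\<lambda>x. Q x \<bullet> i) \<in> T"
      using T(2)[OF w(3)] by blast
    show "continuous_on UNIV w" using S(2)[OF w(2)] T(2)[OF w(3)] by (auto simp: w(1) intro!: continuous_intros)
    show "\<exists>D. (\<forall>x. (w has_derivative (\<lambda>h. D x \<bullet> h)) (at x)) \<and> (\<forall>i\<in>Basis. (\<lambda>x. D x \<bullet> i) \<in> W)"
    proof (intro exI[of _ "\<lambda>x. r *\<^sub>R P x + s *\<^sub>R Q x"] conjI allI ballI)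
      show "(w has_derivative (\<lambda>h. (r *\<^sub>R P x + s *\<^sub>R Q x) \<bullet> h)) (at x)" for x
        unfolding w(1) inner_add_left inner_scaleR_left
        by (intro has_derivative_add has_derivative_mult_right P Q)
      show "(\<lambda>x. (r *\<^sub>R P x + s *\<^sub>R Q x) \<bullet> i) \<in> W" if "i \<in> Basis" for i
        using P(2)[OF that] Q(2)[OF that] by (auto simp: W_def inner_add_left)
    qed
  qed
qed

lemma inner_zero_fun: "(\<bullet>) 0 = (\<lambda>_. 0)"
  by (simp add: fun_eq_iff)

lemma smooth_fun_zero: "smooth_fun (\<lambda>_. 0)"
  unfolding smooth_fun_def
  by (intro exI[of _ "{\<lambda>_. 0}"]) (auto simp: inner_zero_fun intro!: exI[of _ "\<lambda>_. 0"])

lemma gradient_unique: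
  fixes D D' :: "'a::euclidean_space \<Rightarrow> 'a"
  assumes "(f has_derivative (\<lambda>h. D x \<bullet> h)) (at x)" "(f has_derivative (\<lambda>h. D' x \<bullet> h)) (at x)"
  shows "D x = D' x"
  using has_derivative_unique[OF assms] by (metis euclidean_eqI)

section \<open>Test functions and weak gradients on a bounded domain\<close>

locale bounded_domain =
  fixes \<Omega> :: "'a::euclidean_space set"
  assumes op: "open \<Omega>" and bd: "bounded \<Omega>"
begin

abbreviation "M \<equiv> lebesgue_on \<Omega>"

lemma Om[simp]: "\<Omega> \<inter> space lebesgue \<in> sets lebesgue"
  using op by (auto intro: borel_open sets_completionI_sets)

lemma fin_M: "finite_measure M"
  by (rule finite_measure_lebesgue_on) (use op bd in \<open>auto intro: lmeasurable_open\<close>)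

lemma LINT_eq: "(LINT x:\<Omega>|lebesgue. f x) = integral\<^sup>L M f" for f :: "'a \<Rightarrow> 'b::euclidean_space"
  unfolding set_lebesgue_integral_def by (rule integral_restrict_space[OF Om, symmetric])

lemma set_meas_iff: "set_borel_measurable lebesgue \<Omega> f \<longleftrightarrow> f \<in> borel_measurable M" for f :: "'a \<Rightarrow> 'b::euclidean_space"
  unfolding set_borel_measurable_def by (rule borel_measurable_restrict_space_iff[OF Om, symmetric])

lemma set_int_iff: "set_integrable lebesgue \<Omega> f \<longleftrightarrow> integrable M f" for f :: "'a \<Rightarrow> 'b::euclidean_space"
  unfolding set_integrable_def by (rule integrable_restrict_space[OF Om, symmetric])

lemma AE_iff: "(AE x in lebesgue. x \<in> \<Omega> \<longrightarrow> P x) \<longleftrightarrow> (AE x in M. P x)"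
  by (rule AE_restrict_space_iff[OF Om, symmetric])

lemma L2_iff: "L2_fun \<Omega> u \<longleftrightarrow> sq_int M u"
  by (simp add: L2_fun_def sq_int_def set_meas_iff set_int_iff)

lemma L2v_iff: "L2_vfun \<Omega> g \<longleftrightarrow> sq_int M g"
  by (simp add: L2_vfun_def sq_int_def set_meas_iff set_int_iff)

definition tst :: "('a \<Rightarrow> real) \<Rightarrow> ('a \<Rightarrow> 'a) \<Rightarrow> bool" where
  "tst \<phi> D \<longleftrightarrow> test_fun \<Omega> \<phi> \<and> (\<forall>x. (\<phi> has_derivative (\<lambda>h. D x \<bullet> h)) (at x))"

lemma H01_grad_iff: "H01_grad \<Omega> u g \<longleftrightarrow> sq_int M u \<and> sq_int M g \<and>
   (\<exists>\<phi> D. (\<forall>k. tst (\<phi> k) (D k)) \<and> (\<lambda>k. sqn M (\<lambda>x. \<phi> k x - u x)) \<longlonglongrightarrow> 0 \<and> (\<lambda>k. sqn M (\<lambda>x. D k x - g x)) \<longlonglongrightarrow> 0)"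
  by (simp add: H01_grad_def L2_iff L2v_iff LINT_eq tst_def sqn_def)

text \<open>Off its closed support \<phi> is locally 0, and derivatives are unique.\<close>

lemma tst_deriv_zero:
  assumes "tst \<phi> D" "x \<notin> closure {x. \<phi> x \<noteq> 0}"
  shows "\<phi> x = 0" "D x = 0"
proof -
  show "\<phi> x = 0" using assms(2) closure_subset[of "{x. \<phi> x \<noteq> 0}"] by blast
  have "((\<lambda>_. 0) has_derivative (\<lambda>h. D x \<bullet> h)) (at x)"
  proof (rule has_derivative_transform_within_open)
    show "(\<phi> has_derivative (\<lambda>h. D x \<bullet> h)) (at x)" using assms(1) by (simp add: tst_def)
    show "open (- closure {x. \<phi> x \<noteq> 0})" by auto
    show "x \<in> - closure {x. \<phi> x \<noteq> 0}" using assms(2) by simp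
    show "\<phi> y = 0" if "y \<in> - closure {x. \<phi> x \<noteq> 0}" for y
      using that closure_subset[of "{x. \<phi> x \<noteq> 0}"] by blast
  qed
  moreover have "((\<lambda>_. 0::real) has_derivative (\<lambda>h. 0 \<bullet> h)) (at x)" by (simp add: inner_zero_fun)
  ultimately show "D x = 0" using gradient_unique[of "\<lambda>_. 0" D x "\<lambda>_. 0"] by simp
qed

text \<open>The set that witnesses smoothness of \<phi> contains the partial derivatives and
  witnesses their smoothness too. Hence the gradient of a test function has test functions as
  components and can itself be differentiated, as the integration by parts in
  \<open>H01_grad_zero\<close> demands.\<close>

lemma tst_component:
  assumes "tst \<phi> D" "i \<in> Basis"
  shows "\<exists>D'. tst (\<lambda>x. D x \<bullet> i) D'"
proof -
  obtain S where S: "\<phi> \<in> S" "\<And>g. g \<in> S \<Longrightarrow> continuous_on UNIV g \<and>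
        (\<exists>D. (\<forall>x. (g has_derivative (\<lambda>h. D x \<bullet> h)) (at x)) \<and> (\<forall>i\<in>Basis. (\<lambda>x. D x \<bullet> i) \<in> S))"
    using assms(1) unfolding tst_def test_fun_def smooth_fun_def by blast
  obtain D0 where D0: "\<And>x. (\<phi> has_derivative (\<lambda>h. D0 x \<bullet> h)) (at x)" "\<And>i. i \<in> Basis \<Longrightarrow> (\<lambda>x. D0 x \<bullet> i) \<in> S"
    using S(2)[OF S(1)] by blast
  have "D0 x = D x" for x by (rule gradient_unique[OF D0(1)]) (use assms in \<open>simp add: tst_def\<close>)
  then have "D0 = D" by auto
  then have DS: "(\<lambda>x. D x \<bullet> i) \<in> S" using D0(2) assms(2) by blast
  then have sm: "smooth_fun (\<lambda>x. D x \<bullet> i)" unfolding smooth_fun_def using S(2) by blast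
  have sub: "closure {x. D x \<bullet> i \<noteq> 0} \<subseteq> closure {x. \<phi> x \<noteq> 0}"
    using tst_deriv_zero(2)[OF assms(1)] by (intro closure_minimal) (auto, metis inner_zero_left)
  have "compact (closure {x. \<phi> x \<noteq> 0})" "closure {x. \<phi> x \<noteq> 0} \<subseteq> \<Omega>"
    using assms(1) by (auto simp: tst_def test_fun_def)
  then have "test_fun \<Omega> (\<lambda>x. D x \<bullet> i)"
    unfolding test_fun_def using sm sub compact_Int_closed[of "closure {x. \<phi> x \<noteq> 0}" "closure {x. D x \<bullet> i \<noteq> 0}"]
    by (auto simp: Int_absorb1)
  moreover obtain D' where "\<And>x. ((\<lambda>x. D x \<bullet> i) has_derivative (\<lambda>h. D' x \<bullet> h)) (at x)" using S(2)[OF DS] by blast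
  ultimately show ?thesis unfolding tst_def by blast
qed

lemma tst_c1c:
  assumes "tst \<phi> D"
  shows "c1c \<phi> D"
proof -
  have "continuous_on UNIV D"
  proof -
    have "continuous_on UNIV (\<lambda>x. D x \<bullet> i)" if i: "i \<in> Basis" for i
    proof -
      obtain D' where "tst (\<lambda>x. D x \<bullet> i) D'" using tst_component[OF assms i] by blast
      then have "\<forall>x. ((\<lambda>x. D x \<bullet> i) has_derivative (\<lambda>h. D' x \<bullet> h)) (at x)" by (simp add: tst_def)
      then show ?thesis by (meson has_derivative_continuous continuous_at_imp_continuous_on)
    qed
    then show ?thesis by (subst continuous_on_componentwise) auto
  qed
  moreover have "\<exists>R>0. \<forall>x. norm x > R \<longrightarrow> \<phi> x = 0 \<and> D x = 0"
  proof -
    have "bounded (closure {x. \<phi> x \<noteq> 0})" using assms by (auto simp: tst_def test_fun_def compact_imp_bounded)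
    then obtain R where "R > 0" "\<And>x. x \<in> closure {x. \<phi> x \<noteq> 0} \<Longrightarrow> norm x \<le> R" by (meson bounded_pos)
    then show ?thesis using tst_deriv_zero[OF assms] by (meson not_le)
  qed
  ultimately show ?thesis using assms by (simp add: c1c_def tst_def)
qed

lemma tst_outside: "tst \<phi> D \<Longrightarrow> x \<notin> \<Omega> \<Longrightarrow> \<phi> x = 0 \<and> D x = 0"
  using tst_deriv_zero[of \<phi> D x] by (auto simp: tst_def test_fun_def)

lemma tst_lincomb:
  assumes "tst \<phi> D" "tst \<psi> E"
  shows "tst (\<lambda>x. r * \<phi> x + s * \<psi> x) (\<lambda>x. r *\<^sub>R D x + s *\<^sub>R E x)"
proof -
  let ?c = "\<lambda>f. closure {x. f x \<noteq> (0::real)}"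
  let ?h = "\<lambda>x. r * \<phi> x + s * \<psi> x"
  have c: "compact (?c \<phi> \<union> ?c \<psi>)" "?c \<phi> \<union> ?c \<psi> \<subseteq> \<Omega>"
    using assms by (auto simp: tst_def test_fun_def)
  have sub: "?c ?h \<subseteq> ?c \<phi> \<union> ?c \<psi>"
    unfolding closure_Un[symmetric] by (intro closure_mono) auto
  have "compact (?c ?h)"
    using compact_Int_closed[OF c(1), of "?c ?h"] sub by (simp add: Int_absorb1)
  moreover have "smooth_fun ?h" using assms by (intro smooth_fun_lincomb) (auto simp: tst_def test_fun_def)
  moreover have "(?h has_derivative (\<lambda>h. (r *\<^sub>R D x + s *\<^sub>R E x) \<bullet> h)) (at x)" for x
    unfolding inner_add_left inner_scaleR_left
    by (intro has_derivative_add has_derivative_mult_right) (use assms in \<open>auto simp: tst_def\<close>)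
  ultimately show ?thesis using sub c(2) by (auto simp: tst_def test_fun_def)
qed

lemma tst_zero: "tst (\<lambda>_. 0) (\<lambda>_. 0)"
  by (simp add: tst_def test_fun_def smooth_fun_zero)

lemma integral_M_eq:
  fixes f :: "'a \<Rightarrow> 'b::euclidean_space"
  assumes "f \<in> borel_measurable borel" "\<And>x. x \<notin> \<Omega> \<Longrightarrow> f x = 0"
  shows "integral\<^sup>L M f = integral\<^sup>L lborel f"
proof -
  have "integral\<^sup>L M f = integral\<^sup>L lebesgue (\<lambda>x. indicator \<Omega> x *\<^sub>R f x)" by (rule integral_restrict_space[OF Om])
  also have "(\<lambda>x. indicator \<Omega> x *\<^sub>R f x) = f" using assms(2) by (auto simp: fun_eq_iff indicator_def)
  finally show ?thesis using assms(1) by (simp add: integral_completion)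
qed

lemma cont_meas_M: "continuous_on UNIV f \<Longrightarrow> f \<in> borel_measurable M" for f :: "'a \<Rightarrow> 'b::euclidean_space"
  by (intro measurable_restrict_space1 measurable_completion) (simp add: borel_measurable_continuous_onI)

lemma integrable_M:
  fixes f :: "'a \<Rightarrow> 'b::euclidean_space"
  assumes "integrable lborel f"
  shows "integrable M f"
proof -
  have "integrable lebesgue f" using assms by (subst integrable_completion) auto
  then have "integrable lebesgue (\<lambda>x. indicator \<Omega> x *\<^sub>R f x)"
    by (rule integrable_mult_indicator[rotated]) (use Om in simp)
  then show ?thesis by (subst integrable_restrict_space[OF Om])
qed

lemma tst_sq_int:
  assumes "tst \<phi> D"
  shows "sq_int M \<phi>" "sq_int M D"
proof -
  note c = tst_c1c[OF assms]
  obtain R where R: "R > 0" "\<And>x. norm x > R \<Longrightarrow> \<phi> x = 0 \<and> D x = 0" using c by (auto simp: c1c_def)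
  have cc: "continuous_on UNIV \<phi>" "continuous_on UNIV D" using c c1c_cont by (auto simp: c1c_def)
  show "sq_int M \<phi>" unfolding sq_int_def
    by (intro conjI cont_meas_M cc integrable_M integrable_compact_support[of _ R])
      (use R cc in \<open>auto intro!: continuous_intros\<close>)
  show "sq_int M D" unfolding sq_int_def
    by (intro conjI cont_meas_M cc integrable_M integrable_compact_support[of _ R])
      (use R cc in \<open>auto intro!: continuous_intros\<close>)
qed

lemma H01_grad_lincomb:
  assumes "H01_grad \<Omega> u g" "H01_grad \<Omega> w h"
  shows "H01_grad \<Omega> (\<lambda>x. r * u x + s * w x) (\<lambda>x. r *\<^sub>R g x + s *\<^sub>R h x)"
proof -
  have L: "sq_int M u" "sq_int M g" "sq_int M w" "sq_int M h" using assms by (auto simp: H01_grad_iff)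
  obtain \<phi> D where 1: "\<And>k. tst (\<phi> k) (D k)" "(\<lambda>k. sqn M (\<lambda>x. \<phi> k x - u x)) \<longlonglongrightarrow> 0" "(\<lambda>k. sqn M (\<lambda>x. D k x - g x)) \<longlonglongrightarrow> 0"
    using assms(1) by (auto simp: H01_grad_iff)
  obtain \<psi> E where 2: "\<And>k. tst (\<psi> k) (E k)" "(\<lambda>k. sqn M (\<lambda>x. \<psi> k x - w x)) \<longlonglongrightarrow> 0" "(\<lambda>k. sqn M (\<lambda>x. E k x - h x)) \<longlonglongrightarrow> 0"
    using assms(2) by (auto simp: H01_grad_iff)
  have lim: "(\<lambda>k. sqn M (\<lambda>x. (r *\<^sub>R P k x + s *\<^sub>R Q k x) - (r *\<^sub>R p x + s *\<^sub>R q x))) \<longlonglongrightarrow> 0"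
    if P: "\<And>k. sq_int M (P k)" "\<And>k. sq_int M (Q k)" "sq_int M p" "sq_int M q"
      and l: "(\<lambda>k. sqn M (\<lambda>x. P k x - p x)) \<longlonglongrightarrow> 0" "(\<lambda>k. sqn M (\<lambda>x. Q k x - q x)) \<longlonglongrightarrow> 0"
    for P Q :: "nat \<Rightarrow> 'a \<Rightarrow> 'b::euclidean_space" and p q
  proof (rule tendsto_sandwich[OF _ _ tendsto_const])
    have eq: "(\<lambda>x. (r *\<^sub>R P k x + s *\<^sub>R Q k x) - (r *\<^sub>R p x + s *\<^sub>R q x))
       = (\<lambda>x. r *\<^sub>R (P k x - p x) + s *\<^sub>R (Q k x - q x))" for k by (simp add: algebra_simps)
    show "\<forall>\<^sub>F k in sequentially. sqn M (\<lambda>x. (r *\<^sub>R P k x + s *\<^sub>R Q k x) - (r *\<^sub>R p x + s *\<^sub>R q x))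
       \<le> 2 * (r\<^sup>2 * sqn M (\<lambda>x. P k x - p x)) + 2 * (s\<^sup>2 * sqn M (\<lambda>x. Q k x - q x))"
    proof (rule always_eventually, rule allI)
      fix k
      have a: "sq_int M (\<lambda>x. P k x - p x)" "sq_int M (\<lambda>x. Q k x - q x)"
        by (rule sq_int_diff(1)[OF P(1) P(3)], rule sq_int_diff(1)[OF P(2) P(4)])
      show "sqn M (\<lambda>x. (r *\<^sub>R P k x + s *\<^sub>R Q k x) - (r *\<^sub>R p x + s *\<^sub>R q x))
       \<le> 2 * (r\<^sup>2 * sqn M (\<lambda>x. P k x - p x)) + 2 * (s\<^sup>2 * sqn M (\<lambda>x. Q k x - q x))"
        unfolding eq using sq_int_add(2)[OF sq_int_scale(1)[OF a(1), of r] sq_int_scale(1)[OF a(2), of s]]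
        by (simp add: sq_int_scale(2)[OF a(1)] sq_int_scale(2)[OF a(2)])
    qed
    have "(\<lambda>k. 2 * (r\<^sup>2 * sqn M (\<lambda>x. P k x - p x)) + 2 * (s\<^sup>2 * sqn M (\<lambda>x. Q k x - q x))) \<longlonglongrightarrow> 2 * (r\<^sup>2 * 0) + 2 * (s\<^sup>2 * 0)"
      by (intro tendsto_intros l)
    then show "(\<lambda>k. 2 * (r\<^sup>2 * sqn M (\<lambda>x. P k x - p x)) + 2 * (s\<^sup>2 * sqn M (\<lambda>x. Q k x - q x))) \<longlonglongrightarrow> 0" by simp
  qed (simp add: sqn_nonneg)
  have t: "\<And>k. tst (\<lambda>x. r * \<phi> k x + s * \<psi> k x) (\<lambda>x. r *\<^sub>R D k x + s *\<^sub>R E k x)"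
    by (rule tst_lincomb[OF 1(1) 2(1)])
  have "(\<lambda>k. sqn M (\<lambda>x. (r * \<phi> k x + s * \<psi> k x) - (r * u x + s * w x))) \<longlonglongrightarrow> 0"
    using lim[of \<phi> \<psi> u w] tst_sq_int[OF 1(1)] tst_sq_int[OF 2(1)] L 1 2 by simp
  moreover have "(\<lambda>k. sqn M (\<lambda>x. (r *\<^sub>R D k x + s *\<^sub>R E k x) - (r *\<^sub>R g x + s *\<^sub>R h x))) \<longlonglongrightarrow> 0"
    by (rule lim[of D E g h]) (use tst_sq_int[OF 1(1)] tst_sq_int[OF 2(1)] L 1 2 in auto)
  moreover have "sq_int M (\<lambda>x. r * u x + s * w x)"
    using sq_int_add(1)[OF sq_int_scale(1)[OF L(1), of r] sq_int_scale(1)[OF L(3), of s]] by simp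
  moreover have "sq_int M (\<lambda>x. r *\<^sub>R g x + s *\<^sub>R h x)"
    by (rule sq_int_add(1)[OF sq_int_scale(1)[OF L(2)] sq_int_scale(1)[OF L(4)]])
  ultimately show ?thesis unfolding H01_grad_iff using t
    by (intro conjI exI[of _ "\<lambda>k x. r * \<phi> k x + s * \<psi> k x"] exI[of _ "\<lambda>k x. r *\<^sub>R D k x + s *\<^sub>R E k x"] allI) auto
qed

text \<open>Uniqueness of the weak gradient needs no density of test functions in \<open>L\<^sup>2\<close>: if test
  functions \<open>\<phi> k\<close> tend to 0 and their gradients to \<open>g\<close>, integrate \<open>D (\<phi> k)\<close> by parts against
  \<open>D (\<phi> l)\<close> and let first \<open>k\<close>, then \<open>l\<close> tend to infinity.\<close>
lemma H01_grad_zero: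
  assumes "H01_grad \<Omega> u g" "AE x in M. u x = 0"
  shows "AE x in M. g x = 0"
proof -
  have L: "sq_int M u" "sq_int M g" using assms by (auto simp: H01_grad_iff)
  obtain \<phi> D where t: "\<And>k. tst (\<phi> k) (D k)" and p0: "(\<lambda>k. sqn M (\<lambda>x. \<phi> k x - u x)) \<longlonglongrightarrow> 0"
    and d: "(\<lambda>k. sqn M (\<lambda>x. D k x - g x)) \<longlonglongrightarrow> 0"
    using assms(1) by (auto simp: H01_grad_iff)
  note ts = tst_sq_int[OF t]
  have "sqn M (\<lambda>x. \<phi> k x - u x) = sqn M (\<phi> k)" for k
    by (rule sq_int_cong_AE(2)) (use sq_int_diff(1)[OF ts(1) L(1)] sq_int_meas[OF ts(1)] assms(2) in auto)
  then have p: "(\<lambda>k. sqn M (\<phi> k)) \<longlonglongrightarrow> 0" using p0 by simp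
  have zero_lim: "(\<lambda>k. integral\<^sup>L M (\<lambda>x. P k x \<bullet> Q x)) \<longlonglongrightarrow> 0"
    if "\<And>k. sq_int M (P k)" "sq_int M Q" "(\<lambda>k. sqn M (P k)) \<longlonglongrightarrow> 0"
    for P :: "nat \<Rightarrow> 'a \<Rightarrow> 'b::euclidean_space" and Q
  proof -
    have "(\<lambda>k. (integral\<^sup>L M (\<lambda>x. P k x \<bullet> Q x))\<^sup>2) \<longlonglongrightarrow> 0"
    proof (rule tendsto_sandwich[OF _ _ tendsto_const])
      show "\<forall>\<^sub>F k in sequentially. (integral\<^sup>L M (\<lambda>x. P k x \<bullet> Q x))\<^sup>2 \<le> sqn M (P k) * sqn M Q"
        using sq_int_cs[OF that(1) that(2)] by simp
      show "(\<lambda>k. sqn M (P k) * sqn M Q) \<longlonglongrightarrow> 0" using tendsto_mult_right[OF that(3), of "sqn M Q"] by simp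
    qed simp
    then have "(\<lambda>k. sqrt ((integral\<^sup>L M (\<lambda>x. P k x \<bullet> Q x))\<^sup>2)) \<longlonglongrightarrow> 0" using tendsto_real_sqrt by fastforce
    then show ?thesis by (simp add: tendsto_rabs_zero_iff)
  qed
  have ibp: "integral\<^sup>L M (\<lambda>x. D k x \<bullet> D l x) = - (\<Sum>i\<in>Basis. integral\<^sup>L M (\<lambda>x. \<phi> k x \<bullet> (DD i x \<bullet> i)))"
    if DD: "\<And>i. i \<in> Basis \<Longrightarrow> tst (\<lambda>x. D l x \<bullet> i) (DD i)" for k l DD
  proof -
    have c: "continuous_on UNIV (\<phi> k)" "continuous_on UNIV (D k)" "continuous_on UNIV (D l)"
      using tst_c1c[OF t, of k] tst_c1c[OF t, of l] c1c_cont by (auto simp: c1c_def)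
    have cDD: "continuous_on UNIV (DD i)" if "i \<in> Basis" for i
      using tst_c1c[OF DD[OF that]] by (auto simp: c1c_def)
    have i: "integrable M (\<lambda>x. (D k x \<bullet> i) * (D l x \<bullet> i))" if i: "i \<in> Basis" for i
    proof -
      obtain D' where "tst (\<lambda>x. D k x \<bullet> i) D'" using tst_component[OF t i] by blast
      from sq_int_inner[OF tst_sq_int(1)[OF this] tst_sq_int(1)[OF DD[OF i]]] show ?thesis by simp
    qed
    have "integral\<^sup>L M (\<lambda>x. D k x \<bullet> D l x) = integral\<^sup>L M (\<lambda>x. \<Sum>i\<in>Basis. (D k x \<bullet> i) * (D l x \<bullet> i))"
      by (intro Bochner_Integration.integral_cong refl) (simp add: euclidean_inner[symmetric])
    also have "\<dots> = (\<Sum>i\<in>Basis. integral\<^sup>L M (\<lambda>x. (D k x \<bullet> i) * (D l x \<bullet> i)))"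
      using i by (simp add: Bochner_Integration.integral_sum)
    also have "\<dots> = (\<Sum>i\<in>Basis. - integral\<^sup>L M (\<lambda>x. \<phi> k x \<bullet> (DD i x \<bullet> i)))"
    proof (rule sum.cong[OF refl])
      fix i :: 'a assume i: "i \<in> Basis"
      have "integral\<^sup>L M (\<lambda>x. (D k x \<bullet> i) * (D l x \<bullet> i)) = integral\<^sup>L lborel (\<lambda>x. (D k x \<bullet> i) * (D l x \<bullet> i))"
        using tst_outside[OF t] c by (intro integral_M_eq borel_measurable_continuous_onI continuous_intros) auto
      also have "\<dots> = - integral\<^sup>L lborel (\<lambda>x. \<phi> k x * (DD i x \<bullet> i))"
        by (rule c1c_parts[OF tst_c1c[OF t] tst_c1c[OF DD[OF i]]])
      also have "integral\<^sup>L lborel (\<lambda>x. \<phi> k x * (DD i x \<bullet> i)) = integral\<^sup>L M (\<lambda>x. \<phi> k x * (DD i x \<bullet> i))"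
        using tst_outside[OF t] c cDD[OF i]
        by (intro integral_M_eq[symmetric] borel_measurable_continuous_onI continuous_intros) auto
      finally show "integral\<^sup>L M (\<lambda>x. (D k x \<bullet> i) * (D l x \<bullet> i)) = - integral\<^sup>L M (\<lambda>x. \<phi> k x \<bullet> (DD i x \<bullet> i))" by simp
    qed
    finally show ?thesis by (simp add: sum_negf)
  qed
  have gD: "integral\<^sup>L M (\<lambda>x. g x \<bullet> D l x) = 0" for l
  proof -
    have "\<forall>i\<in>Basis. \<exists>E. tst (\<lambda>x. D l x \<bullet> i) E" using tst_component[OF t] by blast
    then obtain DD where DD: "\<And>i. i \<in> Basis \<Longrightarrow> tst (\<lambda>x. D l x \<bullet> i) (DD i)" by metis
    have sDD: "sq_int M (\<lambda>x. DD i x \<bullet> i)" if i: "i \<in> Basis" for i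
    proof -
      obtain E where "tst (\<lambda>x. DD i x \<bullet> i) E" using tst_component[OF DD[OF i] i] by blast
      then show ?thesis using tst_sq_int by blast
    qed
    have "(\<lambda>k. - (\<Sum>i\<in>Basis. integral\<^sup>L M (\<lambda>x. \<phi> k x \<bullet> (DD i x \<bullet> i)))) \<longlonglongrightarrow> - (\<Sum>i\<in>(Basis::'a set). 0)"
      by (intro tendsto_intros zero_lim ts(1) sDD p)
    then have 1: "(\<lambda>k. integral\<^sup>L M (\<lambda>x. D k x \<bullet> D l x)) \<longlonglongrightarrow> 0" by (simp add: ibp[OF DD])
    have 2: "(\<lambda>k. integral\<^sup>L M (\<lambda>x. (D k x - g x) \<bullet> D l x)) \<longlonglongrightarrow> 0"
      by (rule zero_lim[OF sq_int_diff(1)[OF ts(2) L(2)] ts(2) d])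
    have "integral\<^sup>L M (\<lambda>x. (D k x - g x) \<bullet> D l x) = integral\<^sup>L M (\<lambda>x. D k x \<bullet> D l x) - integral\<^sup>L M (\<lambda>x. g x \<bullet> D l x)" for k
      using sq_int_inner[OF ts(2) ts(2)] sq_int_inner[OF L(2) ts(2)] by (simp add: inner_diff_left)
    then have "(\<lambda>k. integral\<^sup>L M (\<lambda>x. g x \<bullet> D l x)) \<longlonglongrightarrow> 0"
      using tendsto_diff[OF 1 2] by simp
    then show ?thesis by (simp add: LIMSEQ_const_iff)
  qed
  have "sqn M g = 0"
  proof -
    have "integral\<^sup>L M (\<lambda>x. (D l x - g x) \<bullet> g x) = - sqn M g" for l
      using sq_int_inner[OF ts(2) L(2)] sq_int_inner[OF L(2) L(2)] gD[of l]
      by (simp add: inner_diff_left sqn_def power2_norm_eq_inner inner_commute[of "g _" "D l _"])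
    moreover have "(\<lambda>l. integral\<^sup>L M (\<lambda>x. (D l x - g x) \<bullet> g x)) \<longlonglongrightarrow> 0"
      by (rule zero_lim[OF sq_int_diff(1)[OF ts(2) L(2)] L(2) d])
    ultimately show ?thesis by (simp add: LIMSEQ_const_iff)
  qed
  then show ?thesis by (rule sqn_zero_AE[OF L(2)])
qed

lemma H01_grad_unique:
  assumes "H01_grad \<Omega> u g" "H01_grad \<Omega> w h" "AE x in M. u x = w x"
  shows "AE x in M. g x = h x"
  using H01_grad_zero[OF H01_grad_lincomb[OF assms(1,2), of 1 "-1"]] assms(3) by auto

text \<open>Diagonal argument: replace the n-th function by a test function which, with its
  gradient, is within \<open>1 / (n + 1)\<close> in \<open>sqn\<close>.\<close>

lemma H01_grad_closed:
  assumes g: "\<And>n. H01_grad \<Omega> (u n) (g n)" and L: "sq_int M v" "sq_int M h"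
    and l: "(\<lambda>n. sqn M (\<lambda>x. u n x - v x)) \<longlonglongrightarrow> 0" "(\<lambda>n. sqn M (\<lambda>x. g n x - h x)) \<longlonglongrightarrow> 0"
  shows "H01_grad \<Omega> v h"
proof -
  have Lu: "sq_int M (u n)" "sq_int M (g n)" for n using g by (auto simp: H01_grad_iff)
  have "\<exists>\<phi> D. tst \<phi> D \<and> sqn M (\<lambda>x. \<phi> x - u n x) < 1 / real (Suc n) \<and> sqn M (\<lambda>x. D x - g n x) < 1 / real (Suc n)" for n
  proof -
    obtain \<phi> D where t: "\<And>k. tst (\<phi> k) (D k)" and p: "(\<lambda>k. sqn M (\<lambda>x. \<phi> k x - u n x)) \<longlonglongrightarrow> 0"
      and d: "(\<lambda>k. sqn M (\<lambda>x. D k x - g n x)) \<longlonglongrightarrow> 0"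
      using g[of n] by (auto simp: H01_grad_iff)
    have "\<forall>\<^sub>F k in sequentially. sqn M (\<lambda>x. \<phi> k x - u n x) < 1 / real (Suc n) \<and> sqn M (\<lambda>x. D k x - g n x) < 1 / real (Suc n)"
      using order_tendstoD(2)[OF p, of "1 / real (Suc n)"] order_tendstoD(2)[OF d, of "1 / real (Suc n)"]
      by (auto intro: eventually_conj)
    then obtain k where "sqn M (\<lambda>x. \<phi> k x - u n x) < 1 / real (Suc n) \<and> sqn M (\<lambda>x. D k x - g n x) < 1 / real (Suc n)"
      unfolding eventually_sequentially by blast
    then show ?thesis using t by blast
  qed
  then obtain \<phi> D where t: "\<And>n. tst (\<phi> n) (D n)" and p: "\<And>n. sqn M (\<lambda>x. \<phi> n x - u n x) < 1 / real (Suc n)"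
    and d: "\<And>n. sqn M (\<lambda>x. D n x - g n x) < 1 / real (Suc n)" by metis
  have lim: "(\<lambda>n. sqn M (\<lambda>x. P n x - q x)) \<longlonglongrightarrow> 0"
    if P: "\<And>n. sq_int M (P n)" "\<And>n. sq_int M (Q n)" "sq_int M q"
      and s: "\<And>n. sqn M (\<lambda>x. P n x - Q n x) < 1 / real (Suc n)" and l: "(\<lambda>n. sqn M (\<lambda>x. Q n x - q x)) \<longlonglongrightarrow> 0"
    for P Q :: "nat \<Rightarrow> 'a \<Rightarrow> 'b::euclidean_space" and q
  proof (rule tendsto_sandwich[OF _ _ tendsto_const])
    show "\<forall>\<^sub>F n in sequentially. sqn M (\<lambda>x. P n x - q x) \<le> 2 * (1 / real (Suc n)) + 2 * sqn M (\<lambda>x. Q n x - q x)"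
    proof (rule always_eventually, rule allI)
      fix n
      have "sqn M (\<lambda>x. (P n x - Q n x) + (Q n x - q x)) \<le> 2 * sqn M (\<lambda>x. P n x - Q n x) + 2 * sqn M (\<lambda>x. Q n x - q x)"
        by (rule sq_int_add(2)[OF sq_int_diff(1)[OF P(1) P(2)] sq_int_diff(1)[OF P(2) P(3)]])
      then show "sqn M (\<lambda>x. P n x - q x) \<le> 2 * (1 / real (Suc n)) + 2 * sqn M (\<lambda>x. Q n x - q x)"
        using s[of n] by simp
    qed
    have "(\<lambda>n. 2 * (1 / real (Suc n)) + 2 * sqn M (\<lambda>x. Q n x - q x)) \<longlonglongrightarrow> 2 * 0 + 2 * 0"
      by (intro tendsto_intros l LIMSEQ_Suc[OF lim_1_over_n])
    then show "(\<lambda>n. 2 * (1 / real (Suc n)) + 2 * sqn M (\<lambda>x. Q n x - q x)) \<longlonglongrightarrow> 0" by simp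
  qed (simp add: sqn_nonneg)
  have "(\<lambda>n. sqn M (\<lambda>x. \<phi> n x - v x)) \<longlonglongrightarrow> 0"
    by (rule lim[of \<phi> u]) (use tst_sq_int[OF t] Lu L p l in auto)
  moreover have "(\<lambda>n. sqn M (\<lambda>x. D n x - h x)) \<longlonglongrightarrow> 0"
    by (rule lim[of D g]) (use tst_sq_int[OF t] Lu L d l in auto)
  ultimately show ?thesis using L t unfolding H01_grad_iff by blast
qed

lemma H01_grad_null:
  assumes "sq_int M u" "AE x in M. u x = 0"
  shows "H01_grad \<Omega> u (\<lambda>_. 0)"
proof -
  have z: "sq_int M (\<lambda>_. 0::'a)" "sqn M (\<lambda>_. 0::'a) = 0" by (simp_all add: sq_int_def sqn_def)
  have "sqn M (\<lambda>x. 0 - u x) = sqn M (\<lambda>x. 0::real)"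
    by (rule sq_int_cong_AE(2)) (use sq_int_scale(1)[OF assms(1), of "-1"] assms(2) in auto)
  then have "sqn M (\<lambda>x. 0 - u x) = 0" by (simp add: sqn_def)
  then show ?thesis
    unfolding H01_grad_iff using assms z tst_zero
    by (intro conjI exI[of _ "\<lambda>_ _. 0"]) (auto simp: sqn_def)
qed

text \<open>For test functions this is \<open>poincare_finite_rank\<close> on a ball that contains
  the domain. Both sides are continuous under the convergence that defines \<open>H01_grad\<close>,
  the cell integrals being bounded functionals on L^2, so the inequality passes to the
  closure.\<close>

lemma poincare_H01:
  assumes "0 < (\<epsilon>::real)"
  shows "\<exists>(K :: ('a \<Rightarrow> int) set) s A. finite K \<and> 0 < s \<and> 0 \<le> A \<and>
    (\<forall>u g. H01_grad \<Omega> u g \<longrightarrow> sqn M u \<le> \<epsilon> * sqn M g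
        + A * (\<Sum>k\<in>K. (integral\<^sup>L M (\<lambda>x. indicator (cell s k) x * u x))\<^sup>2))"
proof -
  obtain R where R: "0 < R" "\<And>x. x \<in> \<Omega> \<Longrightarrow> norm x \<le> R" using bd by (meson bounded_pos)
  obtain K :: "('a \<Rightarrow> int) set" and s A where K: "finite K" "0 < s" "0 \<le> A" and
    P: "\<And>F DF. c1c F DF \<Longrightarrow> (\<forall>x. norm x > R \<longrightarrow> F x = 0) \<Longrightarrow>
      (\<integral>x. (F x)\<^sup>2 \<partial>lborel) \<le> \<epsilon> * (\<integral>x. (norm (DF x))\<^sup>2 \<partial>lborel)
        + A * (\<Sum>k\<in>K. (\<integral>x. indicator (cell s k) x * F x \<partial>lborel)\<^sup>2)"
    using poincare_finite_rank[OF R(1) assms] by blast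
  have im: "sq_int M (\<lambda>x. indicator (cell s k) x :: real)" for k :: "'a \<Rightarrow> int"
  proof -
    interpret finite_measure M by (rule fin_M)
    have m: "(\<lambda>x. indicator (cell s k) x :: real) \<in> borel_measurable M"
      by (intro measurable_restrict_space1 measurable_completion) measurable
    have "integrable M (\<lambda>x. (norm (indicator (cell s k) x :: real))\<^sup>2)"
      by (rule integrable_const_bound[of _ 1]) (use m in \<open>auto simp: indicator_def\<close>)
    then show ?thesis using m by (simp add: sq_int_def)
  qed
  have T: "sqn M \<phi> \<le> \<epsilon> * sqn M D + A * (\<Sum>k\<in>K. (integral\<^sup>L M (\<lambda>x. indicator (cell s k) x * \<phi> x))\<^sup>2)"
    if t: "tst \<phi> D" for \<phi> D
  proof -
    have c: "continuous_on UNIV \<phi>" "continuous_on UNIV D" using tst_c1c[OF t] c1c_cont by (auto simp: c1c_def)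
    have [measurable]: "\<phi> \<in> borel_measurable borel" "D \<in> borel_measurable borel"
      using c by (auto intro: borel_measurable_continuous_onI)
    have "\<forall>x. norm x > R \<longrightarrow> \<phi> x = 0" using tst_outside[OF t] R(2) by (meson not_le)
    from P[OF tst_c1c[OF t] this] show ?thesis
      using tst_outside[OF t] by (simp add: sqn_def integral_M_eq)
  qed
  have "sqn M u \<le> \<epsilon> * sqn M g + A * (\<Sum>k\<in>K. (integral\<^sup>L M (\<lambda>x. indicator (cell s k) x * u x))\<^sup>2)"
    if H: "H01_grad \<Omega> u g" for u g
  proof -
    have L: "sq_int M u" "sq_int M g" using H by (auto simp: H01_grad_iff)
    obtain \<phi> D where t: "\<And>k. tst (\<phi> k) (D k)" and p: "(\<lambda>k. sqn M (\<lambda>x. \<phi> k x - u x)) \<longlonglongrightarrow> 0"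
      and d: "(\<lambda>k. sqn M (\<lambda>x. D k x - g x)) \<longlonglongrightarrow> 0"
      using H by (auto simp: H01_grad_iff)
    note ts = tst_sq_int[OF t]
    have iplim: "(\<lambda>n. integral\<^sup>L M (\<lambda>x. P n x \<bullet> Q x)) \<longlonglongrightarrow> integral\<^sup>L M (\<lambda>x. q x \<bullet> Q x)"
      if P: "\<And>n. sq_int M (P n)" "sq_int M q" "sq_int M Q" and l: "(\<lambda>n. sqn M (\<lambda>x. P n x - q x)) \<longlonglongrightarrow> 0"
      for P :: "nat \<Rightarrow> 'a \<Rightarrow> 'b::euclidean_space" and q Q
    proof -
      have "(\<lambda>n. (integral\<^sup>L M (\<lambda>x. (P n x - q x) \<bullet> Q x))\<^sup>2) \<longlonglongrightarrow> 0"
      proof (rule tendsto_sandwich[OF _ _ tendsto_const])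
        show "\<forall>\<^sub>F n in sequentially. (integral\<^sup>L M (\<lambda>x. (P n x - q x) \<bullet> Q x))\<^sup>2 \<le> sqn M (\<lambda>x. P n x - q x) * sqn M Q"
          using sq_int_cs[OF sq_int_diff(1)[OF P(1) P(2)] P(3)] by simp
        show "(\<lambda>n. sqn M (\<lambda>x. P n x - q x) * sqn M Q) \<longlonglongrightarrow> 0" using tendsto_mult_right[OF l, of "sqn M Q"] by simp
      qed simp
      then have "(\<lambda>n. sqrt ((integral\<^sup>L M (\<lambda>x. (P n x - q x) \<bullet> Q x))\<^sup>2)) \<longlonglongrightarrow> 0" using tendsto_real_sqrt by fastforce
      then have "(\<lambda>n. integral\<^sup>L M (\<lambda>x. (P n x - q x) \<bullet> Q x)) \<longlonglongrightarrow> 0" by (simp add: tendsto_rabs_zero_iff)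
      moreover have "integral\<^sup>L M (\<lambda>x. (P n x - q x) \<bullet> Q x) = integral\<^sup>L M (\<lambda>x. P n x \<bullet> Q x) - integral\<^sup>L M (\<lambda>x. q x \<bullet> Q x)" for n
        using sq_int_inner[OF P(1,3)] sq_int_inner[OF P(2,3)] by (simp add: inner_diff_left)
      ultimately show ?thesis by (simp add: LIM_zero_iff)
    qed
    have nlim: "(\<lambda>n. sqn M (P n)) \<longlonglongrightarrow> sqn M q"
      if P: "\<And>n. sq_int M (P n)" "sq_int M q" and l: "(\<lambda>n. sqn M (\<lambda>x. P n x - q x)) \<longlonglongrightarrow> 0"
      for P :: "nat \<Rightarrow> 'a \<Rightarrow> 'b::euclidean_space" and q
    proof -
      have "sqn M (P n) = sqn M (\<lambda>x. P n x - q x) + 2 * integral\<^sup>L M (\<lambda>x. P n x \<bullet> q x) - integral\<^sup>L M (\<lambda>x. q x \<bullet> q x)" for n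
      proof -
        have "sqn M (P n) = integral\<^sup>L M (\<lambda>x. (norm (P n x - q x))\<^sup>2 + 2 * (P n x \<bullet> q x) - q x \<bullet> q x)"
          unfolding sqn_def by (intro Bochner_Integration.integral_cong refl)
            (simp add: power2_norm_eq_inner inner_diff inner_commute)
        also have "\<dots> = sqn M (\<lambda>x. P n x - q x) + 2 * integral\<^sup>L M (\<lambda>x. P n x \<bullet> q x) - integral\<^sup>L M (\<lambda>x. q x \<bullet> q x)"
          using sq_int_diff(1)[OF P(1) P(2), of n] sq_int_inner[OF P(1,2), of n] sq_int_inner[OF P(2,2)]
          by (simp add: sqn_def sq_int_def)
        finally show ?thesis .
      qed
      moreover have "(\<lambda>n. sqn M (\<lambda>x. P n x - q x) + 2 * integral\<^sup>L M (\<lambda>x. P n x \<bullet> q x) - integral\<^sup>L M (\<lambda>x. q x \<bullet> q x))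
         \<longlonglongrightarrow> 0 + 2 * integral\<^sup>L M (\<lambda>x. q x \<bullet> q x) - integral\<^sup>L M (\<lambda>x. q x \<bullet> q x)"
        by (intro tendsto_intros l iplim P)
      ultimately show ?thesis by (simp add: sqn_def power2_norm_eq_inner)
    qed
    have cl: "(\<lambda>n. integral\<^sup>L M (\<lambda>x. indicator (cell s k) x * \<phi> n x)) \<longlonglongrightarrow> integral\<^sup>L M (\<lambda>x. indicator (cell s k) x * u x)" for k
      using iplim[OF ts(1) L(1) im p] by (simp add: mult.commute)
    show ?thesis
    proof (rule LIMSEQ_le[OF nlim[OF ts(1) L(1) p]])
      show "(\<lambda>n. \<epsilon> * sqn M (D n) + A * (\<Sum>k\<in>K. (integral\<^sup>L M (\<lambda>x. indicator (cell s k) x * \<phi> n x))\<^sup>2))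
        \<longlonglongrightarrow> \<epsilon> * sqn M g + A * (\<Sum>k\<in>K. (integral\<^sup>L M (\<lambda>x. indicator (cell s k) x * u x))\<^sup>2)"
        by (intro tendsto_intros nlim[OF ts(2) L(2) d] cl)
    qed (use T[OF t] in blast)
  qed
  then show ?thesis using K by blast
qed

end

section \<open>Riesz representation and Rayleigh quotients\<close>

context psd_form
begin

lemma tendsto_form:
  assumes "(\<lambda>n. q (x n - y) (x n - y)) \<longlonglongrightarrow> 0"
  shows "(\<lambda>n. q (x n) z) \<longlonglongrightarrow> q y z" "(\<lambda>n. q (x n) (x n)) \<longlonglongrightarrow> q y y"
proof -
  have l: "(\<lambda>n. q (x n - y) z) \<longlonglongrightarrow> 0" for z
  proof -
    have "(\<lambda>n. (q (x n - y) z)\<^sup>2) \<longlonglongrightarrow> 0"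
    proof (rule tendsto_sandwich[OF _ _ tendsto_const])
      show "\<forall>\<^sub>F n in sequentially. (q (x n - y) z)\<^sup>2 \<le> q (x n - y) (x n - y) * q z z"
        by (simp add: cs)
      show "(\<lambda>n. q (x n - y) (x n - y) * q z z) \<longlonglongrightarrow> 0" using tendsto_mult_right[OF assms, of "q z z"] by simp
    qed simp
    then have "(\<lambda>n. sqrt ((q (x n - y) z)\<^sup>2)) \<longlonglongrightarrow> 0" using tendsto_real_sqrt by fastforce
    then show ?thesis by (simp add: tendsto_rabs_zero_iff)
  qed
  then show "(\<lambda>n. q (x n) z) \<longlonglongrightarrow> q y z" by (simp add: diff_left LIM_zero_iff)
  have "q (x n) (x n) = q (x n - y) (x n - y) + 2 * q (x n - y) y + q y y" for n
    using quad_add[of "x n - y" y] by simp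
  moreover have "(\<lambda>n. q (x n - y) (x n - y) + 2 * q (x n - y) y + q y y) \<longlonglongrightarrow> 0 + 2 * 0 + q y y"
    by (intro tendsto_intros assms l)
  ultimately show "(\<lambda>n. q (x n) (x n)) \<longlonglongrightarrow> q y y" by simp
qed

lemma parallelogram: "q (x - y) (x - y) = 2 * q x x + 2 * q y y - q (x + y) (x + y)"
  by (simp add: quad_add quad_diff)

end

text \<open>First-order condition at a minimum: a small step against the sign of \<open>c\<close>
  would make the expression negative, and \<open>s = - c / (\<bar>d\<bar> + 1)\<close> is small
  enough.\<close>

lemma linear_le_quadratic:
  assumes "\<And>s::real. 0 \<le> 2 * s * c + s\<^sup>2 * d"
  shows "c = 0"
proof (rule ccontr)
  assume c: "c \<noteq> 0"
  define e where "e = \<bar>d\<bar> + 1"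
  have e: "e > 0" "d < e" by (auto simp: e_def)
  have "0 \<le> 2 * (- c / e) * c + (- c / e)\<^sup>2 * d" by (rule assms)
  also have "\<dots> = (c\<^sup>2 / e) * (d / e - 2)" using e by (simp add: power2_eq_square field_simps)
  finally have "0 \<le> (c\<^sup>2 / e) * (d / e - 2)" .
  moreover have "0 < c\<^sup>2 / e" using c e by simp
  ultimately have "0 \<le> d / e - 2" by (meson mult_pos_neg not_le)
  moreover have "d / e < 1" using e by simp
  ultimately show False by simp
qed

text \<open>Bolzano-Weierstrass, one sequence after the other.\<close>

lemma common_convergent_subseq:
  fixes f :: "nat \<Rightarrow> nat \<Rightarrow> real"
  assumes "\<And>i j. i < m \<Longrightarrow> \<bar>f i j\<bar> \<le> B"
  shows "\<exists>r. strict_mono (r :: nat \<Rightarrow> nat) \<and> (\<forall>i<m. convergent (\<lambda>j. f i (r j)))"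
  using assms
proof (induction m)
  case 0
  show ?case by (intro exI[of _ id]) (auto simp: strict_mono_def)
next
  case (Suc m)
  then obtain r where r: "strict_mono (r :: nat \<Rightarrow> nat)" "\<And>i. i < m \<Longrightarrow> convergent (\<lambda>j. f i (r j))" by auto
  have "bounded (range (\<lambda>j. f m (r j)))" using Suc.prems[of m] by (auto simp: bounded_iff)
  then obtain l s where s: "strict_mono (s :: nat \<Rightarrow> nat)" "((\<lambda>j. f m (r j)) \<circ> s) \<longlonglongrightarrow> l"
    using bounded_imp_convergent_subsequence by blast
  have "convergent (\<lambda>j. f i ((r \<circ> s) j))" if "i < Suc m" for i
  proof (cases "i = m")
    case True
    then show ?thesis using s(2) by (auto simp: convergent_def o_def)
  next
    case False
    then have "convergent (\<lambda>j. f i (r j))" using r(2) that by simp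
    from convergent_subseq_convergent[OF this s(1)] show ?thesis by (simp add: o_def)
  qed
  then show ?case using strict_mono_o[OF r(1) s(1)] by blast
qed

text \<open>\<open>p\<close> chooses a representative of each class modulo null vectors of
  \<open>a\<close>, so that the solution operator becomes linear and not merely linear up to null
  vectors. \<open>compact\<close> is the finite-rank Poincare inequality: up to finitely many
  functionals, \<open>b\<close> is bounded by an arbitrarily small multiple of
  \<open>a\<close>.\<close>

locale hilbert_pair = a: psd_form a + b: psd_form b for a b :: "'v::real_vector \<Rightarrow> 'v \<Rightarrow> real" +
  fixes p :: "'v \<Rightarrow> 'v" and Cb :: real
  assumes p_add: "p (x + y) = p x + p y" and p_scale: "p (c *\<^sub>R x) = c *\<^sub>R p x"
    and p_idem: "p (p x) = p x" and a_p: "a (p x) y = a x y"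
    and null: "a x x = 0 \<Longrightarrow> p x = 0"
    and Cb: "0 < Cb" and bounded: "b x x \<le> Cb * a x x"
    and complete: "\<And>x :: nat \<Rightarrow> 'v. (\<And>e. e > 0 \<Longrightarrow> \<exists>N. \<forall>i\<ge>N. \<forall>j\<ge>N. a (x i - x j) (x i - x j) < e)
       \<Longrightarrow> \<exists>y. (\<lambda>n. a (x n - y) (x n - y)) \<longlonglongrightarrow> (0::real)"
    and compact: "\<And>\<epsilon>. \<epsilon> > 0 \<Longrightarrow> \<exists>m (f :: nat \<Rightarrow> 'v \<Rightarrow> real) A. 0 \<le> A \<and>
       (\<forall>k<m. (\<forall>x y. f k (x - y) = f k x - f k y) \<and> (\<forall>x. (f k x)\<^sup>2 \<le> A * b x x)) \<and>
       (\<forall>x. b x x \<le> \<epsilon> * a x x + A * (\<Sum>k<m. (f k x)\<^sup>2))"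
begin

lemma p_diff: "p (x - y) = p x - p y"
  using p_add[of "x - y" y] by simp

text \<open>Direct method: \<open>J w = a w w - 2 * b f w\<close> is bounded below because
  \<open>a\<close> dominates \<open>b\<close>, a minimizing sequence is Cauchy, and the first
  variation at its limit is the claim.\<close>

lemma riesz: "\<exists>w. \<forall>v. a w v = b f v"
proof -
  define J where "J w = a w w - 2 * b f w" for w
  have lb: "- (Cb * b f f) \<le> J w" for w
  proof -
    have "\<bar>b f w\<bar> \<le> b.nrm f * b.nrm w" by (rule b.abs_le_nrm)
    moreover have "2 * (b.nrm f * b.nrm w) \<le> Cb * (b.nrm f)\<^sup>2 + (b.nrm w)\<^sup>2 / Cb"
      using sum_squares_bound[of "sqrt Cb * b.nrm f" "b.nrm w / sqrt Cb"] Cb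
      by (simp add: power_mult_distrib power_divide)
    moreover have "(b.nrm w)\<^sup>2 / Cb \<le> a w w" using bounded[of w] Cb by (simp add: b.nrm_sq divide_le_eq mult.commute)
    ultimately show ?thesis unfolding J_def b.nrm_sq by linarith
  qed
  define d where "d = Inf (range J)"
  have bb: "bdd_below (range J)" using lb by (intro bdd_belowI[of _ "- (Cb * b f f)"]) auto
  have dle: "d \<le> J w" for w unfolding d_def by (rule cInf_lower[OF _ bb]) simp
  have "\<exists>w. J w < d + 1 / real (Suc n)" for n
    using cInf_less_iff[of "range J" "d + 1 / real (Suc n)"] bb unfolding d_def by auto
  then obtain w where w: "\<And>n. J (w n) < d + 1 / real (Suc n)" by metis
  \<comment> \<open>The midpoint of two near-minimizers cannot lie below the infimum; the
    parallelogram law turns this into closeness.\<close>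
  have par: "a (w i - w j) (w i - w j) \<le> 2 / real (Suc i) + 2 / real (Suc j)" for i j
  proof -
    have "a (w i - w j) (w i - w j) = 2 * J (w i) + 2 * J (w j) - 4 * J ((1/2) *\<^sub>R (w i + w j))"
      by (simp add: J_def a.parallelogram[of "w i" "w j"] a.quad_scale b.scale_right b.add_right power2_eq_square)
        (simp add: add_divide_distrib)
    also have "\<dots> \<le> 2 * (d + 1 / real (Suc i)) + 2 * (d + 1 / real (Suc j)) - 4 * d"
      using w[of i] w[of j] dle[of "(1/2) *\<^sub>R (w i + w j)"] by argo
    finally show ?thesis by simp
  qed
  have "\<exists>y. (\<lambda>n. a (w n - y) (w n - y)) \<longlonglongrightarrow> 0"
  proof (rule complete)
    fix e :: real assume e: "e > 0"
    obtain N where N: "1 / real (Suc N) < e / 4" using nat_approx_posE[of "e/4"] e by auto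
    show "\<exists>N. \<forall>i\<ge>N. \<forall>j\<ge>N. a (w i - w j) (w i - w j) < e"
    proof (intro exI[of _ N] allI impI)
      fix i j assume "N \<le> i" "N \<le> j"
      then have "1 / real (Suc i) \<le> 1 / real (Suc N)" "1 / real (Suc j) \<le> 1 / real (Suc N)"
        by (auto intro!: divide_left_mono)
      then show "a (w i - w j) (w i - w j) < e" using par[of i j] N by simp
    qed
  qed
  then obtain y where y: "(\<lambda>n. a (w n - y) (w n - y)) \<longlonglongrightarrow> 0" by blast
  have yb: "(\<lambda>n. b (w n - y) (w n - y)) \<longlonglongrightarrow> 0"
  proof (rule tendsto_sandwich[OF _ _ tendsto_const])
    show "\<forall>\<^sub>F n in sequentially. b (w n - y) (w n - y) \<le> Cb * a (w n - y) (w n - y)" by (simp add: bounded)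
    show "(\<lambda>n. Cb * a (w n - y) (w n - y)) \<longlonglongrightarrow> 0" using tendsto_mult_left[OF y, of Cb] by simp
  qed (simp add: b.nonneg)
  have "(\<lambda>n. J (w n)) \<longlonglongrightarrow> J y"
    unfolding J_def b.sym[of f] by (intro tendsto_intros a.tendsto_form[OF y] b.tendsto_form[OF yb])
  moreover have "(\<lambda>n. d + 1 / real (Suc n)) \<longlonglongrightarrow> d + 0" by (intro tendsto_intros LIMSEQ_Suc[OF lim_1_over_n])
  ultimately have "J y \<le> d" using LIMSEQ_le[of "\<lambda>n. J (w n)" "J y" "\<lambda>n. d + 1 / real (Suc n)" "d + 0"] w
    by (auto intro: less_imp_le)
  then have min: "J y \<le> J z" for z using dle[of z] by linarith
  have "a y v - b f v = 0" for v
  proof (rule linear_le_quadratic)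
    fix s :: real
    show "0 \<le> 2 * s * (a y v - b f v) + s\<^sup>2 * a v v"
      using min[of "y + s *\<^sub>R v"]
      by (simp add: J_def a.quad_add a.scale_left a.scale_right power2_eq_square b.add_right b.scale_right algebra_simps)
  qed
  then show ?thesis by (intro exI[of _ y]) simp
qed

text \<open>The weak equation determines its solution up to null vectors only. Applying
  \<open>p\<close> removes this freedom, and linearity follows from \<open>G_eqI\<close>.\<close>

definition "G f = p (SOME w. \<forall>v. a w v = b f v)"

lemma aG: "a (G f) v = b f v"
  using someI_ex[OF riesz[of f]] by (simp add: G_def a_p)

lemma p_G: "p (G f) = G f"
  by (simp add: G_def p_idem)

lemma p_eqI: "(\<And>v. a x v = a y v) \<Longrightarrow> p x = p y"
  using null[of "x - y"] by (simp add: a.diff_left p_diff)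

lemma G_eqI: "(\<And>v. a x v = b f v) \<Longrightarrow> p x = G f"
  using p_eqI[of x "G f"] by (simp add: aG p_G)

lemma G_add: "G (x + y) = G x + G y"
  using G_eqI[of "G x + G y" "x + y"] by (simp add: a.add_left aG b.add_left p_add p_G)

lemma G_scale: "G (c *\<^sub>R x) = c *\<^sub>R G x"
  using G_eqI[of "c *\<^sub>R G x" "c *\<^sub>R x"] by (simp add: a.scale_left aG b.scale_left p_scale p_G)

text \<open>Minimize \<open>a\<close> over the \<open>b\<close>-unit vectors orthogonal to the
  \<open>e i\<close>; \<open>x\<close> shows that the infimum is below \<open>L\<close>. A minimizer
  satisfies the eigenvalue equation against orthogonal test vectors, and testing with the
  \<open>e i\<close> adds nothing because they are eigenvectors. \<open>compact\<close> is what
  produces the minimizer.\<close>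

lemma ex_eigenvector_below:
  fixes e :: "nat \<Rightarrow> 'v" and n :: nat
  assumes on: "\<And>i j. i < n \<Longrightarrow> j < n \<Longrightarrow> b (e i) (e j) = (if i = j then 1 else 0)"
    and eig: "\<And>i v. i < n \<Longrightarrow> a (e i) v = lam i * b (e i) v"
    and x: "\<And>i. i < n \<Longrightarrow> b x (e i) = 0" "a x x < L * b x x"
  shows "\<exists>w \<mu>. \<mu> < L \<and> b w w = 1 \<and> (\<forall>i<n. b w (e i) = 0) \<and> (\<forall>v. a w v = \<mu> * b w v)"
proof -
  define W where "W = {x. \<forall>i<n. b x (e i) = 0}"
  have Wlin: "r *\<^sub>R y + s *\<^sub>R z \<in> W" if "y \<in> W" "z \<in> W" for r s y z
    using that by (simp add: W_def b.add_left b.scale_left)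
  have Wadd: "y + z \<in> W" if "y \<in> W" "z \<in> W" for y z
    using Wlin[OF that, of 1 1] by simp
  define S where "S = {a y y | y. y \<in> W \<and> b y y = 1}"
  have b0: "0 < b x x"
  proof (rule ccontr)
    assume "\<not> 0 < b x x"
    then have "b x x = 0" using b.nonneg[of x] by simp
    then show False using x(2) a.nonneg[of x] by simp
  qed
  define x1 where "x1 = (1 / b.nrm x) *\<^sub>R x"
  have nx: "0 < b.nrm x" "(b.nrm x)\<^sup>2 = b x x" using b0 by (simp_all add: b.nrm_def)
  have x1: "x1 \<in> W" "b x1 x1 = 1" "a x1 x1 < L"
  proof -
    show "x1 \<in> W" using x by (simp add: x1_def W_def b.scale_left)
    show "b x1 x1 = 1" "a x1 x1 < L"
      using x nx b0 by (simp_all add: x1_def b.quad_scale a.quad_scale power_divide divide_less_eq)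
  qed
  then have Sx: "a x1 x1 \<in> S" by (auto simp: S_def)
  have Sb: "bdd_below S" using a.nonneg by (intro bdd_belowI[of _ 0]) (auto simp: S_def)
  define \<mu> where "\<mu> = Inf S"
  have muL: "\<mu> < L" using cInf_lower[OF Sx Sb] x1(3) by (simp add: \<mu>_def)
  have mu0: "0 \<le> \<mu>" unfolding \<mu>_def using Sx a.nonneg by (intro cInf_greatest) (auto simp: S_def)
  have ray: "\<mu> * b y y \<le> a y y" if y: "y \<in> W" for y
  proof (cases "b y y = 0")
    case True
    then show ?thesis using a.nonneg by simp
  next
    case False
    then have ny: "0 < b.nrm y" "(b.nrm y)\<^sup>2 = b y y" using b.nonneg[of y] by (simp_all add: b.nrm_def)
    have "(1 / b.nrm y) *\<^sub>R y \<in> W" using Wlin[OF y y, of "1 / b.nrm y" 0] by simp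
    moreover have "b ((1 / b.nrm y) *\<^sub>R y) ((1 / b.nrm y) *\<^sub>R y) = 1"
      using ny False by (simp add: b.quad_scale power_divide)
    ultimately have "a ((1 / b.nrm y) *\<^sub>R y) ((1 / b.nrm y) *\<^sub>R y) \<in> S" by (auto simp: S_def)
    then have "\<mu> \<le> a ((1 / b.nrm y) *\<^sub>R y) ((1 / b.nrm y) *\<^sub>R y)" unfolding \<mu>_def by (rule cInf_lower[OF _ Sb])
    then have "\<mu> \<le> a y y / b y y" by (simp add: a.quad_scale power_divide ny)
    then show ?thesis using False b.nonneg[of y] by (simp add: le_divide_eq)
  qed
  define q where "q y z = a y z - \<mu> * b y z" for y z
  have "\<exists>u. u \<in> W \<and> b u u = 1 \<and> a u u < \<mu> + 1 / real (Suc k)" for k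
  proof -
    have "\<exists>z\<in>S. z < \<mu> + 1 / real (Suc k)"
      using cInf_less_iff[of S "\<mu> + 1 / real (Suc k)"] Sb Sx unfolding \<mu>_def by auto
    then show ?thesis by (auto simp: S_def)
  qed
  then obtain u where u: "\<And>k. u k \<in> W" "\<And>k. b (u k) (u k) = 1" "\<And>k. a (u k) (u k) < \<mu> + 1 / real (Suc k)" by metis
  \<comment> \<open>A minimizing sequence is Cauchy for \<open>q\<close>. This does not yet control
    \<open>a\<close>, since \<open>q\<close> vanishes on eigenvectors for \<mu>; compactness has to
    supply the missing directions.\<close>
  have par: "q (u i - u j) (u i - u j) \<le> 2 / real (Suc i) + 2 / real (Suc j)" for i j
  proof -
    have "q (u i - u j) (u i - u j) = 2 * q (u i) (u i) + 2 * q (u j) (u j) - q (u i + u j) (u i + u j)"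
      unfolding q_def a.parallelogram b.parallelogram by (simp add: algebra_simps)
    moreover have "0 \<le> q (u i + u j) (u i + u j)" using ray[OF Wadd[OF u(1) u(1)]] by (simp add: q_def)
    moreover have "q (u k) (u k) < 1 / real (Suc k)" for k using u(2,3)[of k] by (simp add: q_def)
    ultimately show ?thesis by (smt (verit, best) add_divide_distrib one_add_one)
  qed
  \<comment> \<open>\<open>\<epsilon> * \<mu> \<le> 1/2\<close> lets the \<open>b\<close> term that
    arises from \<open>a = q + \<mu> b\<close> be absorbed on the left.\<close>
  define \<epsilon> where "\<epsilon> = 1 / (2 * (\<mu> + 1))"
  have eps: "0 < \<epsilon>" "\<epsilon> * \<mu> \<le> 1/2" "\<epsilon> \<le> 1/2" using mu0 by (auto simp: \<epsilon>_def field_simps)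
  obtain m and f :: "nat \<Rightarrow> 'v \<Rightarrow> real" and A where A: "0 \<le> A"
    and f: "\<And>k x y. k < m \<Longrightarrow> f k (x - y) = f k x - f k y" "\<And>k x. k < m \<Longrightarrow> (f k x)\<^sup>2 \<le> A * b x x"
    and poi: "\<And>x. b x x \<le> \<epsilon> * a x x + A * (\<Sum>k<m. (f k x)\<^sup>2)"
    using compact[OF eps(1)] by metis
  have "\<bar>f i (u j)\<bar> \<le> sqrt A" if "i < m" for i j
    using f(2)[OF that, of "u j"] u(2)[of j] by (simp add: real_le_rsqrt)
  from common_convergent_subseq[of m "\<lambda>i j. f i (u j)", OF this]
  obtain r where r: "strict_mono (r :: nat \<Rightarrow> nat)" "\<And>i. i < m \<Longrightarrow> convergent (\<lambda>j. f i (u (r j)))" by auto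
  have bnd: "a (u i - u j) (u i - u j) \<le> (\<mu> + 1) * (2 * (2 / real (Suc i) + 2 / real (Suc j)))
      + 2 * \<mu> * A * (\<Sum>k<m. (f k (u i) - f k (u j))\<^sup>2)" for i j
  proof -
    let ?w = "u i - u j" and ?s = "\<Sum>k<m. (f k (u i) - f k (u j))\<^sup>2" and ?t = "2 / real (Suc i) + 2 / real (Suc j)"
    have t0: "0 \<le> ?t" by simp
    have aw: "a ?w ?w = q ?w ?w + \<mu> * b ?w ?w" by (simp add: q_def)
    have "b ?w ?w \<le> \<epsilon> * a ?w ?w + A * ?s" using poi[of ?w] f(1) by simp
    moreover have "\<epsilon> * a ?w ?w = \<epsilon> * q ?w ?w + (\<epsilon> * \<mu>) * b ?w ?w" by (simp add: aw algebra_simps)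
    moreover have "\<epsilon> * q ?w ?w \<le> \<epsilon> * ?t" using par eps by (intro mult_left_mono) auto
    moreover have "\<epsilon> * ?t \<le> 1/2 * ?t" using eps t0 by (intro mult_right_mono) auto
    moreover have "(\<epsilon> * \<mu>) * b ?w ?w \<le> 1/2 * b ?w ?w" using eps by (intro mult_right_mono b.nonneg) auto
    ultimately have "b ?w ?w \<le> ?t + 2 * (A * ?s)" by argo
    then have "\<mu> * b ?w ?w \<le> \<mu> * (?t + 2 * (A * ?s))" using mu0 by (intro mult_left_mono) auto
    then have "a ?w ?w \<le> ?t + \<mu> * (?t + 2 * (A * ?s))" using par[of i j] aw by linarith
    also have "\<dots> = (\<mu> + 1) * ?t + 2 * \<mu> * A * ?s" by (simp only: algebra_simps)
    also have "(\<mu> + 1) * ?t \<le> (\<mu> + 1) * (2 * ?t)"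
    proof (rule mult_left_mono)
      show "?t \<le> 2 * ?t" using t0 by argo
    qed (use mu0 in simp)
    finally show ?thesis by simp
  qed
  have "\<exists>y. (\<lambda>j. a (u (r j) - y) (u (r j) - y)) \<longlonglongrightarrow> 0"
  proof (rule complete)
    fix \<delta> :: real assume d: "\<delta> > 0"
    have "\<exists>N. \<forall>i\<ge>N. \<forall>j\<ge>N. 2 * \<mu> * A * (\<Sum>k<m. (f k (u (r i)) - f k (u (r j)))\<^sup>2) < \<delta> / 2"
    proof -
      define C where "C = 2 * \<mu> * A * real m + 1"
      have C: "C > 0" using mu0 A by (simp add: C_def add_nonneg_pos)
      have "\<exists>N. \<forall>k<m. \<forall>i\<ge>N. \<forall>j\<ge>N. \<bar>f k (u (r i)) - f k (u (r j))\<bar> < sqrt (\<delta> / (2 * C))"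
      proof -
        have "\<exists>N. \<forall>i\<ge>N. \<forall>j\<ge>N. \<bar>f k (u (r i)) - f k (u (r j))\<bar> < sqrt (\<delta> / (2 * C))" if "k < m" for k
          using convergent_Cauchy[OF r(2)[OF that]] d C unfolding Cauchy_def dist_real_def by (meson divide_pos_pos mult_pos_pos real_sqrt_gt_zero zero_less_numeral)
        then obtain N where N: "\<And>k i j. k < m \<Longrightarrow> N k \<le> i \<Longrightarrow> N k \<le> j \<Longrightarrow> \<bar>f k (u (r i)) - f k (u (r j))\<bar> < sqrt (\<delta> / (2 * C))"
          by metis
        have "N k \<le> (\<Sum>k<m. N k)" if "k < m" for k using that by (intro member_le_sum) auto
        then show ?thesis using N by (intro exI[of _ "\<Sum>k<m. N k"]) (meson order_trans)
      qed
      then obtain N where N: "\<And>k i j. k < m \<Longrightarrow> N \<le> i \<Longrightarrow> N \<le> j \<Longrightarrow> \<bar>f k (u (r i)) - f k (u (r j))\<bar> < sqrt (\<delta> / (2 * C))" by blast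
      have "2 * \<mu> * A * (\<Sum>k<m. (f k (u (r i)) - f k (u (r j)))\<^sup>2) < \<delta> / 2" if ij: "N \<le> i" "N \<le> j" for i j
      proof -
        have "(\<Sum>k<m. (f k (u (r i)) - f k (u (r j)))\<^sup>2) \<le> (\<Sum>k<m. \<delta> / (2 * C))"
        proof (rule sum_mono)
          fix k assume "k \<in> {..<m}"
          then have "\<bar>f k (u (r i)) - f k (u (r j))\<bar> \<le> sqrt (\<delta> / (2 * C))" using N ij by (simp add: less_imp_le)
          then have "\<bar>f k (u (r i)) - f k (u (r j))\<bar>\<^sup>2 \<le> (sqrt (\<delta> / (2 * C)))\<^sup>2" by (intro power_mono) auto
          then show "(f k (u (r i)) - f k (u (r j)))\<^sup>2 \<le> \<delta> / (2 * C)" using d C by simp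
        qed
        then have "2 * \<mu> * A * (\<Sum>k<m. (f k (u (r i)) - f k (u (r j)))\<^sup>2) \<le> 2 * \<mu> * A * (real m * (\<delta> / (2 * C)))"
          using mu0 A by (intro mult_left_mono) auto
        also have "\<dots> = (C - 1) * (\<delta> / (2 * C))" by (simp add: C_def)
        also have "\<dots> < C * (\<delta> / (2 * C))" using d C by (intro mult_strict_right_mono) auto
        also have "\<dots> = \<delta> / 2" using C by simp
        finally show ?thesis .
      qed
      then show ?thesis by blast
    qed
    then obtain N1 where N1: "\<And>i j. N1 \<le> i \<Longrightarrow> N1 \<le> j \<Longrightarrow> 2 * \<mu> * A * (\<Sum>k<m. (f k (u (r i)) - f k (u (r j)))\<^sup>2) < \<delta> / 2" by blast
    obtain N2 where N2: "1 / real (Suc N2) < \<delta> / (16 * (\<mu> + 1))"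
      using nat_approx_posE[of "\<delta> / (16 * (\<mu> + 1))"] d mu0 by auto
    show "\<exists>N. \<forall>i\<ge>N. \<forall>j\<ge>N. a (u (r i) - u (r j)) (u (r i) - u (r j)) < \<delta>"
    proof (intro exI[of _ "max N1 N2"] allI impI)
      fix i j assume ij: "max N1 N2 \<le> i" "max N1 N2 \<le> j"
      have s: "1 / real (Suc (r i)) \<le> 1 / real (Suc N2)" if "N2 \<le> i" for i
        using that seq_suble[OF r(1), of i] by (intro divide_left_mono) auto
      have "2 / real (Suc (r i)) + 2 / real (Suc (r j)) \<le> 4 * (1 / real (Suc N2))"
        using s[of i] s[of j] ij by simp
      also have "\<dots> \<le> 4 * (\<delta> / (16 * (\<mu> + 1)))" using N2 by simp
      finally have "(\<mu> + 1) * (2 * (2 / real (Suc (r i)) + 2 / real (Suc (r j)))) \<le> (\<mu> + 1) * (2 * (4 * (\<delta> / (16 * (\<mu> + 1)))))"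
        using mu0 by (intro mult_left_mono) auto
      also have "\<dots> = \<delta> / 2" using mu0 by (simp add: field_simps)
      finally have h: "(\<mu> + 1) * (2 * (2 / real (Suc (r i)) + 2 / real (Suc (r j)))) \<le> \<delta> / 2" .
      have "2 * \<mu> * A * (\<Sum>k<m. (f k (u (r i)) - f k (u (r j)))\<^sup>2) < \<delta> / 2"
        by (rule N1) (use ij in simp_all)
      then show "a (u (r i) - u (r j)) (u (r i) - u (r j)) < \<delta>"
        using bnd[of "r i" "r j"] h by argo
    qed
  qed
  then obtain y where y: "(\<lambda>j. a (u (r j) - y) (u (r j) - y)) \<longlonglongrightarrow> 0" by blast
  have yb: "(\<lambda>n. b (u (r n) - y) (u (r n) - y)) \<longlonglongrightarrow> 0"
  proof (rule tendsto_sandwich[OF _ _ tendsto_const])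
    show "\<forall>\<^sub>F n in sequentially. b (u (r n) - y) (u (r n) - y) \<le> Cb * a (u (r n) - y) (u (r n) - y)" by (simp add: bounded)
    show "(\<lambda>n. Cb * a (u (r n) - y) (u (r n) - y)) \<longlonglongrightarrow> 0" using tendsto_mult_left[OF y, of Cb] by simp
  qed (simp add: b.nonneg)
  have by1: "b y y = 1" using b.tendsto_form(2)[OF yb] u(2) by (simp add: LIMSEQ_const_iff)
  have yW: "y \<in> W"
    unfolding W_def
  proof (intro CollectI allI impI)
    fix i assume i: "i < n"
    have "b (u (r k)) (e i) = 0" for k using u(1)[of "r k"] i by (simp add: W_def)
    then show "b y (e i) = 0" using b.tendsto_form(1)[OF yb, of "e i"] by (simp add: LIMSEQ_const_iff)
  qed
  have "a y y \<le> \<mu>"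
  proof -
    have "(\<lambda>j. \<mu> + 1 / real (Suc (r j))) \<longlonglongrightarrow> \<mu> + 0"
      using LIMSEQ_subseq_LIMSEQ[OF LIMSEQ_Suc[OF lim_1_over_n] r(1)] by (intro tendsto_intros) (simp add: o_def)
    from LIMSEQ_le[OF a.tendsto_form(2)[OF y] this] show ?thesis
      using less_imp_le[OF u(3)] by simp
  qed
  then have qy: "q y y = 0" using ray[OF yW] by1 by (simp add: q_def)
  have qW: "q y v = 0" if v: "v \<in> W" for v
  proof (rule linear_le_quadratic)
    fix s :: real
    have "0 \<le> q (y + s *\<^sub>R v) (y + s *\<^sub>R v)"
      using ray[OF Wadd[OF yW Wlin[OF v v, of s 0]]] by (simp add: q_def)
    also have "\<dots> = q y y + 2 * s * q y v + s\<^sup>2 * q v v"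
      by (simp add: q_def a.quad_add b.quad_add a.scale_left b.scale_left a.scale_right b.scale_right
        power2_eq_square algebra_simps)
    finally show "0 \<le> 2 * s * q y v + s\<^sup>2 * q v v" using qy by simp
  qed
  \<comment> \<open>On \<open>W\<close> the equation is minimality, on the \<open>e i\<close> both
    sides are 0; \<open>v\<close> is split accordingly.\<close>
  have "a y v = \<mu> * b y v" for v
  proof -
    define z where "z = v - (\<Sum>i<n. b v (e i) *\<^sub>R e i)"
    have zW: "z \<in> W" unfolding W_def z_def using b.orth_expansion(2)[OF on] by simp
    have ye: "b y (e i) = 0" "a y (e i) = 0" if "i < n" for i
      using yW that eig[OF that, of y] b.sym[of y "e i"] a.sym[of y "e i"] by (simp_all add: W_def)
    have v: "v = z + (\<Sum>i<n. b v (e i) *\<^sub>R e i)" by (simp add: z_def)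
    have "a y v = a y z" "b y v = b y z"
      by (subst v, simp add: a.add_right a.sum_right a.scale_right ye) (subst v, simp add: b.add_right b.sum_right b.scale_right ye)
    then show ?thesis using qW[OF zW] by (simp add: q_def)
  qed
  then show ?thesis using muL by1 yW unfolding W_def by blast
qed

end

section \<open>Orthogonal matrices and the largest eigenvalue\<close>

text \<open>A dimension count without dimensions. By \<open>s\<close> each \<open>v j\<close> is
  recovered from the \<open>e k\<close>. The Bessel defects of the \<open>e k\<close> with respect
  to the \<open>v j\<close> are nonnegative and, by exchanging the two sums, total
  \<open>N - N = 0\<close>; so each \<open>e k\<close> is recovered from the
  \<open>v j\<close>.\<close>

lemma (in psd_form) orthonormal_swap:
  fixes e v :: "nat \<Rightarrow> 'v"
  assumes e: "\<And>i j. i < N \<Longrightarrow> j < N \<Longrightarrow> q (e i) (e j) = (if i = j then 1 else 0)"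
    and v: "\<And>i j. i < N \<Longrightarrow> j < N \<Longrightarrow> q (v i) (v j) = (if i = j then 1 else 0)"
    and s: "\<And>j. j < N \<Longrightarrow> (\<Sum>k<N. (q (v j) (e k))\<^sup>2) = 1" and k: "k < N"
  shows "q (e k) y = (\<Sum>j<N. q (e k) (v j) * q y (v j))"
proof (rule parseval_all[OF v])
  have le: "(\<Sum>j<N. (q (e k) (v j))\<^sup>2) \<le> 1" if "k < N" for k
    using bessel[of N v "e k", OF v] e[OF that that] by simp
  have "(\<Sum>k<N. 1 - (\<Sum>j<N. (q (e k) (v j))\<^sup>2)) = real N - (\<Sum>j<N. \<Sum>k<N. (q (v j) (e k))\<^sup>2)"
    by (simp add: sum_subtractf) (subst sum.swap, simp add: sym[of "e _" "v _"])
  also have "\<dots> = 0" by (simp add: s)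
  finally have "\<forall>k\<in>{..<N}. 1 - (\<Sum>j<N. (q (e k) (v j))\<^sup>2) = 0"
    using le by (subst (asm) sum_nonneg_eq_0_iff) auto
  then show "q (e k) (e k) = (\<Sum>j<N. (q (e k) (v j))\<^sup>2)" using k e[OF k k] by simp
qed

text \<open>\<open>orthonormal_swap\<close> for the columns of \<open>Q\<close> and the unit
  vectors: the columns expand in the unit vectors, hence the unit vectors in the columns.\<close>

lemma orthogonal_mat_rows:
  assumes Q: "orthogonal_mat N Q" and ij: "i < N" "j < N"
  shows "(\<Sum>k<N. Q i k * Q j k) = (if i = j then 1 else 0)"
proof -
  define c where "c k = RVec (\<lambda>i. Q i k)" for k
  have c: "dot N (c k) (c l) = (if k = l then 1 else 0)" if "k < N" "l < N" for k l
    using Q that by (simp add: c_def dot_def orthogonal_mat_def idm_def)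
  have "dot N (unitv i) (unitv j) = (\<Sum>k<N. dot N (unitv i) (c k) * dot N (unitv j) (c k))"
  proof (rule dot.orthonormal_swap)
    show "(\<Sum>k<N. (dot N (c j) (unitv k))\<^sup>2) = 1" if "j < N" for j
      using c[OF that that] by (simp add: dot_self)
  qed (use c ij in auto)
  then show ?thesis using ij by (simp add: c_def eq_commute)
qed

section \<open>The largest eigenvalue of a symmetric matrix\<close>

definition qform :: "nat \<Rightarrow> (nat \<Rightarrow> nat \<Rightarrow> real) \<Rightarrow> nat rvec \<Rightarrow> nat rvec \<Rightarrow> real" where
  "qform N A x y = (\<Sum>i<N. \<Sum>j<N. rapp x i * A i j * rapp y j)"

lemma qform_unitv: "i < N \<Longrightarrow> qform N A (unitv i) x = (\<Sum>j<N. A i j * rapp x j)"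
proof -
  assume i: "i < N"
  have "qform N A (unitv i) x = (\<Sum>k<N. if k = i then (\<Sum>j<N. A i j * rapp x j) else 0)"
    unfolding qform_def by (intro sum.cong) auto
  then show ?thesis using i by simp
qed

context
  fixes N :: nat and A :: "nat \<Rightarrow> nat \<Rightarrow> real"
  assumes N: "1 \<le> N" and sy: "\<And>i j. i < N \<Longrightarrow> j < N \<Longrightarrow> A i j = A j i"
begin

lemma qform_sym: "qform N A x y = qform N A y x"
  unfolding qform_def by (subst sum.swap) (intro sum.cong refl, simp add: sy mult_ac)

lemma qform_add: "qform N A (x + y) z = qform N A x z + qform N A y z"
  and qform_scale: "qform N A (c *\<^sub>R x) y = c * qform N A x y"
  by (simp_all add: qform_def algebra_simps sum.distrib sum_distrib_left)

text \<open>\<open>lmax\<close> is a \<open>Max\<close>, which is meaningful only for finite sets.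
  Unit eigenvectors for different eigenvalues are orthonormal, and \<open>N + 1\<close> of them
  would violate Bessel's inequality summed over the \<open>N\<close> unit vectors.\<close>

lemma finite_eigenvalues:
  "finite {\<mu>. \<exists>x. (\<exists>i<N. x i \<noteq> 0) \<and> (\<forall>i<N. (\<Sum>j<N. A i j * x j) = \<mu> * x i)}" (is "finite ?E")
proof (rule ccontr)
  assume "infinite ?E"
  then obtain B where B: "B \<subseteq> ?E" "finite B" "card B = Suc N" using infinite_arbitrarily_large by blast
  obtain h where h: "bij_betw h {0..<Suc N} B" using ex_bij_betw_nat_finite[OF B(2)] B(3) by metis
  have "\<exists>x. dot N x x = 1 \<and> (\<forall>i<N. (\<Sum>j<N. A i j * rapp x j) = h k * rapp x i)" if "k < Suc N" for k
  proof -
    have "h k \<in> B" using h that by (auto simp: bij_betw_def)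
    then have "h k \<in> ?E" using B(1) by blast
    then obtain x where x: "\<exists>i<N. x i \<noteq> 0" "\<And>i. i < N \<Longrightarrow> (\<Sum>j<N. A i j * x j) = h k * x i" by auto
    define s where "s = (\<Sum>i<N. (x i)\<^sup>2)"
    have s: "0 < s" using x(1) unfolding s_def by (auto intro!: sum_pos2)
    show ?thesis
    proof (intro exI[of _ "RVec (\<lambda>i. x i / sqrt s)"] conjI allI impI)
      show "dot N (RVec (\<lambda>i. x i / sqrt s)) (RVec (\<lambda>i. x i / sqrt s)) = 1"
        using s by (simp add: dot_self power_divide sum_divide_distrib[symmetric] s_def[symmetric])
      fix i assume "i < N"
      then show "(\<Sum>j<N. A i j * rapp (RVec (\<lambda>i. x i / sqrt s)) j) = h k * rapp (RVec (\<lambda>i. x i / sqrt s)) i"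
        using x(2) by (simp add: sum_divide_distrib[symmetric])
    qed
  qed
  then obtain w where w: "\<And>k. k < Suc N \<Longrightarrow> dot N (w k) (w k) = 1"
    "\<And>k i. k < Suc N \<Longrightarrow> i < N \<Longrightarrow> (\<Sum>j<N. A i j * rapp (w k) j) = h k * rapp (w k) i" by metis
  have qw: "qform N A x (w k) = h k * dot N x (w k)" if "k < Suc N" for k x
  proof -
    have "qform N A x (w k) = (\<Sum>i<N. rapp x i * (\<Sum>j<N. A i j * rapp (w k) j))"
      by (simp add: qform_def sum_distrib_left mult.assoc)
    also have "\<dots> = (\<Sum>i<N. rapp x i * (h k * rapp (w k) i))"
      using w(2)[OF that] by (intro sum.cong) auto
    finally show ?thesis by (simp add: dot_def sum_distrib_left mult_ac)
  qed
  have on: "dot N (w k) (w l) = (if k = l then 1 else 0)" if k: "k < Suc N" and l: "l < Suc N" for k l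
  proof (cases "k = l")
    case False
    then have "h k \<noteq> h l" using h k l by (auto simp: bij_betw_def inj_on_def)
    moreover have "h k * dot N (w k) (w l) = h l * dot N (w k) (w l)"
      using qw[OF k, of "w l"] qw[OF l, of "w k"] qform_sym[of "w k" "w l"] dot.sym[of N "w k" "w l"] by simp
    ultimately show ?thesis using False by simp
  qed (use w(1)[OF l] in simp)
  have "(\<Sum>i<N. \<Sum>k<Suc N. (dot N (unitv i) (w k))\<^sup>2) \<le> (\<Sum>i<N. 1)"
    using dot.bessel[of "Suc N" N w, OF on] by (intro sum_mono) (metis dot_unitv(1) lessThan_iff rapp_unitv)
  moreover have "(\<Sum>i<N. \<Sum>k<Suc N. (dot N (unitv i) (w k))\<^sup>2) = (\<Sum>k<Suc N. dot N (w k) (w k))"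
    by (subst sum.swap) (simp add: dot_self)
  moreover have "(\<Sum>k<Suc N. dot N (w k) (w k)) = (\<Sum>k<Suc N. 1)" using w(1) by (intro sum.cong) auto
  ultimately show False by simp
qed

text \<open>By compactness the quadratic form attains its maximum \<mu> on the unit sphere at some
  \<open>y\<close>. This \<open>y\<close> is a null vector of the positive semidefinite form
  \<open>\<mu> * dot N x y - qform N A x y\<close>, hence an eigenvector, so \<mu> is one of the
  numbers over which \<open>lmax\<close> maximizes.\<close>

lemma qform_le_lmax: "qform N A x x \<le> lmax N A * dot N x x"
proof -
  define S where "S = {qform N A x x | x. dot N x x = 1}"
  have ne: "qform N A (unitv 0) (unitv 0) \<in> S"
  proof -
    have "dot N (unitv 0) (unitv 0) = 1" using N by simp
    then show ?thesis unfolding S_def by blast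
  qed
  have co: "\<bar>rapp x i\<bar> \<le> 1" if "dot N x x = 1" "i < N" for x i
  proof -
    have "(rapp x i)\<^sup>2 \<le> dot N x x" unfolding dot_self using that(2) by (intro member_le_sum) auto
    then show ?thesis using that(1) by (simp add: abs_square_le_1)
  qed
  have bb: "bdd_above S"
  proof (rule bdd_aboveI)
    fix s assume "s \<in> S"
    then obtain x where x: "s = qform N A x x" "dot N x x = 1" by (auto simp: S_def)
    have "s \<le> (\<Sum>i<N. \<Sum>j<N. \<bar>A i j\<bar>)"
      unfolding x(1) qform_def
    proof (intro sum_mono)
      fix i j assume ij: "i \<in> {..<N}" "j \<in> {..<N}"
      have "\<bar>rapp x i * A i j * rapp x j\<bar> \<le> 1 * \<bar>A i j\<bar> * 1"
        unfolding abs_mult using co[OF x(2)] ij by (intro mult_mono) auto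
      then show "rapp x i * A i j * rapp x j \<le> \<bar>A i j\<bar>" by simp
    qed
    then show "s \<le> (\<Sum>i<N. \<Sum>j<N. \<bar>A i j\<bar>)" .
  qed
  define \<mu> where "\<mu> = Sup S"
  have "\<exists>x. dot N x x = 1 \<and> \<mu> - 1 / real (Suc n) < qform N A x x" for n
  proof -
    have "\<exists>s\<in>S. \<mu> - 1 / real (Suc n) < s"
      unfolding \<mu>_def using less_cSup_iff[OF _ bb, of "Sup S - 1 / real (Suc n)"] ne by auto
    then show ?thesis by (auto simp: S_def)
  qed
  then obtain u where u: "\<And>n. dot N (u n) (u n) = 1" "\<And>n. \<mu> - 1 / real (Suc n) < qform N A (u n) (u n)" by metis
  obtain r where r: "strict_mono (r :: nat \<Rightarrow> nat)" "\<And>i. i < N \<Longrightarrow> convergent (\<lambda>j. rapp (u (r j)) i)"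
    using common_convergent_subseq[of N "\<lambda>i j. rapp (u j) i" 1] co[OF u(1)] by blast
  define y where "y = RVec (\<lambda>i. lim (\<lambda>j. rapp (u (r j)) i))"
  have lim: "(\<lambda>j. rapp (u (r j)) i) \<longlonglongrightarrow> rapp y i" if "i < N" for i
    using r(2)[OF that] by (simp add: y_def convergent_LIMSEQ_iff)
  have "(\<lambda>j. dot N (u (r j)) (u (r j))) \<longlonglongrightarrow> dot N y y"
    unfolding dot_def by (intro tendsto_intros lim) auto
  then have y1: "dot N y y = 1" using u(1) by (simp add: LIMSEQ_const_iff)
  have ql: "(\<lambda>j. qform N A (u (r j)) (u (r j))) \<longlonglongrightarrow> qform N A y y"
    unfolding qform_def by (intro tendsto_intros lim) auto
  have "(\<lambda>j. \<mu> - 1 / real (Suc (r j))) \<longlonglongrightarrow> \<mu> - 0"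
    using LIMSEQ_subseq_LIMSEQ[OF LIMSEQ_Suc[OF lim_1_over_n] r(1)] by (intro tendsto_intros) (simp add: o_def)
  from LIMSEQ_le[OF this ql] have ylo: "\<mu> \<le> qform N A y y" using less_imp_le[OF u(2)] by simp
  have up: "qform N A x x \<le> \<mu> * dot N x x" for x
  proof (cases "dot N x x = 0")
    case True
    then have "rapp x i = 0" if "i < N" for i
      using that by (simp add: dot_self sum_nonneg_eq_0_iff)
    then show ?thesis using True by (simp add: qform_def)
  next
    case False
    then have n: "0 < dot.nrm N x" "(dot.nrm N x)\<^sup>2 = dot N x x" using dot.nonneg[of N x] by (simp_all add: dot.nrm_def)
    let ?z = "(1 / dot.nrm N x) *\<^sub>R x"
    have "dot N ?z ?z = 1" using n False by (simp add: dot.quad_scale power_divide)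
    then have "qform N A ?z ?z \<le> \<mu>" unfolding \<mu>_def by (intro cSup_upper[OF _ bb]) (auto simp: S_def)
    moreover have "qform N A ?z ?z = qform N A x x / dot N x x"
      using qform_sym[of x ?z] n by (simp add: qform_scale power2_eq_square)
    ultimately show ?thesis using False dot.nonneg[of N x] by (simp add: divide_le_eq)
  qed
  interpret psd_form "\<lambda>x y. \<mu> * dot N x y - qform N A x y"
  proof
    show "\<mu> * dot N x y - qform N A x y = \<mu> * dot N y x - qform N A y x" for x y
      by (simp add: qform_sym[of x y] dot.sym[of N x y])
  qed (use up in \<open>auto simp: dot.add_left dot.scale_left qform_add qform_scale algebra_simps\<close>)
  have "\<mu> * dot N y z - qform N A y z = 0" for z
    by (rule null_orth) (use up[of y] ylo y1 in simp)
  then have "(\<Sum>j<N. A i j * rapp y j) = \<mu> * rapp y i" if "i < N" for i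
    using qform_unitv[OF that, of A y] qform_sym[of y "unitv i"] that by (metis dot_unitv(2) eq_iff_diff_eq_0)
  moreover have "\<exists>i<N. rapp y i \<noteq> 0" using y1 unfolding dot_self by (metis (no_types, lifting) lessThan_iff sum.neutral zero_neq_one zero_power2)
  ultimately have "\<mu> \<in> {\<mu>. \<exists>x. (\<exists>i<N. x i \<noteq> 0) \<and> (\<forall>i<N. (\<Sum>j<N. A i j * x j) = \<mu> * x i)}" by blast
  then have "\<mu> \<le> lmax N A" unfolding lmax_def by (intro Max_ge finite_eigenvalues)
  then have "\<mu> * dot N x x \<le> lmax N A * dot N x x" by (intro mult_right_mono dot.nonneg)
  then show ?thesis using up[of x] by linarith
qed

end

text \<open>Extend a basis of \<open>Z\<close> to one of \<open>H\<close>. \<open>g\<close> projects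
  the whole space onto \<open>H\<close>, and \<open>f\<close> kills the basis of \<open>Z\<close>
  and fixes the remaining basis vectors of \<open>H\<close>; their composite is a choice of
  representatives modulo \<open>Z\<close> that is linear.\<close>

lemma ex_representative_map:
  fixes H Z :: "'v::real_vector set"
  assumes H: "subspace H" and Z: "subspace Z" "Z \<subseteq> H"
  shows "\<exists>p. linear p \<and> (\<forall>x. p x \<in> H) \<and> (\<forall>x. p (p x) = p x) \<and> (\<forall>x\<in>Z. p x = 0) \<and> (\<forall>x\<in>H. p x - x \<in> Z)"
proof -
  obtain B0 where B0: "B0 \<subseteq> Z" "independent B0" "Z \<subseteq> span B0" using real_vector.basis_exists[of Z] by metis
  obtain B1 where B1: "B0 \<subseteq> B1" "B1 \<subseteq> H" "independent B1" "H \<subseteq> span B1"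
    using real_vector.maximal_independent_subset_extend[of B0 H] B0 Z by blast
  obtain f where f: "linear f" "\<And>x. x \<in> B1 \<Longrightarrow> f x = (if x \<in> B0 then 0 else x)"
    using linear_independent_extend[OF B1(3), of "\<lambda>x. if x \<in> B0 then 0 else x"] by blast
  obtain g where g: "linear g" "\<And>x. x \<in> span B1 \<Longrightarrow> g x = x" "range g \<subseteq> span B1"
  proof -
    let ?B = "real_vector.extend_basis B1"
    have iB: "independent ?B" "B1 \<subseteq> ?B" "span ?B = UNIV"
      using real_vector.independent_extend_basis[OF B1(3)] real_vector.extend_basis_superset[OF B1(3)]
        real_vector.span_extend_basis[OF B1(3)] by auto
    obtain g where g: "linear g" "\<And>x. x \<in> ?B \<Longrightarrow> g x = (if x \<in> B1 then x else 0)"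
      using linear_independent_extend[OF iB(1), of "\<lambda>x. if x \<in> B1 then x else 0"] by blast
    have 1: "g x = x" if x: "x \<in> span B1" for x
      by (rule linear_eq_on_span[OF g(1) linear_id[unfolded id_def] _ x]) (use g(2) iB(2) in auto)
    have "g x \<in> span B1" for x
    proof -
      have "x \<in> span ?B" using iB(3) by simp
      then show ?thesis
      proof (induction rule: span_induct_alt)
        case base
        then show ?case using g(1) by (simp add: linear_0 span_zero)
      next
        case (step c x y)
        then show ?case using g by (simp add: linear_add linear_scale span_add span_scale span_base span_zero)
      qed
    qed
    then show ?thesis using that g(1) 1 by blast
  qed
  have spB1: "span B1 = H" using B1(2,4) H by (metis span_subspace)
  have spB0: "span B0 = Z" using B0(1,3) Z by (metis span_subspace)
  have fH: "f x \<in> H \<and> f (f x) = f x \<and> f x - x \<in> Z" if "x \<in> span B1" for x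
    using that
  proof (induction rule: span_induct_alt)
    case base
    then show ?case using f(1) H Z by (simp add: linear_0 subspace_0)
  next
    case (step c x y)
    have "f x \<in> H" "f (f x) = f x" "f x - x \<in> Z"
      using f(2)[OF step(1)] B1 B0 step(1) H Z spB0 linear_0[OF f(1)]
      by (auto simp: subspace_0 subspace_neg span_base split: if_splits)
    moreover have "f (c *\<^sub>R x + y) - (c *\<^sub>R x + y) = c *\<^sub>R (f x - x) + (f y - y)"
      by (simp add: linear_add[OF f(1)] linear_scale[OF f(1)] algebra_simps)
    moreover have "c *\<^sub>R (f x - x) + (f y - y) \<in> Z"
      using step Z calculation(3) by (intro subspace_add subspace_scale) auto
    moreover have "f (c *\<^sub>R x + y) \<in> H" "f (f (c *\<^sub>R x + y)) = f (c *\<^sub>R x + y)"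
      using step H calculation(1,2) by (simp_all add: linear_add[OF f(1)] linear_scale[OF f(1)] subspace_add subspace_scale)
    ultimately show ?case by metis
  qed
  have fZ: "f x = 0" if "x \<in> span B0" for x
    using that
  proof (induction rule: span_induct_alt)
    case base
    then show ?case using f(1) by (simp add: linear_0)
  next
    case (step c x y)
    then show ?case using f(2)[of x] B1(1) by (auto simp: linear_add[OF f(1)] linear_scale[OF f(1)])
  qed
  have gH: "g x \<in> span B1" for x using g(3) by blast
  have p: "linear (f \<circ> g)" using linear_compose[OF g(1) f(1)] .
  show ?thesis
  proof (intro exI[of _ "f \<circ> g"] conjI allI ballI p)
    show "(f \<circ> g) x \<in> H" for x using fH[OF gH] by simp
    have "g (f (g x)) = f (g x)" for x using g(2) fH[OF gH] spB1 by simp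
    then show "(f \<circ> g) ((f \<circ> g) x) = (f \<circ> g) x" for x using fH[OF gH] by simp
    show "(f \<circ> g) x = 0" if "x \<in> Z" for x using fZ g(2) that spB0 spB1 Z by auto
    show "(f \<circ> g) x - x \<in> Z" if "x \<in> H" for x using fH[of x] g(2)[of x] that spB1 by auto
  qed
qed

section \<open>The Schroedinger form on \<open>H\<^sub>0\<^sup>1\<close>\<close>

locale schroedinger = bounded_domain \<Omega> for \<Omega> :: "'a::euclidean_space set" +
  fixes V :: "'a \<Rightarrow> real" and c1 c2 c\<Omega> :: real
  assumes V_int: "\<And>u v. H01 \<Omega> u \<Longrightarrow> H01 \<Omega> v \<Longrightarrow> set_integrable lebesgue \<Omega> (\<lambda>x. V x * u x * v x)"
    and c1: "c1 > 0" and c2: "c2 > 0"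
    and coerc: "\<And>u. H01 \<Omega> u \<Longrightarrow>
         c1 * (LINT x:\<Omega>|lebesgue. (norm (wgrad \<Omega> u x))\<^sup>2) \<le> aform \<Omega> V u u \<and>
         aform \<Omega> V u u \<le> c2 * (LINT x:\<Omega>|lebesgue. (norm (wgrad \<Omega> u x))\<^sup>2)"
    and cO: "c\<Omega> > 0"
    and cOmega: "\<And>u. H01 \<Omega> u \<Longrightarrow> sqrt (l2 \<Omega> u u) \<le> c\<Omega> * sqrt (aform \<Omega> V u u)"
begin

lemma wgrad: "H01 \<Omega> u \<Longrightarrow> H01_grad \<Omega> u (wgrad \<Omega> u)"
  using someI_ex[of "H01_grad \<Omega> u"] by (simp add: H01_def wgrad_def)

lemma H01_sq: "H01 \<Omega> u \<Longrightarrow> sq_int M u" "H01 \<Omega> u \<Longrightarrow> sq_int M (wgrad \<Omega> u)"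
  using wgrad by (auto simp: H01_grad_iff)

lemma wgrad_AE: "H01 \<Omega> u \<Longrightarrow> H01_grad \<Omega> w g \<Longrightarrow> AE x in M. u x = w x \<Longrightarrow> AE x in M. wgrad \<Omega> u x = g x"
  by (rule H01_grad_unique[OF wgrad])

lemma H01_lincomb: "H01 \<Omega> u \<Longrightarrow> H01 \<Omega> w \<Longrightarrow> H01 \<Omega> (\<lambda>x. r * u x + s * w x)"
  unfolding H01_def using H01_grad_lincomb by blast

lemma H01_zero: "H01 \<Omega> (\<lambda>_. 0)"
  using H01_grad_null[of "\<lambda>_. 0"] by (auto simp: H01_def sq_int_def)

lemma H01_sum: "(\<And>i. i \<in> I \<Longrightarrow> H01 \<Omega> (f i)) \<Longrightarrow> H01 \<Omega> (\<lambda>x. \<Sum>i\<in>I. f i x * c i)"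
proof (induction I rule: infinite_finite_induct)
  case (insert i I)
  then show ?case using H01_lincomb[of "f i" "\<lambda>x. \<Sum>i\<in>I. f i x * c i" "c i" 1] by (simp add: mult.commute)
qed (simp_all add: H01_zero)

lemma l2_eq: "l2 \<Omega> u w = integral\<^sup>L M (\<lambda>x. u x * w x)"
  by (simp add: l2_def LINT_eq)

lemma l2_int: "H01 \<Omega> u \<Longrightarrow> H01 \<Omega> w \<Longrightarrow> integrable M (\<lambda>x. u x * w x)"
  using sq_int_inner[OF H01_sq(1) H01_sq(1), of u w] by simp

lemma l2_self: "l2 \<Omega> u u = sqn M u"
  by (simp add: l2_eq sqn_def power2_eq_square)

lemma aform_eq: "aform \<Omega> V u w = integral\<^sup>L M (\<lambda>x. wgrad \<Omega> u x \<bullet> wgrad \<Omega> w x + V x * u x * w x)"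
  by (simp add: aform_def LINT_eq)

lemma aform_int:
  assumes "H01 \<Omega> u" "H01 \<Omega> w"
  shows "integrable M (\<lambda>x. wgrad \<Omega> u x \<bullet> wgrad \<Omega> w x)" "integrable M (\<lambda>x. V x * u x * w x)"
  using sq_int_inner[OF H01_sq(2) H01_sq(2), of u w] V_int[of u w] assms by (auto simp: set_int_iff)

lemma l2_sym: "l2 \<Omega> u w = l2 \<Omega> w u"
  by (simp add: l2_eq mult.commute)

lemma aform_sym: "aform \<Omega> V u w = aform \<Omega> V w u"
  by (simp add: aform_eq inner_commute mult_ac)

lemma l2_lincomb:
  assumes "H01 \<Omega> u" "H01 \<Omega> w" "H01 \<Omega> z"
  shows "l2 \<Omega> (\<lambda>x. r * u x + s * w x) z = r * l2 \<Omega> u z + s * l2 \<Omega> w z"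
proof -
  have "l2 \<Omega> (\<lambda>x. r * u x + s * w x) z = integral\<^sup>L M (\<lambda>x. r * (u x * z x) + s * (w x * z x))"
    by (simp add: l2_eq algebra_simps)
  then show ?thesis using l2_int assms by (simp add: l2_eq)
qed

text \<open>\<open>wgrad\<close> is an arbitrary choice among weak gradients and linear only almost
  everywhere, by uniqueness; under the integral this is enough.\<close>

lemma aform_lincomb:
  assumes "H01 \<Omega> u" "H01 \<Omega> w" "H01 \<Omega> z"
  shows "aform \<Omega> V (\<lambda>x. r * u x + s * w x) z = r * aform \<Omega> V u z + s * aform \<Omega> V w z"
proof -
  have g: "AE x in M. wgrad \<Omega> (\<lambda>x. r * u x + s * w x) x = r *\<^sub>R wgrad \<Omega> u x + s *\<^sub>R wgrad \<Omega> w x"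
    by (rule wgrad_AE[OF H01_lincomb H01_grad_lincomb[OF wgrad wgrad]]) (use assms in auto)
  have i: "integrable M (\<lambda>x. r * (wgrad \<Omega> u x \<bullet> wgrad \<Omega> z x + V x * u x * z x) + s * (wgrad \<Omega> w x \<bullet> wgrad \<Omega> z x + V x * w x * z x))"
    using aform_int assms by auto
  have "aform \<Omega> V (\<lambda>x. r * u x + s * w x) z = integral\<^sup>L M (\<lambda>x. r * (wgrad \<Omega> u x \<bullet> wgrad \<Omega> z x + V x * u x * z x) + s * (wgrad \<Omega> w x \<bullet> wgrad \<Omega> z x + V x * w x * z x))"
    unfolding aform_eq
  proof (rule integral_cong_AE)
    show "(\<lambda>x. wgrad \<Omega> (\<lambda>x. r * u x + s * w x) x \<bullet> wgrad \<Omega> z x + V x * (r * u x + s * w x) * z x) \<in> borel_measurable M"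
      using aform_int[OF H01_lincomb[OF assms(1,2), of r s] assms(3)] by (intro borel_measurable_add) auto
    show "AE x in M. wgrad \<Omega> (\<lambda>x. r * u x + s * w x) x \<bullet> wgrad \<Omega> z x + V x * (r * u x + s * w x) * z x
      = r * (wgrad \<Omega> u x \<bullet> wgrad \<Omega> z x + V x * u x * z x) + s * (wgrad \<Omega> w x \<bullet> wgrad \<Omega> z x + V x * w x * z x)"
      using g by eventually_elim (simp add: inner_add_left algebra_simps)
  qed (use i in auto)
  then show ?thesis using aform_int assms by (simp add: aform_eq)
qed

lemma form_cong:
  assumes "H01 \<Omega> u" "H01 \<Omega> w" "H01 \<Omega> z" "AE x in M. u x = w x"
  shows "l2 \<Omega> u z = l2 \<Omega> w z" "aform \<Omega> V u z = aform \<Omega> V w z"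
proof -
  have g: "AE x in M. wgrad \<Omega> u x = wgrad \<Omega> w x" by (rule wgrad_AE[OF assms(1) wgrad[OF assms(2)] assms(4)])
  show "l2 \<Omega> u z = l2 \<Omega> w z" unfolding l2_eq
    by (rule integral_cong_AE) (use l2_int[OF assms(1,3)] l2_int[OF assms(2,3)] assms(4) in auto)
  show "aform \<Omega> V u z = aform \<Omega> V w z" unfolding aform_eq
    by (rule integral_cong_AE)
      (use aform_int[OF assms(1,3)] aform_int[OF assms(2,3)] assms(4) g in \<open>auto intro!: borel_measurable_add\<close>)
qed

lemma aform_bounds:
  assumes "H01 \<Omega> u"
  shows "c1 * sqn M (wgrad \<Omega> u) \<le> aform \<Omega> V u u" "aform \<Omega> V u u \<le> c2 * sqn M (wgrad \<Omega> u)"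
    "0 \<le> aform \<Omega> V u u" "l2 \<Omega> u u \<le> c\<Omega>\<^sup>2 * aform \<Omega> V u u" "0 \<le> l2 \<Omega> u u"
proof -
  show 1: "c1 * sqn M (wgrad \<Omega> u) \<le> aform \<Omega> V u u" "aform \<Omega> V u u \<le> c2 * sqn M (wgrad \<Omega> u)"
    using coerc[OF assms] by (simp_all add: sqn_def LINT_eq)
  have "0 \<le> c1 * sqn M (wgrad \<Omega> u)" using c1 sqn_nonneg by (intro mult_nonneg_nonneg) auto
  then show a: "0 \<le> aform \<Omega> V u u" using 1 by linarith
  show l: "0 \<le> l2 \<Omega> u u" by (simp add: l2_self sqn_nonneg)
  have "(sqrt (l2 \<Omega> u u))\<^sup>2 \<le> (c\<Omega> * sqrt (aform \<Omega> V u u))\<^sup>2" using cOmega[OF assms] l by (intro power_mono) auto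
  then show "l2 \<Omega> u u \<le> c\<Omega>\<^sup>2 * aform \<Omega> V u u" using l a by (simp add: power_mult_distrib)
qed

definition "HH = {x. H01 \<Omega> (rapp x)}"
definition "ZZ = {x. H01 \<Omega> (rapp x) \<and> (AE t in M. rapp x t = 0)}"

lemma rapp_fun: "rapp (r *\<^sub>R x + s *\<^sub>R y) = (\<lambda>t. r * rapp x t + s * rapp y t)"
  by (simp add: fun_eq_iff)

lemma subspace_HH: "subspace HH" and subspace_ZZ: "subspace ZZ" and ZZ_HH: "ZZ \<subseteq> HH"
proof -
  have "rapp (0 :: 'a rvec) = (\<lambda>_. 0)" by (simp add: fun_eq_iff)
  then have 0: "H01 \<Omega> (rapp (0 :: 'a rvec))" by (simp add: H01_zero)
  have 1: "H01 \<Omega> (rapp (x + y))" if "H01 \<Omega> (rapp x)" "H01 \<Omega> (rapp y)" for x y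
    using H01_lincomb[OF that, of 1 1] rapp_fun[of 1 x 1 y] by simp
  have 2: "H01 \<Omega> (rapp (c *\<^sub>R x))" if "H01 \<Omega> (rapp x)" for c x
    using H01_lincomb[OF that that, of c 0] rapp_fun[of c x 0 x] by simp
  note * = 0 1 2
  show "subspace HH" unfolding subspace_def HH_def using * by auto
  show "subspace ZZ" unfolding subspace_def ZZ_def using * by auto
  show "ZZ \<subseteq> HH" by (auto simp: ZZ_def HH_def)
qed

text \<open>Functions in \<open>H\<^sub>0\<^sup>1\<close> are identified with a linear choice of representatives modulo null
  functions, which turns equalities almost everywhere into equalities.\<close>
definition "rep = (SOME p. linear p \<and> (\<forall>x. p x \<in> HH) \<and> (\<forall>x. p (p x) = p x) \<and> (\<forall>x\<in>ZZ. p x = 0) \<and> (\<forall>x\<in>HH. p x - x \<in> ZZ))"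

lemma rep: "linear rep" "rep x \<in> HH" "rep (rep x) = rep x" "x \<in> ZZ \<Longrightarrow> rep x = 0" "x \<in> HH \<Longrightarrow> rep x - x \<in> ZZ"
  using someI_ex[OF ex_representative_map[OF subspace_HH subspace_ZZ ZZ_HH]] unfolding rep_def[symmetric] by auto

lemma rep_H01: "H01 \<Omega> (rapp (rep x))"
  using rep(2)[of x] by (simp add: HH_def)

lemma rep_AE: "H01 \<Omega> (rapp x) \<Longrightarrow> AE t in M. rapp (rep x) t = rapp x t"
  using rep(5)[of x] by (auto simp: HH_def ZZ_def elim!: eventually_mono)

text \<open>Precomposition with \<open>rep\<close> makes the forms total on the vector space of all
  functions, at the price of degeneracy.\<close>

definition "af x y = aform \<Omega> V (rapp (rep x)) (rapp (rep y))"
definition "bf x y = l2 \<Omega> (rapp (rep x)) (rapp (rep y))"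

lemma rapp_rep: "rapp (rep (r *\<^sub>R x + s *\<^sub>R y)) = (\<lambda>t. r * rapp (rep x) t + s * rapp (rep y) t)"
  by (simp add: linear_add[OF rep(1)] linear_scale[OF rep(1)] fun_eq_iff)

sublocale af: psd_form af
proof
  show "af x y = af y x" for x y unfolding af_def by (rule aform_sym)
  show "af (x + y) z = af x z + af y z" for x y z
    using aform_lincomb[OF rep_H01 rep_H01 rep_H01, of 1 x 1 y z] rapp_rep[of 1 x 1 y] by (simp add: af_def)
  show "af (c *\<^sub>R x) z = c * af x z" for c x z
    using aform_lincomb[OF rep_H01 rep_H01 rep_H01, of c x 0 x z] rapp_rep[of c x 0 x] by (simp add: af_def)
  show "0 \<le> af x x" for x unfolding af_def by (rule aform_bounds(3)[OF rep_H01])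
qed

sublocale bf: psd_form bf
proof
  show "bf x y = bf y x" for x y unfolding bf_def by (rule l2_sym)
  show "bf (x + y) z = bf x z + bf y z" for x y z
    using l2_lincomb[OF rep_H01 rep_H01 rep_H01, of 1 x 1 y z] rapp_rep[of 1 x 1 y] by (simp add: bf_def)
  show "bf (c *\<^sub>R x) z = c * bf x z" for c x z
    using l2_lincomb[OF rep_H01 rep_H01 rep_H01, of c x 0 x z] rapp_rep[of c x 0 x] by (simp add: bf_def)
  show "0 \<le> bf x x" for x unfolding bf_def by (rule aform_bounds(5)[OF rep_H01])
qed

lemma forms_RVec:
  assumes "H01 \<Omega> u" "H01 \<Omega> w"
  shows "af (RVec u) (RVec w) = aform \<Omega> V u w" "bf (RVec u) (RVec w) = l2 \<Omega> u w"
proof -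
  have u: "AE t in M. rapp (rep (RVec u)) t = u t" and w: "AE t in M. rapp (rep (RVec w)) t = w t"
    using rep_AE[of "RVec u"] rep_AE[of "RVec w"] assms by simp_all
  show "af (RVec u) (RVec w) = aform \<Omega> V u w"
    using form_cong(2)[OF rep_H01 assms(1) rep_H01 u] form_cong(2)[OF rep_H01 assms(2) assms(1) w]
    by (simp add: af_def aform_sym[of u])
  show "bf (RVec u) (RVec w) = l2 \<Omega> u w"
    using form_cong(1)[OF rep_H01 assms(1) rep_H01 u] form_cong(1)[OF rep_H01 assms(2) assms(1) w]
    by (simp add: bf_def l2_sym[of u])
qed

lemma sqn_grad_le: "H01 \<Omega> u \<Longrightarrow> sqn M (wgrad \<Omega> u) \<le> aform \<Omega> V u u / c1"
  using aform_bounds(1)[of u] c1 by (simp add: field_simps)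

text \<open>A Cauchy sequence for \<open>af\<close> is Cauchy in L^2 by the constant
  \<open>c\<Omega>\<close>, and so are its gradients by \<open>c1\<close>. The limits exist by
  \<open>sq_int_complete\<close>, belong together by \<open>H01_grad_closed\<close>, and the upper
  bound \<open>c2\<close> leads back from gradients to the form.\<close>

lemma af_complete:
  fixes x :: "nat \<Rightarrow> 'a rvec"
  assumes "\<And>e. e > 0 \<Longrightarrow> \<exists>N. \<forall>i\<ge>N. \<forall>j\<ge>N. af (x i - x j) (x i - x j) < e"
  shows "\<exists>y. (\<lambda>n. af (x n - y) (x n - y)) \<longlonglongrightarrow> 0"
proof -
  define u where "u n = rapp (rep (x n))" for n
  have Hu: "H01 \<Omega> (u n)" for n by (simp add: u_def rep_H01)
  have dif: "rapp (rep (x i - x j)) = (\<lambda>t. 1 * u i t + (-1) * u j t)" for i j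
    using rapp_rep[of 1 "x i" "-1" "x j"] by (simp add: u_def)
  have afd: "af (x i - x j) (x i - x j) = aform \<Omega> V (\<lambda>t. 1 * u i t + (-1) * u j t) (\<lambda>t. 1 * u i t + (-1) * u j t)" for i j
    unfolding af_def dif ..
  have Hd: "H01 \<Omega> (\<lambda>t. 1 * u i t + (-1) * u j t)" for i j by (rule H01_lincomb[OF Hu Hu])
  have gd: "AE t in M. wgrad \<Omega> (\<lambda>t. 1 * u i t + (-1) * u j t) t = wgrad \<Omega> (u i) t - wgrad \<Omega> (u j) t" for i j
    using wgrad_AE[OF Hd H01_grad_lincomb[OF wgrad[OF Hu[of i]] wgrad[OF Hu[of j]], where r = 1 and s = "-1"]] by simp
  have sg: "sqn M (\<lambda>t. wgrad \<Omega> (u i) t - wgrad \<Omega> (u j) t) = sqn M (wgrad \<Omega> (\<lambda>t. 1 * u i t + (-1) * u j t))" for i j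
    by (rule sq_int_cong_AE(2)[symmetric])
      (use H01_sq(2)[OF Hd] gd sq_int_meas[OF sq_int_diff(1)[OF H01_sq(2)[OF Hu] H01_sq(2)[OF Hu]]] in auto)
  have cau1: "\<exists>N. \<forall>i\<ge>N. \<forall>j\<ge>N. sqn M (\<lambda>t. u i t - u j t) < e" if e: "e > 0" for e
  proof -
    obtain N where N: "\<forall>i\<ge>N. \<forall>j\<ge>N. af (x i - x j) (x i - x j) < e / c\<Omega>\<^sup>2" using assms[of "e / c\<Omega>\<^sup>2"] e cO by auto
    have "sqn M (\<lambda>t. u i t - u j t) < e" if "N \<le> i" "N \<le> j" for i j
    proof -
      have "sqn M (\<lambda>t. u i t - u j t) \<le> c\<Omega>\<^sup>2 * af (x i - x j) (x i - x j)"
        using aform_bounds(4)[OF Hd, of i j] unfolding afd l2_self by simp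
      also have "\<dots> < c\<Omega>\<^sup>2 * (e / c\<Omega>\<^sup>2)" using N that cO by (intro mult_strict_left_mono) auto
      finally show ?thesis using cO by simp
    qed
    then show ?thesis by blast
  qed
  have cau2: "\<exists>N. \<forall>i\<ge>N. \<forall>j\<ge>N. sqn M (\<lambda>t. wgrad \<Omega> (u i) t - wgrad \<Omega> (u j) t) < e" if e: "e > 0" for e
  proof -
    obtain N where N: "\<forall>i\<ge>N. \<forall>j\<ge>N. af (x i - x j) (x i - x j) < e * c1" using assms[of "e * c1"] e c1 by auto
    have "sqn M (\<lambda>t. wgrad \<Omega> (u i) t - wgrad \<Omega> (u j) t) < e" if "N \<le> i" "N \<le> j" for i j
    proof -
      have "sqn M (\<lambda>t. wgrad \<Omega> (u i) t - wgrad \<Omega> (u j) t) \<le> af (x i - x j) (x i - x j) / c1"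
        unfolding sg afd by (rule sqn_grad_le[OF Hd])
      also have "\<dots> < e" using N that c1 by (simp add: divide_less_eq)
      finally show ?thesis .
    qed
    then show ?thesis by blast
  qed
  obtain v where v: "sq_int M v" "(\<lambda>n. sqn M (\<lambda>t. u n t - v t)) \<longlonglongrightarrow> 0"
    using sq_int_complete[OF fin_M H01_sq(1)[OF Hu] cau1] by blast
  obtain g where g: "sq_int M g" "(\<lambda>n. sqn M (\<lambda>t. wgrad \<Omega> (u n) t - g t)) \<longlonglongrightarrow> 0"
    using sq_int_complete[OF fin_M H01_sq(2)[OF Hu] cau2] by blast
  have Hg: "H01_grad \<Omega> v g" by (rule H01_grad_closed[OF wgrad[OF Hu] v(1) g(1) v(2) g(2)])
  then have Hv: "H01 \<Omega> v" by (auto simp: H01_def)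
  have est: "af (x n - RVec v) (x n - RVec v) \<le> c2 * sqn M (\<lambda>t. wgrad \<Omega> (u n) t - g t)" for n
  proof -
    let ?d = "\<lambda>t. 1 * u n t + (-1) * v t"
    have Hd: "H01 \<Omega> ?d" by (rule H01_lincomb[OF Hu Hv])
    have eq: "rapp (rep (x n - RVec v)) = (\<lambda>t. 1 * u n t + (-1) * rapp (rep (RVec v)) t)"
      using rapp_rep[of 1 "x n" "-1" "RVec v"] by (simp add: u_def)
    have ae: "AE t in M. rapp (rep (x n - RVec v)) t = ?d t"
      using rep_AE[of "RVec v"] Hv unfolding eq by (auto elim!: eventually_mono)
    have "af (x n - RVec v) (x n - RVec v) = aform \<Omega> V ?d ?d"
      unfolding af_def
      using form_cong(2)[OF rep_H01 Hd rep_H01 ae, of "x n - RVec v"] form_cong(2)[OF rep_H01 Hd Hd ae]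
        aform_sym[of ?d "rapp (rep (x n - RVec v))"] by simp
    also have "\<dots> \<le> c2 * sqn M (wgrad \<Omega> ?d)" by (rule aform_bounds(2)[OF Hd])
    also have "sqn M (wgrad \<Omega> ?d) = sqn M (\<lambda>t. wgrad \<Omega> (u n) t - g t)"
    proof (rule sq_int_cong_AE(2)[OF H01_sq(2)[OF Hd]])
      show "(\<lambda>t. wgrad \<Omega> (u n) t - g t) \<in> borel_measurable M"
        by (rule sq_int_meas[OF sq_int_diff(1)[OF H01_sq(2)[OF Hu] g(1)]])
      show "AE t in M. wgrad \<Omega> ?d t = wgrad \<Omega> (u n) t - g t"
        using wgrad_AE[OF Hd H01_grad_lincomb[OF wgrad[OF Hu[of n]] Hg, where r = 1 and s = "-1"]] by simp
    qed
    finally show ?thesis .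
  qed
  have "(\<lambda>n. af (x n - RVec v) (x n - RVec v)) \<longlonglongrightarrow> 0"
  proof (rule tendsto_sandwich[OF _ _ tendsto_const])
    show "\<forall>\<^sub>F n in sequentially. af (x n - RVec v) (x n - RVec v) \<le> c2 * sqn M (\<lambda>t. wgrad \<Omega> (u n) t - g t)"
      using est by simp
    show "(\<lambda>n. c2 * sqn M (\<lambda>t. wgrad \<Omega> (u n) t - g t)) \<longlonglongrightarrow> 0" using tendsto_mult_left[OF g(2), of c2] by simp
  qed (simp add: af.nonneg)
  then show ?thesis by blast
qed

text \<open>\<open>poincare_H01\<close> for \<open>\<epsilon> * c1\<close>, because coercivity
  bounds \<open>c1\<close> times the squared gradient norm by \<open>af\<close>.\<close>

lemma af_compact:
  assumes e: "\<epsilon> > 0"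
  shows "\<exists>m (f :: nat \<Rightarrow> 'a rvec \<Rightarrow> real) A. 0 \<le> A \<and>
       (\<forall>k<m. (\<forall>x y. f k (x - y) = f k x - f k y) \<and> (\<forall>x. (f k x)\<^sup>2 \<le> A * bf x x)) \<and>
       (\<forall>x. bf x x \<le> \<epsilon> * af x x + A * (\<Sum>k<m. (f k x)\<^sup>2))"
proof -
  obtain K :: "('a \<Rightarrow> int) set" and s A where K: "finite K" "0 < s" "0 \<le> A"
    and P: "\<And>u g. H01_grad \<Omega> u g \<Longrightarrow> sqn M u \<le> (\<epsilon> * c1) * sqn M g
        + A * (\<Sum>k\<in>K. (integral\<^sup>L M (\<lambda>x. indicator (cell s k) x * u x))\<^sup>2)"
    using poincare_H01[OF mult_pos_pos[OF e c1]] by blast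
  obtain h where h: "bij_betw h {0..<card K} K" using ex_bij_betw_nat_finite[OF K(1)] by blast
  define f where "f k x = integral\<^sup>L M (\<lambda>t. indicator (cell s (h k)) t * rapp (rep x) t)" for k x
  \<comment> \<open>One constant for two purposes: the factor of the inequality and the bound of the
    cell functionals, whose squared L^2 norm is at most the measure of the domain.\<close>
  define B where "B = max A (measure M (space M))"
  interpret finite_measure M by (rule fin_M)
  have im: "sq_int M (\<lambda>t. indicator (cell s k) t :: real) \<and> sqn M (\<lambda>t. indicator (cell s k) t :: real) \<le> measure M (space M)" for k :: "'a \<Rightarrow> int"
  proof -
    have m: "(\<lambda>t. indicator (cell s k) t :: real) \<in> borel_measurable M"
      by (intro measurable_restrict_space1 measurable_completion) measurable
    have i: "integrable M (\<lambda>t. (norm (indicator (cell s k) t :: real))\<^sup>2)"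
      by (rule integrable_const_bound[of _ 1]) (use m in \<open>auto simp: indicator_def\<close>)
    have "sqn M (\<lambda>t. indicator (cell s k) t :: real) \<le> integral\<^sup>L M (\<lambda>_. 1)"
      unfolding sqn_def by (rule integral_mono[OF i]) (auto simp: indicator_def)
    then show ?thesis using m i by (simp add: sq_int_def)
  qed
  have fi: "integrable M (\<lambda>t. indicator (cell s k) t * rapp (rep x) t)" for k x
    using sq_int_inner[OF conjunct1[OF im] H01_sq(1)[OF rep_H01]] by simp
  have B: "0 \<le> B" "A \<le> B" using K by (auto simp: B_def)
  have lin: "f k (x - y) = f k x - f k y" for k x y
  proof -
    have "rapp (rep (x - y)) = (\<lambda>t. rapp (rep x) t - rapp (rep y) t)" using rapp_rep[of 1 x "-1" y] by simp
    then show ?thesis using fi by (simp add: f_def right_diff_distrib)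
  qed
  have bd: "(f k x)\<^sup>2 \<le> B * bf x x" for k x
  proof -
    have "(f k x)\<^sup>2 \<le> sqn M (\<lambda>t. indicator (cell s (h k)) t :: real) * sqn M (rapp (rep x))"
      using sq_int_cs[OF conjunct1[OF im] H01_sq(1)[OF rep_H01], of "h k" x] by (simp add: f_def)
    also have "\<dots> \<le> B * sqn M (rapp (rep x))"
    proof (rule mult_right_mono[OF _ sqn_nonneg])
      have "sqn M (\<lambda>t. indicator (cell s (h k)) t :: real) \<le> measure M (space M)" using im by blast
      also have "\<dots> \<le> B" unfolding B_def by (rule max.cobounded2)
      finally show "sqn M (\<lambda>t. indicator (cell s (h k)) t :: real) \<le> B" .
    qed
    finally show ?thesis by (simp add: bf_def l2_self)
  qed
  have po: "bf x x \<le> \<epsilon> * af x x + B * (\<Sum>k<card K. (f k x)\<^sup>2)" for x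
  proof -
    have S: "(\<Sum>k\<in>K. (integral\<^sup>L M (\<lambda>t. indicator (cell s k) t * rapp (rep x) t))\<^sup>2) = (\<Sum>k<card K. (f k x)\<^sup>2)"
      unfolding f_def by (subst sum.reindex_bij_betw[OF h, symmetric]) (simp add: atLeast0LessThan)
    have "bf x x \<le> (\<epsilon> * c1) * sqn M (wgrad \<Omega> (rapp (rep x))) + A * (\<Sum>k<card K. (f k x)\<^sup>2)"
      using P[OF wgrad[OF rep_H01], of x] unfolding S by (simp add: bf_def l2_self)
    also have "(\<epsilon> * c1) * sqn M (wgrad \<Omega> (rapp (rep x))) = \<epsilon> * (c1 * sqn M (wgrad \<Omega> (rapp (rep x))))" by simp
    also have "\<dots> \<le> \<epsilon> * af x x" unfolding af_def using e by (intro mult_left_mono aform_bounds(1) rep_H01) auto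
    also have "A * (\<Sum>k<card K. (f k x)\<^sup>2) \<le> B * (\<Sum>k<card K. (f k x)\<^sup>2)" using B by (intro mult_right_mono sum_nonneg) auto
    finally show ?thesis by simp
  qed
  show ?thesis
    by (intro exI[of _ "card K"] exI[of _ f] exI[of _ B]) (use B lin bd po in auto)
qed

sublocale hp: hilbert_pair af bf rep "c\<Omega>\<^sup>2"
proof
  show "rep (x + y) = rep x + rep y" for x y by (rule linear_add[OF rep(1)])
  show "rep (c *\<^sub>R x) = c *\<^sub>R rep x" for c x by (rule linear_scale[OF rep(1)])
  show "rep (rep x) = rep x" for x by (rule rep(3))
  show "af (rep x) y = af x y" for x y by (simp add: af_def rep(3))
  show bd: "bf x x \<le> c\<Omega>\<^sup>2 * af x x" for x unfolding af_def bf_def by (rule aform_bounds(4)[OF rep_H01])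
  show "rep x = 0" if "af x x = 0" for x
  proof -
    have "sqn M (rapp (rep x)) = 0" using bd[of x] that sqn_nonneg[of M "rapp (rep x)"] by (simp add: bf_def l2_self)
    then have "AE t in M. rapp (rep x) t = 0" by (rule sqn_zero_AE[OF H01_sq(1)[OF rep_H01]])
    then have "rep x \<in> ZZ" using rep_H01 by (simp add: ZZ_def)
    then show ?thesis using rep(4)[of "rep x"] rep(3)[of x] by simp
  qed
  show "0 < c\<Omega>\<^sup>2" using cO by simp
qed (use af_complete af_compact in auto)

definition "cls u = rep (RVec u)"

lemma rep_cls: "rep (cls u) = cls u"
  by (simp add: cls_def rep(3))

lemma cls_forms:
  assumes "H01 \<Omega> u" "H01 \<Omega> w"
  shows "af (cls u) (cls w) = aform \<Omega> V u w" "bf (cls u) (cls w) = l2 \<Omega> u w"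
  using forms_RVec[OF assms] by (simp_all add: cls_def af_def bf_def rep(3))

lemma cls_AE: "H01 \<Omega> u \<Longrightarrow> H01 \<Omega> w \<Longrightarrow> AE x in M. u x = w x \<Longrightarrow> cls u = cls w"
proof -
  assume u: "H01 \<Omega> u" and w: "H01 \<Omega> w" and ae: "AE x in M. u x = w x"
  have "H01 \<Omega> (\<lambda>x. 1 * u x + (-1) * w x)" by (rule H01_lincomb[OF u w])
  moreover have "rapp (RVec u - RVec w) = (\<lambda>x. 1 * u x + (-1) * w x)" by (simp add: fun_eq_iff)
  ultimately have "RVec u - RVec w \<in> ZZ" using ae by (auto simp: ZZ_def elim!: eventually_mono)
  then show "cls u = cls w" using rep(4)[of "RVec u - RVec w"] linear_diff[OF rep(1), of "RVec u" "RVec w"] by (simp add: cls_def)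
qed

lemma cls_lincomb: "cls (\<lambda>x. r * u x + s * w x) = r *\<^sub>R cls u + s *\<^sub>R cls w"
proof -
  have "RVec (\<lambda>x. r * u x + s * w x) = r *\<^sub>R RVec u + s *\<^sub>R RVec w" by (rule rvec_eqI) simp
  then show ?thesis by (simp add: cls_def linear_add[OF rep(1)] linear_scale[OF rep(1)])
qed

lemma cls_sum: "cls (\<lambda>x. \<Sum>i\<in>I. f i x * c i) = (\<Sum>i\<in>I. c i *\<^sub>R cls (f i))"
proof -
  have "RVec (\<lambda>x. \<Sum>i\<in>I. f i x * c i) = (\<Sum>i\<in>I. c i *\<^sub>R RVec (f i))" by (rule rvec_eqI) (simp add: mult.commute)
  then show ?thesis by (simp add: cls_def linear_sum[OF rep(1)] linear_scale[OF rep(1)])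
qed

lemma cls_add: "cls (\<lambda>x. u x + w x) = cls u + cls w"
  and cls_diff: "cls (\<lambda>x. u x - w x) = cls u - cls w"
  and cls_scale: "cls (\<lambda>x. r * u x) = r *\<^sub>R cls u"
  using cls_lincomb[of 1 u 1 w] cls_lincomb[of 1 u "-1" w] cls_lincomb[of r u 0 u] by simp_all

lemma cls_rapp: "rep x = x \<Longrightarrow> cls (rapp x) = x"
  by (simp add: cls_def)

text \<open>\<open>green\<close> is a choice too. A solution exists, namely
  \<open>rapp (hp.G (cls f))\<close>, and all solutions have the same class because the weak
  equation determines it up to null vectors.\<close>

lemma green:
  assumes f: "H01 \<Omega> f"
  shows "H01 \<Omega> (green \<Omega> V f)" "cls (green \<Omega> V f) = hp.G (cls f)"
proof -
  have "\<exists>w. H01 \<Omega> w \<and> (\<forall>v. H01 \<Omega> v \<longrightarrow> aform \<Omega> V w v = l2 \<Omega> f v)"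
  proof (intro exI[of _ "rapp (hp.G (cls f))"] conjI allI impI)
    show H: "H01 \<Omega> (rapp (hp.G (cls f)))" using rep_H01[of "hp.G (cls f)"] by (simp add: hp.p_G)
    fix v assume v: "H01 \<Omega> v"
    have "aform \<Omega> V (rapp (hp.G (cls f))) v = af (hp.G (cls f)) (cls v)"
      using cls_forms(1)[OF H v] by (simp add: cls_rapp hp.p_G)
    then show "aform \<Omega> V (rapp (hp.G (cls f))) v = l2 \<Omega> f v" using cls_forms(2)[OF f v] by (simp add: hp.aG)
  qed
  from someI_ex[OF this] have g: "H01 \<Omega> (green \<Omega> V f)" "\<And>v. H01 \<Omega> v \<Longrightarrow> aform \<Omega> V (green \<Omega> V f) v = l2 \<Omega> f v"
    unfolding green_def by blast+
  show "H01 \<Omega> (green \<Omega> V f)" by (rule g(1))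
  have "af (cls (green \<Omega> V f)) z = bf (cls f) z" for z
  proof -
    have "af (cls (green \<Omega> V f)) (cls (rapp (rep z))) = bf (cls f) (cls (rapp (rep z)))"
      using g(2)[OF rep_H01] cls_forms(1)[OF g(1) rep_H01] cls_forms(2)[OF f rep_H01] by simp
    then show ?thesis by (simp add: cls_rapp rep(3)) (simp add: af_def bf_def rep(3))
  qed
  from hp.G_eqI[OF this] show "cls (green \<Omega> V f) = hp.G (cls f)" by (simp add: rep_cls)
qed

end

section \<open>Continuity of the residual\<close>

lemma (in psd_form) tendsto_form2:
  assumes "(\<lambda>n. q (x n - y) (x n - y)) \<longlonglongrightarrow> 0" "(\<lambda>n. q (w n - z) (w n - z)) \<longlonglongrightarrow> 0"
  shows "(\<lambda>n. q (x n) (w n)) \<longlonglongrightarrow> q y z"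
proof -
  have "(\<lambda>n. q ((x n + w n) - (y + z)) ((x n + w n) - (y + z))) \<longlonglongrightarrow> 0"
  proof (rule tendsto_sandwich[OF _ _ tendsto_const])
    have "q ((x n + w n) - (y + z)) ((x n + w n) - (y + z)) \<le> 2 * q (x n - y) (x n - y) + 2 * q (w n - z) (w n - z)" for n
      using quad_add_le[of "x n - y" "w n - z"] by (simp add: algebra_simps)
    then show "\<forall>\<^sub>F n in sequentially. q ((x n + w n) - (y + z)) ((x n + w n) - (y + z)) \<le> 2 * q (x n - y) (x n - y) + 2 * q (w n - z) (w n - z)"
      by simp
    have "(\<lambda>n. 2 * q (x n - y) (x n - y) + 2 * q (w n - z) (w n - z)) \<longlonglongrightarrow> 2 * 0 + 2 * 0"
      by (intro tendsto_intros assms)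
    then show "(\<lambda>n. 2 * q (x n - y) (x n - y) + 2 * q (w n - z) (w n - z)) \<longlonglongrightarrow> 0" by simp
  qed (simp add: nonneg)
  note l = tendsto_form(2)[OF this] tendsto_form(2)[OF assms(1)] tendsto_form(2)[OF assms(2)]
  have pol: "q u v = (q (u + v) (u + v) - q u u - q v v) / 2" for u v by (simp add: quad_add)
  have "(\<lambda>n. (q (x n + w n) (x n + w n) - q (x n) (x n) - q (w n) (w n)) / 2) \<longlonglongrightarrow> (q (y + z) (y + z) - q y y - q z z) / 2"
    by (intro tendsto_intros l) simp
  then show ?thesis by (simp only: pol[symmetric])
qed

context hilbert_pair
begin

text \<open>\<open>a (G d) (G d)\<close> equals \<open>b d (G d)\<close>; use Cauchy-Schwarz in
  \<open>b\<close> and \<open>bounded\<close> for both factors, then cancel.\<close>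

lemma aGG_le: "a (G d) (G d) \<le> Cb\<^sup>2 * a d d"
proof (cases "a (G d) (G d) = 0")
  case True
  then show ?thesis using a.nonneg[of d] by simp
next
  case False
  then have p: "0 < a (G d) (G d)" using a.nonneg[of "G d"] by simp
  have "(a (G d) (G d))\<^sup>2 = (b d (G d))\<^sup>2" by (simp add: aG)
  also have "\<dots> \<le> b d d * b (G d) (G d)" by (rule b.cs)
  also have "\<dots> \<le> (Cb * a d d) * (Cb * a (G d) (G d))" using Cb by (intro mult_mono bounded b.nonneg mult_nonneg_nonneg a.nonneg) auto
  finally have "a (G d) (G d) * a (G d) (G d) \<le> a (G d) (G d) * (Cb\<^sup>2 * a d d)" by (simp add: power2_eq_square mult_ac)
  then show ?thesis using p by simp
qed

text \<open>Subtracting the vanishing residual of \<open>z\<close> leaves terms each linear in a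
  difference of vectors or of coefficients, with factors that stay bounded.\<close>

lemma residual_tendsto:
  assumes x: "\<And>j. j < N \<Longrightarrow> (\<lambda>n. a (x n j - z j) (x n j - z j)) \<longlonglongrightarrow> 0" and j: "j < N"
    and z: "G (z j) = (\<Sum>i<N. b (G (z i)) (z j) *\<^sub>R z i)"
  shows "(\<lambda>n. a (G (x n j) - (\<Sum>i<N. b (G (x n i)) (x n j) *\<^sub>R x n i)) (G (x n j) - (\<Sum>i<N. b (G (x n i)) (x n j) *\<^sub>R x n i))) \<longlonglongrightarrow> 0"
proof -
  have Gd: "G (u - w) = G u - G w" for u w using G_add[of "u - w" w] by simp
  have Gl: "(\<lambda>n. a (G (x n i) - G (z i)) (G (x n i) - G (z i))) \<longlonglongrightarrow> 0" if "i < N" for i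
  proof (rule tendsto_sandwich[OF _ _ tendsto_const])
    show "\<forall>\<^sub>F n in sequentially. a (G (x n i) - G (z i)) (G (x n i) - G (z i)) \<le> Cb\<^sup>2 * a (x n i - z i) (x n i - z i)"
      using aGG_le by (simp add: Gd[symmetric])
    show "(\<lambda>n. Cb\<^sup>2 * a (x n i - z i) (x n i - z i)) \<longlonglongrightarrow> 0" using tendsto_mult_left[OF x[OF that], of "Cb\<^sup>2"] by simp
  qed (simp add: a.nonneg)
  have ba: "b (G u) w = a (G u) (G w)" for u w
    using aG[of w "G u"] a.sym[of "G w" "G u"] b.sym[of "G u" w] by simp
  have bl: "(\<lambda>n. b (G (x n i)) (x n j)) \<longlonglongrightarrow> b (G (z i)) (z j)" if "i < N" for i
    unfolding ba by (rule a.tendsto_form2[OF Gl[OF that] Gl[OF j]])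
  have nl: "(\<lambda>n. a.nrm (y n)) \<longlonglongrightarrow> 0" if "(\<lambda>n. a (y n) (y n)) \<longlonglongrightarrow> 0" for y
    using tendsto_real_sqrt[OF that] by (simp add: a.nrm_def)
  let ?W = "\<lambda>n. G (x n j) - (\<Sum>i<N. b (G (x n i)) (x n j) *\<^sub>R x n i)"
  let ?B = "\<lambda>n. a.nrm (G (x n j) - G (z j)) + (\<Sum>i<N. \<bar>b (G (x n i)) (x n j)\<bar> * a.nrm (x n i - z i)
      + \<bar>b (G (x n i)) (x n j) - b (G (z i)) (z j)\<bar> * a.nrm (z i))"
  have le: "a.nrm (?W n) \<le> ?B n" for n
  proof -
    have "?W n = (G (x n j) - G (z j)) - (\<Sum>i<N. b (G (x n i)) (x n j) *\<^sub>R (x n i - z i)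
       + (b (G (x n i)) (x n j) - b (G (z i)) (z j)) *\<^sub>R z i)"
      unfolding z by (simp add: scaleR_diff_left scaleR_diff_right sum.distrib sum_subtractf)
    then have "a.nrm (?W n) \<le> a.nrm (G (x n j) - G (z j)) + a.nrm (\<Sum>i<N. b (G (x n i)) (x n j) *\<^sub>R (x n i - z i)
       + (b (G (x n i)) (x n j) - b (G (z i)) (z j)) *\<^sub>R z i)" by (simp only: a.nrm_diff)
    moreover have "a.nrm (\<Sum>i<N. b (G (x n i)) (x n j) *\<^sub>R (x n i - z i) + (b (G (x n i)) (x n j) - b (G (z i)) (z j)) *\<^sub>R z i)
      \<le> (\<Sum>i<N. \<bar>b (G (x n i)) (x n j)\<bar> * a.nrm (x n i - z i) + \<bar>b (G (x n i)) (x n j) - b (G (z i)) (z j)\<bar> * a.nrm (z i))"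
      by (rule order_trans[OF a.nrm_sum], rule sum_mono, rule order_trans[OF a.nrm_triangle]) (simp add: a.nrm_scale)
    ultimately show ?thesis by linarith
  qed
  have "?B \<longlonglongrightarrow> 0 + (\<Sum>i<N. \<bar>b (G (z i)) (z j)\<bar> * 0 + \<bar>b (G (z i)) (z j) - b (G (z i)) (z j)\<bar> * a.nrm (z i))"
    by (intro tendsto_add tendsto_sum tendsto_mult tendsto_rabs tendsto_diff tendsto_const nl Gl[OF j] bl x) auto
  then have B: "?B \<longlonglongrightarrow> 0" by simp
  have "(\<lambda>n. a.nrm (?W n)) \<longlonglongrightarrow> 0"
    by (rule tendsto_sandwich[OF _ _ tendsto_const B]) (use le in auto)
  then have "(\<lambda>n. (a.nrm (?W n))\<^sup>2) \<longlonglongrightarrow> 0\<^sup>2" by (rule tendsto_power)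
  then show ?thesis by (simp add: a.nrm_sq)
qed

end

section \<open>The spectral gap\<close>

locale eigen_system = schroedinger \<Omega> V c1 c2 c\<Omega> for \<Omega> :: "'a::euclidean_space set" and V c1 c2 c\<Omega> +
  fixes lam :: "nat \<Rightarrow> real" and e :: "nat \<Rightarrow> 'a \<Rightarrow> real"
  assumes lam_step: "\<And>i. i \<ge> 1 \<Longrightarrow> lam i \<le> lam (Suc i)"
    and e_eig: "\<And>i. i \<ge> 1 \<Longrightarrow> eigpair \<Omega> V (lam i) (e i)"
    and e_on: "\<And>i j. i \<ge> 1 \<Longrightarrow> j \<ge> 1 \<Longrightarrow> l2 \<Omega> (e i) (e j) = (if i = j then 1 else 0)"
    and e_all: "\<And>\<mu> u. eigpair \<Omega> V \<mu> u \<Longrightarrow> \<exists>I c. finite I \<and> I \<subseteq> {i. i \<ge> 1 \<and> lam i = \<mu>} \<and>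
                 (AE x in lebesgue. x \<in> \<Omega> \<longrightarrow> u x = (\<Sum>i\<in>I. c i * e i x))"
begin

lemma lam_mono: "1 \<le> i \<Longrightarrow> i \<le> j \<Longrightarrow> lam i \<le> lam j"
proof (induction j)
  case (Suc n)
  show ?case
  proof (cases "i = Suc n")
    case False
    then have "i \<le> n" "1 \<le> n" using Suc.prems by auto
    then show ?thesis using Suc.IH[OF Suc.prems(1)] lam_step[of n] by linarith
  qed simp
qed simp

lemma eigpair_af:
  assumes "eigpair \<Omega> V \<mu> u"
  shows "H01 \<Omega> u" "af (cls u) z = \<mu> * bf (cls u) z"
proof -
  show H: "H01 \<Omega> u" using assms by (simp add: eigpair_def)
  have "aform \<Omega> V u (rapp (rep z)) = \<mu> * l2 \<Omega> u (rapp (rep z))" using assms rep_H01 by (simp add: eigpair_def)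
  then have "af (cls u) (cls (rapp (rep z))) = \<mu> * bf (cls u) (cls (rapp (rep z)))"
    using cls_forms[OF H rep_H01] by simp
  then show "af (cls u) z = \<mu> * bf (cls u) z"
    by (simp add: cls_rapp rep(3)) (simp add: af_def bf_def rep(3))
qed

lemma eigpair_expand:
  assumes "eigpair \<Omega> V \<mu> u"
  shows "\<exists>I c. finite I \<and> I \<subseteq> {i. i \<ge> 1 \<and> lam i = \<mu>} \<and> cls u = (\<Sum>i\<in>I. c i *\<^sub>R cls (e i))"
proof -
  obtain I c where I: "finite I" "I \<subseteq> {i. i \<ge> 1 \<and> lam i = \<mu>}" "AE x in lebesgue. x \<in> \<Omega> \<longrightarrow> u x = (\<Sum>i\<in>I. c i * e i x)"
    using e_all[OF assms] by blast
  have "cls u = cls (\<lambda>x. \<Sum>i\<in>I. e i x * c i)"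
  proof (rule cls_AE[OF eigpair_af(1)[OF assms]])
    show "H01 \<Omega> (\<lambda>x. \<Sum>i\<in>I. e i x * c i)" 
    proof (rule H01_sum)
      fix i assume "i \<in> I"
      then show "H01 \<Omega> (e i)" using I(2) by (intro eigpair_af(1)[OF e_eig]) auto
    qed
    show "AE x in M. u x = (\<Sum>i\<in>I. e i x * c i)" using I(3) by (simp add: AE_iff mult.commute)
  qed
  then show ?thesis using I(1,2) by (auto simp: cls_sum)
qed

text \<open>Shifts the list: the abstract locales index eigenvectors from 0, while
  \<open>lam\<close> starts at 1.\<close>

definition "E k = cls (e (Suc k))"

lemma E_on: "bf (E i) (E j) = (if i = j then 1 else 0)"
  using cls_forms(2)[OF eigpair_af(1)[OF e_eig] eigpair_af(1)[OF e_eig], of "Suc i" "Suc j"] e_on[of "Suc i" "Suc j"]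
  by (simp add: E_def)

lemma E_eig: "af (E i) z = lam (Suc i) * bf (E i) z"
  unfolding E_def by (rule eigpair_af(2)[OF e_eig]) simp

text \<open>The embedding constant bounds the spectrum from below; in \<open>step_size_bound\<close>
  it is compared with \<open>1 / lam 1\<close>.\<close>

lemma lam_lower: "1 \<le> c\<Omega>\<^sup>2 * lam (Suc i)"
  using hp.bounded[of "E i"] E_on[of i i] E_eig[of i "E i"] by simp

lemma lam_pos: "0 < lam (Suc i)"
  using lam_lower[of i] by (smt (verit) mult_nonneg_nonpos zero_le_power2)

text \<open>Otherwise minimization yields an eigenvector below \<open>lam (Suc n)\<close> that is
  orthogonal to the first \<open>n\<close>. By completeness of the list it is a combination of
  eigenfunctions with that same eigenvalue, all of which are among the first \<open>n\<close>; so it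
  is orthogonal to itself.\<close>

lemma gap_E:
  assumes x: "\<And>i. i < n \<Longrightarrow> bf x (E i) = 0"
  shows "lam (Suc n) * bf x x \<le> af x x"
proof (rule ccontr)
  assume "\<not> ?thesis"
  then have "af x x < lam (Suc n) * bf x x" by simp
  from hp.ex_eigenvector_below[of n E "\<lambda>i. lam (Suc i)", OF _ E_eig x this]
  obtain w \<mu> where w: "\<mu> < lam (Suc n)" "bf w w = 1" "\<And>i. i < n \<Longrightarrow> bf w (E i) = 0" "\<And>v. af w v = \<mu> * bf w v"
    using E_on by auto
  let ?u = "rapp (rep w)"
  have cw: "cls ?u = rep w" by (rule cls_rapp[OF rep(3)])
  have ar: "af (rep w) v = af w v" "bf (rep w) v = bf w v" for v by (simp_all add: af_def bf_def rep(3))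
  have "eigpair \<Omega> V \<mu> ?u"
    unfolding eigpair_def
  proof (intro conjI allI impI)
    show "H01 \<Omega> ?u" by (rule rep_H01)
    show "\<not> (AE x in lebesgue. x \<in> \<Omega> \<longrightarrow> ?u x = 0)"
    proof
      assume "AE x in lebesgue. x \<in> \<Omega> \<longrightarrow> ?u x = 0"
      then have "rep w \<in> ZZ" using rep_H01 by (simp add: ZZ_def AE_iff)
      then have "rep w = 0" using rep(4)[of "rep w"] rep(3)[of w] by simp
      then show False using w(2) ar(2)[of w] by simp
    qed
    show "aform \<Omega> V ?u v = \<mu> * l2 \<Omega> ?u v" if "H01 \<Omega> v" for v
      using cls_forms[OF rep_H01 that, of w] w(4)[of "cls v"] by (simp add: cw ar)
  qed
  from eigpair_expand[OF this] obtain I c where I: "finite I" "I \<subseteq> {i. i \<ge> 1 \<and> lam i = \<mu>}" "rep w = (\<Sum>i\<in>I. c i *\<^sub>R cls (e i))"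
    unfolding cw by blast
  have "bf w (cls (e i)) = 0" if "i \<in> I" for i
  proof -
    have i: "i \<ge> 1" "lam i < lam (Suc n)" using I(2) that w(1) by auto
    then have "i \<le> n" using lam_mono[of "Suc n" i] by (cases "i \<le> n") auto
    then show ?thesis using w(3)[of "i - 1"] i(1) by (simp add: E_def)
  qed
  then have "bf w (rep w) = 0" by (simp add: I(3) bf.sum_right bf.scale_right)
  then show False using w(2) ar(2)[of w] bf.sym[of w "rep w"] by simp
qed

text \<open>The gap forces every eigenfunction for an eigenvalue up to \<open>lam N\<close> to be a
  combination of the first \<open>N\<close> entries of the list. Hence the \<open>Vs j\<close> lie
  in their span, and \<open>orthonormal_swap\<close> reverses the inclusion, so that
  \<open>gap_E\<close> applies.\<close>

lemma gap_V:
  assumes gp: "lam N < lam (Suc N)"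
    and v_eig: "\<And>j. j < N \<Longrightarrow> eigpair \<Omega> V (lam (Suc j)) (Vs j)"
    and v_on: "\<And>i j. i < N \<Longrightarrow> j < N \<Longrightarrow> l2 \<Omega> (Vs i) (Vs j) = idm i j"
    and x: "\<And>i. i < N \<Longrightarrow> bf x (cls (Vs i)) = 0"
  shows "lam (Suc N) * bf x x \<le> af x x"
proof (rule gap_E)
  fix k assume k: "k < N"
  let ?v = "\<lambda>j. cls (Vs j)"
  have on: "bf (?v i) (?v j) = (if i = j then 1 else 0)" if "i < N" "j < N" for i j
    using cls_forms(2)[OF eigpair_af(1)[OF v_eig] eigpair_af(1)[OF v_eig], OF that] v_on[OF that] by (simp add: idm_def)
  have s: "(\<Sum>k<N. (bf (?v j) (E k))\<^sup>2) = 1" if j: "j < N" for j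
  proof -
    obtain I c where I: "finite I" "I \<subseteq> {i. i \<ge> 1 \<and> lam i = lam (Suc j)}" "?v j = (\<Sum>i\<in>I. c i *\<^sub>R cls (e i))"
      using eigpair_expand[OF v_eig[OF j]] by blast
    have IN: "1 \<le> i \<and> i \<le> N" if "i \<in> I" for i
    proof -
      have "1 \<le> i" "lam i = lam (Suc j)" using I(2) that by auto
      moreover have "lam (Suc j) \<le> lam N" using j by (intro lam_mono) auto
      ultimately have "lam i < lam (Suc N)" using gp by simp
      then show ?thesis using \<open>1 \<le> i\<close> lam_mono[of "Suc N" i] by (cases "i \<le> N") auto
    qed
    have ee: "bf (cls (e i)) (cls (e l)) = (if i = l then 1 else 0)" if "1 \<le> i" "1 \<le> l" for i l
      using E_on[of "i - 1" "l - 1"] that by (auto simp: E_def)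
    have c: "bf (?v j) (cls (e i)) = c i" if "i \<in> I" for i
    proof -
      have "bf (?v j) (cls (e i)) = (\<Sum>l\<in>I. c l * (if l = i then 1 else 0))"
        unfolding I(3) bf.sum_left bf.scale_left by (intro sum.cong refl) (use ee IN that in auto)
      also have "\<dots> = c i" using I(1) that by (simp add: mult_delta_right)
      finally show ?thesis .
    qed
    have "1 = bf (?v j) (?v j)" using on[OF j j] by simp
    also have "\<dots> = (\<Sum>i\<in>I. (bf (?v j) (cls (e i)))\<^sup>2)"
      by (subst (2) I(3)) (simp add: bf.sum_right bf.scale_right c power2_eq_square)
    also have "\<dots> \<le> (\<Sum>i\<in>{1..N}. (bf (?v j) (cls (e i)))\<^sup>2)"
      using IN by (intro sum_mono2) auto
    also have "\<dots> = (\<Sum>k<N. (bf (?v j) (E k))\<^sup>2)"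
      by (simp add: E_def sum.atLeast1_atMost_eq)
    finally have "1 \<le> (\<Sum>k<N. (bf (?v j) (E k))\<^sup>2)" .
    moreover have "(\<Sum>k<N. (bf (?v j) (E k))\<^sup>2) \<le> 1"
      using bf.bessel[of N E "?v j", OF E_on] on[OF j j] by simp
    ultimately show ?thesis by simp
  qed
  have "bf (E k) x = (\<Sum>j<N. bf (E k) (?v j) * bf x (?v j))"
    by (rule bf.orthonormal_swap[OF E_on on s k])
  then show "bf x (E k) = 0" using x by (simp add: bf.sym[of x "E k"])
qed

end

section \<open>The scheme on \<open>H\<^sub>0\<^sup>1\<close>\<close>

text \<open>\<open>Y x\<close> is \<open>Q\<^sup>T x\<close>, so both claims amount to
  \<open>Q Q\<^sup>T = I\<close>, which \<open>orthogonal_mat_rows\<close> provides.\<close>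

lemma orthogonal_mat_comb:
  fixes u :: "nat \<Rightarrow> 'v::real_vector"
  assumes Q: "orthogonal_mat N Q"
  defines "Y \<equiv> \<lambda>x. RVec (\<lambda>j. \<Sum>i<N. Q i j * rapp x i)"
  shows "comb N (\<lambda>j. \<Sum>i<N. Q i j *\<^sub>R u i) (Y x) = comb N u x" "dot N (Y x) (Y x) = dot N x x"
proof -
  have R: "(\<Sum>j<N. Q i j * rapp (Y x) j) = rapp x i" if i: "i < N" for i
  proof -
    have "(\<Sum>j<N. Q i j * rapp (Y x) j) = (\<Sum>j<N. \<Sum>k<N. rapp x k * (Q i j * Q k j))"
      by (simp add: Y_def sum_distrib_left mult_ac)
    also have "\<dots> = (\<Sum>k<N. rapp x k * (\<Sum>j<N. Q i j * Q k j))"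
      by (subst sum.swap) (simp add: sum_distrib_left)
    also have "\<dots> = (\<Sum>k<N. rapp x k * (if i = k then 1 else 0))"
      by (intro sum.cong refl) (use orthogonal_mat_rows[OF Q i] in auto)
    also have "\<dots> = rapp x i" using i by (simp add: mult_delta_right)
    finally show ?thesis .
  qed
  have "comb N (\<lambda>j. \<Sum>i<N. Q i j *\<^sub>R u i) (Y x) = (\<Sum>j<N. \<Sum>i<N. (Q i j * rapp (Y x) j) *\<^sub>R u i)"
    by (simp add: comb_def scaleR_sum_right mult.commute)
  also have "\<dots> = (\<Sum>i<N. (\<Sum>j<N. Q i j * rapp (Y x) j) *\<^sub>R u i)"
    by (subst sum.swap) (simp add: scaleR_sum_left)
  also have "\<dots> = comb N u x" unfolding comb_def by (intro sum.cong refl) (simp add: R)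
  finally show "comb N (\<lambda>j. \<Sum>i<N. Q i j *\<^sub>R u i) (Y x) = comb N u x" .
  have "dot N (Y x) (Y x) = (\<Sum>j<N. \<Sum>i<N. rapp x i * (Q i j * rapp (Y x) j))"
    unfolding dot_def by (intro sum.cong refl) (simp add: Y_def sum_distrib_right mult_ac)
  also have "\<dots> = (\<Sum>i<N. rapp x i * (\<Sum>j<N. Q i j * rapp (Y x) j))"
    by (subst sum.swap) (simp add: sum_distrib_left)
  also have "\<dots> = dot N x x" unfolding dot_def by (intro sum.cong refl) (simp add: R)
  finally show "dot N (Y x) (Y x) = dot N x x" .
qed

text \<open>\<open>1 / l \<le> c\<^sup>2\<close> bounds \<open>E * L / l\<close> by the product that
  occurs in \<open>c_e\<close>, so \<open>2 * c_e\<close> is at least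
  \<open>4 * (E * L / l) + 1\<close>; the summand 1/2 of \<open>c_e\<close> supplies the 1. Energy
  and time step appear divided by \<open>l\<close>, as the abstract scheme expects.\<close>

lemma step_size_bound:
  fixes l c E L \<tau> n :: real
  assumes l: "0 < l" "1 \<le> c\<^sup>2 * l" and E: "0 \<le> E" and L: "1 \<le> L" and n: "1 \<le> n" and t: "0 < \<tau>"
    and s: "\<tau> < l / (max 3 (2 * (2 * (sqrt 2 * E / l + c\<^sup>2 * sqrt (E * L)) * sqrt (n * E * L) + 1/2)) * L)"
  shows "\<tau> / l * (4 * (E / l) * L\<^sup>2 + L) \<le> 1"
proof -
  let ?m = "max 3 (2 * (2 * (sqrt 2 * E / l + c\<^sup>2 * sqrt (E * L)) * sqrt (n * E * L) + 1/2))"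
  have EL: "0 \<le> E * L" using E L by simp
  have "1 / l \<le> c\<^sup>2" using l by (simp add: divide_le_eq)
  have "E * L / l = 1 / l * (sqrt (E * L) * sqrt (E * L))" using EL by simp
  also have "\<dots> \<le> c\<^sup>2 * (sqrt (E * L) * sqrt (n * E * L))"
  proof (intro mult_mono)
    have "1 * (E * L) \<le> n * (E * L)" using n EL by (rule mult_right_mono)
    then show "sqrt (E * L) \<le> sqrt (n * E * L)" by (simp add: mult.assoc)
  qed (use \<open>1 / l \<le> c\<^sup>2\<close> EL in auto)
  also have "\<dots> \<le> (sqrt 2 * E / l + c\<^sup>2 * sqrt (E * L)) * sqrt (n * E * L)"
    using E l L n by (simp add: distrib_right)
  finally have "E * L / l \<le> (sqrt 2 * E / l + c\<^sup>2 * sqrt (E * L)) * sqrt (n * E * L)" .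
  moreover have "4 * z + 1 \<le> 2 * (2 * x * y + 1/2)" if "z \<le> x * y" for x y z :: real using that by simp
  ultimately have m: "4 * (E * L / l) + 1 \<le> ?m" by (intro max.coboundedI2)
  have "\<tau> * (?m * L) < l" using s L by (simp add: less_divide_eq)
  moreover have "\<tau> * ((4 * (E * L / l) + 1) * L) \<le> \<tau> * (?m * L)" using m t L by (intro mult_left_mono mult_right_mono) auto
  ultimately have "\<tau> * ((4 * (E * L / l) + 1) * L) \<le> l" by linarith
  then have "\<tau> * ((4 * (E * L / l) + 1) * L) / l \<le> 1" using l by simp
  moreover have "\<tau> * ((4 * (E * L / l) + 1) * L) / l = \<tau> / l * (4 * (E / l) * L\<^sup>2 + L)"
    by (simp add: power2_eq_square algebra_simps add_divide_distrib)
  ultimately show ?thesis by (simp only:)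
qed

context schroedinger
begin

lemma H01_add: "H01 \<Omega> u \<Longrightarrow> H01 \<Omega> w \<Longrightarrow> H01 \<Omega> (\<lambda>x. u x + w x)"
  and H01_diff: "H01 \<Omega> u \<Longrightarrow> H01 \<Omega> w \<Longrightarrow> H01 \<Omega> (\<lambda>x. u x - w x)"
  and H01_scale: "H01 \<Omega> u \<Longrightarrow> H01 \<Omega> (\<lambda>x. r * u x)"
  using H01_lincomb[of u w 1 1] H01_lincomb[of u w 1 "-1"] H01_lincomb[of u u r 0] by simp_all

text \<open>Equations almost everywhere between functions become equations in a vector space:
  \<open>cls\<close> respects every operation of the scheme, and \<open>green\<close> corresponds to
  \<open>hp.G\<close>.\<close>

lemma two_stage_cls:
  assumes "two_stage N \<Omega> V \<tau> U"
  shows "tH01 N \<Omega> (U n)"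
    and "\<exists>w. \<forall>n. \<forall>j<N. w n j = cls (U n j) + \<tau> n *\<^sub>R (\<Sum>k<N. bf (cls (U n k)) ((1/2) *\<^sub>R (w n j + cls (U n j))) *\<^sub>R hp.G (cls (U n k))
        - bf (cls (U n k)) (hp.G ((1/2) *\<^sub>R (w n j + cls (U n j)))) *\<^sub>R cls (U n k)) \<and>
      cls (U (Suc n) j) = w n j - \<tau> n *\<^sub>R (\<Sum>k<N. (bf (w n k) (w n j) - (if k = j then 1 else 0)) *\<^sub>R hp.G (w n k))"
proof -
  obtain Uh where Uh: "\<And>n. tH01 N \<Omega> (U n)" "\<And>n. tH01 N \<Omega> (Uh n)"
      "\<And>n. teq N \<Omega> (Uh n) (\<lambda>j x. U n j x + \<tau> n * opA N \<Omega> V (U n) (\<lambda>i y. (Uh n i y + U n i y) / 2) j x)"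
      "\<And>n. teq N \<Omega> (U (Suc n)) (\<lambda>j x. Uh n j x - \<tau> n * tmul N (tgreen \<Omega> V (Uh n)) (\<lambda>i k. gram \<Omega> (Uh n) (Uh n) i k - idm i k) j x)"
    using assms unfolding two_stage_def by blast
  show "tH01 N \<Omega> (U n)" by (rule Uh(1))
  have HU: "H01 \<Omega> (U n i)" and HUh: "H01 \<Omega> (Uh n i)" if "i < N" for n i
    using Uh(1,2) that by (auto simp: tH01_def)
  define w where "w n j = cls (Uh n j)" for n j
  have mid: "H01 \<Omega> (\<lambda>y. (Uh n j y + U n j y) / 2)" "cls (\<lambda>y. (Uh n j y + U n j y) / 2) = (1/2) *\<^sub>R (w n j + cls (U n j))"
    if "j < N" for n j
    using H01_lincomb[OF HUh HU, OF that that, of "1/2" _ "1/2"] cls_lincomb[of "1/2" "Uh n j" "1/2" "U n j"]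
    by (simp_all add: w_def add_divide_distrib scaleR_add_right)
  have 1: "w n j = cls (U n j) + \<tau> n *\<^sub>R (\<Sum>k<N. bf (cls (U n k)) ((1/2) *\<^sub>R (w n j + cls (U n j))) *\<^sub>R hp.G (cls (U n k))
        - bf (cls (U n k)) (hp.G ((1/2) *\<^sub>R (w n j + cls (U n j)))) *\<^sub>R cls (U n k))" if j: "j < N" for n j
  proof -
    define p where "p k = l2 \<Omega> (U n k) (\<lambda>y. (Uh n j y + U n j y) / 2)" for k
    define r where "r k = l2 \<Omega> (U n k) (green \<Omega> V (\<lambda>y. (Uh n j y + U n j y) / 2))" for k
    have F: "U n j x + \<tau> n * opA N \<Omega> V (U n) (\<lambda>i y. (Uh n i y + U n i y) / 2) j x
      = U n j x + \<tau> n * ((\<Sum>k<N. green \<Omega> V (U n k) x * p k) - (\<Sum>k<N. U n k x * r k))" for x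
      by (simp add: opA_def tmul_def tgreen_def gram_def p_def r_def)
    have "w n j = cls (\<lambda>x. U n j x + \<tau> n * ((\<Sum>k<N. green \<Omega> V (U n k) x * p k) - (\<Sum>k<N. U n k x * r k)))"
      unfolding w_def
    proof (rule cls_AE[OF HUh[OF j]])
      show "H01 \<Omega> (\<lambda>x. U n j x + \<tau> n * ((\<Sum>k<N. green \<Omega> V (U n k) x * p k) - (\<Sum>k<N. U n k x * r k)))"
        by (intro H01_add H01_scale H01_diff H01_sum green(1) HU j) auto
      show "AE x in M. Uh n j x = U n j x + \<tau> n * ((\<Sum>k<N. green \<Omega> V (U n k) x * p k) - (\<Sum>k<N. U n k x * r k))"
        using spec[OF Uh(3)[of n, unfolded teq_def], of j] j unfolding F AE_iff by iprover
    qed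
    also have "\<dots> = cls (U n j) + \<tau> n *\<^sub>R ((\<Sum>k<N. p k *\<^sub>R cls (green \<Omega> V (U n k))) - (\<Sum>k<N. r k *\<^sub>R cls (U n k)))"
      unfolding cls_add cls_scale cls_diff cls_sum ..
    also have "(\<Sum>k<N. p k *\<^sub>R cls (green \<Omega> V (U n k))) - (\<Sum>k<N. r k *\<^sub>R cls (U n k))
      = (\<Sum>k<N. p k *\<^sub>R cls (green \<Omega> V (U n k)) - r k *\<^sub>R cls (U n k))" by (rule sum_subtractf[symmetric])
    also have "\<dots> = (\<Sum>k<N. bf (cls (U n k)) ((1/2) *\<^sub>R (w n j + cls (U n j))) *\<^sub>R hp.G (cls (U n k))
        - bf (cls (U n k)) (hp.G ((1/2) *\<^sub>R (w n j + cls (U n j)))) *\<^sub>R cls (U n k))"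
    proof (intro sum.cong refl)
      fix k assume "k \<in> {..<N}"
      then have k: "k < N" by simp
      show "p k *\<^sub>R cls (green \<Omega> V (U n k)) - r k *\<^sub>R cls (U n k)
        = bf (cls (U n k)) ((1/2) *\<^sub>R (w n j + cls (U n j))) *\<^sub>R hp.G (cls (U n k))
        - bf (cls (U n k)) (hp.G ((1/2) *\<^sub>R (w n j + cls (U n j)))) *\<^sub>R cls (U n k)"
        unfolding p_def r_def cls_forms(2)[OF HU[OF k] mid(1)[OF j], symmetric]
          cls_forms(2)[OF HU[OF k] green(1)[OF mid(1)[OF j]], symmetric] green(2)[OF HU[OF k]] green(2)[OF mid(1)[OF j]] mid(2)[OF j] ..
    qed
    finally show ?thesis .
  qed
  have 2: "cls (U (Suc n) j) = w n j - \<tau> n *\<^sub>R (\<Sum>k<N. (bf (w n k) (w n j) - (if k = j then 1 else 0)) *\<^sub>R hp.G (w n k))"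
    if j: "j < N" for n j
  proof -
    define p where "p k = l2 \<Omega> (Uh n k) (Uh n j) - idm k j" for k
    have F: "Uh n j x - \<tau> n * tmul N (tgreen \<Omega> V (Uh n)) (\<lambda>i k. gram \<Omega> (Uh n) (Uh n) i k - idm i k) j x
      = Uh n j x - \<tau> n * (\<Sum>k<N. green \<Omega> V (Uh n k) x * p k)" for x
      by (simp add: tmul_def tgreen_def gram_def p_def)
    have "cls (U (Suc n) j) = cls (\<lambda>x. Uh n j x - \<tau> n * (\<Sum>k<N. green \<Omega> V (Uh n k) x * p k))"
    proof (rule cls_AE[OF HU[OF j]])
      show "H01 \<Omega> (\<lambda>x. Uh n j x - \<tau> n * (\<Sum>k<N. green \<Omega> V (Uh n k) x * p k))"
        by (intro H01_scale H01_diff H01_sum green(1) HUh j) auto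
      show "AE x in M. U (Suc n) j x = Uh n j x - \<tau> n * (\<Sum>k<N. green \<Omega> V (Uh n k) x * p k)"
        using spec[OF Uh(4)[of n, unfolded teq_def], of j] j unfolding F AE_iff by iprover
    qed
    also have "\<dots> = w n j - \<tau> n *\<^sub>R (\<Sum>k<N. p k *\<^sub>R cls (green \<Omega> V (Uh n k)))"
      unfolding cls_scale cls_diff cls_sum w_def ..
    also have "(\<Sum>k<N. p k *\<^sub>R cls (green \<Omega> V (Uh n k))) = (\<Sum>k<N. (bf (w n k) (w n j) - (if k = j then 1 else 0)) *\<^sub>R hp.G (w n k))"
      by (intro sum.cong refl) (simp add: p_def w_def cls_forms(2) green(2) HUh j idm_def)
    finally show ?thesis .
  qed
  show "\<exists>w. \<forall>n. \<forall>j<N. w n j = cls (U n j) + \<tau> n *\<^sub>R (\<Sum>k<N. bf (cls (U n k)) ((1/2) *\<^sub>R (w n j + cls (U n j))) *\<^sub>R hp.G (cls (U n k))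
        - bf (cls (U n k)) (hp.G ((1/2) *\<^sub>R (w n j + cls (U n j)))) *\<^sub>R cls (U n k)) \<and>
      cls (U (Suc n) j) = w n j - \<tau> n *\<^sub>R (\<Sum>k<N. (bf (w n k) (w n j) - (if k = j then 1 else 0)) *\<^sub>R hp.G (w n k))"
    by (intro exI[of _ w] allI impI conjI 1 2)
qed

lemma anorm_cls:
  assumes "tH01 N \<Omega> W"
  shows "anorm N \<Omega> V W = sqrt (\<Sum>i<N. af (cls (W i)) (cls (W i)))"
  unfolding anorm_def using assms by (intro arg_cong[where f = sqrt] sum.cong refl) (simp add: cls_forms(1) tH01_def)

lemma energy_cls:
  assumes "tH01 N \<Omega> W"
  shows "energy N \<Omega> V W = (\<Sum>i<N. af (cls (W i)) (cls (W i))) / 2"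
  unfolding energy_def anorm_cls[OF assms] by (simp add: sum_nonneg af.nonneg)

lemma gradG_cls:
  assumes "tH01 N \<Omega> W"
  shows "tH01 N \<Omega> (gradG N \<Omega> V W)"
    "j < N \<Longrightarrow> cls (gradG N \<Omega> V W j) = hp.G (cls (W j)) - (\<Sum>i<N. bf (hp.G (cls (W i))) (cls (W j)) *\<^sub>R cls (W i))"
proof -
  have H: "H01 \<Omega> (W i)" if "i < N" for i using assms that by (simp add: tH01_def)
  have g: "gradG N \<Omega> V W j = (\<lambda>x. green \<Omega> V (W j) x - (\<Sum>i<N. W i x * l2 \<Omega> (green \<Omega> V (W i)) (W j)))" for j
    by (simp add: gradG_def tmul_def tgreen_def gram_def)
  show "tH01 N \<Omega> (gradG N \<Omega> V W)"
    unfolding tH01_def g by (intro allI impI H01_diff H01_sum green(1) H) auto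
  assume j: "j < N"
  have "(\<Sum>i<N. l2 \<Omega> (green \<Omega> V (W i)) (W j) *\<^sub>R cls (W i)) = (\<Sum>i<N. bf (hp.G (cls (W i))) (cls (W j)) *\<^sub>R cls (W i))"
    by (intro sum.cong refl) (simp add: green(2)[symmetric] green(1) cls_forms(2) H j)
  then show "cls (gradG N \<Omega> V W j) = hp.G (cls (W j)) - (\<Sum>i<N. bf (hp.G (cls (W i))) (cls (W j)) *\<^sub>R cls (W i))"
    unfolding g cls_diff cls_sum by (simp add: green(2) H j)
qed

lemma tmul_cls:
  assumes "tH01 N \<Omega> W"
  shows "tH01 N \<Omega> (tmul N W Q)" "cls (tmul N W Q j) = (\<Sum>i<N. Q i j *\<^sub>R cls (W i))"
proof -
  have H: "H01 \<Omega> (W i)" if "i < N" for i using assms that by (simp add: tH01_def)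
  show "tH01 N \<Omega> (tmul N W Q)" unfolding tH01_def tmul_def by (intro allI impI H01_sum H) auto
  show "cls (tmul N W Q j) = (\<Sum>i<N. Q i j *\<^sub>R cls (W i))" unfolding tmul_def cls_sum ..
qed

lemma qform_gram:
  assumes "tH01 N \<Omega> W"
  shows "qform N (gram \<Omega> W W) x x = bf (comb N (\<lambda>i. cls (W i)) x) (comb N (\<lambda>i. cls (W i)) x)"
proof -
  have "bf (comb N (\<lambda>i. cls (W i)) x) (comb N (\<lambda>i. cls (W i)) x) = (\<Sum>i<N. \<Sum>j<N. rapp x i * (rapp x j * bf (cls (W j)) (cls (W i))))"
    by (simp only: bf.comb_left[of N _ x] bf.comb_right[of _ N _ x] sum_distrib_left)
  then show ?thesis
    unfolding qform_def using assms
    by (simp add: gram_def tH01_def cls_forms(2) mult.assoc) (intro sum.cong refl, simp add: l2_sym mult_ac)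
qed

text \<open>The Gram matrices of \<open>W Q\<close> and \<open>W\<close> are orthogonally
  equivalent; evaluate the condition for \<open>W Q\<close> at \<open>Q\<^sup>T x\<close>.\<close>

lemma quasi_stiefel_le:
  assumes W: "tH01 N \<Omega> W" and Q: "orthogonal_mat N Q" and S: "quasi_stiefel N \<Omega> (tmul N W Q)"
  shows "dot N x x \<le> bf (comb N (\<lambda>i. cls (W i)) x) (comb N (\<lambda>i. cls (W i)) x)"
proof -
  have *: "dot N y y \<le> bf (comb N (\<lambda>i. cls (tmul N W Q i)) y) (comb N (\<lambda>i. cls (tmul N W Q i)) y)" for y
  proof -
    let ?g = "gram \<Omega> (tmul N W Q) (tmul N W Q)"
    have "0 \<le> (\<Sum>i<N. \<Sum>j<N. rapp y i * (?g i j - idm i j) * rapp y j)"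
      using S by (simp add: quasi_stiefel_def psd_mat_def)
    also have "\<dots> = qform N ?g y y - (\<Sum>i<N. \<Sum>j<N. rapp y i * (if i = j then rapp y j else 0))"
      unfolding qform_def sum_subtractf[symmetric] by (intro sum.cong refl) (simp add: idm_def algebra_simps)
    also have "(\<Sum>i<N. \<Sum>j<N. rapp y i * (if i = j then rapp y j else 0)) = dot N y y"
      unfolding dot_def by (intro sum.cong refl) (simp add: mult_delta_right)
    finally show ?thesis using qform_gram[OF tmul_cls(1)[OF W]] by simp
  qed
  show ?thesis
    using *[of "RVec (\<lambda>j. \<Sum>i<N. Q i j * rapp x i)"]
    unfolding tmul_cls(2)[OF W] orthogonal_mat_comb[OF Q] .
qed

end

context eigen_system
begin

theorem two_stage_convergence:
  assumes N: "N \<ge> 1" and gp: "lam N < lam (Suc N)"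
    and v_eig: "\<And>j. j < N \<Longrightarrow> eigpair \<Omega> V (lam (Suc j)) (Vs j)"
    and v_on: "\<And>i j. i < N \<Longrightarrow> j < N \<Longrightarrow> l2 \<Omega> (Vs i) (Vs j) = idm i j"
    and U0_S: "\<exists>Q. orthogonal_mat N Q \<and> quasi_stiefel N \<Omega> (tmul N (U 0) Q) \<and>
               energy N \<Omega> V (U 0) \<le>
                 (energy N \<Omega> V Vs + ((\<Sum>i=1..N-1. lam i) + lam (Suc N)) / 2) / 2"
    and scheme: "two_stage N \<Omega> V \<tau> U"
    and tmin: "\<tau>min > 0" "\<And>n. \<tau>min < \<tau> n"
    and steps: "\<And>n. \<tau> n < lam 1 / (max 3 (2 * (2 * (sqrt 2 * energy N \<Omega> V (U 0) / lam 1
                     + c\<Omega>\<^sup>2 * sqrt (energy N \<Omega> V (U 0) * lmax N (gram \<Omega> (U 0) (U 0))))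
                   * sqrt (real N * energy N \<Omega> V (U 0) * lmax N (gram \<Omega> (U 0) (U 0))) + 1/2))
                   * lmax N (gram \<Omega> (U 0) (U 0)))"
  shows "\<exists>Q. orthogonal_mat N Q \<and>
            (\<lambda>n. anorm N \<Omega> V (\<lambda>j x. U n j x - tmul N Vs Q j x)) \<longlonglongrightarrow> 0" (is ?conv)
    and "(\<lambda>n. energy N \<Omega> V (U n)) \<longlonglongrightarrow> energy N \<Omega> V Vs" (is ?en)
    and "(\<lambda>n. anorm N \<Omega> V (gradG N \<Omega> V (U n))) \<longlonglongrightarrow> 0" (is ?gr)
proof -
  note HU = two_stage_cls(1)[OF scheme]
  have HV: "tH01 N \<Omega> Vs" using v_eig by (simp add: tH01_def eigpair_def)
  define l where "l = lam 1"
  have l: "0 < l" "1 \<le> c\<Omega>\<^sup>2 * l" using lam_pos[of 0] lam_lower[of 0] by (simp_all add: l_def)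
  define u where "u n j = cls (U n j)" for n j
  define v where "v j = cls (Vs j)" for j
  obtain w where w1: "\<And>n j. j < N \<Longrightarrow> w n j = u n j + \<tau> n *\<^sub>R (\<Sum>k<N. bf (u n k) ((1/2) *\<^sub>R (w n j + u n j)) *\<^sub>R hp.G (u n k)
        - bf (u n k) (hp.G ((1/2) *\<^sub>R (w n j + u n j))) *\<^sub>R u n k)"
      and w2: "\<And>n j. j < N \<Longrightarrow> u (Suc n) j = w n j - \<tau> n *\<^sub>R (\<Sum>k<N. (bf (w n k) (w n j) - (if k = j then 1 else 0)) *\<^sub>R hp.G (w n k))"
    using two_stage_cls(2)[OF scheme] unfolding u_def by blast
  \<comment> \<open>Dividing \<open>a\<close> and \<open>\<tau>\<close> by \<open>lam 1\<close> leaves the scheme unchanged and makes \<open>b \<le> a\<close>.\<close>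
  define a' where "a' x y = 1 / l * af x y" for x y
  define G' where "G' x = l *\<^sub>R hp.G x" for x
  define L where "L = lmax N (gram \<Omega> (U 0) (U 0))"
  define E where "E = energy N \<Omega> V (U 0)"
  have E: "E = (\<Sum>i<N. af (u 0 i) (u 0 i)) / 2" unfolding E_def u_def by (rule energy_cls[OF HU])
  have E0: "0 \<le> E" unfolding E by (simp add: sum_nonneg af.nonneg)
  obtain Q0 where Q0: "orthogonal_mat N Q0" "quasi_stiefel N \<Omega> (tmul N (U 0) Q0)"
      "E \<le> (energy N \<Omega> V Vs + ((\<Sum>i=1..N-1. lam i) + lam (Suc N)) / 2) / 2"
    using U0_S unfolding E_def by blast
  have S_lo: "dot N x x \<le> bf (comb N (u 0) x) (comb N (u 0) x)" for x
    using quasi_stiefel_le[OF HU Q0(1,2)] by (simp add: u_def[abs_def])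
  have S_up: "bf (comb N (u 0) x) (comb N (u 0) x) \<le> L * dot N x x" for x
    using qform_le_lmax[OF N, of "gram \<Omega> (U 0) (U 0)" x] qform_gram[OF HU, of 0 x]
    by (simp add: L_def u_def[abs_def] gram_def l2_sym)
  have L1: "1 \<le> L"
    using order_trans[OF S_lo S_up, of "unitv 0"] N by simp
  interpret a': psd_form a' unfolding a'_def[abs_def] by (rule psd_form_scale[OF af.psd_form_axioms]) (use l in simp)
  have base: "form_pair a' bf G'"
  proof
    \<comment> \<open>\<open>gap_E\<close> with no orthogonality condition: \<open>lam 1\<close> is
      a lower bound of the Rayleigh quotient.\<close>
    show "bf x x \<le> a' x x" for x
      using gap_E[of 0 x] l by (simp add: a'_def l_def field_simps)
    show "a' (G' f) x = bf f x" for f x using l by (simp add: a'_def G'_def af.scale_left hp.aG)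
  qed (simp_all add: G'_def hp.G_add hp.G_scale scaleR_add_right)
  interpret fp: form_pair a' bf G' by (rule base)
  have vv: "bf (v i) (v j) = (if i = j then 1 else 0)" if "i < N" "j < N" for i j
    using cls_forms(2)[OF eigpair_af(1)[OF v_eig] eigpair_af(1)[OF v_eig], OF that] v_on[OF that] by (simp add: v_def idm_def)
  have av: "af (v i) x = lam (Suc i) * bf (v i) x" if "i < N" for i x
    unfolding v_def by (rule eigpair_af(2)[OF v_eig[OF that]])
  interpret eig_gap a' bf G' N v "\<lambda>i. lam (Suc i) / l" "lam N / l" "lam (Suc N) / l"
  proof
    show "bf (v i) (v j) = (if i = j then 1 else 0)" if "i < N" "j < N" for i j by (rule vv[OF that])
    show "a' (v i) x = lam (Suc i) / l * bf (v i) x" if "i < N" for i x by (simp add: a'_def av[OF that])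
    show "0 < lam (Suc i) / l" for i using lam_pos[of i] l by simp
    show "lam (Suc i) / l \<le> lam N / l" if "i < N" for i using lam_mono[of "Suc i" N] that l by (simp add: divide_right_mono)
    show "0 < lam N / l" using lam_pos[of "N - 1"] N l by simp
    show "lam N / l < lam (Suc N) / l" using gp l by (simp add: divide_strict_right_mono)
    show "lam (Suc N) / l * bf x x \<le> a' x x" if "\<And>i. i < N \<Longrightarrow> bf x (v i) = 0" for x
      using gap_V[OF gp v_eig v_on that[unfolded v_def]] l by (simp add: a'_def divide_right_mono)
  qed
  have av2: "af (\<Sum>i<N. p i *\<^sub>R v i) (\<Sum>i<N. r i *\<^sub>R v i) = (\<Sum>i<N. lam (Suc i) * (p i * r i))" for p r
    using sum_v(2)[of p r] l by (simp add: a'_def sum_divide_distrib[symmetric])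
  have nu: "fp.nrg N (u 0) = E / l" by (simp add: fp.nrg_def a'_def E sum_divide_distrib mult.commute)
  have EV: "energy N \<Omega> V Vs = (\<Sum>i<N. lam (Suc i)) / 2"
    unfolding energy_cls[OF HV] using av vv by (simp add: v_def)
  \<comment> \<open>\<open>N - 1\<close> is natural subtraction; \<open>N \<ge> 1\<close> makes this
    the sum of the first \<open>N\<close> eigenvalues without \<open>lam N\<close>, so the excited
    energy exceeds that of \<open>Vs\<close> by half the gap.\<close>
  have ll: "(\<Sum>i=1..N-1. lam i) = (\<Sum>i<N. lam (Suc i)) - lam N"
    using N by (cases N) (simp_all add: sum.atLeast1_atMost_eq)
  interpret ts: two_stage_scheme a' bf G' N v "\<lambda>i. lam (Suc i) / l" "lam N / l" "lam (Suc N) / l" u w "\<lambda>n. \<tau> n / l" "\<tau>min / l" L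
  proof
    show "1 \<le> N" by (rule N)
    show "w n j = u n j + (\<tau> n / l) *\<^sub>R (\<Sum>k<N. bf (u n k) ((1/2) *\<^sub>R (w n j + u n j)) *\<^sub>R G' (u n k)
      - bf (u n k) (G' ((1/2) *\<^sub>R (w n j + u n j))) *\<^sub>R u n k)" if j: "j < N" for n j
    proof -
      have "\<tau> n *\<^sub>R (\<Sum>k<N. bf (u n k) y *\<^sub>R hp.G (u n k) - bf (u n k) (hp.G y) *\<^sub>R u n k)
        = (\<tau> n / l) *\<^sub>R (\<Sum>k<N. bf (u n k) y *\<^sub>R G' (u n k) - bf (u n k) (G' y) *\<^sub>R u n k)" for y
        using l by (simp add: G'_def scaleR_sum_right scaleR_diff_right bf.scale_right)
      from this[of "(1/2) *\<^sub>R (w n j + u n j)"] show ?thesis using w1[OF j, of n] by (simp only:)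
    qed
    show "u (Suc n) j = w n j - (\<tau> n / l) *\<^sub>R (\<Sum>k<N. (bf (w n k) (w n j) - (if k = j then 1 else 0)) *\<^sub>R G' (w n k))" if j: "j < N" for n j
    proof -
      have "\<tau> n *\<^sub>R (\<Sum>k<N. c k *\<^sub>R hp.G (w n k)) = (\<tau> n / l) *\<^sub>R (\<Sum>k<N. c k *\<^sub>R G' (w n k))" for c
        using l by (simp add: G'_def scaleR_sum_right)
      then show ?thesis unfolding w2[OF j, of n] by (simp only:)
    qed
    show "0 < \<tau>min / l" "\<tau>min / l \<le> \<tau> n / l" for n using tmin l by (simp_all add: divide_right_mono less_imp_le)
    show "\<tau> n / l * (4 * fp.nrg N (u 0) * L\<^sup>2 + L) \<le> 1" for n
      unfolding nu
    proof (rule step_size_bound[OF l E0 L1])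
      show "1 \<le> real N" using N by simp
      show "0 < \<tau> n" using tmin(1) tmin(2)[of n] by linarith
    qed (use steps[of n] in \<open>simp only: E_def L_def l_def\<close>)
    show "dot N x x \<le> bf (comb N (u 0) x) (comb N (u 0) x)" for x by (rule S_lo)
    show "bf (comb N (u 0) x) (comb N (u 0) x) \<le> L * dot N x x" for x by (rule S_up)
    have "2 * E \<le> (\<Sum>i<N. lam (Suc i)) + (lam (Suc N) - lam N) / 2"
      using Q0(3) unfolding EV ll by argo
    then have "2 * E / l \<le> ((\<Sum>i<N. lam (Suc i)) + (lam (Suc N) - lam N) / 2) / l" using l by (intro divide_right_mono) auto
    then show "2 * fp.nrg N (u 0) \<le> (\<Sum>i<N. lam (Suc i) / l) + (lam (Suc N) / l - lam N / l) / 2"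
      unfolding nu by (simp add: sum_divide_distrib add_divide_distrib diff_divide_distrib)
  qed
  obtain Q where Q: "\<And>i j. i < N \<Longrightarrow> j < N \<Longrightarrow> (\<Sum>k<N. Q k i * Q k j) = (if i = j then 1 else 0)"
      "(\<lambda>n. \<Sum>j<N. a' (u n j - (\<Sum>i<N. Q i j *\<^sub>R v i)) (u n j - (\<Sum>i<N. Q i j *\<^sub>R v i))) \<longlonglongrightarrow> 0"
    using ts.convergence by blast
  have oQ: "orthogonal_mat N Q" using Q(1) by (simp add: orthogonal_mat_def idm_def)
  define z where "z j = (\<Sum>i<N. Q i j *\<^sub>R v i)" for j
  have S: "(\<lambda>n. \<Sum>j<N. af (u n j - z j) (u n j - z j)) \<longlonglongrightarrow> 0"
    using tendsto_mult_left[OF Q(2), of l] l by (simp add: z_def a'_def sum_distrib_left)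
  have uz: "(\<lambda>n. af (u n j - z j) (u n j - z j)) \<longlonglongrightarrow> 0" if j: "j < N" for j
  proof (rule tendsto_sandwich[OF _ _ tendsto_const S])
    show "\<forall>\<^sub>F n in sequentially. af (u n j - z j) (u n j - z j) \<le> (\<Sum>j<N. af (u n j - z j) (u n j - z j))"
      by (intro always_eventually allI member_le_sum) (use j in \<open>auto simp: af.nonneg\<close>)
  qed (simp add: af.nonneg)
  show ?conv
  proof (intro exI[of _ Q] conjI oQ)
    have H: "tH01 N \<Omega> (\<lambda>j x. U n j x - tmul N Vs Q j x)" for n
      using HU[of n] tmul_cls(1)[OF HV, of Q] by (auto simp: tH01_def intro: H01_diff)
    have "cls (\<lambda>x. U n j x - tmul N Vs Q j x) = u n j - z j" for n j
      unfolding cls_diff by (simp add: u_def z_def v_def tmul_cls(2)[OF HV])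
    then show "(\<lambda>n. anorm N \<Omega> V (\<lambda>j x. U n j x - tmul N Vs Q j x)) \<longlonglongrightarrow> 0"
      unfolding anorm_cls[OF H] using tendsto_real_sqrt[OF S] by simp
  qed
  have "(\<Sum>j<N. af (z j) (z j)) = (\<Sum>j<N. \<Sum>i<N. lam (Suc i) * (Q i j * Q i j))"
    by (simp add: z_def av2)
  also have "\<dots> = (\<Sum>i<N. lam (Suc i) * (\<Sum>j<N. Q i j * Q i j))"
    by (subst sum.swap) (simp add: sum_distrib_left)
  also have "\<dots> = (\<Sum>i<N. lam (Suc i))"
    by (intro sum.cong refl) (simp add: orthogonal_mat_rows[OF oQ])
  finally have zE: "(\<Sum>j<N. af (z j) (z j)) / 2 = energy N \<Omega> V Vs" by (simp add: EV)
  have "(\<lambda>n. (\<Sum>j<N. af (u n j) (u n j)) / 2) \<longlonglongrightarrow> (\<Sum>j<N. af (z j) (z j)) / 2"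
    by (intro tendsto_divide tendsto_sum tendsto_const af.tendsto_form(2)[OF uz]) auto
  then show ?en unfolding energy_cls[OF HU] zE by (simp add: u_def)
  have Gv: "hp.G (v i) = (1 / lam (Suc i)) *\<^sub>R v i" if i: "i < N" for i
  proof -
    have "af ((1 / lam (Suc i)) *\<^sub>R v i) x = bf (v i) x" for x
      using lam_pos[OF i] by (auto simp: af.scale_left av[OF i])
    then have "rep ((1 / lam (Suc i)) *\<^sub>R v i) = hp.G (v i)" by (rule hp.G_eqI)
    then show ?thesis by (simp add: hp.p_scale v_def rep_cls)
  qed
  have Gz: "hp.G (z j) = (\<Sum>i<N. (Q i j / lam (Suc i)) *\<^sub>R v i)" if "j < N" for j
  proof -
    have "hp.G (\<Sum>i\<in>I. Q i j *\<^sub>R v i) = (\<Sum>i\<in>I. Q i j *\<^sub>R hp.G (v i))" if "finite I" for I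
      using that by (induction I) (use hp.G_scale[of 0 0] in \<open>simp_all add: hp.G_add hp.G_scale\<close>)
    from this[of "{..<N}"] show ?thesis unfolding z_def using Gv by simp
  qed
  \<comment> \<open>\<open>z\<close> is \<open>Vs\<close> times \<open>Q\<close>, so its matrix of
    \<open>G\<close> is \<open>Q\<^sup>T diag (1 / lam) Q\<close>, and
    \<open>Q Q\<^sup>T = I\<close> makes the residual vanish.\<close>
  have zres: "hp.G (z j) = (\<Sum>i<N. bf (hp.G (z i)) (z j) *\<^sub>R z i)" if j: "j < N" for j
  proof -
    have "(\<Sum>i<N. bf (hp.G (z i)) (z j) *\<^sub>R z i) = (\<Sum>i<N. \<Sum>k<N. (\<Sum>m<N. Q m i / lam (Suc m) * Q m j * Q k i) *\<^sub>R v k)"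
      using Gz by (simp add: z_def[of j] sum_v(1)) (simp add: z_def scaleR_sum_right sum_distrib_right)
    also have "\<dots> = (\<Sum>k<N. (\<Sum>i<N. \<Sum>m<N. Q m i / lam (Suc m) * Q m j * Q k i) *\<^sub>R v k)"
      by (subst sum.swap) (simp add: scaleR_sum_left)
    also have "\<dots> = (\<Sum>k<N. (Q k j / lam (Suc k)) *\<^sub>R v k)"
    proof (intro sum.cong refl arg_cong2[where f = scaleR])
      fix k assume k: "k \<in> {..<N}"
      have "(\<Sum>i<N. \<Sum>m<N. Q m i / lam (Suc m) * Q m j * Q k i) = (\<Sum>m<N. Q m j / lam (Suc m) * (\<Sum>i<N. Q k i * Q m i))"
        by (subst sum.swap) (simp add: sum_distrib_left mult_ac)
      also have "\<dots> = (\<Sum>m<N. Q m j / lam (Suc m) * (if k = m then 1 else 0))"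
        by (intro sum.cong refl) (use k orthogonal_mat_rows[OF oQ] in simp)
      also have "\<dots> = Q k j / lam (Suc k)" using k by (simp add: mult_delta_right)
      finally show "(\<Sum>i<N. \<Sum>m<N. Q m i / lam (Suc m) * Q m j * Q k i) = Q k j / lam (Suc k)" .
    qed
    finally show ?thesis using Gz[OF j] by simp
  qed
  let ?r = "\<lambda>n j. hp.G (u n j) - (\<Sum>i<N. bf (hp.G (u n i)) (u n j) *\<^sub>R u n i)"
  have "(\<lambda>n. \<Sum>j<N. af (?r n j) (?r n j)) \<longlonglongrightarrow> (\<Sum>j<N. 0)"
  proof (rule tendsto_sum)
    fix j assume "j \<in> {..<N}"
    then have j: "j < N" by simp
    show "(\<lambda>n. af (?r n j) (?r n j)) \<longlonglongrightarrow> 0"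
      by (rule hp.residual_tendsto[where z = z, OF uz j zres[OF j]])
  qed
  moreover have "anorm N \<Omega> V (gradG N \<Omega> V (U n)) = sqrt (\<Sum>j<N. af (?r n j) (?r n j))" for n
    unfolding anorm_cls[OF gradG_cls(1)[OF HU]] by (simp add: gradG_cls(2)[OF HU] u_def)
  ultimately show ?gr using tendsto_real_sqrt by fastforce
qed

end

theorem theorem4p7:
  fixes \<Omega> :: "'a::euclidean_space set"
    and V :: "'a \<Rightarrow> real"
    and c1 c2 c\<Omega> :: real
    and N :: nat
    and lam :: "nat \<Rightarrow> real"
    and Vs :: "'a tuple"
    and U :: "nat \<Rightarrow> 'a tuple"
    and \<tau> :: "nat \<Rightarrow> real"
    and \<tau>min :: real
  assumes dom: "open \<Omega>" "connected \<Omega>" "bounded \<Omega>" "\<Omega> \<noteq> {}"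
    and V_meas: "set_borel_measurable lebesgue \<Omega> V"
    and V_int: "\<And>u v. H01 \<Omega> u \<Longrightarrow> H01 \<Omega> v \<Longrightarrow>
                  set_integrable lebesgue \<Omega> (\<lambda>x. V x * u x * v x)"
    and coerc: "c1 > 0" "c2 > 0"
      "\<And>u. H01 \<Omega> u \<Longrightarrow>
         c1 * (LINT x:\<Omega>|lebesgue. (norm (wgrad \<Omega> u x))\<^sup>2) \<le> aform \<Omega> V u u \<and>
         aform \<Omega> V u u \<le> c2 * (LINT x:\<Omega>|lebesgue. (norm (wgrad \<Omega> u x))\<^sup>2)"
    and cOmega: "c\<Omega> > 0"
      "\<And>u. H01 \<Omega> u \<Longrightarrow> sqrt (l2 \<Omega> u u) \<le> c\<Omega> * sqrt (aform \<Omega> V u u)"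
    and N_pos: "N \<ge> 1"
    and eigs: "eigen_seq \<Omega> V lam"
    and gap: "lam N < lam (Suc N)"
    and Vs_eig: "\<And>j. j < N \<Longrightarrow> eigpair \<Omega> V (lam (Suc j)) (Vs j)"
    and Vs_on: "\<And>i j. i < N \<Longrightarrow> j < N \<Longrightarrow> l2 \<Omega> (Vs i) (Vs j) = idm i j"
    and U0_H01: "tH01 N \<Omega> (U 0)"
    and U0_S: "\<exists>Q. orthogonal_mat N Q \<and> quasi_stiefel N \<Omega> (tmul N (U 0) Q) \<and>
               energy N \<Omega> V (U 0) \<le>
                 (energy N \<Omega> V Vs + ((\<Sum>i=1..N-1. lam i) + lam (Suc N)) / 2) / 2"
    and scheme: "two_stage N \<Omega> V \<tau> U"
    and tmin: "\<tau>min > 0"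
    and steps: "\<And>n. \<tau>min < \<tau> n \<and>
       \<tau> n < min (lam 1 / (max 3 (2 * (2 * (sqrt 2 * energy N \<Omega> V (U 0) / lam 1
                     + c\<Omega>\<^sup>2 * sqrt (energy N \<Omega> V (U 0) * lmax N (gram \<Omega> (U 0) (U 0))))
                   * sqrt (real N * energy N \<Omega> V (U 0) * lmax N (gram \<Omega> (U 0) (U 0))) + 1/2))
                   * lmax N (gram \<Omega> (U 0) (U 0))))
                 (lam 1 / (2 * sqrt (2 * energy N \<Omega> V (U 0) * lmax N (gram \<Omega> (U 0) (U 0)))))"
  shows "(\<exists>Q. orthogonal_mat N Q \<and>
            (\<lambda>n. anorm N \<Omega> V (\<lambda>j x. U n j x - tmul N Vs Q j x)) \<longlonglongrightarrow> 0)
       \<and> (\<lambda>n. energy N \<Omega> V (U n)) \<longlonglongrightarrow> energy N \<Omega> V Vs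
       \<and> (\<lambda>n. anorm N \<Omega> V (gradG N \<Omega> V (U n))) \<longlonglongrightarrow> 0"
proof -
  interpret schroedinger \<Omega> V c1 c2 c\<Omega>
    by unfold_locales (fact dom(1) dom(3) V_int coerc cOmega)+
  obtain e where e: "\<forall>i\<ge>1. eigpair \<Omega> V (lam i) (e i)"
      "\<forall>i\<ge>1. \<forall>j\<ge>1. l2 \<Omega> (e i) (e j) = (if i = j then 1 else 0)"
      "\<forall>\<mu> u. eigpair \<Omega> V \<mu> u \<longrightarrow> (\<exists>I c. finite I \<and> I \<subseteq> {i. i \<ge> 1 \<and> lam i = \<mu>} \<and>
                 (AE x in lebesgue. x \<in> \<Omega> \<longrightarrow> u x = (\<Sum>i\<in>I. c i * e i x)))"
    using eigs unfolding eigen_seq_def by blast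
  have st: "\<forall>i\<ge>1. lam i \<le> lam (Suc i)" using eigs unfolding eigen_seq_def by blast
  interpret eigen_system \<Omega> V c1 c2 c\<Omega> lam e
  proof
    show "lam i \<le> lam (Suc i)" "eigpair \<Omega> V (lam i) (e i)" if "i \<ge> 1" for i using st e(1) that by blast+
    show "l2 \<Omega> (e i) (e j) = (if i = j then 1 else 0)" if "i \<ge> 1" "j \<ge> 1" for i j using e(2) that by blast
  qed (rule e(3)[rule_format])
  have tn: "\<tau>min < \<tau> n" for n using steps[of n] by blast
  note conv = two_stage_convergence[OF N_pos gap Vs_eig Vs_on U0_S scheme tmin tn
      less_le_trans[OF conjunct2[OF steps] min.cobounded1]]
  show ?thesis by (intro conjI conv)
qed

end
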